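(* Extremizers for the inequality $\|Tf\|_{L^p(\mathbb{R}^{d+1})}\le \mathbf{H}_{d,p}\,\|f\|_{L^2(\mathbb{H}^d)}$ exist in the following cases: (a) $d=1$ and $6<p<\infty$; (b) $d=2$ and $4<p<6$. That is, in each of these cases there exists a nonzero $f\in L^2(\mathbb{H}^d)$ with $\|Tf\|_{L^p(\mathbb{R}^{d+1})}=\mathbf{H}_{d,p}\,\|f\|_{L^2(\mathbb{H}^d)}$.
   Context: Write $\langle y\rangle=\sqrt{1+|y|^2}$ for $y\in\mathbb{R}^d$. The hyperboloid is $\mathbb{H}^d=\{(y,y')\in\mathbb{R}^d\times\mathbb{R}: y'=\sqrt{1+|y|^2}\}$, equipped with the Lorentz invariant measure $\sigma$ given by $\int_{\mathbb{H}^d}\varphi\,d\sigma=\int_{\mathbb{R}^d}\varphi(y,\langle y\rangle)\frac{dy}{\langle y\rangle}$. A function $f:\mathbb{H}^d\to\mathbb{C}$ is identified with the function $y\mapsto f(y,\langle y\rangle)$ on $\mathbb{R}^d$, and $\|f\|_{L^2(\mathbb{H}^d)}=\left(\int_{\mathbb{R}^d}|f(y)|^2\frac{dy}{\langle y\rangle}\right)^{1/2}$. The Fourier extension operator is $$Tf(x,t)=\int_{\mathbb{R}^d}e^{ix\cdot y}e^{it\langle y\rangle}f(y)\frac{dy}{\langle y\rangle},\qquad (x,t)\in\mathbb{R}^d\times\mathbb{R},$$ for Schwartz $f$. By a classical result of Strichartz it extends by density to a bounded operator from $L^2(\mathbb{H}^d)$ to $L^p(\mathbb{R}^{d+1})$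 when $6\le p<\infty$ if $d=1$, and when $\frac{2(d+2)}{d}\le p\le\frac{2(d+1)}{d-1}$ if $d\ge2$. The optimal constant is $\mathbf{H}_{d,p}=\sup_{0\ne f\in L^2(\mathbb{H}^d)}\|Tf\|_{L^p(\mathbb{R}^{d+1})}/\|f\|_{L^2(\mathbb{H}^d)}$. *)

theory Defs
  imports "HOL-Analysis.Analysis"
begin

text \<open>
  The space \<open>\<real>\<^sup>d\<close> is a Euclidean space type \<^typ>\<open>'a::euclidean_space\<close> with \<open>DIM('a) = d\<close>, and
  \<open>\<real>\<^sup>d\<^sup>+\<^sup>1\<close> is the type \<^typ>\<open>'a::euclidean_space \<times> real\<close> of pairs \<open>(x, t)\<close>.
  Functions on the hyperboloid \<open>{(y, \<langle>y\<rangle>) | y. y \<in> \<real>\<^sup>d}\<close> are identified with functions of \<open>y\<close>,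
  under which the Lorentz invariant measure becomes \<open>dy / \<langle>y\<rangle>\<close> on \<open>\<real>\<^sup>d\<close>.
\<close>

definition japanese :: "'a::euclidean_space \<Rightarrow> real" where
  "japanese y = sqrt (1 + (norm y)\<^sup>2)"

definition hyp_measure :: "'a::euclidean_space measure" where
  "hyp_measure = density lborel (\<lambda>y. ennreal (1 / japanese y))"

text \<open>The seminorm \<open>(\<integral> |f|\<^sup>p dM)\<^bsup>1/p\<^esup>\<close> for \<open>0 < p < \<infinity>\<close>, with values in \<open>[0, \<infinity>]\<close>.\<close>

definition Lp_norm :: "real \<Rightarrow> 'a measure \<Rightarrow> ('a \<Rightarrow> complex) \<Rightarrow> ennreal" where
  "Lp_norm p M f =
     (let I = (\<integral>\<^sup>+x. ennreal (cmod (f x) powr p) \<partial>M)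
      in if I = \<infinity> then \<infinity> else ennreal (enn2real I powr (1 / p)))"

definition Lp_space :: "real \<Rightarrow> 'a measure \<Rightarrow> ('a \<Rightarrow> complex) set" where
  "Lp_space p M = {f \<in> borel_measurable M. Lp_norm p M f < \<infinity>}"

definition partial_derivative ::
  "'a::euclidean_space \<Rightarrow> ('a \<Rightarrow> complex) \<Rightarrow> 'a \<Rightarrow> complex" where
  "partial_derivative b f = (\<lambda>x. frechet_derivative f (at x) b)"

text \<open>
  A list \<open>bs\<close> of basis vectors encodes an iterated partial derivative. Differentiability of all
  iterated partial derivatives says that \<open>f\<close> is infinitely differentiable.
\<close>

definition schwartz :: "('a::euclidean_space \<Rightarrow> complex) \<Rightarrow> bool" where
  "schwartz f \<longleftrightarrow>
     (\<forall>bs \<in> lists Basis.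
        (\<forall>x. foldr partial_derivative bs f differentiable (at x)) \<and>
        (\<forall>k::nat. bounded (range (\<lambda>x. norm x ^ k *\<^sub>R foldr partial_derivative bs f x))))"

definition ext_schwartz ::
  "('a::euclidean_space \<Rightarrow> complex) \<Rightarrow> 'a \<times> real \<Rightarrow> complex" where
  "ext_schwartz f = (\<lambda>(x, t).
     \<integral>y. exp (\<i> * of_real (x \<bullet> y)) * exp (\<i> * of_real (t * japanese y)) * f y \<partial>hyp_measure)"

text \<open>
  \<open>F\<close> represents the value at \<open>f\<close> of the extension by density of \<^const>\<open>ext_schwartz\<close> to
  \<open>L\<^sup>2 \<rightarrow> L\<^sup>p\<close>. For exponents for which \<^const>\<open>ext_schwartz\<close> is bounded, such an \<open>F\<close> exists for every
  \<open>f\<close> in \<open>L\<^sup>2\<close>, is unique up to null sets, and does not depend on the approximating sequence.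
\<close>

definition is_extension ::
  "real \<Rightarrow> ('a::euclidean_space \<Rightarrow> complex) \<Rightarrow> ('a \<times> real \<Rightarrow> complex) \<Rightarrow> bool" where
  "is_extension p f F \<longleftrightarrow>
     F \<in> Lp_space p lborel \<and>
     (\<exists>g :: nat \<Rightarrow> 'a \<Rightarrow> complex.
        (\<forall>n. schwartz (g n)) \<and>
        (\<lambda>n. Lp_norm 2 hyp_measure (\<lambda>y. g n y - f y)) \<longlonglongrightarrow> 0 \<and>
        (\<lambda>n. Lp_norm p lborel (\<lambda>z. ext_schwartz (g n) z - F z)) \<longlonglongrightarrow> 0)"

definition fourier_ext ::
  "real \<Rightarrow> ('a::euclidean_space \<Rightarrow> complex) \<Rightarrow> 'a \<times> real \<Rightarrow> complex" where
  "fourier_ext p f = (SOME F. is_extension p f F)"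

definition nonzero_L2 :: "('a::euclidean_space \<Rightarrow> complex) set" where
  "nonzero_L2 = {f \<in> Lp_space 2 hyp_measure. \<not> (AE y in hyp_measure. f y = 0)}"

text \<open>
  The optimal constant. The \<^typ>\<open>'a itself\<close> argument selects the dimension, and the supremum is
  taken in \<open>[0, \<infinity>]\<close>, so that no boundedness is presupposed.
\<close>

definition opt_const :: "'a::euclidean_space itself \<Rightarrow> real \<Rightarrow> ennreal" where
  "opt_const (_ :: 'a itself) p =
     (SUP f \<in> (nonzero_L2 :: ('a \<Rightarrow> complex) set).
        Lp_norm p lborel (fourier_ext p f) / Lp_norm 2 hyp_measure f)"

definition extremizer :: "real \<Rightarrow> ('a::euclidean_space \<Rightarrow> complex) \<Rightarrow> bool" where
  "extremizer p (f :: 'a \<Rightarrow> complex) \<longleftrightarrow>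
     f \<in> nonzero_L2 \<and>
     Lp_norm p lborel (fourier_ext p f) = opt_const TYPE('a) p * Lp_norm 2 hyp_measure f"

end

theory Submission
  imports Defs "HOL-Probability.Probability" "HOL-Library.Diagonal_Subsequence"
begin

text \<open>
  Take a maximizing sequence of functions of norm 1. For an even exponent \<open>2 * m\<close>, Plancherel bounds
  \<open>\<parallel>T f\<parallel>\<close> by an integral of \<open>\<Prod>i<m. |f (a i)|\<^sup>2\<close> against the density of the \<open>m\<close>-fold convolution of
  the invariant measure. At an even exponent below \<open>p\<close> this density decays in the Lorentz norm, hence
  \<open>T f\<close> is small unless \<open>f\<close> has mass in some Lorentz ball. Interpolation with an even exponent above
  \<open>p\<close> shows that maximizing functions do have such mass, and a boost moves the ball to the origin.
  By maximality the part of \<open>f\<close> in the ball accounts for a fixed fraction of the operator norm, so its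
  extension is large at some point, and a modulation moves this point to \<open>0\<close>. After this
  normalization the weak limit of a subsequence is not zero. The extension gains half a derivative locally
  in space, which makes the extensions converge almost everywhere, and the Brezis-Lieb lemma together
  with \<open>p > 2\<close> shows that the weak limit is an extremizer.
\<close>

section \<open>The spaces \<open>L\<^sup>p\<close>\<close>

text \<open>The obstacle is a noncompact symmetry group: boosts act on \<open>f\<close>, and
  space-time translations of \<open>T f\<close> are modulations of \<open>f\<close>. Either can
  drive a maximizing sequence weakly to 0, so both are undone before a limit is taken. The strict
  bounds on \<open>p\<close> leave room for an even exponent on each side. The lower one needs a
  convolution density with decay (6 in dimension one, 4 in dimension two); of the upper one only
  boundedness is used (any large even number in dimension one, 6 in dimension two). Strong
  convergence in L2 is never proved: Brezis-Lieb splits the \<open>p\<close>-th power of the norm in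
  the limit, the remainder is bounded by the operator norm, and s^(p/2) + (1-s)^(p/2) \<le> 1 then
  gives extremality for a weak limit of any positive norm. The best constant is handled as a
  supremum \<open>H\<close> over integrable L2 functions, where \<open>T f\<close> is an absolutely
  convergent integral; this class allows sharp cutoffs, which the Schwartz class does not. That
  \<open>H\<close> equals \<open>opt_const\<close> is derived at the end, from the function that
  attains it.\<close>

definition nrm :: "real \<Rightarrow> 'a measure \<Rightarrow> ('a \<Rightarrow> complex) \<Rightarrow> real" where
  "nrm p M f = (\<integral>x. cmod (f x) powr p \<partial>M) powr (1 / p)"

lemma Lp_space_iff:
  assumes "0 < p"
  shows "f \<in> Lp_space p M \<longleftrightarrow> f \<in> borel_measurable M \<and> integrable M (\<lambda>x. cmod (f x) powr p)"
proof (cases "f \<in> borel_measurable M")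
  case True
  note [measurable] = True
  have "Lp_norm p M f < \<infinity> \<longleftrightarrow> (\<integral>\<^sup>+x. ennreal (cmod (f x) powr p) \<partial>M) < \<infinity>"
    by (auto simp: Lp_norm_def Let_def top.not_eq_extremum)
  also have "\<dots> \<longleftrightarrow> integrable M (\<lambda>x. cmod (f x) powr p)"
    by (subst integrable_iff_bounded) auto
  finally show ?thesis using True by (simp add: Lp_space_def)
qed (simp add: Lp_space_def)

lemma Lp_spaceI:
  assumes "0 < p" "f \<in> borel_measurable M" "(\<integral>\<^sup>+x. ennreal (cmod (f x) powr p) \<partial>M) < \<infinity>"
  shows "f \<in> Lp_space p M"
  using assms by (subst Lp_space_iff) (auto simp: integrable_iff_bounded)

lemma Lp_space_measurable: "f \<in> Lp_space p M \<Longrightarrow> f \<in> borel_measurable M"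
  by (simp add: Lp_space_def)

lemma nn_integral_powr_eq_nrm:
  assumes "0 < p" "f \<in> Lp_space p M"
  shows "(\<integral>\<^sup>+x. ennreal (cmod (f x) powr p) \<partial>M) = ennreal (nrm p M f powr p)"
proof -
  have "integrable M (\<lambda>x. cmod (f x) powr p)"
    using assms by (simp add: Lp_space_iff)
  then show ?thesis
    using assms by (subst nn_integral_eq_integral) (auto simp: nrm_def powr_powr)
qed

lemma nrm_nonneg [simp]: "0 \<le> nrm p M f"
  by (simp add: nrm_def)

lemma nrm_powr: "0 < p \<Longrightarrow> nrm p M f powr p = (\<integral>x. cmod (f x) powr p \<partial>M)"
  by (simp add: nrm_def powr_powr)

text \<open>Membership matters here: for a measurable function of infinite norm the Bochner integral
  inside \<open>nrm\<close> defaults to 0, whereas \<open>Lp_norm\<close> is infinite. Every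
  estimate of \<open>nrm\<close> is therefore accompanied by a membership statement.\<close>

lemma Lp_norm_eq_nrm:
  assumes "0 < p" "f \<in> Lp_space p M"
  shows "Lp_norm p M f = ennreal (nrm p M f)"
  using assms
  by (simp add: Lp_norm_def Let_def nn_integral_powr_eq_nrm powr_powr)

text \<open>The entry point for estimates: they are proved for integrals in [0, infinity], where
  nothing has to be known about integrability, and yield membership and the real bound
  together.\<close>

lemma nrm_leI:
  assumes "0 < p" "0 \<le> C" "f \<in> borel_measurable M"
    and "(\<integral>\<^sup>+x. ennreal (cmod (f x) powr p) \<partial>M) \<le> ennreal (C powr p)"
  shows "f \<in> Lp_space p M" "nrm p M f \<le> C"
proof -
  show f: "f \<in> Lp_space p M"
    by (rule Lp_spaceI) (use assms in \<open>auto intro: le_less_trans\<close>)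
  have "nrm p M f powr p \<le> C powr p"
    using assms f by (simp add: nn_integral_powr_eq_nrm)
  then show "nrm p M f \<le> C"
    using powr_less_mono2[of p C "nrm p M f"] assms by (cases "nrm p M f \<le> C") auto
qed

lemma nrm_eq_0_AE:
  assumes "0 < p" "f \<in> Lp_space p M" "nrm p M f = 0"
  shows "AE x in M. f x = 0"
proof -
  have [measurable]: "f \<in> borel_measurable M" using assms by (simp add: Lp_space_def)
  have "(\<integral>\<^sup>+x. ennreal (cmod (f x) powr p) \<partial>M) = 0"
    using assms by (simp add: nn_integral_powr_eq_nrm)
  then have "AE x in M. ennreal (cmod (f x) powr p) = 0"
    by (subst (asm) nn_integral_0_iff_AE) auto
  then show ?thesis by eventually_elim auto
qed

lemma nrm_mono:
  assumes "0 < p" "g \<in> Lp_space p M" "f \<in> borel_measurable M" "AE x in M. cmod (f x) \<le> cmod (g x)"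
  shows "f \<in> Lp_space p M" "nrm p M f \<le> nrm p M g"
proof -
  have "(\<integral>\<^sup>+x. ennreal (cmod (f x) powr p) \<partial>M) \<le> (\<integral>\<^sup>+x. ennreal (cmod (g x) powr p) \<partial>M)"
  proof (rule nn_integral_mono_AE)
    show "AE x in M. ennreal (cmod (f x) powr p) \<le> ennreal (cmod (g x) powr p)"
      using assms(4) by eventually_elim (use assms in \<open>auto intro!: ennreal_leI powr_mono2\<close>)
  qed
  then show "f \<in> Lp_space p M" "nrm p M f \<le> nrm p M g"
    using nrm_leI[of p "nrm p M g" f M] assms by (auto simp: nn_integral_powr_eq_nrm)
qed

lemma nrm_cmult:
  assumes "0 < p" "f \<in> Lp_space p M"
  shows "(\<lambda>x. c * f x) \<in> Lp_space p M" "nrm p M (\<lambda>x. c * f x) = cmod c * nrm p M f"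
  using assms by (auto simp: Lp_space_iff nrm_def norm_mult powr_mult powr_powr)

section \<open>Convexity, Minkowski's inequality and completeness\<close>

lemma convex_powr_nonneg:
  fixes x y :: real
  assumes "1 \<le> p" "0 \<le> x" "0 \<le> y" "0 \<le> u" "0 \<le> v" "u + v = 1"
  shows "(u * x + v * y) powr p \<le> u * x powr p + v * y powr p"
proof -
  \<comment> \<open>When one of the two points is 0, convexity reduces to s^p \<le> s on the unit
    interval.\<close>
  have aux: "(s * z) powr p \<le> s * z powr p" if "0 \<le> s" "s \<le> 1" "0 \<le> z" for s z :: real
  proof (cases "s = 0")
    case False
    then have "s powr p \<le> s powr 1"
      using that assms by (intro powr_mono') auto
    then show ?thesis using that False by (simp add: powr_mult mult_right_mono)
  qed simp
  consider "x = 0" | "y = 0" | "x > 0" "y > 0" using assms by linarith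
  then show ?thesis
  proof cases
    case 1 then show ?thesis using aux[of v y] assms by simp
  next
    case 2 then show ?thesis using aux[of u x] assms by simp
  next
    case 3
    then show ?thesis
      using convex_onD[OF powr_convex[OF assms(1)], of v x y] assms
      by (simp add: eq_diff_eq[symmetric, of u v 1])
  qed
qed

text \<open>Convexity of the \<open>p\<close>-th power is applied to |f|/A and |g|/B with weights
  A/(A+B) and B/(A+B). The numbers A and B are positive upper bounds of the norms rather than the
  norms themselves, so vanishing norms are covered by letting the bounds decrease to them.\<close>

lemma Minkowski:
  assumes p: "1 \<le> p" and f: "f \<in> Lp_space p M" and g: "g \<in> Lp_space p M"
  shows "(\<lambda>x. f x + g x) \<in> Lp_space p M" "nrm p M (\<lambda>x. f x + g x) \<le> nrm p M f + nrm p M g"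
proof -
  have p0: "0 < p" using p by simp
  have [measurable]: "f \<in> borel_measurable M" "g \<in> borel_measurable M"
    using f g by (auto simp: Lp_space_def)
  have main: "(\<lambda>x. f x + g x) \<in> Lp_space p M \<and> nrm p M (\<lambda>x. f x + g x) \<le> A + B"
    if "nrm p M f \<le> A" "nrm p M g \<le> B" "A > 0" "B > 0" for A B
  proof -
    have pw: "cmod (f x + g x) powr p \<le>
       ((A + B) powr p) * (A / (A + B)) * (cmod (f x) powr p / A powr p) +
       ((A + B) powr p) * (B / (A + B)) * (cmod (g x) powr p / B powr p)" for x
    proof -
      have "cmod (f x + g x) powr p \<le> (cmod (f x) + cmod (g x)) powr p"
        using p0 by (intro powr_mono2 norm_triangle_ineq) auto
      also have "\<dots> = ((A + B) * (A / (A + B) * (cmod (f x) / A) + B / (A + B) * (cmod (g x) / B))) powr p"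
      proof -
        have "cmod (f x) + cmod (g x) = (A + B) * (A / (A + B) * (cmod (f x) / A) + B / (A + B) * (cmod (g x) / B))"
          using that(3,4) by (simp add: distrib_left mult.assoc[symmetric])
        then show ?thesis by simp
      qed
      also have "\<dots> = (A + B) powr p * (A / (A + B) * (cmod (f x) / A) + B / (A + B) * (cmod (g x) / B)) powr p"
        using that by (subst powr_mult) auto
      also have "\<dots> \<le> (A + B) powr p * (A / (A + B) * (cmod (f x) / A) powr p + B / (A + B) * (cmod (g x) / B) powr p)"
        using that p by (intro mult_left_mono convex_powr_nonneg) (auto simp: add_divide_distrib[symmetric])
      finally show ?thesis using that by (simp add: powr_divide algebra_simps)
    qed
    have If: "integrable M (\<lambda>x. cmod (f x) powr p)" and Ig: "integrable M (\<lambda>x. cmod (g x) powr p)"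
      using f g p0 by (auto simp: Lp_space_iff)
    have "(\<integral>\<^sup>+x. ennreal (cmod (f x + g x) powr p) \<partial>M) \<le> (\<integral>\<^sup>+x. ennreal (((A + B) powr p) * (A / (A + B)) * (cmod (f x) powr p / A powr p) +
       ((A + B) powr p) * (B / (A + B)) * (cmod (g x) powr p / B powr p)) \<partial>M)"
      by (intro nn_integral_mono ennreal_leI pw)
    also have "\<dots> = ennreal (((A + B) powr p) * (A / (A + B)) * ((\<integral>x. cmod (f x) powr p \<partial>M) / A powr p) +
       ((A + B) powr p) * (B / (A + B)) * ((\<integral>x. cmod (g x) powr p \<partial>M) / B powr p))"
      using If Ig that by (subst nn_integral_eq_integral) auto
    also have "\<dots> \<le> ennreal ((A + B) powr p)"
    proof (rule ennreal_leI)
      have 1: "(\<integral>x. cmod (f x) powr p \<partial>M) / A powr p \<le> 1" "(\<integral>x. cmod (g x) powr p \<partial>M) / B powr p \<le> 1"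
        using that p0 powr_mono2[of p "nrm p M f" A] powr_mono2[of p "nrm p M g" B]
        by (auto simp: nrm_powr)
      have "((A + B) powr p) * (A / (A + B)) * ((\<integral>x. cmod (f x) powr p \<partial>M) / A powr p) +
       ((A + B) powr p) * (B / (A + B)) * ((\<integral>x. cmod (g x) powr p \<partial>M) / B powr p) \<le>
        ((A + B) powr p) * (A / (A + B)) * 1 + ((A + B) powr p) * (B / (A + B)) * 1"
        using that 1 by (intro add_mono mult_left_mono) auto
      also have "\<dots> = (A + B) powr p * (A / (A + B) + B / (A + B))"
        by (simp add: distrib_left)
      also have "\<dots> = (A + B) powr p" using that by (simp add: add_divide_distrib[symmetric])
      finally show "((A + B) powr p) * (A / (A + B)) * ((\<integral>x. cmod (f x) powr p \<partial>M) / A powr p) +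
       ((A + B) powr p) * (B / (A + B)) * ((\<integral>x. cmod (g x) powr p \<partial>M) / B powr p) \<le> (A + B) powr p" .
    qed
    finally show ?thesis
      using nrm_leI[of p "A + B" "\<lambda>x. f x + g x" M] p0 that by auto
  qed
  show "(\<lambda>x. f x + g x) \<in> Lp_space p M"
    using main[of "nrm p M f + 1" "nrm p M g + 1"] by (auto simp: add_nonneg_pos)
  show "nrm p M (\<lambda>x. f x + g x) \<le> nrm p M f + nrm p M g"
  proof (rule field_le_epsilon)
    fix e :: real assume "e > 0"
    then show "nrm p M (\<lambda>x. f x + g x) \<le> nrm p M f + nrm p M g + e"
      using main[of "nrm p M f + e/2" "nrm p M g + e/2"] by (auto simp: add_nonneg_pos)
  qed
qed

lemma Lp_uminus:
  assumes "0 < p" "f \<in> Lp_space p M"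
  shows "(\<lambda>x. - f x) \<in> Lp_space p M" "nrm p M (\<lambda>x. - f x) = nrm p M f"
  using nrm_cmult[OF assms, of "-1"] by auto

lemma Lp_diff:
  assumes "1 \<le> p" "f \<in> Lp_space p M" "g \<in> Lp_space p M"
  shows "(\<lambda>x. f x - g x) \<in> Lp_space p M" "nrm p M (\<lambda>x. f x - g x) \<le> nrm p M f + nrm p M g"
  using Minkowski[OF assms(1,2) Lp_uminus(1)[of p g M]] assms Lp_uminus(2)[of p g M] by auto

lemma nrm_diff_ge:
  assumes "1 \<le> p" "f \<in> Lp_space p M" "g \<in> Lp_space p M"
  shows "nrm p M f - nrm p M g \<le> nrm p M (\<lambda>x. f x - g x)"
  using Minkowski(2)[OF assms(1) Lp_diff(1)[OF assms] assms(3)] by simp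

lemma nrm_minus_commute: "nrm p M (\<lambda>x. f x - g x) = nrm p M (\<lambda>x. g x - f x)"
  by (simp add: nrm_def norm_minus_commute)

lemma nrm_triangle3:
  assumes "1 \<le> p" "f \<in> Lp_space p M" "g \<in> Lp_space p M" "h \<in> Lp_space p M"
  shows "nrm p M (\<lambda>x. f x - h x) \<le> nrm p M (\<lambda>x. f x - g x) + nrm p M (\<lambda>x. g x - h x)"
  using Minkowski(2)[OF assms(1) Lp_diff(1)[OF assms(1,2,3)] Lp_diff(1)[OF assms(1,3,4)]] by simp

lemma Lp_Fatou:
  assumes p: "0 < p" and f: "\<And>n. f n \<in> borel_measurable M" and g: "g \<in> borel_measurable M"
    and ae: "AE x in M. (\<lambda>n. f n x) \<longlonglongrightarrow> g x"
    and C: "0 \<le> C" "\<And>n. f n \<in> Lp_space p M" "eventually (\<lambda>n. nrm p M (f n) \<le> C) sequentially"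
  shows "g \<in> Lp_space p M" "nrm p M g \<le> C"
proof -
  note [measurable] = f g
  have "(\<integral>\<^sup>+x. ennreal (cmod (g x) powr p) \<partial>M) = (\<integral>\<^sup>+x. liminf (\<lambda>n. ennreal (cmod (f n x) powr p)) \<partial>M)"
  proof (rule nn_integral_cong_AE)
    show "AE x in M. ennreal (cmod (g x) powr p) = liminf (\<lambda>n. ennreal (cmod (f n x) powr p))"
      using ae
    proof eventually_elim
      case (elim x)
      have "(\<lambda>n. ennreal (cmod (f n x) powr p)) \<longlonglongrightarrow> ennreal (cmod (g x) powr p)"
        using elim p by (intro tendsto_ennrealI tendsto_powr' tendsto_intros) auto
      then show ?case by (metis lim_imp_Liminf sequentially_bot)
    qed
  qed
  also have "\<dots> \<le> liminf (\<lambda>n. \<integral>\<^sup>+x. ennreal (cmod (f n x) powr p) \<partial>M)"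
    by (intro nn_integral_liminf) auto
  also have "\<dots> \<le> liminf (\<lambda>n::nat. ennreal (C powr p))"
  proof (rule Liminf_mono)
    show "\<forall>\<^sub>F n in sequentially. (\<integral>\<^sup>+x. ennreal (cmod (f n x) powr p) \<partial>M) \<le> ennreal (C powr p)"
      using C(3) by eventually_elim (use p C in \<open>auto simp: nn_integral_powr_eq_nrm intro!: ennreal_leI powr_mono2\<close>)
  qed
  also have "\<dots> = ennreal (C powr p)" by (simp add: Liminf_const)
  finally show "g \<in> Lp_space p M" "nrm p M g \<le> C"
    using nrm_leI[OF p C(1) g] by auto
qed

text \<open>Along a subsequence with geometrically small steps the sum of the absolute increments
  has finite norm, hence is finite almost everywhere, which gives a pointwise limit; Fatou turns it
  into a limit in norm.\<close>

lemma Riesz_Fischer: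
  assumes p: "1 \<le> p" and f: "\<And>n. f n \<in> Lp_space p M"
    and Cauchy: "\<And>e. e > 0 \<Longrightarrow> \<exists>N. \<forall>m\<ge>N. \<forall>n\<ge>N. nrm p M (\<lambda>x. f m x - f n x) < e"
  obtains g where "g \<in> Lp_space p M" "(\<lambda>n. nrm p M (\<lambda>x. f n x - g x)) \<longlonglongrightarrow> 0"
proof -
  have p0: "0 < p" using p by simp
  have fm [measurable]: "f n \<in> borel_measurable M" for n using f by (simp add: Lp_space_def)
  obtain N where N: "\<And>k m n. m \<ge> N k \<Longrightarrow> n \<ge> N k \<Longrightarrow> nrm p M (\<lambda>x. f m x - f n x) < (1/2)^k"
    using Cauchy[of "(1/2)^k" for k] by (metis zero_less_power half_gt_zero_iff zero_less_one)
  \<comment> \<open>The recursion makes \<open>r\<close> strictly increasing and keeps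
    \<open>r k\<close> beyond the Cauchy index \<open>N k\<close>.\<close>
  define r where "r = rec_nat (N 0) (\<lambda>k m. max (Suc m) (N (Suc k)))"
  have r: "strict_mono r" "\<And>k. r k \<ge> N k"
  proof -
    show "strict_mono r" by (rule strict_monoI_Suc) (simp add: r_def)
    show "r k \<ge> N k" for k by (cases k) (simp_all add: r_def)
  qed
  define D where "D k x = cmod (f (r (Suc k)) x - f (r k) x)" for k x
  define S where "S K x = complex_of_real (\<Sum>k<K. D k x)" for K x
  have [measurable]: "D k \<in> borel_measurable M" for k unfolding D_def by measurable
  have [measurable]: "S K \<in> borel_measurable M" for K unfolding S_def by measurable
  have Dn: "(\<lambda>x. complex_of_real (D k x)) \<in> Lp_space p M \<and> nrm p M (\<lambda>x. complex_of_real (D k x)) \<le> (1/2)^k" for k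
  proof -
    have "(\<lambda>x. complex_of_real (D k x)) \<in> Lp_space p M \<and>
        nrm p M (\<lambda>x. complex_of_real (D k x)) \<le> nrm p M (\<lambda>x. f (r (Suc k)) x - f (r k) x)"
      using nrm_mono[OF p0 Lp_diff(1)[OF p f f, of "r (Suc k)" "r k"], of "\<lambda>x. complex_of_real (D k x)"]
      by (auto simp: D_def)
    moreover have "nrm p M (\<lambda>x. f (r (Suc k)) x - f (r k) x) < (1/2)^k"
      using r(2)[of k] strict_monoD[OF r(1), of k "Suc k"] by (intro N) linarith+
    ultimately show ?thesis by linarith
  qed
  \<comment> \<open>The bound is the exact partial sum of the geometric series 1 + 1/2 + 1/4 + ...,
    the form in which the induction closes; only the bound 2 is used afterwards.\<close>
  have Sn: "S K \<in> Lp_space p M \<and> nrm p M (S K) \<le> 2 - 2 * (1/2)^K" for K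
  proof (induction K)
    case 0
    then show ?case using p0 by (auto simp: S_def nrm_def Lp_space_iff)
  next
    case (Suc K)
    have "S (Suc K) = (\<lambda>x. S K x + complex_of_real (D K x))" by (auto simp: S_def)
    then show ?case using Minkowski[OF p, of "S K" M "\<lambda>x. complex_of_real (D K x)"] Suc Dn[of K]
      by (auto simp: algebra_simps)
  qed
  have "(\<integral>\<^sup>+x. (SUP K. ennreal (cmod (S K x) powr p)) \<partial>M) = (SUP K. \<integral>\<^sup>+x. ennreal (cmod (S K x) powr p) \<partial>M)"
  proof (rule nn_integral_monotone_convergence_SUP)
    show "incseq (\<lambda>K x. ennreal (cmod (S K x) powr p))"
    proof (rule incseq_SucI, rule le_funI, rule ennreal_leI)
      fix K x
      have "(\<Sum>k<K. D k x) \<ge> 0" "D K x \<ge> 0" by (auto simp: D_def intro!: sum_nonneg)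
      then show "cmod (S K x) powr p \<le> cmod (S (Suc K) x) powr p"
        using p0 unfolding S_def norm_of_real by (intro powr_mono2) auto
    qed
  qed measurable
  also have "\<dots> \<le> ennreal (2 powr p)"
  proof (rule SUP_least)
    fix K
    have "nrm p M (S K) powr p \<le> 2 powr p"
      using Sn[of K] p0 by (intro powr_mono2) (auto intro: order_trans)
    then show "(\<integral>\<^sup>+x. ennreal (cmod (S K x) powr p) \<partial>M) \<le> ennreal (2 powr p)"
      using Sn[of K] p0 by (auto simp: nn_integral_powr_eq_nrm)
  qed
  finally have fin: "(\<integral>\<^sup>+x. (SUP K. ennreal (cmod (S K x) powr p)) \<partial>M) < \<infinity>"
    by (rule le_less_trans) simp
  have "AE x in M. (SUP K. ennreal (cmod (S K x) powr p)) \<noteq> \<infinity>"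
    using fin by (intro nn_integral_noteq_infinite) auto
  then have ae: "AE x in M. convergent (\<lambda>k. f (r k) x)"
  proof eventually_elim
    case (elim x)
    then obtain c where c: "0 \<le> c" "(SUP K. ennreal (cmod (S K x) powr p)) = ennreal c"
      by (metis ennreal_cases infinity_ennreal_def)
    have b: "(\<Sum>k<K. D k x) \<le> c powr (1/p)" for K
    proof -
      have "ennreal (cmod (S K x) powr p) \<le> ennreal c" unfolding c(2)[symmetric] by (rule SUP_upper) simp
      then have "cmod (S K x) powr p \<le> c" using c by simp
      then have "(cmod (S K x) powr p) powr (1/p) \<le> c powr (1/p)" using p0 by (intro powr_mono2) auto
      then have "cmod (S K x) \<le> c powr (1/p)" using p0 by (simp add: powr_powr)
      then show ?thesis unfolding S_def norm_of_real by linarith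
    qed
    have "summable (\<lambda>k. D k x)"
      by (rule summableI_nonneg_bounded[OF _ b]) (simp add: D_def)
    then have "summable (\<lambda>k. f (r (Suc k)) x - f (r k) x)"
      unfolding D_def by (rule summable_norm_cancel)
    then have "convergent (\<lambda>k. f (r k) x - f (r 0) x)"
      unfolding summable_iff_convergent sum_lessThan_telescope[of "\<lambda>k. f (r k) x"] .
    from convergent_add[OF this convergent_const[of "f (r 0) x"]] show ?case by simp
  qed
  define g where "g x = lim (\<lambda>k. f (r k) x)" for x
  have gm [measurable]: "g \<in> borel_measurable M"
    unfolding g_def by (intro borel_measurable_lim_metric) auto
  have lim: "AE x in M. (\<lambda>k. f (r k) x) \<longlonglongrightarrow> g x"
    using ae by eventually_elim (simp add: g_def convergent_LIMSEQ_iff)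
  \<comment> \<open>Fatou along the subsequence bounds the distance to the limit for every index
    \<open>m\<close>, not merely for the indices \<open>r k\<close>.\<close>
  have est: "(\<lambda>x. f m x - g x) \<in> Lp_space p M \<and> nrm p M (\<lambda>x. f m x - g x) \<le> e"
    if "0 < e" "\<And>n. n \<ge> N0 \<Longrightarrow> nrm p M (\<lambda>x. f m x - f n x) < e" for m N0 e
  proof -
    have "AE x in M. (\<lambda>k. f m x - f (r k) x) \<longlonglongrightarrow> f m x - g x"
      using lim by eventually_elim (intro tendsto_intros)
    moreover have "eventually (\<lambda>k. nrm p M (\<lambda>x. f m x - f (r k) x) \<le> e) sequentially"
      using eventually_ge_at_top[of N0]
    proof eventually_elim
      case (elim k)
      have "r k \<ge> N0" using elim seq_suble[OF r(1), of k] by simp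
      then show ?case using that(2) by (simp add: less_imp_le)
    qed
    moreover have "(\<lambda>x. f m x - f (r k) x) \<in> Lp_space p M" for k
      by (rule Lp_diff(1)[OF p f f])
    moreover have "(\<lambda>x. f m x - f (r k) x) \<in> borel_measurable M" "(\<lambda>x. f m x - g x) \<in> borel_measurable M" for k
      by measurable
    ultimately show ?thesis
      using less_imp_le[OF that(1)]
      by (simp add: Lp_Fatou[where f="\<lambda>k x. f m x - f (r k) x" and C=e, OF p0])
  qed
  have lim0: "(\<lambda>n. nrm p M (\<lambda>x. f n x - g x)) \<longlonglongrightarrow> 0"
  proof (rule LIMSEQ_I)
    fix e :: real assume e: "e > 0"
    have "e/2 > 0" using e by simp
    then obtain N0 where N0: "\<forall>m\<ge>N0. \<forall>n\<ge>N0. nrm p M (\<lambda>x. f m x - f n x) < e/2"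
      using Cauchy by blast
    have "norm (nrm p M (\<lambda>x. f n x - g x) - 0) < e" if "n \<ge> N0" for n
    proof -
      have "nrm p M (\<lambda>x. f n x - g x) \<le> e/2"
        by (rule conjunct2[OF est[of "e/2" N0 n]]) (use N0 that e in simp_all)
      then show ?thesis using e by (simp only: diff_zero real_norm_def abs_of_nonneg[OF nrm_nonneg])
    qed
    then show "\<exists>no. \<forall>n\<ge>no. norm (nrm p M (\<lambda>x. f n x - g x) - 0) < e" by blast
  qed
  obtain N0 where N0: "\<forall>m\<ge>N0. \<forall>n\<ge>N0. nrm p M (\<lambda>x. f m x - f n x) < 1" using Cauchy zero_less_one by blast
  have "(\<lambda>x. f N0 x - g x) \<in> Lp_space p M"
    by (rule conjunct1[OF est[of 1 N0 N0]]) (use N0 in simp_all)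
  from Lp_diff(1)[OF p f[of N0] this] have "g \<in> Lp_space p M" by simp
  then show thesis using lim0 by (rule that)
qed

section \<open>The Brezis-Lieb lemma and interpolation between exponents\<close>

lemma powr_norm_add_approx:
  assumes p: "0 < p" and e: "0 < (e::real)"
  obtains K :: real where "0 \<le> K"
    "\<And>a b :: complex. \<bar>cmod (a + b) powr p - cmod a powr p - cmod b powr p\<bar> \<le> e * cmod a powr p + K * cmod b powr p"
proof -
  \<comment> \<open>Continuity of the power at 1, applied to |a + b| / |a|, handles the case where
    \<open>b\<close> is small compared with \<open>a\<close>. Otherwise |a| is at most 2/d times |b|
    and everything is absorbed into |b|^p.\<close>
  have "isCont (\<lambda>x::real. x powr p) 1" by (intro continuous_intros) auto
  then obtain d where d: "d > 0" "\<And>x. \<bar>x - 1\<bar> < d \<Longrightarrow> \<bar>x powr p - 1\<bar> < e"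
    unfolding isCont_def LIM_eq using e
    by (metis diff_self abs_zero powr_one_eq_one real_norm_def)
  \<comment> \<open>The three summands bound |b|^p, |a + b|^p and |a|^p in the case where |a| is at
    most 2/d times |b|.\<close>
  define K where "K = 1 + (2 / d + 1) powr p + (2 / d) powr p"
  have K1: "K \<ge> 1" by (auto simp: K_def)
  have "\<bar>cmod (a + b) powr p - cmod a powr p - cmod b powr p\<bar> \<le> e * cmod a powr p + K * cmod b powr p" for a b
  proof (cases "2 * cmod b \<ge> d * cmod a")
    case True
    then have a: "cmod a \<le> 2 / d * cmod b" using d(1) by (simp add: field_simps)
    have "cmod (a + b) \<le> (2 / d + 1) * cmod b"
      using norm_triangle_ineq[of a b] a by (simp add: algebra_simps)
    then have 1: "cmod (a + b) powr p \<le> (2 / d + 1) powr p * cmod b powr p"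
      using powr_mono2[of p "cmod (a + b)" "(2 / d + 1) * cmod b"] p d(1) by (simp add: powr_mult)
    have 2: "cmod a powr p \<le> (2 / d) powr p * cmod b powr p"
      using powr_mono2[of p "cmod a" "(2 / d) * cmod b"] p d(1) a
      by (simp add: powr_mult del: times_divide_eq_left)
    have "\<bar>cmod (a + b) powr p - cmod a powr p - cmod b powr p\<bar> \<le> cmod (a + b) powr p + cmod a powr p + cmod b powr p"
      using powr_ge_zero[of "cmod (a+b)" p] powr_ge_zero[of "cmod a" p] powr_ge_zero[of "cmod b" p] by linarith
    also have "\<dots> \<le> K * cmod b powr p" using 1 2 by (simp add: K_def algebra_simps)
    also have "\<dots> \<le> e * cmod a powr p + K * cmod b powr p" using e by simp
    finally show ?thesis .
  next
    case False
    have a: "cmod a > 0" using False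
      by (metis d(1) linorder_not_le mult_nonneg_nonneg norm_ge_zero order.strict_iff_order zero_less_norm_iff norm_zero mult_zero_right zero_le_numeral)
    have "\<bar>cmod (a + b) - cmod a\<bar> \<le> cmod b"
      by (metis add_diff_cancel_left' norm_triangle_ineq3)
    then have "\<bar>cmod (a + b) / cmod a - 1\<bar> \<le> cmod b / cmod a"
      using a by (simp add: diff_divide_eq_iff[symmetric] abs_divide[symmetric] field_simps abs_le_iff)
    also have "\<dots> < d" using False norm_ge_zero[of b] by (subst pos_divide_less_eq[OF a]) linarith
    finally have "\<bar>(cmod (a + b) / cmod a) powr p - 1\<bar> < e" using d(2) by blast
    then have "\<bar>cmod (a + b) powr p - cmod a powr p\<bar> \<le> e * cmod a powr p"
      using a by (simp add: powr_divide field_simps abs_less_iff abs_le_iff)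
    moreover have "cmod b powr p \<le> K * cmod b powr p" using K1 by (simp add: mult_le_cancel_right1)
    ultimately show ?thesis using powr_ge_zero[of "cmod b" p] by linarith
  qed
  then show thesis using that[of K] K1 by force
qed

text \<open>With a = u n - v and b = v the pointwise estimate leaves an error of a small multiple of
  |u n - v|^p, whose integral is bounded uniformly in n, plus a fixed multiple of |v|^p, which
  serves as dominating function.\<close>

lemma Brezis_Lieb:
  assumes p: "1 \<le> p" and u: "\<And>n. u n \<in> Lp_space p M" and v: "v \<in> Lp_space p M"
    and C: "\<And>n. nrm p M (u n) \<le> C" and ae: "AE x in M. (\<lambda>n. u n x) \<longlonglongrightarrow> v x"
  shows "(\<lambda>n. nrm p M (u n) powr p - nrm p M (\<lambda>x. u n x - v x) powr p) \<longlonglongrightarrow> nrm p M v powr p"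
proof -
  have p0: "0 < p" using p by simp
  have [measurable]: "u n \<in> borel_measurable M" "v \<in> borel_measurable M" for n
    using u v by (auto simp: Lp_space_def)
  define W where "W n x = \<bar>cmod (u n x) powr p - cmod (u n x - v x) powr p - cmod (v x) powr p\<bar>" for n x
  have w: "(\<lambda>x. u n x - v x) \<in> Lp_space p M" for n using Lp_diff[OF p u v] by auto
  have Iu: "integrable M (\<lambda>x. cmod (u n x) powr p)" and Iw: "integrable M (\<lambda>x. cmod (u n x - v x) powr p)"
    and Iv: "integrable M (\<lambda>x. cmod (v x) powr p)" for n
    using u v w p0 by (auto simp: Lp_space_iff)
  have IW: "integrable M (W n)" for n unfolding W_def using Iu Iv Iw by auto
  have [measurable]: "W n \<in> borel_measurable M" for n using IW by auto
  define B where "B = (C + nrm p M v) powr p"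
  have B: "(\<integral>x. cmod (u n x - v x) powr p \<partial>M) \<le> B" for n
    unfolding nrm_powr[OF p0, symmetric] B_def
    using Lp_diff(2)[OF p u v, of n] C[of n] p0 by (intro powr_mono2) auto
  have "(\<lambda>n. \<integral>x. W n x \<partial>M) \<longlonglongrightarrow> 0"
  proof (rule LIMSEQ_I)
    fix e :: real assume e: "e > 0"
    define e' where "e' = e / (2 * (B + 1))"
    have B0: "B \<ge> 0" by (simp add: B_def)
    have e': "e' > 0" using e B0 by (simp add: e'_def)
    obtain K where K: "0 \<le> K" "\<And>a b :: complex. \<bar>cmod (a + b) powr p - cmod a powr p - cmod b powr p\<bar> \<le> e' * cmod a powr p + K * cmod b powr p"
      using powr_norm_add_approx[OF p0 e'] by blast
    \<comment> \<open>Only the excess over the small multiple of |u n - v|^p is dominated by an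
      integrable function; dominated convergence is applied to this excess.\<close>
    define h where "h n x = max (W n x - e' * cmod (u n x - v x) powr p) 0" for n x
    have "(\<lambda>n. \<integral>x. h n x \<partial>M) \<longlonglongrightarrow> (\<integral>x. 0 \<partial>M)"
    proof (rule integral_dominated_convergence)
      show "integrable M (\<lambda>x. K * cmod (v x) powr p)" using Iv by simp
      show "h n \<in> borel_measurable M" for n unfolding h_def by measurable
      show "AE x in M. norm (h n x) \<le> K * cmod (v x) powr p" for n
      proof (rule AE_I2)
        fix x
        show "norm (h n x) \<le> K * cmod (v x) powr p"
          using K(1) K(2)[of "u n x - v x" "v x"] mult_nonneg_nonneg[OF K(1) powr_ge_zero[of "cmod (v x)" p]]
          unfolding h_def W_def by simp
      qed
      show "AE x in M. (\<lambda>n. h n x) \<longlonglongrightarrow> 0" using ae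
      proof eventually_elim
        case (elim x)
        have a: "(\<lambda>n. cmod (u n x - v x) powr p) \<longlonglongrightarrow> 0"
        proof -
          have "(\<lambda>n. cmod (u n x - v x) powr p) \<longlonglongrightarrow> cmod (v x - v x) powr p"
            using p0 by (intro tendsto_powr' tendsto_intros elim) auto
          then show ?thesis by simp
        qed
        have b: "(\<lambda>n. cmod (u n x) powr p) \<longlonglongrightarrow> cmod (v x) powr p"
          using p0 by (intro tendsto_powr' tendsto_intros elim) auto
        have "(\<lambda>n. h n x) \<longlonglongrightarrow> max (\<bar>cmod (v x) powr p - 0 - cmod (v x) powr p\<bar> - e' * 0) 0"
          unfolding h_def W_def by (intro tendsto_intros a b)
        then show ?case by simp
      qed
    qed auto
    then have "\<forall>\<^sub>F n in sequentially. (\<integral>x. h n x \<partial>M) < e/2"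
      using e by (intro order_tendstoD) auto
    then obtain N where N: "\<And>n. n \<ge> N \<Longrightarrow> (\<integral>x. h n x \<partial>M) < e/2" by (auto simp: eventually_sequentially)
    show "\<exists>no. \<forall>n\<ge>no. norm ((\<integral>x. W n x \<partial>M) - 0) < e"
    proof (intro exI allI impI)
      fix n assume n: "n \<ge> N"
      have "integrable M (h n)" unfolding h_def using IW Iw by auto
      then have "(\<integral>x. W n x \<partial>M) \<le> (\<integral>x. h n x + e' * cmod (u n x - v x) powr p \<partial>M)"
        using IW Iw by (intro integral_mono) (auto simp: h_def)
      also have "\<dots> = (\<integral>x. h n x \<partial>M) + e' * (\<integral>x. cmod (u n x - v x) powr p \<partial>M)"
        using \<open>integrable M (h n)\<close> Iw by simp
      also have "\<dots> \<le> (\<integral>x. h n x \<partial>M) + e' * B" using B[of n] e' by auto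
      also have "\<dots> < e"
      proof -
        have "e' * B \<le> e' * (B + 1)" using e' by simp
        also have "\<dots> = e / 2" using B0 by (simp add: e'_def field_simps)
        finally show ?thesis using N[OF n] by linarith
      qed
      finally have "(\<integral>x. W n x \<partial>M) < e" .
      moreover have "(\<integral>x. W n x \<partial>M) \<ge> 0" by (auto simp: W_def)
      ultimately show "norm ((\<integral>x. W n x \<partial>M) - 0) < e" by simp
    qed
  qed
  then have "(\<lambda>n. nrm p M (u n) powr p - nrm p M (\<lambda>x. u n x - v x) powr p - nrm p M v powr p) \<longlonglongrightarrow> 0"
  proof (rule Lim_null_comparison[rotated], intro always_eventually allI)
    fix n
    have "nrm p M (u n) powr p - nrm p M (\<lambda>x. u n x - v x) powr p - nrm p M v powr p =
       (\<integral>x. cmod (u n x) powr p - cmod (u n x - v x) powr p - cmod (v x) powr p \<partial>M)"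
      using Iu Iv Iw by (simp add: nrm_powr[OF p0])
    also have "norm \<dots> \<le> (\<integral>x. norm (cmod (u n x) powr p - cmod (u n x - v x) powr p - cmod (v x) powr p) \<partial>M)"
      by (rule integral_norm_bound)
    finally show "norm (nrm p M (u n) powr p - nrm p M (\<lambda>x. u n x - v x) powr p - nrm p M v powr p) \<le> (\<integral>x. W n x \<partial>M)"
      by (simp add: W_def)
  qed
  then show ?thesis by (simp add: LIM_zero_iff)
qed

text \<open>The integrand is split at height \<open>l\<close>: below it the power \<open>p0\<close>
  dominates, above it the power \<open>p1\<close>. The free height replaces the multiplicative form:
  a large \<open>l\<close> makes the second term small, and l = 1 gives plain boundedness.\<close>

lemma Lp_interpolation:
  assumes p: "0 < p0" "p0 < p" "p < p1" and l: "0 < l"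
    and f: "f \<in> Lp_space p0 M" "f \<in> Lp_space p1 M"
  shows "f \<in> Lp_space p M"
    "nrm p M f powr p \<le> l powr (p - p0) * nrm p0 M f powr p0 + l powr (p - p1) * nrm p1 M f powr p1"
proof -
  have [measurable]: "f \<in> borel_measurable M" using f by (simp add: Lp_space_def)
  have pw: "cmod z powr p \<le> l powr (p - p0) * cmod z powr p0 + l powr (p - p1) * cmod z powr p1" for z
  proof (cases "z = 0")
    case False
    then have z: "cmod z > 0" by simp
    show ?thesis
    proof (cases "cmod z \<le> l")
      case True
      have "cmod z powr p = cmod z powr (p - p0) * cmod z powr p0" by (simp add: powr_add[symmetric])
      also have "\<dots> \<le> l powr (p - p0) * cmod z powr p0"
        using p True by (intro mult_right_mono powr_mono2) auto
      finally show ?thesis by (simp add: add_increasing2)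
    next
      case False
      have "cmod z powr p = cmod z powr (p - p1) * cmod z powr p1" by (simp add: powr_add[symmetric])
      also have "\<dots> \<le> l powr (p - p1) * cmod z powr p1"
        using p False l by (intro mult_right_mono powr_mono2') auto
      finally show ?thesis by (simp add: add_increasing)
    qed
  qed simp
  have I: "integrable M (\<lambda>x. cmod (f x) powr p0)" "integrable M (\<lambda>x. cmod (f x) powr p1)"
    using f p by (auto simp: Lp_space_iff)
  then have I': "integrable M (\<lambda>x. l powr (p - p0) * cmod (f x) powr p0 + l powr (p - p1) * cmod (f x) powr p1)"
    by auto
  have Ip: "integrable M (\<lambda>x. cmod (f x) powr p)"
    by (rule Bochner_Integration.integrable_bound[OF I']) (use pw in \<open>auto simp: add_increasing2\<close>)
  then show "f \<in> Lp_space p M" using p by (simp add: Lp_space_iff)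
  have "(\<integral>x. cmod (f x) powr p \<partial>M) \<le> (\<integral>x. l powr (p - p0) * cmod (f x) powr p0 + l powr (p - p1) * cmod (f x) powr p1 \<partial>M)"
    using Ip I' pw by (intro integral_mono) auto
  then show "nrm p M f powr p \<le> l powr (p - p0) * nrm p0 M f powr p0 + l powr (p - p1) * nrm p1 M f powr p1"
    using I p by (simp add: nrm_powr)
qed

text \<open>Read backwards: a lower bound of the \<open>p\<close>-norm and an upper bound of the
  \<open>p0\<close>-norm prevent the function from being small everywhere. This produces the point
  at which an extension is large.\<close>

lemma Lp_interpolation_bounded:
  assumes p: "0 < p0" "p0 < p" and B: "\<And>x. cmod (f x) \<le> B"
    and f: "f \<in> Lp_space p0 M"
  shows "nrm p M f powr p \<le> B powr (p - p0) * nrm p0 M f powr p0"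
proof -
  have [measurable]: "f \<in> borel_measurable M" using f by (simp add: Lp_space_def)
  have pw: "cmod (f x) powr p \<le> B powr (p - p0) * cmod (f x) powr p0" for x
  proof -
    have "cmod (f x) powr p = cmod (f x) powr (p - p0) * cmod (f x) powr p0" by (simp add: powr_add[symmetric])
    also have "\<dots> \<le> B powr (p - p0) * cmod (f x) powr p0"
      using p B by (intro mult_right_mono powr_mono2) auto
    finally show ?thesis .
  qed
  have I: "integrable M (\<lambda>x. B powr (p - p0) * cmod (f x) powr p0)"
    using f p by (auto simp: Lp_space_iff)
  have Ip: "integrable M (\<lambda>x. cmod (f x) powr p)"
    by (rule Bochner_Integration.integrable_bound[OF I]) (use pw in auto)
  have "(\<integral>x. cmod (f x) powr p \<partial>M) \<le> (\<integral>x. B powr (p - p0) * cmod (f x) powr p0 \<partial>M)"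
    using Ip I pw by (intro integral_mono) auto
  then show ?thesis using p by (simp add: nrm_powr)
qed

section \<open>Gaussians and oscillatory integrals\<close>

text \<open>The case d = 1 is the characteristic function of the standard normal law; the
  substitution of d x for x gives the rest.\<close>

lemma gaussian_FT_real:
  fixes t d :: real assumes d: "d > 0"
  shows "integrable lborel (\<lambda>x. of_real (exp (- (d * x)\<^sup>2 / 2)) * iexp (x * t))"
    "(\<integral>x. of_real (exp (- (d * x)\<^sup>2 / 2)) * iexp (x * t) \<partial>lborel) =
       complex_of_real (sqrt (2 * pi) / d * exp (- (t / d)\<^sup>2 / 2))"
proof -
  let ?g = "\<lambda>x. complex_of_real (exp (- x\<^sup>2 / 2)) * iexp (x * (t / d))"
  have n: "complex_of_real (exp (- x\<^sup>2 / 2)) * iexp (x * (t / d)) = sqrt (2*pi) *\<^sub>R (std_normal_density x *\<^sub>R iexp (t / d * x))" for x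
    by (simp add: std_normal_density_def scaleR_conv_of_real mult.commute)
  have "integrable lborel (\<lambda>x. std_normal_density x *\<^sub>R iexp (t / d * x))"
    by (rule Bochner_Integration.integrable_bound[OF integrable_std_normal_moment[of 0]]) auto
  then have I: "integrable lborel ?g" unfolding n by (rule integrable_scaleR_right)
  have "(\<integral>x. std_normal_density x *\<^sub>R iexp (t / d * x) \<partial>lborel) = char std_normal_distribution (t / d)"
    unfolding char_def by (subst integral_density) (auto simp: normal_density_nonneg)
  also have "\<dots> = complex_of_real (exp (- (t / d)\<^sup>2 / 2))" by (simp add: char_std_normal_distribution)
  finally have V: "(\<integral>x. ?g x \<partial>lborel) = complex_of_real (sqrt (2 * pi) * exp (- (t / d)\<^sup>2 / 2))"
    unfolding n by (simp add: scaleR_conv_of_real)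
  have eq: "?g (d * x) = of_real (exp (- (d * x)\<^sup>2 / 2)) * iexp (x * t)" for x
    using d by simp
  show "integrable lborel (\<lambda>x. of_real (exp (- (d * x)\<^sup>2 / 2)) * iexp (x * t))"
    using lborel_integrable_real_affine[OF I, of d 0] d unfolding add_0 eq by simp
  have "complex_of_real (sqrt (2 * pi) * exp (- (t / d)\<^sup>2 / 2)) = \<bar>d\<bar> *\<^sub>R (\<integral>x. ?g (0 + d * x) \<partial>lborel)"
    unfolding V[symmetric] using d by (intro lborel_integral_real_affine) auto
  then have "complex_of_real (sqrt (2 * pi) * exp (- (t / d)\<^sup>2 / 2)) = of_real d * (\<integral>x. of_real (exp (- (d * x)\<^sup>2 / 2)) * iexp (x * t) \<partial>lborel)"
    using d unfolding add_0 eq by (simp add: scaleR_conv_of_real)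
  then show "(\<integral>x. of_real (exp (- (d * x)\<^sup>2 / 2)) * iexp (x * t) \<partial>lborel) =
       complex_of_real (sqrt (2 * pi) / d * exp (- (t / d)\<^sup>2 / 2))"
    using d by (simp add: field_simps)
qed

lemma gaussian_prod_Basis:
  fixes z :: "'b::euclidean_space"
  shows "exp (- (d * norm z)\<^sup>2 / 2) = (\<Prod>b\<in>Basis. exp (- (d * (z \<bullet> b))\<^sup>2 / 2))"
proof -
  have "(norm z)\<^sup>2 = (\<Sum>b\<in>Basis. (z \<bullet> b)\<^sup>2)"
    unfolding power2_norm_eq_inner by (subst euclidean_inner) (simp add: power2_eq_square)
  then have "- (d * norm z)\<^sup>2 / 2 = (\<Sum>b\<in>Basis. - (d * (z \<bullet> b))\<^sup>2 / 2)"
    by (simp add: power_mult_distrib sum_distrib_left sum_negf sum_divide_distrib)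
  then show ?thesis by (simp add: exp_sum)
qed

text \<open>Weight and phase both factor over \<open>Basis\<close>, and Lebesgue measure is the
  image of a product measure, so the integral is a product of one-dimensional ones.\<close>

lemma gaussian_FT:
  fixes P :: "'b::euclidean_space" assumes d: "d > 0"
  shows "integrable lborel (\<lambda>z. of_real (exp (- (d * norm z)\<^sup>2 / 2)) * iexp (z \<bullet> P))"
    "(\<integral>z. of_real (exp (- (d * norm z)\<^sup>2 / 2)) * iexp (z \<bullet> P) \<partial>lborel) =
       complex_of_real ((sqrt (2 * pi) / d) ^ DIM('b) * exp (- (norm P / d)\<^sup>2 / 2))"
proof -
  interpret product_sigma_finite "\<lambda>b::'b. lborel :: real measure" ..
  let ?h = "\<lambda>b x. complex_of_real (exp (- (d * x)\<^sup>2 / 2)) * iexp (x * (P \<bullet> b))"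
  let ?g = "\<lambda>z::'b. complex_of_real (exp (- (d * norm z)\<^sup>2 / 2)) * iexp (z \<bullet> P)"
  have g: "?g z = (\<Prod>b\<in>Basis. ?h b (z \<bullet> b))" for z
  proof -
    have "iexp (z \<bullet> P) = (\<Prod>b\<in>Basis. iexp ((z \<bullet> b) * (P \<bullet> b)))"
      by (simp add: euclidean_inner[of z P] sum_distrib_left exp_sum)
    then show ?thesis by (simp only: gaussian_prod_Basis of_real_prod prod.distrib)
  qed
  have eq: "?g (\<Sum>b\<in>Basis. f b *\<^sub>R b) = (\<Prod>b\<in>Basis. ?h b (f b))" for f
    unfolding g by (intro prod.cong refl) simp
  have m: "(\<lambda>f. \<Sum>b\<in>Basis. f b *\<^sub>R b) \<in> measurable (\<Pi>\<^sub>M b\<in>Basis. lborel) (borel :: 'b measure)"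
    by measurable
  have meas: "?g \<in> borel_measurable borel" by measurable
  have 1: "integrable (\<Pi>\<^sub>M b\<in>Basis. lborel) (\<lambda>f. \<Prod>b\<in>(Basis::'b set). ?h b (f b))"
    by (intro product_integrable_prod gaussian_FT_real d) simp
  show "integrable lborel ?g"
    by (subst lborel_eq, subst integrable_distr_eq[OF m meas], unfold eq, rule 1)
  have "(\<integral>z. ?g z \<partial>lborel) = (\<integral>f. (\<Prod>b\<in>(Basis::'b set). ?h b (f b)) \<partial>(\<Pi>\<^sub>M b\<in>Basis. lborel))"
    by (subst lborel_eq, subst integral_distr[OF m meas], unfold eq, rule refl)
  also have "\<dots> = (\<Prod>b\<in>(Basis::'b set). \<integral>x. ?h b x \<partial>lborel)"
    by (intro product_integral_prod gaussian_FT_real d) simp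
  also have "\<dots> = complex_of_real (\<Prod>b\<in>(Basis::'b set). sqrt (2 * pi) / d * exp (- (P \<bullet> b / d)\<^sup>2 / 2))"
    unfolding of_real_prod by (intro prod.cong refl gaussian_FT_real d)
  also have "(\<Prod>b\<in>(Basis::'b set). sqrt (2 * pi) / d * exp (- (P \<bullet> b / d)\<^sup>2 / 2)) =
    (sqrt (2 * pi) / d) ^ DIM('b) * exp (- (norm P / d)\<^sup>2 / 2)"
    using gaussian_prod_Basis[of "1/d" P] unfolding prod.distrib by simp
  finally show "(\<integral>z. ?g z \<partial>lborel) = complex_of_real ((sqrt (2 * pi) / d) ^ DIM('b) * exp (- (norm P / d)\<^sup>2 / 2))" .
qed

lemma gaussian_integral:
  assumes d: "d > 0"
  shows "integrable lborel (\<lambda>z::'b::euclidean_space. exp (- (d * norm z)\<^sup>2 / 2))"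
    "(\<integral>z. exp (- (d * norm (z::'b))\<^sup>2 / 2) \<partial>lborel) = (sqrt (2 * pi) / d) ^ DIM('b)"
proof -
  have "integrable lborel (\<lambda>z::'b. complex_of_real (exp (- (d * norm z)\<^sup>2 / 2)))"
    using gaussian_FT(1)[OF d, of "0::'b"] by simp
  then show "integrable lborel (\<lambda>z::'b. exp (- (d * norm z)\<^sup>2 / 2))"
    by (simp only: complex_of_real_integrable_eq)
  have "complex_of_real (\<integral>z. exp (- (d * norm (z::'b))\<^sup>2 / 2) \<partial>lborel) = of_real ((sqrt (2 * pi) / d) ^ DIM('b))"
    using gaussian_FT(2)[OF d, of "0::'b"] by simp
  then show "(\<integral>z. exp (- (d * norm (z::'b))\<^sup>2 / 2) \<partial>lborel) = (sqrt (2 * pi) / d) ^ DIM('b)"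
    unfolding of_real_eq_iff .
qed

lemma (in pair_sigma_finite) integrable_mult_pair:
  fixes f :: "'a \<Rightarrow> complex" and g :: "'b \<Rightarrow> complex"
  assumes f: "integrable M1 f" and g: "integrable M2 g"
  shows "integrable (M1 \<Otimes>\<^sub>M M2) (\<lambda>(x, y). f x * g y)"
    "(\<integral>(x, y). f x * g y \<partial>(M1 \<Otimes>\<^sub>M M2)) = (\<integral>x. f x \<partial>M1) * (\<integral>y. g y \<partial>M2)"
proof -
  have [measurable]: "f \<in> borel_measurable M1" "g \<in> borel_measurable M2" using f g by auto
  show I: "integrable (M1 \<Otimes>\<^sub>M M2) (\<lambda>(x, y). f x * g y)"
  proof (rule Fubini_integrable)
    show "integrable M1 (\<lambda>x. \<integral>y. norm (case (x, y) of (x, y) \<Rightarrow> f x * g y) \<partial>M2)"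
      using f g by (simp add: norm_mult)
  qed (use g in auto)
  show "(\<integral>(x, y). f x * g y \<partial>(M1 \<Otimes>\<^sub>M M2)) = (\<integral>x. f x \<partial>M1) * (\<integral>y. g y \<partial>M2)"
    unfolding integral_fst[OF I, symmetric] by simp
qed

text \<open>The squared modulus is a double integral over two copies of \<open>M\<close>;
  integrating in \<open>z\<close> first replaces the phases by the Fourier transform of the Gaussian
  at S x - S y. What is left is a positive symmetric kernel, to which a Schur test applies.\<close>

lemma (in sigma_finite_measure) oscillatory_L2_gaussian:
  fixes S :: "'a \<Rightarrow> 'b::euclidean_space" and F :: "'a \<Rightarrow> complex"
  assumes [measurable]: "S \<in> borel_measurable M" and F: "integrable M F" and d: "d > 0"
  shows "(\<integral>\<^sup>+z. ennreal (exp (- (d * norm z)\<^sup>2 / 2) * (cmod (\<integral>x. iexp (z \<bullet> S x) * F x \<partial>M))\<^sup>2) \<partial>lborel)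
    \<le> (\<integral>\<^sup>+x. \<integral>\<^sup>+y. ennreal ((cmod (F x))\<^sup>2) *
          ennreal ((sqrt (2 * pi) / d) ^ DIM('b) * exp (- (norm (S x - S y) / d)\<^sup>2 / 2)) \<partial>M \<partial>M)"
proof -
  interpret MM: pair_sigma_finite M M ..
  interpret MML: pair_sigma_finite "M \<Otimes>\<^sub>M M" "lborel :: 'b measure" ..
  have [measurable]: "F \<in> borel_measurable M" using F by auto
  have [measurable]: "cnj \<in> borel_measurable borel"
    by (intro borel_measurable_continuous_onI continuous_intros)
  define I where "I z = (\<integral>x. iexp (z \<bullet> S x) * F x \<partial>M)" for z
  define w where "w z = exp (- (d * norm z)\<^sup>2 / 2)" for z :: 'b
  define G where "G P = (sqrt (2 * pi) / d) ^ DIM('b) * exp (- (norm P / d)\<^sup>2 / 2)" for P :: 'b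
  have Gpos: "G P \<ge> 0" for P using d by (simp add: G_def)
  have [measurable]: "w \<in> borel_measurable borel" "G \<in> borel_measurable borel" unfolding w_def G_def by measurable
  have int: "integrable M (\<lambda>x. iexp (z \<bullet> S x) * F x)" for z
    by (rule Bochner_Integration.integrable_bound[OF F]) (auto simp: norm_mult)
  have [measurable]: "I \<in> borel_measurable borel" unfolding I_def by measurable
  define \<Phi> where "\<Phi> = (\<lambda>(a, z). of_real (w z) * iexp (z \<bullet> (S (fst a) - S (snd a))) * (F (fst a) * cnj (F (snd a))))"
  have [measurable]: "\<Phi> \<in> borel_measurable ((M \<Otimes>\<^sub>M M) \<Otimes>\<^sub>M lborel)" unfolding \<Phi>_def by measurable
  have FF: "integrable (M \<Otimes>\<^sub>M M) (\<lambda>(x, y). F x * cnj (F y))"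
    by (intro MM.integrable_mult_pair F) (use F in simp)
  have I2: "of_real ((cmod (I z))\<^sup>2) = (\<integral>a. iexp (z \<bullet> (S (fst a) - S (snd a))) * (F (fst a) * cnj (F (snd a))) \<partial>(M \<Otimes>\<^sub>M M))" for z
  proof -
    have "of_real ((cmod (I z))\<^sup>2) = I z * cnj (I z)" by (rule complex_norm_square)
    also have "\<dots> = (\<integral>x. iexp (z \<bullet> S x) * F x \<partial>M) * (\<integral>x. cnj (iexp (z \<bullet> S x) * F x) \<partial>M)"
      unfolding I_def by (simp del: complex_cnj_mult)
    also have "\<dots> = (\<integral>(x,y). (iexp (z \<bullet> S x) * F x) * cnj (iexp (z \<bullet> S y) * F y) \<partial>(M \<Otimes>\<^sub>M M))"
      by (intro MM.integrable_mult_pair(2)[symmetric] int integrable_cnj)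
    also have "\<dots> = (\<integral>a. iexp (z \<bullet> (S (fst a) - S (snd a))) * (F (fst a) * cnj (F (snd a))) \<partial>(M \<Otimes>\<^sub>M M))"
      by (intro Bochner_Integration.integral_cong refl)
        (simp add: split_beta exp_cnj inner_diff_right right_diff_distrib exp_diff exp_minus divide_inverse)
    finally show ?thesis .
  qed
  \<comment> \<open>The Gaussian weight makes the joint integral absolutely convergent, which is
    what permits integrating in \<open>z\<close> first.\<close>
  have Phi_int: "integrable ((M \<Otimes>\<^sub>M M) \<Otimes>\<^sub>M lborel) \<Phi>"
  proof (rule MML.Fubini_integrable)
    have "(\<integral>z. norm (\<Phi> (a, z)) \<partial>lborel) = (sqrt (2 * pi) / d) ^ DIM('b) * norm (F (fst a) * cnj (F (snd a)))" for a
      using gaussian_integral[OF d, where 'b='b] by (simp add: \<Phi>_def norm_mult w_def)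
    then show "integrable (M \<Otimes>\<^sub>M M) (\<lambda>a. \<integral>z. norm (\<Phi> (a, z)) \<partial>lborel)"
      using integrable_norm[OF FF] by (simp add: split_beta del: norm_mult)
    show "AE a in M \<Otimes>\<^sub>M M. integrable lborel (\<lambda>z. \<Phi> (a, z))"
    proof (rule AE_I2)
      fix a
      show "integrable lborel (\<lambda>z. \<Phi> (a, z))"
        using integrable_mult_left[OF gaussian_FT(1)[OF d, of "S (fst a) - S (snd a)"], of "F (fst a) * cnj (F (snd a))"]
        by (simp add: \<Phi>_def w_def)
    qed
  qed measurable
  have A: "(\<integral>z. \<Phi> (a, z) \<partial>lborel) = of_real (G (S (fst a) - S (snd a))) * (F (fst a) * cnj (F (snd a)))" for a
    using gaussian_FT(2)[OF d, of "S (fst a) - S (snd a)"] by (simp add: \<Phi>_def w_def G_def)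
  have B: "(\<integral>a. \<Phi> (a, z) \<partial>(M \<Otimes>\<^sub>M M)) = of_real (w z * (cmod (I z))\<^sup>2)" for z
    unfolding of_real_mult I2 by (simp add: \<Phi>_def mult.assoc)
  have int1: "integrable lborel (\<lambda>z. complex_of_real (w z * (cmod (I z))\<^sup>2))"
    using MML.integrable_snd[of "\<lambda>a z. \<Phi> (a, z)"] Phi_int by (simp add: B)
  have int2: "integrable lborel (\<lambda>z. w z * (cmod (I z))\<^sup>2)"
    using int1 by (simp only: complex_of_real_integrable_eq)
  have int3: "integrable (M \<Otimes>\<^sub>M M) (\<lambda>a. of_real (G (S (fst a) - S (snd a))) * (F (fst a) * cnj (F (snd a))))"
    using MML.integrable_fst[of "\<lambda>a z. \<Phi> (a, z)"] Phi_int by (simp add: A)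
  have "complex_of_real (\<integral>z. w z * (cmod (I z))\<^sup>2 \<partial>lborel) = (\<integral>z. (\<integral>a. \<Phi> (a, z) \<partial>(M \<Otimes>\<^sub>M M)) \<partial>lborel)"
    unfolding B by (rule integral_complex_of_real[symmetric])
  also have "\<dots> = (\<integral>a. (\<integral>z. \<Phi> (a, z) \<partial>lborel) \<partial>(M \<Otimes>\<^sub>M M))"
    using MML.Fubini_integral[of "\<lambda>a z. \<Phi> (a, z)"] Phi_int by simp
  also have "\<dots> = (\<integral>a. of_real (G (S (fst a) - S (snd a))) * (F (fst a) * cnj (F (snd a))) \<partial>(M \<Otimes>\<^sub>M M))"
    by (simp only: A)
  finally have eq: "complex_of_real (\<integral>z. w z * (cmod (I z))\<^sup>2 \<partial>lborel) = \<dots>" .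
  have "(\<integral>\<^sup>+z. ennreal (w z * (cmod (I z))\<^sup>2) \<partial>lborel) = ennreal (\<integral>z. w z * (cmod (I z))\<^sup>2 \<partial>lborel)"
    by (rule nn_integral_eq_integral[OF int2]) (simp add: w_def)
  also have "\<dots> = ennreal (cmod (complex_of_real (\<integral>z. w z * (cmod (I z))\<^sup>2 \<partial>lborel)))"
    by (simp add: w_def)
  also have "\<dots> \<le> (\<integral>\<^sup>+a. ennreal (G (S (fst a) - S (snd a)) * (cmod (F (fst a)) * cmod (F (snd a)))) \<partial>(M \<Otimes>\<^sub>M M))"
    unfolding eq using integral_norm_bound_ennreal[OF int3] Gpos by (simp add: norm_mult)
  \<comment> \<open>Schur test: |F x| |F y| is at most half the sum of the squares, and by symmetry
    of the kernel both halves contribute equally.\<close>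
  also have "\<dots> \<le> (\<integral>\<^sup>+a. ennreal (1/2) * (ennreal ((cmod (F (fst a)))\<^sup>2) * ennreal (G (S (fst a) - S (snd a)))) +
      ennreal (1/2) * (ennreal ((cmod (F (snd a)))\<^sup>2) * ennreal (G (S (fst a) - S (snd a)))) \<partial>(M \<Otimes>\<^sub>M M))"
  proof (rule nn_integral_mono)
    fix a
    have "cmod (F (fst a)) * cmod (F (snd a)) \<le> 1/2 * (cmod (F (fst a)))\<^sup>2 + 1/2 * (cmod (F (snd a)))\<^sup>2"
      using sum_squares_bound[of "cmod (F (fst a))" "cmod (F (snd a))"] by simp
    from mult_left_mono[OF this Gpos[of "S (fst a) - S (snd a)"]]
    have "G (S (fst a) - S (snd a)) * (cmod (F (fst a)) * cmod (F (snd a))) \<le>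
      1/2 * ((cmod (F (fst a)))\<^sup>2 * G (S (fst a) - S (snd a))) + 1/2 * ((cmod (F (snd a)))\<^sup>2 * G (S (fst a) - S (snd a)))"
      by (simp add: algebra_simps)
    from ennreal_leI[OF this]
    show "ennreal (G (S (fst a) - S (snd a)) * (cmod (F (fst a)) * cmod (F (snd a)))) \<le>
      ennreal (1/2) * (ennreal ((cmod (F (fst a)))\<^sup>2) * ennreal (G (S (fst a) - S (snd a)))) +
      ennreal (1/2) * (ennreal ((cmod (F (snd a)))\<^sup>2) * ennreal (G (S (fst a) - S (snd a))))"
      using Gpos by (simp add: ennreal_mult ennreal_plus del: times_divide_eq_left)
  qed
  also have "\<dots> = ennreal (1/2) * (\<integral>\<^sup>+x. \<integral>\<^sup>+y. ennreal ((cmod (F x))\<^sup>2) * ennreal (G (S x - S y)) \<partial>M \<partial>M) +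
     ennreal (1/2) * (\<integral>\<^sup>+y. \<integral>\<^sup>+x. ennreal ((cmod (F y))\<^sup>2) * ennreal (G (S x - S y)) \<partial>M \<partial>M)"
  proof -
    have "(\<integral>\<^sup>+a. ennreal ((cmod (F (fst a)))\<^sup>2) * ennreal (G (S (fst a) - S (snd a))) \<partial>(M \<Otimes>\<^sub>M M)) =
        (\<integral>\<^sup>+x. \<integral>\<^sup>+y. ennreal ((cmod (F x))\<^sup>2) * ennreal (G (S x - S y)) \<partial>M \<partial>M)"
      by (subst nn_integral_fst[symmetric]) simp_all
    moreover have "(\<integral>\<^sup>+a. ennreal ((cmod (F (snd a)))\<^sup>2) * ennreal (G (S (fst a) - S (snd a))) \<partial>(M \<Otimes>\<^sub>M M)) =
        (\<integral>\<^sup>+y. \<integral>\<^sup>+x. ennreal ((cmod (F y))\<^sup>2) * ennreal (G (S x - S y)) \<partial>M \<partial>M)"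
      by (subst MM.nn_integral_snd[symmetric]) simp_all
    ultimately show ?thesis by (subst nn_integral_add) (simp_all add: nn_integral_cmult)
  qed
  also have "(\<integral>\<^sup>+y. \<integral>\<^sup>+x. ennreal ((cmod (F y))\<^sup>2) * ennreal (G (S x - S y)) \<partial>M \<partial>M) = (\<integral>\<^sup>+x. \<integral>\<^sup>+y. ennreal ((cmod (F x))\<^sup>2) * ennreal (G (S x - S y)) \<partial>M \<partial>M)"
    by (simp add: G_def norm_minus_commute)
  also have "ennreal (1/2) * (\<integral>\<^sup>+x. \<integral>\<^sup>+y. ennreal ((cmod (F x))\<^sup>2) * ennreal (G (S x - S y)) \<partial>M \<partial>M) + ennreal (1/2) * (\<integral>\<^sup>+x. \<integral>\<^sup>+y. ennreal ((cmod (F x))\<^sup>2) * ennreal (G (S x - S y)) \<partial>M \<partial>M) =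
     (\<integral>\<^sup>+x. \<integral>\<^sup>+y. ennreal ((cmod (F x))\<^sup>2) * ennreal (G (S x - S y)) \<partial>M \<partial>M)"
  proof -
    have "ennreal (1/2) + ennreal (1/2) = 1"
      by (subst ennreal_plus[symmetric]) (auto simp del: ennreal_plus)
    then show ?thesis by (simp only: distrib_right[symmetric] mult_1_left)
  qed
  finally show ?thesis by (simp add: w_def I_def G_def)
qed

lemma nn_integral_lborel_affine:
  fixes f :: "'b::euclidean_space \<Rightarrow> ennreal"
  assumes [measurable]: "f \<in> borel_measurable borel" and c: "c > 0"
  shows "(\<integral>\<^sup>+x. f x \<partial>lborel) = ennreal (c ^ DIM('b)) * (\<integral>\<^sup>+x. f (t + c *\<^sub>R x) \<partial>lborel)"
proof -
  have "(\<integral>\<^sup>+x. f x \<partial>lborel) = (\<integral>\<^sup>+x. f x \<partial>density (distr lborel borel (\<lambda>x. t + c *\<^sub>R x)) (\<lambda>x. ennreal (\<bar>c\<bar> ^ DIM('b))))"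
    by (rule arg_cong[where f="\<lambda>M. integral\<^sup>N M f"], rule lborel_affine) (use c in simp)
  then show ?thesis
    using c by (simp add: nn_integral_density nn_integral_distr nn_integral_cmult)
qed

text \<open>A density bound for the image of \<open>M\<close> under \<open>S\<close> replaces Plancherel's theorem: both sides are
  regularised by a Gaussian, whose Fourier transform is a positive approximate identity.\<close>

lemma (in sigma_finite_measure) oscillatory_L2:
  fixes S :: "'a \<Rightarrow> 'b::euclidean_space" and F :: "'a \<Rightarrow> complex"
  assumes S [measurable]: "S \<in> borel_measurable M" and F: "integrable M F"
    and F2: "integrable M (\<lambda>x. (cmod (F x))\<^sup>2)"
    and k: "continuous_on UNIV k" "\<And>P. 0 \<le> k P" "\<And>P. k P \<le> C"
    and dens: "\<And>G. G \<in> borel_measurable borel \<Longrightarrow> (\<integral>\<^sup>+x. G (S x) \<partial>M) \<le> (\<integral>\<^sup>+Q. G Q * ennreal (k Q) \<partial>lborel)"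
  shows "(\<integral>\<^sup>+z. ennreal ((cmod (\<integral>x. iexp (z \<bullet> S x) * F x \<partial>M))\<^sup>2) \<partial>lborel)
    \<le> ennreal ((2 * pi) ^ DIM('b) * (\<integral>x. (cmod (F x))\<^sup>2 * k (S x) \<partial>M))"
proof -
  have [measurable]: "F \<in> borel_measurable M" using F by auto
  have [measurable]: "k \<in> borel_measurable borel" using k(1) by (rule borel_measurable_continuous_onI)
  define I where "I z = (\<integral>x. iexp (z \<bullet> S x) * F x \<partial>M)" for z
  have [measurable]: "I \<in> borel_measurable borel" unfolding I_def by measurable
  define g where "g v = exp (- (norm v)\<^sup>2 / 2)" for v :: 'b
  have g: "integrable lborel g" "(\<integral>v. g v \<partial>lborel) = sqrt (2 * pi) ^ DIM('b)" "g v > 0" "g v \<le> 1" for v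
    using gaussian_integral[of 1, where 'b='b] by (auto simp: g_def[abs_def])
  have g0: "g v \<ge> 0" for v using g(3)[of v] by simp
  have [measurable]: "g \<in> borel_measurable borel" unfolding g_def by measurable
  define s where "s = sqrt (2 * pi) ^ DIM('b)"
  have s: "s > 0" by (simp add: s_def)
  define \<delta> where "\<delta> n = 1 / real (Suc n)" for n
  have \<delta>: "\<delta> n > 0" "\<delta> \<longlonglongrightarrow> 0" for n
    unfolding \<delta>_def using LIMSEQ_inverse_real_of_nat by (auto simp: inverse_eq_divide)
  \<comment> \<open>This is the Gaussian kernel of width \<open>\<delta> n\<close> around
    \<open>P\<close> integrated against the density \<open>k\<close>, after the substitution Q = P +
    \<delta> n v. One factor \<open>s\<close> comes from the Fourier transform, a second one appears
    in the limit as the mass of \<open>g\<close>; together they make the power of 2 pi.\<close>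
  define B where "B n P = s * (\<integral>v. g v * k (P + \<delta> n *\<^sub>R v) \<partial>lborel)" for n P
  have gk: "integrable lborel (\<lambda>v. g v * k (P + \<delta> n *\<^sub>R v))" for n P
  proof (rule Bochner_Integration.integrable_bound[of _ "\<lambda>v. C * g v"])
    show "AE v in lborel. norm (g v * k (P + \<delta> n *\<^sub>R v)) \<le> norm (C * g v)"
    proof (rule AE_I2)
      fix v
      have "\<bar>k (P + \<delta> n *\<^sub>R v)\<bar> \<le> \<bar>C\<bar>" using k(2,3)[of "P + \<delta> n *\<^sub>R v"] by linarith
      then show "norm (g v * k (P + \<delta> n *\<^sub>R v)) \<le> norm (C * g v)"
        using g(3)[of v] by (simp add: abs_mult mult.commute)
    qed
  qed (use g in auto)
  have [measurable]: "B n \<in> borel_measurable borel" for n unfolding B_def by measurable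
  have B0: "B n P \<ge> 0" for n P
    unfolding B_def using s k(2) g0 by (intro mult_nonneg_nonneg[OF _ integral_nonneg_AE]) auto
  have BC: "B n P \<le> s * s * C" for n P
  proof -
    have "(\<integral>v. g v * k (P + \<delta> n *\<^sub>R v) \<partial>lborel) \<le> (\<integral>v. g v * C \<partial>lborel)"
      using g(1) k(3) g0 by (intro integral_mono gk) (auto intro: mult_left_mono)
    also have "\<dots> = s * C" using g(2) by (simp add: s_def)
    finally show ?thesis using s by (simp add: B_def)
  qed
  have Blim: "(\<lambda>n. B n P) \<longlonglongrightarrow> s * (s * k P)" for P
  proof -
    have "(\<lambda>n. \<integral>v. g v * k (P + \<delta> n *\<^sub>R v) \<partial>lborel) \<longlonglongrightarrow> (\<integral>v. g v * k P \<partial>lborel)"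
    proof (rule integral_dominated_convergence[where w="\<lambda>v. C * g v"])
      show "AE v in lborel. (\<lambda>n. g v * k (P + \<delta> n *\<^sub>R v)) \<longlonglongrightarrow> g v * k P"
      proof (rule AE_I2)
        fix v
        have "(\<lambda>n. P + \<delta> n *\<^sub>R v) \<longlonglongrightarrow> P + 0 *\<^sub>R v" by (intro tendsto_intros \<delta>)
        then have "(\<lambda>n. k (P + \<delta> n *\<^sub>R v)) \<longlonglongrightarrow> k P"
          using k(1) by (intro continuous_on_tendsto_compose[of UNIV k]) auto
        then show "(\<lambda>n. g v * k (P + \<delta> n *\<^sub>R v)) \<longlonglongrightarrow> g v * k P" by (intro tendsto_intros)
      qed
      show "AE v in lborel. norm (g v * k (P + \<delta> n *\<^sub>R v)) \<le> C * g v" for n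
        using mult_left_mono[OF k(3) g0] k(2) g0 by (intro AE_I2) (simp add: abs_mult mult.commute)
    qed (use g in auto)
    then have "(\<lambda>n. \<integral>v. g v * k (P + \<delta> n *\<^sub>R v) \<partial>lborel) \<longlonglongrightarrow> s * k P" using g(2) by (simp add: s_def)
    then show ?thesis unfolding B_def by (intro tendsto_intros)
  qed
  have step: "(\<integral>\<^sup>+z. ennreal (exp (- (\<delta> n * norm z)\<^sup>2 / 2) * (cmod (I z))\<^sup>2) \<partial>lborel) \<le> ennreal (\<integral>x. (cmod (F x))\<^sup>2 * B n (S x) \<partial>M)" for n
  proof -
    let ?d = "\<delta> n"
    have inner: "(\<integral>\<^sup>+y. ennreal ((sqrt (2 * pi) / ?d) ^ DIM('b) * exp (- (norm (P - S y) / ?d)\<^sup>2 / 2)) \<partial>M) \<le> ennreal (B n P)" for P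
    proof -
      let ?G = "\<lambda>Q. ennreal ((sqrt (2 * pi) / ?d) ^ DIM('b) * exp (- (norm (P - Q) / ?d)\<^sup>2 / 2))"
      have "(\<integral>\<^sup>+y. ?G (S y) \<partial>M) \<le> (\<integral>\<^sup>+Q. ?G Q * ennreal (k Q) \<partial>lborel)" by (rule dens) measurable
      also have "\<dots> = ennreal (?d ^ DIM('b)) * (\<integral>\<^sup>+v. ?G (P + ?d *\<^sub>R v) * ennreal (k (P + ?d *\<^sub>R v)) \<partial>lborel)"
        using \<delta> by (subst nn_integral_lborel_affine[where c="?d" and t=P]) auto
      also have "\<dots> = (\<integral>\<^sup>+v. ennreal (s * (g v * k (P + ?d *\<^sub>R v))) \<partial>lborel)"
      proof (subst nn_integral_cmult[symmetric])
        have "ennreal (?d ^ DIM('b)) * (?G (P + ?d *\<^sub>R v) * ennreal (k (P + ?d *\<^sub>R v))) = ennreal (s * (g v * k (P + ?d *\<^sub>R v)))" for v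
        proof -
          have "?d ^ DIM('b) * ((sqrt (2 * pi) / ?d) ^ DIM('b) * exp (- (norm (P - (P + ?d *\<^sub>R v)) / ?d)\<^sup>2 / 2) * k (P + ?d *\<^sub>R v)) = s * (g v * k (P + ?d *\<^sub>R v))"
            using \<delta>(1)[of n] by (simp add: s_def g_def power_divide)
          moreover have mult3: "ennreal a * (ennreal b * ennreal c) = ennreal (a * (b * c))" if "a \<ge> 0" "b \<ge> 0" "c \<ge> 0" for a b c
            using that by (simp add: ennreal_mult)
          moreover have "0 \<le> ?d ^ DIM('b)" "0 \<le> (sqrt (2 * pi) / ?d) ^ DIM('b) * exp (- (norm (P - (P + ?d *\<^sub>R v)) / ?d)\<^sup>2 / 2)"
            "0 \<le> k (P + ?d *\<^sub>R v)" using \<delta>(1)[of n] k(2) by auto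
          ultimately show ?thesis by (simp only: mult3)
        qed
        then show "(\<integral>\<^sup>+v. ennreal (?d ^ DIM('b)) * (?G (P + ?d *\<^sub>R v) * ennreal (k (P + ?d *\<^sub>R v))) \<partial>lborel) = (\<integral>\<^sup>+v. ennreal (s * (g v * k (P + ?d *\<^sub>R v))) \<partial>lborel)"
          by simp
      qed measurable
      also have "\<dots> = ennreal (B n P)"
        unfolding B_def using gk[of P n] s g0 k(2) by (subst nn_integral_eq_integral) simp_all
      finally show ?thesis .
    qed
    have "(\<integral>\<^sup>+z. ennreal (exp (- (?d * norm z)\<^sup>2 / 2) * (cmod (I z))\<^sup>2) \<partial>lborel) \<le>
      (\<integral>\<^sup>+x. \<integral>\<^sup>+y. ennreal ((cmod (F x))\<^sup>2) * ennreal ((sqrt (2 * pi) / ?d) ^ DIM('b) * exp (- (norm (S x - S y) / ?d)\<^sup>2 / 2)) \<partial>M \<partial>M)"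
      unfolding I_def by (rule oscillatory_L2_gaussian[OF S F \<delta>(1)])
    also have "\<dots> \<le> (\<integral>\<^sup>+x. ennreal ((cmod (F x))\<^sup>2) * ennreal (B n (S x)) \<partial>M)"
    proof (rule nn_integral_mono)
      fix x
      have "(\<integral>\<^sup>+y. ennreal ((cmod (F x))\<^sup>2) * ennreal ((sqrt (2 * pi) / ?d) ^ DIM('b) * exp (- (norm (S x - S y) / ?d)\<^sup>2 / 2)) \<partial>M) =
        ennreal ((cmod (F x))\<^sup>2) * (\<integral>\<^sup>+y. ennreal ((sqrt (2 * pi) / ?d) ^ DIM('b) * exp (- (norm (S x - S y) / ?d)\<^sup>2 / 2)) \<partial>M)"
        by (rule nn_integral_cmult) measurable
      also have "\<dots> \<le> ennreal ((cmod (F x))\<^sup>2) * ennreal (B n (S x))"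
        by (rule mult_left_mono[OF inner]) simp
      finally show "(\<integral>\<^sup>+y. ennreal ((cmod (F x))\<^sup>2) * ennreal ((sqrt (2 * pi) / ?d) ^ DIM('b) * exp (- (norm (S x - S y) / ?d)\<^sup>2 / 2)) \<partial>M)
        \<le> ennreal ((cmod (F x))\<^sup>2) * ennreal (B n (S x))" .
    qed
    also have "\<dots> = ennreal (\<integral>x. (cmod (F x))\<^sup>2 * B n (S x) \<partial>M)"
    proof (subst ennreal_mult[symmetric])
      have "integrable M (\<lambda>x. (cmod (F x))\<^sup>2 * B n (S x))"
      proof (rule Bochner_Integration.integrable_bound[OF integrable_mult_right[OF F2, of "s * s * C"]])
        show "AE x in M. norm ((cmod (F x))\<^sup>2 * B n (S x)) \<le> norm (s * s * C * (cmod (F x))\<^sup>2)"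
        proof (rule AE_I2)
          fix x
          have "\<bar>B n (S x)\<bar> \<le> \<bar>s * s * C\<bar>" using BC[of n "S x"] B0[of n "S x"] by linarith
          from mult_right_mono[OF this, of "(cmod (F x))\<^sup>2"]
          show "norm ((cmod (F x))\<^sup>2 * B n (S x)) \<le> norm (s * s * C * (cmod (F x))\<^sup>2)"
            by (simp add: abs_mult mult.commute)
        qed
      qed measurable
      then show "(\<integral>\<^sup>+x. ennreal ((cmod (F x))\<^sup>2 * B n (S x)) \<partial>M) = ennreal (\<integral>x. (cmod (F x))\<^sup>2 * B n (S x) \<partial>M)"
        by (rule nn_integral_eq_integral) (simp add: B0)
    qed (auto simp: B0)
    finally show ?thesis .
  qed
  have lim: "(\<lambda>n. \<integral>x. (cmod (F x))\<^sup>2 * B n (S x) \<partial>M) \<longlonglongrightarrow> (\<integral>x. (cmod (F x))\<^sup>2 * (s * (s * k (S x))) \<partial>M)"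
  proof (rule integral_dominated_convergence[where w="\<lambda>x. s * s * C * (cmod (F x))\<^sup>2"])
    show "AE x in M. norm ((cmod (F x))\<^sup>2 * B n (S x)) \<le> s * s * C * (cmod (F x))\<^sup>2" for n
      using mult_right_mono[OF BC zero_le_power2] B0 by (intro AE_I2) (simp add: abs_mult mult.commute)
    show "AE x in M. (\<lambda>n. (cmod (F x))\<^sup>2 * B n (S x)) \<longlonglongrightarrow> (cmod (F x))\<^sup>2 * (s * (s * k (S x)))"
      by (intro AE_I2 tendsto_intros Blim)
  qed (use F2 in auto)
  \<comment> \<open>Fatou removes the Gaussian weight on the left as its width parameter tends to
    0.\<close>
  have "(\<integral>\<^sup>+z. ennreal ((cmod (I z))\<^sup>2) \<partial>lborel) = (\<integral>\<^sup>+z. liminf (\<lambda>n. ennreal (exp (- (\<delta> n * norm z)\<^sup>2 / 2) * (cmod (I z))\<^sup>2)) \<partial>lborel)"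
  proof (rule nn_integral_cong)
    fix z
    have "(\<lambda>n. exp (- (\<delta> n * norm z)\<^sup>2 / 2) * (cmod (I z))\<^sup>2) \<longlonglongrightarrow> exp (- (0 * norm z)\<^sup>2 / 2) * (cmod (I z))\<^sup>2"
      by (intro tendsto_intros \<delta>) simp
    then have "(\<lambda>n. ennreal (exp (- (\<delta> n * norm z)\<^sup>2 / 2) * (cmod (I z))\<^sup>2)) \<longlonglongrightarrow> ennreal ((cmod (I z))\<^sup>2)"
      by (intro tendsto_ennrealI) simp
    then show "ennreal ((cmod (I z))\<^sup>2) = liminf (\<lambda>n. ennreal (exp (- (\<delta> n * norm z)\<^sup>2 / 2) * (cmod (I z))\<^sup>2))"
      by (metis lim_imp_Liminf sequentially_bot)
  qed
  also have "\<dots> \<le> liminf (\<lambda>n. \<integral>\<^sup>+z. ennreal (exp (- (\<delta> n * norm z)\<^sup>2 / 2) * (cmod (I z))\<^sup>2) \<partial>lborel)"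
    by (intro nn_integral_liminf) measurable
  also have "\<dots> \<le> liminf (\<lambda>n. ennreal (\<integral>x. (cmod (F x))\<^sup>2 * B n (S x) \<partial>M))"
    by (intro Liminf_mono always_eventually allI step)
  also have "\<dots> = ennreal (\<integral>x. (cmod (F x))\<^sup>2 * (s * (s * k (S x))) \<partial>M)"
    by (intro lim_imp_Liminf tendsto_ennrealI lim) simp
  also have "(\<integral>x. (cmod (F x))\<^sup>2 * (s * (s * k (S x))) \<partial>M) = (\<integral>x. s * s * ((cmod (F x))\<^sup>2 * k (S x)) \<partial>M)"
    by (intro Bochner_Integration.integral_cong refl) (simp add: mult_ac)
  also have "\<dots> = s * s * (\<integral>x. (cmod (F x))\<^sup>2 * k (S x) \<partial>M)"
    by (rule integral_mult_right_zero)
  also have "s * s = (2 * pi) ^ DIM('b)"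
    unfolding s_def power_mult_distrib[symmetric] by simp
  finally show ?thesis by (simp add: I_def)
qed

section \<open>The extension operator at even exponents\<close>

lemma japanese_ge_1: "1 \<le> japanese y"
  by (simp add: japanese_def)

lemma japanese_pos [simp]: "0 < japanese y" "0 \<le> japanese y" "japanese y \<noteq> 0"
  using japanese_ge_1[of y] by linarith+

lemma japanese_power2: "(japanese y)\<^sup>2 = 1 + (norm y)\<^sup>2"
  by (simp add: japanese_def)

lemma norm_less_japanese: "norm y < japanese y"
  by (rule power2_less_imp_less) (simp_all add: japanese_power2)

lemma continuous_on_japanese [continuous_intros]:
  "continuous_on S f \<Longrightarrow> continuous_on S (\<lambda>x. japanese (f x))"
  unfolding japanese_def by (intro continuous_intros)

lemma borel_measurable_japanese [measurable]: "japanese \<in> borel_measurable borel"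
  by (intro borel_measurable_continuous_onI continuous_intros)

lemma sets_hyp_measure [simp, measurable_cong]: "sets hyp_measure = sets borel"
  by (simp add: hyp_measure_def)

lemma space_hyp_measure [simp]: "space hyp_measure = UNIV"
  by (simp add: hyp_measure_def)

lemma nn_integral_hyp_measure:
  "f \<in> borel_measurable borel \<Longrightarrow>
    (\<integral>\<^sup>+y. f y \<partial>hyp_measure) = (\<integral>\<^sup>+y. ennreal (1 / japanese y) * f y \<partial>lborel)"
  unfolding hyp_measure_def by (subst nn_integral_density) auto

interpretation hyp: sigma_finite_measure hyp_measure
  unfolding hyp_measure_def by (subst sigma_finite_measure.sigma_finite_iff_density_finite[OF sigma_finite_lborel]) auto

interpretation hyps: product_sigma_finite "\<lambda>i. hyp_measure"
  ..

text \<open>The point of the hyperboloid above \<open>y\<close>. With it the two phases of the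
  extension operator merge into a single inner product in space-time.\<close>

definition pos :: "'a::euclidean_space \<Rightarrow> 'a \<times> real" where
  "pos y = (y, japanese y)"

lemma borel_measurable_pos [measurable]: "pos \<in> borel_measurable borel"
  unfolding pos_def by (intro borel_measurable_continuous_onI continuous_intros)

lemma ext_schwartz_eq: "ext_schwartz f z = (\<integral>y. iexp (z \<bullet> pos y) * f y \<partial>hyp_measure)"
  by (simp add: ext_schwartz_def split_beta pos_def inner_prod_def exp_add[symmetric] distrib_left)

lemma ext_schwartz_measurable [measurable]:
  assumes [measurable]: "f \<in> borel_measurable borel"
  shows "ext_schwartz f \<in> borel_measurable borel"
  unfolding ext_schwartz_eq[abs_def] by measurable

lemma integrable_iexp_mult:
  assumes "integrable M f" "g \<in> borel_measurable M"
  shows "integrable M (\<lambda>y. iexp (g y) * f y)"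
  by (rule Bochner_Integration.integrable_bound[OF assms(1)])
    (use assms in \<open>auto simp: norm_mult\<close>)

text \<open>The \<open>m\<close>-fold convolution of the invariant measure has a density at most
  \<open>k\<close>. Testing against all nonnegative functions expresses this without constructing
  either the convolution or its density, and makes a weaker bound as good as an exact
  formula.\<close>

definition conv_bound :: "nat \<Rightarrow> ('a::euclidean_space \<times> real \<Rightarrow> ennreal) \<Rightarrow> bool" where
  "conv_bound m k \<longleftrightarrow> k \<in> borel_measurable borel \<and>
     (\<forall>G \<in> borel_measurable borel.
        (\<integral>\<^sup>+a. G (\<Sum>i<m. pos (a i)) \<partial>(Pi\<^sub>M {..<m} (\<lambda>_. hyp_measure))) \<le> (\<integral>\<^sup>+P. G P * k P \<partial>lborel))"

lemma conv_bound_mono: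
  fixes k k' :: "'a::euclidean_space \<times> real \<Rightarrow> ennreal"
  assumes "conv_bound m k" "k' \<in> borel_measurable borel" "\<And>P. k P \<le> k' P"
  shows "conv_bound m k'"
  unfolding conv_bound_def
proof (intro conjI ballI assms(2))
  fix G :: "'a \<times> real \<Rightarrow> ennreal" assume "G \<in> borel_measurable borel"
  then have "(\<integral>\<^sup>+a. G (\<Sum>i<m. pos (a i)) \<partial>(Pi\<^sub>M {..<m} (\<lambda>_. hyp_measure))) \<le> (\<integral>\<^sup>+P. G P * k P \<partial>lborel)"
    using assms(1) by (auto simp: conv_bound_def)
  also have "\<dots> \<le> (\<integral>\<^sup>+P. G P * k' P \<partial>lborel)"
    by (intro nn_integral_mono mult_left_mono assms) simp
  finally show "(\<integral>\<^sup>+a. G (\<Sum>i<m. pos (a i)) \<partial>(Pi\<^sub>M {..<m} (\<lambda>_. hyp_measure))) \<le> (\<integral>\<^sup>+P. G P * k' P \<partial>lborel)" .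
qed

lemma nn_integral_hyp_lborel_Fubini:
  fixes h :: "'a::euclidean_space \<Rightarrow> 'b::euclidean_space \<Rightarrow> ennreal"
  assumes [measurable]: "case_prod h \<in> borel_measurable (borel \<Otimes>\<^sub>M borel)"
  shows "(\<integral>\<^sup>+b. \<integral>\<^sup>+P. h b P \<partial>lborel \<partial>hyp_measure) = (\<integral>\<^sup>+P. \<integral>\<^sup>+b. h b P \<partial>hyp_measure \<partial>lborel)"
proof -
  interpret pair_sigma_finite "hyp_measure :: 'a measure" "lborel :: 'b measure" ..
  show ?thesis by (rule Fubini'[symmetric]) measurable
qed

lemma nn_integral_lborel_minus:
  fixes f :: "'b::euclidean_space \<Rightarrow> ennreal"
  assumes [measurable]: "f \<in> borel_measurable borel"
  shows "(\<integral>\<^sup>+x. f (x + c) \<partial>lborel) = (\<integral>\<^sup>+x. f x \<partial>lborel)"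
  using nn_integral_lborel_affine[OF assms, of 1 c] by (simp add: add.commute)

text \<open>Splitting off the last point, translating by \<open>pos b\<close> and exchanging the
  integrals convolves the bound with one more copy of the invariant measure.\<close>

lemma conv_bound_Suc:
  fixes k k' :: "'a::euclidean_space \<times> real \<Rightarrow> ennreal"
  assumes k: "conv_bound m k" and k' [measurable]: "k' \<in> borel_measurable borel"
    and le: "\<And>P. (\<integral>\<^sup>+b. k (P - pos b) \<partial>hyp_measure) \<le> k' P"
  shows "conv_bound (Suc m) k'"
  unfolding conv_bound_def
proof (intro conjI ballI k')
  fix G :: "'a \<times> real \<Rightarrow> ennreal" assume G [measurable]: "G \<in> borel_measurable borel"
  have [measurable]: "k \<in> borel_measurable borel" using k by (simp add: conv_bound_def)
  have "(\<integral>\<^sup>+a. G (\<Sum>i<Suc m. pos (a i)) \<partial>(Pi\<^sub>M {..<Suc m} (\<lambda>_. hyp_measure))) =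
     (\<integral>\<^sup>+b. \<integral>\<^sup>+a. G (\<Sum>i<Suc m. pos ((a(m := b)) i)) \<partial>(Pi\<^sub>M {..<m} (\<lambda>_. hyp_measure)) \<partial>hyp_measure)"
    unfolding lessThan_Suc by (subst hyps.product_nn_integral_insert_rev) auto
  also have "\<dots> = (\<integral>\<^sup>+b. \<integral>\<^sup>+a. G ((\<Sum>i<m. pos (a i)) + pos b) \<partial>(Pi\<^sub>M {..<m} (\<lambda>_. hyp_measure)) \<partial>hyp_measure)"
    by simp
  also have "\<dots> \<le> (\<integral>\<^sup>+b. \<integral>\<^sup>+P. G (P + pos b) * k P \<partial>lborel \<partial>hyp_measure)"
  proof (rule nn_integral_mono)
    fix b :: 'a
    have "(\<lambda>P. G (P + pos b)) \<in> borel_measurable borel" by measurable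
    from bspec[OF conjunct2[OF k[unfolded conv_bound_def]] this]
    show "(\<integral>\<^sup>+a. G ((\<Sum>i<m. pos (a i)) + pos b) \<partial>(Pi\<^sub>M {..<m} (\<lambda>_. hyp_measure))) \<le> (\<integral>\<^sup>+P. G (P + pos b) * k P \<partial>lborel)" .
  qed
  also have "\<dots> = (\<integral>\<^sup>+b. \<integral>\<^sup>+P. G P * k (P - pos b) \<partial>lborel \<partial>hyp_measure)"
  proof (rule nn_integral_cong)
    fix b :: 'a
    show "(\<integral>\<^sup>+P. G (P + pos b) * k P \<partial>lborel) = (\<integral>\<^sup>+P. G P * k (P - pos b) \<partial>lborel)"
      using nn_integral_lborel_minus[of "\<lambda>P. G P * k (P - pos b)" "pos b"] by simp
  qed
  also have "\<dots> = (\<integral>\<^sup>+P. \<integral>\<^sup>+b. G P * k (P - pos b) \<partial>hyp_measure \<partial>lborel)"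
    by (rule nn_integral_hyp_lborel_Fubini) measurable
  also have "\<dots> \<le> (\<integral>\<^sup>+P. G P * k' P \<partial>lborel)"
    by (intro nn_integral_mono) (simp add: nn_integral_cmult mult_left_mono le)
  finally show "(\<integral>\<^sup>+a. G (\<Sum>i<Suc m. pos (a i)) \<partial>(Pi\<^sub>M {..<Suc m} (\<lambda>_. hyp_measure))) \<le> (\<integral>\<^sup>+P. G P * k' P \<partial>lborel)" .
qed

text \<open>Inductions over the number of factors start here: a single copy of the measure lives on
  the hyperboloid, which is a null set, and has no density.\<close>

lemma conv_bound_2:
  fixes k :: "'a::euclidean_space \<times> real \<Rightarrow> ennreal"
  assumes [measurable]: "k \<in> borel_measurable borel"
    and le: "\<And>G. G \<in> borel_measurable borel \<Longrightarrow>
      (\<integral>\<^sup>+a. \<integral>\<^sup>+b. G (pos a + pos b) \<partial>hyp_measure \<partial>hyp_measure) \<le> (\<integral>\<^sup>+P. G P * k P \<partial>lborel)"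
  shows "conv_bound 2 k"
  unfolding conv_bound_def
proof (intro conjI ballI)
  fix G :: "'a \<times> real \<Rightarrow> ennreal" assume G [measurable]: "G \<in> borel_measurable borel"
  have "(\<integral>\<^sup>+a. G (\<Sum>i<2::nat. pos (a i)) \<partial>(Pi\<^sub>M {..<2} (\<lambda>_. hyp_measure))) =
    (\<integral>\<^sup>+a. G (pos (a 0) + pos (a 1)) \<partial>(Pi\<^sub>M {0, 1::nat} (\<lambda>_. hyp_measure)))"
    by (simp add: numeral_2_eq_2 lessThan_Suc insert_commute add.commute)
  also have "\<dots> = (\<integral>\<^sup>+z. G (pos (fst z) + pos (snd z)) \<partial>(hyp_measure \<Otimes>\<^sub>M hyp_measure))"
    by (rule hyps.product_nn_integral_pair[where f="\<lambda>a b. G (pos a + pos b)"]) auto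
  also have "\<dots> = (\<integral>\<^sup>+a. \<integral>\<^sup>+b. G (pos a + pos b) \<partial>hyp_measure \<partial>hyp_measure)"
    by (subst hyp.nn_integral_fst[symmetric]) auto
  also have "\<dots> \<le> (\<integral>\<^sup>+P. G P * k P \<partial>lborel)" by (rule le) measurable
  finally show "(\<integral>\<^sup>+a. G (\<Sum>i<2::nat. pos (a i)) \<partial>(Pi\<^sub>M {..<2} (\<lambda>_. hyp_measure))) \<le> (\<integral>\<^sup>+P. G P * k P \<partial>lborel)" .
qed measurable

text \<open>On this class the extension is an absolutely convergent integral, and the class survives
  restriction to balls, Lorentz transformations and modulations.\<close>

definition nice :: "('a::euclidean_space \<Rightarrow> complex) \<Rightarrow> bool" where
  "nice f \<longleftrightarrow> integrable hyp_measure f \<and> f \<in> Lp_space 2 hyp_measure"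

lemma Lp_space_2_iff:
  "f \<in> Lp_space 2 M \<longleftrightarrow> f \<in> borel_measurable M \<and> integrable M (\<lambda>x. (cmod (f x))\<^sup>2)"
  by (subst Lp_space_iff) auto

lemma nrm_2_power2: "(nrm 2 M f)\<^sup>2 = (\<integral>x. (cmod (f x))\<^sup>2 \<partial>M)"
  using nrm_powr[of 2 M f] by simp

lemma nn_integral_power2_eq_nrm:
  assumes "f \<in> Lp_space 2 M"
  shows "(\<integral>\<^sup>+x. ennreal ((cmod (f x))\<^sup>2) \<partial>M) = ennreal ((nrm 2 M f)\<^sup>2)"
  using nn_integral_powr_eq_nrm[OF _ assms] by simp

lemma nice_measurable [measurable_dest]: "nice f \<Longrightarrow> f \<in> borel_measurable borel"
  by (auto simp: nice_def Lp_space_def cong: measurable_cong_sets)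

text \<open>Phases add under multiplication, so the \<open>m\<close>-th power of the extension is
  again an oscillatory integral, now over \<open>m\<close>-tuples of points with the sum of the
  \<open>pos (a i)\<close> in the phase.\<close>

lemma ext_schwartz_power:
  fixes f :: "'a::euclidean_space \<Rightarrow> complex"
  assumes f: "integrable hyp_measure f"
  shows "integrable (Pi\<^sub>M {..<m} (\<lambda>_. hyp_measure)) (\<lambda>a. \<Prod>i<m. f (a i))"
    "ext_schwartz f z ^ m =
     (\<integral>a. iexp (z \<bullet> (\<Sum>i<m. pos (a i))) * (\<Prod>i<m. f (a i)) \<partial>(Pi\<^sub>M {..<m} (\<lambda>_. hyp_measure)))"
proof -
  show "integrable (Pi\<^sub>M {..<m} (\<lambda>_. hyp_measure)) (\<lambda>a. \<Prod>i<m. f (a i))"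
    by (rule hyps.product_integrable_prod) (use f in auto)
  have "ext_schwartz f z ^ m = (\<Prod>i<m. \<integral>y. iexp (z \<bullet> pos y) * f y \<partial>hyp_measure)"
    by (simp add: ext_schwartz_eq)
  also have "\<dots> = (\<integral>a. (\<Prod>i<m. iexp (z \<bullet> pos (a i)) * f (a i)) \<partial>(Pi\<^sub>M {..<m} (\<lambda>_. hyp_measure)))"
    by (rule hyps.product_integral_prod[symmetric]) (use f in \<open>auto intro!: integrable_iexp_mult\<close>)
  also have "\<dots> = (\<integral>a. iexp (z \<bullet> (\<Sum>i<m. pos (a i))) * (\<Prod>i<m. f (a i)) \<partial>(Pi\<^sub>M {..<m} (\<lambda>_. hyp_measure)))"
    by (intro Bochner_Integration.integral_cong refl)
      (simp add: prod.distrib inner_sum_right sum_distrib_left exp_sum)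
  finally show "ext_schwartz f z ^ m = \<dots>" .
qed

lemma nn_integral_prod_hyp:
  fixes I :: "nat set"
  assumes "f \<in> Lp_space 2 hyp_measure" "finite I"
  shows "(\<integral>\<^sup>+a. ennreal (\<Prod>i\<in>I. (cmod (f (a i)))\<^sup>2) \<partial>(Pi\<^sub>M I (\<lambda>_. hyp_measure))) = ennreal ((nrm 2 hyp_measure f)\<^sup>2) ^ card I"
proof -
  have [measurable]: "f \<in> borel_measurable hyp_measure" using assms by (simp add: Lp_space_def)
  show ?thesis
    using assms(2) hyps.product_nn_integral_prod[of I "\<lambda>i x. ennreal ((cmod (f x))\<^sup>2)"]
    by (simp add: prod_ennreal[symmetric] nn_integral_power2_eq_nrm[OF assms(1)])
qed

text \<open>The power 2 m of the modulus is the square of the modulus of an \<open>m\<close>-th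
  power, so the L2 estimate on the product space applies with the convolution density as
  \<open>k\<close>.\<close>

lemma extension_even_power:
  fixes f :: "'a::euclidean_space \<Rightarrow> complex"
  assumes f: "nice f" and cb: "conv_bound m (\<lambda>P. ennreal (k P))"
    and k: "continuous_on UNIV k" "\<And>P. 0 \<le> k P" "\<And>P. k P \<le> C"
  shows "(\<integral>\<^sup>+z. ennreal (cmod (ext_schwartz f z) ^ (2 * m)) \<partial>lborel) \<le>
     ennreal ((2 * pi) ^ DIM('a \<times> real)) * (\<integral>\<^sup>+a. ennreal ((\<Prod>i<m. (cmod (f (a i)))\<^sup>2) * k (\<Sum>i<m. pos (a i))) \<partial>(Pi\<^sub>M {..<m} (\<lambda>_. hyp_measure)))"
proof -
  let ?M = "Pi\<^sub>M {..<m} (\<lambda>_. hyp_measure :: 'a measure)"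
  interpret M: sigma_finite_measure ?M by (rule hyps.sigma_finite) simp
  have f1: "integrable hyp_measure f" and f2: "f \<in> Lp_space 2 hyp_measure" using f by (auto simp: nice_def)
  have [measurable]: "f \<in> borel_measurable hyp_measure" using f1 by auto
  have [measurable]: "k \<in> borel_measurable borel" using k(1) by (rule borel_measurable_continuous_onI)
  have C: "C \<ge> 0" using k(2)[of 0] k(3)[of 0] by linarith
  let ?F = "\<lambda>a. \<Prod>i<m. f (a i)" and ?S = "\<lambda>a. \<Sum>i<m. pos (a i)"
  have F2: "integrable ?M (\<lambda>a. (cmod (?F a))\<^sup>2)"
    using f2 unfolding prod_norm[symmetric] prod_power_distrib
    by (intro hyps.product_integrable_prod) (auto simp: Lp_space_2_iff)
  have "(\<integral>\<^sup>+z. ennreal (cmod (ext_schwartz f z) ^ (2 * m)) \<partial>lborel) = (\<integral>\<^sup>+z. ennreal ((cmod (\<integral>a. iexp (z \<bullet> ?S a) * ?F a \<partial>?M))\<^sup>2) \<partial>lborel)"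
    unfolding ext_schwartz_power(2)[OF f1, symmetric] by (simp add: norm_power power_mult mult.commute[of 2])
  also have "\<dots> \<le> ennreal ((2 * pi) ^ DIM('a \<times> real) * (\<integral>a. (cmod (?F a))\<^sup>2 * k (?S a) \<partial>?M))"
  proof (rule M.oscillatory_L2[OF _ ext_schwartz_power(1)[OF f1] F2 k])
    show "(\<integral>\<^sup>+a. G (?S a) \<partial>?M) \<le> (\<integral>\<^sup>+P. G P * ennreal (k P) \<partial>lborel)" if "G \<in> borel_measurable borel" for G
      using cb that by (auto simp: conv_bound_def)
  qed measurable
  also have "\<dots> = ennreal ((2 * pi) ^ DIM('a \<times> real)) * ennreal (\<integral>a. (cmod (?F a))\<^sup>2 * k (?S a) \<partial>?M)"
    using k(2) by (intro ennreal_mult) (auto intro!: integral_nonneg_AE)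
  also have "ennreal (\<integral>a. (cmod (?F a))\<^sup>2 * k (?S a) \<partial>?M) = (\<integral>\<^sup>+a. ennreal ((cmod (?F a))\<^sup>2 * k (?S a)) \<partial>?M)"
  proof (rule nn_integral_eq_integral[symmetric])
    show "integrable ?M (\<lambda>a. (cmod (?F a))\<^sup>2 * k (?S a))"
    proof (rule Bochner_Integration.integrable_bound[OF integrable_mult_right[OF F2, of C]])
      show "AE a in ?M. norm ((cmod (?F a))\<^sup>2 * k (?S a)) \<le> norm (C * (cmod (?F a))\<^sup>2)"
        using mult_right_mono[OF k(3) zero_le_power2] k(2) C by (intro AE_I2) (simp add: abs_mult mult.commute)
    qed measurable
  qed (use k in auto)
  also have "(\<integral>\<^sup>+a. ennreal ((cmod (?F a))\<^sup>2 * k (?S a)) \<partial>?M) = (\<integral>\<^sup>+a. ennreal ((\<Prod>i<m. (cmod (f (a i)))\<^sup>2) * k (?S a)) \<partial>?M)"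
    by (simp add: prod_norm[symmetric] prod_power_distrib)
  finally show ?thesis .
qed

text \<open>For a constant density the integral over \<open>m\<close>-tuples factors into the
  \<open>m\<close>-th power of the squared L2 norm.\<close>

lemma Strichartz_even:
  assumes cb: "conv_bound m (\<lambda>P :: 'a::euclidean_space \<times> real. ennreal C)" and C: "0 \<le> C" and m: "0 < m"
  obtains A where "0 \<le> A" "\<And>f :: 'a \<Rightarrow> complex. nice f \<Longrightarrow>
    ext_schwartz f \<in> Lp_space (2 * real m) lborel \<and> nrm (2 * real m) lborel (ext_schwartz f) \<le> A * nrm 2 hyp_measure f"
proof
  define q where "q = 2 * real m"
  have q: "q > 0" using m by (simp add: q_def)
  define A where "A = ((2 * pi) ^ DIM('a \<times> real) * C) powr (1 / q)"
  show "0 \<le> A" by (simp add: A_def)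
  fix f :: "'a \<Rightarrow> complex" assume f: "nice f"
  note [measurable] = nice_measurable[OF f]
  let ?M = "Pi\<^sub>M {..<m} (\<lambda>_. hyp_measure :: 'a measure)"
  let ?N = "nrm 2 hyp_measure f"
  have f2: "f \<in> Lp_space 2 hyp_measure" using f by (simp add: nice_def)
  have "(\<integral>\<^sup>+z. ennreal (cmod (ext_schwartz f z) powr q) \<partial>lborel) = (\<integral>\<^sup>+z. ennreal (cmod (ext_schwartz f z) ^ (2 * m)) \<partial>lborel)"
  proof -
    have "x powr q = x ^ (2 * m)" if "x \<ge> 0" for x
      using that m powr_realpow[of x "2 * m"] by (cases "x = 0") (auto simp: q_def)
    then show ?thesis by simp
  qed
  also have "\<dots> \<le> ennreal ((2 * pi) ^ DIM('a \<times> real)) * (\<integral>\<^sup>+a. ennreal ((\<Prod>i<m. (cmod (f (a i)))\<^sup>2) * C) \<partial>?M)"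
    by (rule extension_even_power[OF f cb, where C=C]) (use C in auto)
  also have "(\<integral>\<^sup>+a. ennreal ((\<Prod>i<m. (cmod (f (a i)))\<^sup>2) * C) \<partial>?M) = ennreal (?N\<^sup>2) ^ m * ennreal C"
    using C nn_integral_prod_hyp[OF f2, of "{..<m}"]
    by (simp add: ennreal_mult' nn_integral_multc prod_nonneg)
  also have "ennreal ((2 * pi) ^ DIM('a \<times> real)) * (ennreal (?N\<^sup>2) ^ m * ennreal C) = ennreal ((2 * pi) ^ DIM('a \<times> real) * ((?N\<^sup>2) ^ m * C))"
    using C by (simp add: ennreal_mult ennreal_power)
  also have "(2 * pi) ^ DIM('a \<times> real) * ((?N\<^sup>2) ^ m * C) = (A * ?N) powr q"
  proof -
    have "?N powr q = (?N\<^sup>2) ^ m"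
      using m powr_realpow[of ?N "2 * m"] nrm_nonneg[of 2 hyp_measure f]
      by (cases "?N = 0") (auto simp: q_def power_mult[symmetric])
    then show ?thesis using q C by (simp add: powr_mult A_def powr_powr)
  qed
  finally have *: "(\<integral>\<^sup>+z. ennreal (cmod (ext_schwartz f z) powr q) \<partial>lborel) \<le> ennreal ((A * ?N) powr q)" .
  show "ext_schwartz f \<in> Lp_space (2 * real m) lborel \<and> nrm (2 * real m) lborel (ext_schwartz f) \<le> A * ?N"
    using nrm_leI[OF q _ _ *] \<open>0 \<le> A\<close> unfolding q_def by auto
qed

section \<open>The Lorentz form and concentration at even exponents\<close>

definition lor :: "'a::euclidean_space \<times> real \<Rightarrow> 'a \<times> real \<Rightarrow> real" where
  "lor P Q = snd P * snd Q - fst P \<bullet> fst Q"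

lemma lor_bilinear:
  "lor (P + P') Q = lor P Q + lor P' Q" "lor P (Q + Q') = lor P Q + lor P Q'"
  "lor (P - P') Q = lor P Q - lor P' Q" "lor P (Q - Q') = lor P Q - lor P Q'"
  "lor (c *\<^sub>R P) Q = c * lor P Q" "lor P (c *\<^sub>R Q) = c * lor P Q"
  by (simp_all add: lor_def algebra_simps inner_add_left inner_add_right inner_diff_left inner_diff_right)

lemma lor_commute: "lor P Q = lor Q P"
  by (simp add: lor_def mult.commute inner_commute)

lemma lor_zero [simp]: "lor 0 Q = 0" "lor P 0 = 0"
  by (simp_all add: lor_def)

lemma lor_sum: "lor (\<Sum>i\<in>I. f i) Q = (\<Sum>i\<in>I. lor (f i) Q)" "lor P (\<Sum>i\<in>I. f i) = (\<Sum>i\<in>I. lor P (f i))"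
  by (induction I rule: infinite_finite_induct) (simp_all add: lor_bilinear)

lemma lor_measurable [measurable]:
  assumes [measurable]: "f \<in> borel_measurable M" "g \<in> borel_measurable M"
  shows "(\<lambda>x. lor (f x) (g x :: 'a::euclidean_space \<times> real)) \<in> borel_measurable M"
proof -
  have *: "(fst :: 'a \<times> real \<Rightarrow> _) \<in> borel_measurable borel" "(snd :: 'a \<times> real \<Rightarrow> _) \<in> borel_measurable borel"
    by (intro borel_measurable_continuous_onI continuous_intros)+
  note [measurable] = measurable_compose[OF assms(1) *(1)] measurable_compose[OF assms(1) *(2)]
    measurable_compose[OF assms(2) *(1)] measurable_compose[OF assms(2) *(2)]
  show ?thesis unfolding lor_def by measurable
qed

lemma lor_pos_self: "lor (pos y) (pos y) = 1"
  by (simp add: lor_def pos_def power2_eq_square[symmetric] japanese_power2 power2_norm_eq_inner)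

text \<open>The reversed Cauchy-Schwarz inequality for unit forward vectors. The left-over
  \<open>lor (pos a) (pos b)\<close> is the hyperbolic cosine of the distance of the two points in
  hyperbolic geometry, which is why its sublevel sets serve as Lorentz balls.\<close>

lemma lor_pos_ge_1: "1 \<le> lor (pos a) (pos b)"
proof -
  have "(1 + norm a * norm b)\<^sup>2 \<le> (1 + (norm a)\<^sup>2) * (1 + (norm b)\<^sup>2)"
    using sum_squares_bound[of "norm a" "norm b"] by (simp add: power2_eq_square algebra_simps)
  also have "\<dots> = (japanese a * japanese b)\<^sup>2"
    by (simp add: japanese_power2 power_mult_distrib)
  finally have "1 + norm a * norm b \<le> japanese a * japanese b"
    by (rule power2_le_imp_le) simp
  moreover have "a \<bullet> b \<le> norm a * norm b" by (rule norm_cauchy_schwarz)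
  ultimately show ?thesis by (simp add: lor_def pos_def)
qed

text \<open>All pairs contribute at least 1 to the double sum, so the pairs (0,1) and (1,0) may be
  kept alone.\<close>

lemma lor_sum_pos_ge:
  assumes "2 \<le> (m::nat)"
  shows "2 * lor (pos (a 0)) (pos (a 1)) \<le> lor (\<Sum>i<m. pos (a i)) (\<Sum>i<m. pos (a i))"
proof -
  have "2 * lor (pos (a 0)) (pos (a 1)) = (\<Sum>(i,j)\<in>{(0,1),(1,0)}. lor (pos (a i)) (pos (a j)))"
    by (simp add: lor_commute)
  also have "\<dots> \<le> (\<Sum>(i,j)\<in>{..<m}\<times>{..<m}. lor (pos (a i)) (pos (a j)))"
    using assms order_trans[OF zero_le_one lor_pos_ge_1] by (intro sum_mono2) auto
  also have "\<dots> = lor (\<Sum>i<m. pos (a i)) (\<Sum>i<m. pos (a i))"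
    unfolding lor_sum sum.cartesian_product[symmetric] by (rule sum.swap)
  finally show ?thesis .
qed

text \<open>The Lorentz norm of \<open>\<Sum>i<m. pos (a i)\<close> controls the Lorentzian distance of \<open>a 0\<close> and \<open>a 1\<close>, so the
  kernel is small off a Lorentz ball around \<open>a 0\<close>.\<close>

lemma extension_small_of_spread:
  fixes f :: "'a::euclidean_space \<Rightarrow> complex"
  assumes cb: "conv_bound m (\<lambda>P :: 'a \<times> real. ennreal (K * max 1 (lor P P) powr - e))"
    and K: "0 \<le> K" and e: "0 < e" and m: "2 \<le> m" and f: "nice f" and N: "nrm 2 hyp_measure f \<le> 1"
    and R: "1 \<le> R" and \<delta>: "0 \<le> \<delta>"
    and small: "\<And>b. (\<integral>\<^sup>+a. ennreal ((cmod (f a))\<^sup>2) * indicator {a. lor (pos b) (pos a) \<le> R} a \<partial>hyp_measure) \<le> ennreal \<delta>"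
  shows "nrm (2 * real m) lborel (ext_schwartz f) powr (2 * real m) \<le> (2 * pi) ^ DIM('a \<times> real) * K * (\<delta> + R powr - e)"
proof -
  let ?M = "\<lambda>I. Pi\<^sub>M I (\<lambda>_. hyp_measure :: 'a measure)"
  note [measurable] = nice_measurable[OF f]
  have f2: "f \<in> Lp_space 2 hyp_measure" using f by (simp add: nice_def)
  define k where "k P = K * max 1 (lor P P) powr - e" for P :: "'a \<times> real"
  have k: "continuous_on UNIV k" "0 \<le> k P" "k P \<le> K" for P
  proof -
    show "continuous_on UNIV k" unfolding k_def lor_def by (intro continuous_intros) auto
    show "0 \<le> k P" using K by (simp add: k_def)
    have "max 1 (lor P P) powr - e \<le> 1" using e by (simp add: powr_le_one_le powr_minus inverse_le_1_iff ge_one_powr_ge_zero)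
    then show "k P \<le> K" using K by (simp add: k_def mult_left_le)
  qed
  \<comment> \<open>If \<open>a 1\<close> lies in the ball around \<open>a 0\<close>, the kernel is
    bounded by \<open>K\<close>; otherwise the Lorentz norm of the sum exceeds \<open>R\<close> and
    the decay takes over.\<close>
  have kS: "k (\<Sum>i<m. pos (a i)) \<le> K * (indicator {b. lor (pos (a 0)) (pos b) \<le> R} (a 1) + R powr - e)" for a
  proof (cases "lor (pos (a 0)) (pos (a 1)) \<le> R")
    case True
    then show ?thesis using k(3)[of "\<Sum>i<m. pos (a i)"] K by (simp add: distrib_left add_increasing2)
  next
    case False
    then have "R \<le> max 1 (lor (\<Sum>i<m. pos (a i)) (\<Sum>i<m. pos (a i)))"
      using lor_sum_pos_ge[OF m, of a] R by simp
    then have "max 1 (lor (\<Sum>i<m. pos (a i)) (\<Sum>i<m. pos (a i))) powr - e \<le> R powr - e"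
      using R e by (intro powr_mono2') auto
    then show ?thesis using False K by (simp add: k_def mult_left_mono)
  qed
  have N1: "ennreal ((nrm 2 hyp_measure f)\<^sup>2) \<le> 1"
    using N by (simp add: ennreal_le_1 power_le_one)
  have split: "{..<m} = insert 0 {1..<m}" using m by auto
  have 1: "(\<integral>\<^sup>+a. ennreal (\<Prod>i<m. (cmod (f (a i)))\<^sup>2) * indicator {b. lor (pos (a 0)) (pos b) \<le> R} (a 1) \<partial>?M {..<m}) \<le> ennreal \<delta>"
  proof -
    \<comment> \<open>For fixed b = \<open>a 0\<close> the ball condition concerns the index 1 only,
      so the integrand over the remaining indices is a product of one-variable functions.\<close>
    define g where "g b i x = (if i = 1 then ennreal ((cmod (f x))\<^sup>2) * indicator {a. lor (pos b) (pos a) \<le> R} x else ennreal ((cmod (f x))\<^sup>2))"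
      for b :: 'a and i :: nat and x
    have [measurable]: "g b i \<in> borel_measurable borel" for b i unfolding g_def by measurable
    have "(\<integral>\<^sup>+a. ennreal (\<Prod>i<m. (cmod (f (a i)))\<^sup>2) * indicator {b. lor (pos (a 0)) (pos b) \<le> R} (a 1) \<partial>?M {..<m}) =
      (\<integral>\<^sup>+b. \<integral>\<^sup>+x. ennreal (\<Prod>i<m. (cmod (f ((x(0 := b)) i)))\<^sup>2) * indicator {c. lor (pos b) (pos c) \<le> R} (x 1) \<partial>?M {1..<m} \<partial>hyp_measure)"
      unfolding split using m by (subst hyps.product_nn_integral_insert_rev) auto
    also have "\<dots> = (\<integral>\<^sup>+b. \<integral>\<^sup>+x. ennreal ((cmod (f b))\<^sup>2) * (\<Prod>i\<in>{1..<m}. g b i (x i)) \<partial>?M {1..<m} \<partial>hyp_measure)"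
    proof (intro nn_integral_cong)
      fix b :: 'a and x :: "nat \<Rightarrow> 'a"
      have split1: "{1..<m} = insert 1 {2..<m}" using m by auto
      have "(\<Prod>i\<in>{1..<m}. g b i (x i)) = (\<Prod>i\<in>{1..<m}. ennreal ((cmod (f (x i)))\<^sup>2)) * indicator {c. lor (pos b) (pos c) \<le> R} (x 1)"
        unfolding split1 by (simp add: g_def mult_ac)
      moreover have "(\<Prod>i<m. (cmod (f ((x(0 := b)) i)))\<^sup>2) = (cmod (f b))\<^sup>2 * (\<Prod>i\<in>{1..<m}. (cmod (f (x i)))\<^sup>2)"
        unfolding split by simp
      ultimately show "ennreal (\<Prod>i<m. (cmod (f ((x(0 := b)) i)))\<^sup>2) * indicator {c. lor (pos b) (pos c) \<le> R} (x 1) =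
         ennreal ((cmod (f b))\<^sup>2) * (\<Prod>i\<in>{1..<m}. g b i (x i))"
        by (simp add: ennreal_mult prod_nonneg prod_ennreal mult_ac)
    qed
    also have "\<dots> = (\<integral>\<^sup>+b. ennreal ((cmod (f b))\<^sup>2) * (\<Prod>i\<in>{1..<m}. \<integral>\<^sup>+x. g b i x \<partial>hyp_measure) \<partial>hyp_measure)"
      by (intro nn_integral_cong) (simp add: nn_integral_cmult hyps.product_nn_integral_prod)
    also have "\<dots> \<le> (\<integral>\<^sup>+b. ennreal ((cmod (f b))\<^sup>2) * ennreal \<delta> \<partial>hyp_measure)"
    proof (intro nn_integral_mono mult_left_mono)
      fix b :: 'a
      have split1: "{1..<m} = insert 1 {2..<m}" using m by auto
      have "(\<Prod>i\<in>{2..<m}. \<integral>\<^sup>+x. g b i x \<partial>hyp_measure) \<le> 1"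
        using N1 by (intro prod_le_1) (auto simp: g_def nn_integral_power2_eq_nrm[OF f2])
      then show "(\<Prod>i\<in>{1..<m}. \<integral>\<^sup>+x. g b i x \<partial>hyp_measure) \<le> ennreal \<delta>"
        unfolding split1 using mult_mono[OF small[of b]] by (simp add: g_def) fastforce
    qed simp
    also have "\<dots> = ennreal ((nrm 2 hyp_measure f)\<^sup>2) * ennreal \<delta>"
      by (simp add: nn_integral_multc nn_integral_power2_eq_nrm[OF f2])
    also have "\<dots> \<le> ennreal \<delta>" using mult_right_mono[OF N1, of "ennreal \<delta>"] by simp
    finally show ?thesis .
  qed
  have 2: "(\<integral>\<^sup>+a. ennreal (\<Prod>i<m. (cmod (f (a i)))\<^sup>2) \<partial>?M {..<m}) \<le> 1"
    using nn_integral_prod_hyp[OF f2, of "{..<m}"] power_mono[OF N1, of m] by simp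
  have "(\<integral>\<^sup>+a. ennreal ((\<Prod>i<m. (cmod (f (a i)))\<^sup>2) * k (\<Sum>i<m. pos (a i))) \<partial>?M {..<m})
    \<le> (\<integral>\<^sup>+a. ennreal K * (ennreal (\<Prod>i<m. (cmod (f (a i)))\<^sup>2) * indicator {b. lor (pos (a 0)) (pos b) \<le> R} (a 1) +
         ennreal (\<Prod>i<m. (cmod (f (a i)))\<^sup>2) * ennreal (R powr - e)) \<partial>?M {..<m})"
  proof (rule nn_integral_mono)
    fix a :: "nat \<Rightarrow> 'a"
    let ?p = "\<Prod>i<m. (cmod (f (a i)))\<^sup>2"
    have p: "?p \<ge> 0" by (simp add: prod_nonneg)
    have "ennreal (?p * k (\<Sum>i<m. pos (a i))) \<le> ennreal (K * (?p * indicator {b. lor (pos (a 0)) (pos b) \<le> R} (a 1) + ?p * R powr - e))"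
      using mult_left_mono[OF kS[of a] p] by (intro ennreal_leI) (simp add: algebra_simps)
    also have "\<dots> = ennreal K * (ennreal ?p * indicator {b. lor (pos (a 0)) (pos b) \<le> R} (a 1) + ennreal ?p * ennreal (R powr - e))"
      using K p by (simp add: ennreal_mult ennreal_plus ennreal_indicator)
    finally show "ennreal (?p * k (\<Sum>i<m. pos (a i))) \<le> \<dots>" .
  qed
  also have "\<dots> = ennreal K * ((\<integral>\<^sup>+a. ennreal (\<Prod>i<m. (cmod (f (a i)))\<^sup>2) * indicator {b. lor (pos (a 0)) (pos b) \<le> R} (a 1) \<partial>?M {..<m}) +
         (\<integral>\<^sup>+a. ennreal (\<Prod>i<m. (cmod (f (a i)))\<^sup>2) \<partial>?M {..<m}) * ennreal (R powr - e))"
    using m by (simp add: nn_integral_cmult nn_integral_add nn_integral_multc)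
  also have "\<dots> \<le> ennreal K * (ennreal \<delta> + 1 * ennreal (R powr - e))"
    by (intro mult_left_mono add_mono 1 2 mult_right_mono) auto
  also have "\<dots> = ennreal (K * (\<delta> + R powr - e))"
    using K \<delta> by (simp add: ennreal_mult ennreal_plus)
  finally have 3: "(\<integral>\<^sup>+a. ennreal ((\<Prod>i<m. (cmod (f (a i)))\<^sup>2) * k (\<Sum>i<m. pos (a i))) \<partial>?M {..<m}) \<le> ennreal (K * (\<delta> + R powr - e))" .
  have "(\<integral>\<^sup>+z. ennreal (cmod (ext_schwartz f z) powr (2 * real m)) \<partial>lborel) = (\<integral>\<^sup>+z. ennreal (cmod (ext_schwartz f z) ^ (2 * m)) \<partial>lborel)"
  proof -
    have "x powr (2 * real m) = x ^ (2 * m)" if "x \<ge> 0" for x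
      using that m powr_realpow[of x "2 * m"] by (cases "x = 0") auto
    then show ?thesis by simp
  qed
  also have "\<dots> \<le> ennreal ((2 * pi) ^ DIM('a \<times> real)) * ennreal (K * (\<delta> + R powr - e))"
    by (rule order_trans[OF extension_even_power[OF f cb[folded k_def] k] mult_left_mono[OF 3]]) simp
  also have "\<dots> = ennreal ((2 * pi) ^ DIM('a \<times> real) * K * (\<delta> + R powr - e))"
    using K \<delta> by (simp add: ennreal_mult[symmetric] mult.assoc)
  finally have *: "(\<integral>\<^sup>+z. ennreal (cmod (ext_schwartz f z) powr (2 * real m)) \<partial>lborel) \<le> \<dots>" .
  then have "ext_schwartz f \<in> Lp_space (2 * real m) lborel"
    using m by (intro Lp_spaceI) (auto intro: le_less_trans)
  from nn_integral_powr_eq_nrm[OF _ this] * m K \<delta> show ?thesis by simp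
qed

section \<open>Convolutions of the invariant measure in dimension one\<close>

lemma nn_integral_substitution_ge:
  fixes f :: "real \<Rightarrow> ennreal"
  assumes [measurable]: "f \<in> borel_measurable borel"
    and d: "\<And>x. x \<ge> a \<Longrightarrow> (g has_real_derivative g' x) (at x)"
    and c: "continuous_on UNIV g'" and nn: "\<And>x. x \<ge> a \<Longrightarrow> 0 \<le> g' x"
  shows "(\<integral>\<^sup>+x. f (g x) * ennreal (g' x) * indicator {a..} x \<partial>lborel) \<le> (\<integral>\<^sup>+x. f x * indicator {g a..} x \<partial>lborel)"
proof -
  have [measurable]: "g' \<in> borel_measurable borel" using c by (rule borel_measurable_continuous_onI)
  have gm: "(\<lambda>x. f (g x) * indicator {a..} x) \<in> borel_measurable borel"
  proof -
    \<comment> \<open>\<open>g\<close> is controlled only to the right of \<open>a\<close>;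
      measurability is therefore shown for \<open>g (max a x)\<close>, which agrees with it
      there.\<close>
    have "continuous_on {a..} g"
      using d by (intro continuous_at_imp_continuous_on ballI DERIV_isCont) auto
    then have "(\<lambda>x. g (max a x)) \<in> borel_measurable borel"
      by (intro borel_measurable_continuous_onI continuous_on_compose2[where g=g and f="max a" and t="{a..}"])
        (auto intro!: continuous_intros)
    then have "(\<lambda>x. f (g (max a x)) * indicator {a..} x) \<in> borel_measurable borel" by measurable
    also have "(\<lambda>x. f (g (max a x)) * indicator {a..} x) = (\<lambda>x. f (g x) * indicator {a..} x)"
      by (auto simp: indicator_def max_def)
    finally show ?thesis .
  qed
  have m: "(\<lambda>x. f (g x) * ennreal (g' x) * indicator {a..a + real n} x) \<in> borel_measurable lborel" for n
  proof -
    have "(\<lambda>x. (f (g x) * indicator {a..} x) * (ennreal (g' x) * indicator {a..a + real n} x)) \<in> borel_measurable lborel"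
      using gm by measurable
    also have "(\<lambda>x. (f (g x) * indicator {a..} x) * (ennreal (g' x) * indicator {a..a + real n} x)) = (\<lambda>x. f (g x) * ennreal (g' x) * indicator {a..a + real n} x)"
      by (auto simp: indicator_def)
    finally show ?thesis .
  qed
  have "(\<integral>\<^sup>+x. f (g x) * ennreal (g' x) * indicator {a..} x \<partial>lborel) =
      (\<integral>\<^sup>+x. (SUP n::nat. f (g x) * ennreal (g' x) * indicator {a..a + real n} x) \<partial>lborel)"
  proof (rule nn_integral_cong)
    fix x
    have "(SUP n::nat. indicator {a..a + real n} x :: ennreal) = indicator {a..} x"
    proof (cases "x \<ge> a")
      case True
      obtain n :: nat where "x - a \<le> real n" using real_arch_simple by blast
      then have "indicator {a..a + real n} x = (1::ennreal)" using True by auto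
      then show ?thesis using True
        by (intro antisym SUP_least) (auto simp: indicator_def intro!: SUP_upper2[of n])
    qed (simp add: indicator_def)
    then show "f (g x) * ennreal (g' x) * indicator {a..} x = (SUP n::nat. f (g x) * ennreal (g' x) * indicator {a..a + real n} x)"
      by (simp add: SUP_mult_left_ennreal[symmetric])
  qed
  also have "\<dots> = (SUP n::nat. \<integral>\<^sup>+x. f (g x) * ennreal (g' x) * indicator {a..a + real n} x \<partial>lborel)"
    by (intro nn_integral_monotone_convergence_SUP m) (auto simp: incseq_def le_fun_def indicator_def)
  also have "\<dots> \<le> (\<integral>\<^sup>+x. f x * indicator {g a..} x \<partial>lborel)"
  proof (rule SUP_least)
    fix n :: nat
    show "(\<integral>\<^sup>+x. f (g x) * ennreal (g' x) * indicator {a..a + real n} x \<partial>lborel) \<le> (\<integral>\<^sup>+x. f x * indicator {g a..} x \<partial>lborel)"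
    proof (cases "n = 0")
      \<comment> \<open>The substitution rule is applied to intervals of positive length; the
        degenerate interval is a null set.\<close>
      case True
      have "(\<integral>\<^sup>+x. f (g x) * ennreal (g' x) * indicator {a} x \<partial>lborel) = 0"
        by (subst nn_integral_0_iff_AE) (use m[of 0] AE_lborel_singleton[of a] in auto)
      then show ?thesis using True by simp
    next
      case False
      have eq: "(\<integral>\<^sup>+x. f x * indicator {g a..g (a + real n)} x \<partial>lborel) = (\<integral>\<^sup>+x. f (g x) * ennreal (g' x) * indicator {a..a + real n} x \<partial>lborel)"
        using d nn False by (intro nn_integral_substitution_aux) (auto intro: continuous_on_subset[OF c])
      then show ?thesis
        unfolding eq[symmetric] by (intro nn_integral_mono) (auto simp: indicator_def)
    qed
  qed
  finally show ?thesis .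
qed

text \<open>By \<open>top\<close> and \<open>bot\<close> the images of growing symmetric intervals
  exhaust the line, and monotone convergence passes to the limit.\<close>

lemma nn_integral_substitution_UNIV_le:
  fixes f :: "real \<Rightarrow> ennreal"
  assumes [measurable]: "f \<in> borel_measurable borel"
    and d: "\<And>x. (g has_real_derivative g' x) (at x)"
    and c: "continuous_on UNIV g'" and nn: "\<And>x. 0 \<le> g' x"
    and top: "\<And>y. \<exists>x. y \<le> g x" and bot: "\<And>y. \<exists>x. g x \<le> y"
  shows "(\<integral>\<^sup>+x. f x \<partial>lborel) \<le> (\<integral>\<^sup>+x. f (g x) * ennreal (g' x) \<partial>lborel)"
proof -
  have mono: "g x \<le> g y" if "x \<le> y" for x y
    using that d nn by (intro DERIV_nonneg_imp_nondecreasing[of x y g]) auto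
  have "(\<integral>\<^sup>+x. f x \<partial>lborel) = (\<integral>\<^sup>+x. (SUP n::nat. f x * indicator {g (- real (Suc n))..g (real (Suc n))} x) \<partial>lborel)"
  proof (rule nn_integral_cong)
    fix x
    obtain a b where ab: "x \<le> g a" "g b \<le> x" using top bot by blast
    obtain n :: nat where n: "\<bar>a\<bar> + \<bar>b\<bar> \<le> real n" using real_arch_simple by blast
    have "g (- real (Suc n)) \<le> x" "x \<le> g (real (Suc n))"
      using n ab mono[of "- real (Suc n)" b] mono[of a "real (Suc n)"] by linarith+
    then have "indicator {g (- real (Suc n))..g (real (Suc n))} x = (1::ennreal)" by (auto simp: indicator_def)
    then have "(SUP n::nat. indicator {g (- real (Suc n))..g (real (Suc n))} x :: ennreal) = 1"
      by (intro antisym SUP_least) (auto simp: indicator_def intro!: SUP_upper2[of n])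
    then show "f x = (SUP n::nat. f x * indicator {g (- real (Suc n))..g (real (Suc n))} x)"
      by (simp add: SUP_mult_left_ennreal[symmetric])
  qed
  also have "\<dots> = (SUP n::nat. \<integral>\<^sup>+x. f x * indicator {g (- real (Suc n))..g (real (Suc n))} x \<partial>lborel)"
  proof (rule nn_integral_monotone_convergence_SUP)
    show "incseq (\<lambda>n x. f x * indicator {g (- real (Suc n))..g (real (Suc n))} x)"
    proof (rule incseq_SucI, rule le_funI)
      fix n :: nat and x
      have "{g (- real (Suc n))..g (real (Suc n))} \<subseteq> {g (- real (Suc (Suc n)))..g (real (Suc (Suc n)))}"
        using mono[of "- real (Suc (Suc n))" "- real (Suc n)"] mono[of "real (Suc n)" "real (Suc (Suc n))"] by auto
      then show "f x * indicator {g (- real (Suc n))..g (real (Suc n))} x \<le> f x * indicator {g (- real (Suc (Suc n)))..g (real (Suc (Suc n)))} x"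
        by (intro mult_left_mono indicator_leI) auto
    qed
  qed measurable
  also have "\<dots> \<le> (\<integral>\<^sup>+x. f (g x) * ennreal (g' x) \<partial>lborel)"
  proof (rule SUP_least)
    fix n :: nat
    have "(\<integral>\<^sup>+x. f x * indicator {g (- real (Suc n))..g (real (Suc n))} x \<partial>lborel) =
       (\<integral>\<^sup>+x. f (g x) * ennreal (g' x) * indicator {- real (Suc n)..real (Suc n)} x \<partial>lborel)"
      using d nn by (intro nn_integral_substitution_aux) (auto intro: continuous_on_subset[OF c])
    also have "\<dots> \<le> (\<integral>\<^sup>+x. f (g x) * ennreal (g' x) \<partial>lborel)"
      by (intro nn_integral_mono) (auto simp: indicator_def)
    finally show "(\<integral>\<^sup>+x. f x * indicator {g (- real (Suc n))..g (real (Suc n))} x \<partial>lborel) \<le> (\<integral>\<^sup>+x. f (g x) * ennreal (g' x) \<partial>lborel)" .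
  qed
  finally show ?thesis .
qed

lemma borel_measurable_sinh_cosh [measurable]:
  "(sinh :: real \<Rightarrow> real) \<in> borel_measurable borel" "(cosh :: real \<Rightarrow> real) \<in> borel_measurable borel"
  by (intro borel_measurable_continuous_onI continuous_intros)+

text \<open>The rapidity u, with x = m sinh u, turns the invariant measure dx / sqrt (m^2 + x^2)
  into du. The shift \<open>w\<close> is then free by translation invariance; it is a boost, later
  chosen so that the total momentum is at rest.\<close>

lemma nn_integral_rapidity_le:
  fixes h :: "real \<Rightarrow> ennreal"
  assumes [measurable]: "h \<in> borel_measurable borel" and m: "m > 0"
  shows "(\<integral>\<^sup>+x. h x * ennreal (1 / sqrt (m\<^sup>2 + x\<^sup>2)) \<partial>lborel) \<le> (\<integral>\<^sup>+u. h (m * sinh (u + w)) \<partial>lborel)"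
proof -
  have c: "m * cosh u = sqrt (m\<^sup>2 + (m * sinh u)\<^sup>2)" for u :: real
    using m by (intro real_sqrt_unique[symmetric]) (auto simp: power_mult_distrib cosh_square_eq algebra_simps)
  have "(\<integral>\<^sup>+x. h x * ennreal (1 / sqrt (m\<^sup>2 + x\<^sup>2)) \<partial>lborel) \<le>
    (\<integral>\<^sup>+u. h (m * sinh u) * ennreal (1 / sqrt (m\<^sup>2 + (m * sinh u)\<^sup>2)) * ennreal (m * cosh u) \<partial>lborel)"
  proof (rule nn_integral_substitution_UNIV_le)
    show "((\<lambda>u. m * sinh u) has_real_derivative m * cosh u) (at u)" for u
      by (auto intro!: derivative_eq_intros)
    show "\<exists>u. y \<le> m * sinh u" for y using m by (intro exI[of _ "arsinh (y / m)"]) simp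
    show "\<exists>u. m * sinh u \<le> y" for y using m by (intro exI[of _ "arsinh (y / m)"]) simp
  qed (use m in \<open>auto intro!: continuous_intros\<close>)
  also have "\<dots> = (\<integral>\<^sup>+u. h (m * sinh u) \<partial>lborel)"
  proof (rule nn_integral_cong)
    fix u
    have "ennreal (1 / sqrt (m\<^sup>2 + (m * sinh u)\<^sup>2)) * ennreal (m * cosh u) = 1"
      unfolding c[symmetric] using m by (simp add: ennreal_mult[symmetric])
    then show "h (m * sinh u) * ennreal (1 / sqrt (m\<^sup>2 + (m * sinh u)\<^sup>2)) * ennreal (m * cosh u) = h (m * sinh u)"
      by (simp add: mult.assoc)
  qed
  also have "\<dots> = (\<integral>\<^sup>+u. h (m * sinh (u + w)) \<partial>lborel)"
    by (rule nn_integral_lborel_minus[symmetric]) measurable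
  finally show ?thesis .
qed

text \<open>After x = c sin t the integrand is at most 1. The bound does not depend on
  \<open>c\<close>, and this scale invariance keeps the kernel estimates below uniform.\<close>

lemma nn_integral_arcsin_le:
  assumes c: "c > 0"
  shows "(\<integral>\<^sup>+x. ennreal (1 / sqrt (c\<^sup>2 - x\<^sup>2)) * indicator {- c<..<c} x \<partial>lborel) \<le> ennreal pi"
proof -
  let ?f = "\<lambda>x. ennreal (1 / sqrt (c\<^sup>2 - x\<^sup>2)) * indicator {- c<..<c} x"
  have "(\<integral>\<^sup>+x. ?f x \<partial>lborel) = (\<integral>\<^sup>+x. ?f x * indicator {c * sin (- (pi/2))..c * sin (pi/2)} x \<partial>lborel)"
    by (intro nn_integral_cong) (auto simp: indicator_def)
  also have "\<dots> = (\<integral>\<^sup>+t. ?f (c * sin t) * ennreal (c * cos t) * indicator {- (pi/2)..pi/2} t \<partial>lborel)"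
    using c by (intro nn_integral_substitution_aux)
      (auto intro!: derivative_eq_intros continuous_intros mult_nonneg_nonneg cos_ge_zero)
  also have "\<dots> \<le> (\<integral>\<^sup>+t. indicator {- (pi/2)..pi/2} t \<partial>lborel)"
  proof (rule nn_integral_mono)
    fix t :: real
    show "?f (c * sin t) * ennreal (c * cos t) * indicator {- (pi/2)..pi/2} t \<le> indicator {- (pi/2)..pi/2} t"
    proof (cases "t \<in> {- (pi/2)..pi/2}")
      case True
      then have cos: "cos t \<ge> 0" by (intro cos_ge_zero) auto
      have "sqrt (c\<^sup>2 - (c * sin t)\<^sup>2) = c * cos t"
        using c cos by (intro real_sqrt_unique) (auto simp: power_mult_distrib cos_squared_eq algebra_simps)
      then have "ennreal (1 / sqrt (c\<^sup>2 - (c * sin t)\<^sup>2)) * ennreal (c * cos t) \<le> 1"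
        using c cos by (cases "cos t = 0") (auto simp: ennreal_mult[symmetric])
      then show ?thesis using True by (auto simp: indicator_def)
    qed simp
  qed
  also have "\<dots> = ennreal pi" by simp
  finally show ?thesis .
qed

lemma nn_integral_inv_sqrt_le:
  assumes c: "c > 0"
  shows "(\<integral>\<^sup>+x. ennreal (1 / sqrt \<bar>x\<bar>) * indicator {- c..c} x \<partial>lborel) \<le> ennreal (4 * sqrt c)"
proof -
  let ?f = "\<lambda>x. ennreal (1 / sqrt \<bar>x\<bar>)"
  have half: "(\<integral>\<^sup>+x. ?f x * indicator {0..c} x \<partial>lborel) \<le> ennreal (2 * sqrt c)"
  proof -
    have "(\<integral>\<^sup>+x. ?f x * indicator {0..c} x \<partial>lborel) = (\<integral>\<^sup>+x. ?f x * indicator {0\<^sup>2..(sqrt c)\<^sup>2} x \<partial>lborel)"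
      using c by simp
    also have "\<dots> = (\<integral>\<^sup>+v. ?f (v\<^sup>2) * ennreal (2 * v) * indicator {0..sqrt c} v \<partial>lborel)"
      using c by (intro nn_integral_substitution_aux) (auto intro!: derivative_eq_intros continuous_intros)
    also have "\<dots> \<le> (\<integral>\<^sup>+v. 2 * indicator {0..sqrt c} v \<partial>lborel)"
    proof (rule nn_integral_mono)
      fix v :: real
      show "?f (v\<^sup>2) * ennreal (2 * v) * indicator {0..sqrt c} v \<le> 2 * indicator {0..sqrt c} v"
        by (cases "v = 0") (auto simp: indicator_def ennreal_mult[symmetric])
    qed
    also have "\<dots> = ennreal (2 * sqrt c)" using c by (simp add: nn_integral_cmult ennreal_mult)
    finally show ?thesis .
  qed
  have "(\<integral>\<^sup>+x. ?f x * indicator {- c..c} x \<partial>lborel) \<le> (\<integral>\<^sup>+x. ?f x * indicator {0..c} x + ?f (- x) * indicator {0..c} (- x) \<partial>lborel)"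
    by (intro nn_integral_mono) (auto simp: indicator_def)
  also have "\<dots> = (\<integral>\<^sup>+x. ?f x * indicator {0..c} x \<partial>lborel) + (\<integral>\<^sup>+x. ?f (- x) * indicator {0..c} (- x) \<partial>lborel)"
    by (rule nn_integral_add) measurable
  also have "(\<integral>\<^sup>+x. ?f (- x) * indicator {0..c} (- x) \<partial>lborel) = (\<integral>\<^sup>+x. ?f x * indicator {0..c} x \<partial>lborel)"
    using nn_integral_real_affine[of "\<lambda>x. ?f x * indicator {0..c} x" "-1" 0] by simp
  also have "(\<integral>\<^sup>+x. ?f x * indicator {0..c} x \<partial>lborel) + (\<integral>\<^sup>+x. ?f x * indicator {0..c} x \<partial>lborel) \<le> ennreal (2 * sqrt c) + ennreal (2 * sqrt c)"
    by (intro add_mono half)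
  also have "\<dots> = ennreal (4 * sqrt c)" using c by (simp add: ennreal_plus[symmetric] del: ennreal_plus)
  finally show ?thesis .
qed

text \<open>The function cosh x - x^2 / 2 is nondecreasing on the positive half-line because sinh x
  is at least x.\<close>

lemma cosh_diff_ge:
  fixes u U :: real
  assumes "\<bar>u\<bar> \<le> U"
  shows "(U\<^sup>2 - u\<^sup>2) / 2 \<le> cosh U - cosh u"
proof -
  have sinh: "x \<le> sinh x" if "0 \<le> x" for x :: real
  proof -
    have "(\<lambda>x. sinh x - x) 0 \<le> (\<lambda>x. sinh x - x) x"
      by (rule DERIV_nonneg_imp_nondecreasing[OF that])
        (auto intro!: exI derivative_eq_intros simp: cosh_real_ge_1)
    then show ?thesis by simp
  qed
  have "(\<lambda>x. cosh x - x\<^sup>2 / 2) \<bar>u\<bar> \<le> (\<lambda>x. cosh x - x\<^sup>2 / 2) U"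
    by (rule DERIV_nonneg_imp_nondecreasing[OF assms])
      (force intro!: exI derivative_eq_intros sinh)
  then show ?thesis by (simp add: field_simps abs_if split: if_splits)
qed

text \<open>With A = cosh U the comparison of cosh with its quadratic part reduces the claim to the
  arcsine integral, whose value does not see \<open>U\<close>. The uniformity in \<open>A\<close> is
  the point.\<close>

lemma nn_integral_cosh_le:
  "(\<integral>\<^sup>+u. ennreal (1 / sqrt (A - cosh u)) * indicator {u. cosh u < A} u \<partial>lborel) \<le> ennreal (sqrt 2 * pi)"
proof (cases "A \<le> 1")
  case True
  then have "{u. cosh u < A} = {}" using cosh_real_ge_1 by (auto simp: not_less intro: order_trans)
  then show ?thesis by simp
next
  case False
  define U where "U = arcosh A"
  have U: "U > 0" "cosh U = A" using False by (auto simp: U_def)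
  have "(\<integral>\<^sup>+u. ennreal (1 / sqrt (A - cosh u)) * indicator {u. cosh u < A} u \<partial>lborel) \<le>
    (\<integral>\<^sup>+u. ennreal (sqrt 2) * (ennreal (1 / sqrt (U\<^sup>2 - u\<^sup>2)) * indicator {- U<..<U} u) \<partial>lborel)"
  proof (rule nn_integral_mono)
    fix u :: real
    show "ennreal (1 / sqrt (A - cosh u)) * indicator {u. cosh u < A} u \<le> ennreal (sqrt 2) * (ennreal (1 / sqrt (U\<^sup>2 - u\<^sup>2)) * indicator {- U<..<U} u)"
    proof (cases "cosh u < A")
      case True
      then have u: "\<bar>u\<bar> < U" using U cosh_real_nonneg_less_iff[of "\<bar>u\<bar>" U] by simp
      then have pos: "U\<^sup>2 - u\<^sup>2 > 0" using power_strict_mono[OF u abs_ge_zero, of 2] by simp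
      have "sqrt (U\<^sup>2 - u\<^sup>2) / sqrt 2 \<le> sqrt (A - cosh u)"
        using cosh_diff_ge[of u U] u U(2) by (simp add: real_sqrt_divide[symmetric])
      then have "1 / sqrt (A - cosh u) \<le> 1 / (sqrt (U\<^sup>2 - u\<^sup>2) / sqrt 2)"
        using pos by (intro divide_left_mono) (auto simp: True)
      then have "ennreal (1 / sqrt (A - cosh u)) \<le> ennreal (sqrt 2) * ennreal (1 / sqrt (U\<^sup>2 - u\<^sup>2))"
        using pos by (simp add: ennreal_mult[symmetric] ennreal_leI)
      then show ?thesis using u True by (auto simp: indicator_def abs_less_iff)
    qed simp
  qed
  also have "\<dots> = ennreal (sqrt 2) * (\<integral>\<^sup>+u. ennreal (1 / sqrt (U\<^sup>2 - u\<^sup>2)) * indicator {- U<..<U} u \<partial>lborel)"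
    by (rule nn_integral_cmult) measurable
  also have "\<dots> \<le> ennreal (sqrt 2) * ennreal pi" by (intro mult_left_mono nn_integral_arcsin_le U) simp
  finally show ?thesis by (simp add: ennreal_mult)
qed

text \<open>The convolution of two mass shells in one space dimension: \<open>s = \<tau>\<^sup>2 - \<xi>\<^sup>2\<close> is the squared
  invariant mass of the pair.\<close>

definition two_mass_kernel :: "real \<Rightarrow> real \<Rightarrow> real \<Rightarrow> real" where
  "two_mass_kernel m m' s = (if s > (m + m')\<^sup>2 then 4 / sqrt ((s - m\<^sup>2 - m'\<^sup>2)\<^sup>2 - 4 * m\<^sup>2 * m'\<^sup>2) else 0)"

lemma two_mass_kernel_measurable [measurable]:
  assumes [measurable]: "f \<in> borel_measurable M" "g \<in> borel_measurable M" "h \<in> borel_measurable M"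
  shows "(\<lambda>x. two_mass_kernel (f x) (g x) (h x)) \<in> borel_measurable M"
  unfolding two_mass_kernel_def by measurable

text \<open>The hypothesis compares the rapidities of two particles (x/m and y/m' are hyperbolic
  sines), the conclusion their velocities x/e and y/e' (hyperbolic tangents). The squares of the two
  sides differ by the same amount in both forms, which reduces everything to a discussion of
  signs.\<close>

lemma two_mass_cross:
  fixes x y m m' e e' :: real
  assumes e: "e\<^sup>2 = m\<^sup>2 + x\<^sup>2" "e'\<^sup>2 = m'\<^sup>2 + y\<^sup>2" "e > 0" "e' > 0" and m: "m > 0" "m' > 0"
  shows "y * m \<le> x * m' \<Longrightarrow> y * e \<le> x * e'" "y * m < x * m' \<Longrightarrow> y * e < x * e'"
proof -
  have sq: "(x * e')\<^sup>2 - (y * e)\<^sup>2 = (x * m')\<^sup>2 - (y * m)\<^sup>2"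
    by (simp add: power_mult_distrib e algebra_simps)
  show "y * e \<le> x * e'" if le: "y * m \<le> x * m'"
  proof (cases "0 \<le> x")
    case x: True
    show ?thesis
    proof (cases "0 \<le> y")
      case True
      then have "(y * m)\<^sup>2 \<le> (x * m')\<^sup>2" using m le by (intro power_mono) auto
      then have "(y * e)\<^sup>2 \<le> (x * e')\<^sup>2" using sq by simp
      then show ?thesis by (rule power2_le_imp_le) (use x e in simp)
    next
      case False
      then have "y * e \<le> 0" using e by (simp add: mult_le_0_iff)
      also have "0 \<le> x * e'" using x e by simp
      finally show ?thesis .
    qed
  next
    case False
    then have "x * m' < 0" using m by (simp add: mult_neg_pos)
    then have "y * m < 0" using le by linarith
    then have "y < 0" using m by (simp add: mult_less_0_iff)
    have "(- (x * m'))\<^sup>2 \<le> (- (y * m))\<^sup>2" using le \<open>x * m' < 0\<close> by (intro power_mono) auto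
    then have "(- (x * e'))\<^sup>2 \<le> (- (y * e))\<^sup>2" using sq by simp
    then have "- (x * e') \<le> - (y * e)"
      by (rule power2_le_imp_le) (use \<open>y < 0\<close> e in \<open>simp add: mult_le_0_iff\<close>)
    then show ?thesis by simp
  qed
  show "y * e < x * e'" if lt: "y * m < x * m'"
  proof (cases "0 < x")
    case x: True
    show ?thesis
    proof (cases "0 \<le> y")
      case True
      then have "(y * m)\<^sup>2 < (x * m')\<^sup>2" using m lt by (intro power_strict_mono) auto
      then have "(y * e)\<^sup>2 < (x * e')\<^sup>2" using sq by simp
      then show ?thesis by (rule power2_less_imp_less) (use x e in simp)
    next
      case False
      then have "y * e < 0" using e by (simp add: mult_less_0_iff)
      also have "0 < x * e'" using x e by simp
      finally show ?thesis .
    qed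
  next
    case False
    then have "x * m' \<le> 0" using m by (simp add: mult_le_0_iff)
    then have "y * m < 0" using lt by linarith
    then have "y < 0" using m by (simp add: mult_less_0_iff)
    have "(- (x * m'))\<^sup>2 < (- (y * m))\<^sup>2" using lt \<open>x * m' \<le> 0\<close> by (intro power_strict_mono) auto
    then have "(- (x * e'))\<^sup>2 < (- (y * e))\<^sup>2" using sq by simp
    then have "- (x * e') < - (y * e)"
      by (rule power2_less_imp_less) (use \<open>y < 0\<close> e in \<open>simp add: mult_le_0_iff\<close>)
    then show ?thesis by simp
  qed
qed

text \<open>For fixed total momentum \<xi> the total energy increases in \<open>x\<close> from the
  point \<open>\<xi> * m / (m + m')\<close> on, where both particles have equal rapidity. Taking the
  energy as new variable produces the Jacobian, and the kernel is twice its reciprocal relative to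
  the measure, one half for each branch.\<close>

lemma two_mass_half:
  fixes G :: "real \<Rightarrow> ennreal"
  assumes [measurable]: "G \<in> borel_measurable borel" and m: "m > 0" "m' > 0"
  shows "(\<integral>\<^sup>+x. G (sqrt (m\<^sup>2 + x\<^sup>2) + sqrt (m'\<^sup>2 + (\<xi> - x)\<^sup>2)) *
       ennreal (1 / (sqrt (m\<^sup>2 + x\<^sup>2) * sqrt (m'\<^sup>2 + (\<xi> - x)\<^sup>2))) * indicator {\<xi> * m / (m + m')..} x \<partial>lborel)
    \<le> (\<integral>\<^sup>+t. G t * ennreal (indicator {0<..} t * two_mass_kernel m m' (t\<^sup>2 - \<xi>\<^sup>2) / 2) \<partial>lborel)"
proof -
  define E where "E x = sqrt (m\<^sup>2 + x\<^sup>2)" for x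
  define E' where "E' x = sqrt (m'\<^sup>2 + (\<xi> - x)\<^sup>2)" for x
  define \<phi> where "\<phi> x = E x + E' x" for x
  define \<phi>' where "\<phi>' x = x / E x - (\<xi> - x) / E' x" for x
  define x0 where "x0 = \<xi> * m / (m + m')"
  have E: "E x > 0" "E' x > 0" "(E x)\<^sup>2 = m\<^sup>2 + x\<^sup>2" "(E' x)\<^sup>2 = m'\<^sup>2 + (\<xi> - x)\<^sup>2" for x
    using m by (auto simp: E_def E'_def add_pos_nonneg)
  have [measurable]: "E \<in> borel_measurable borel" "E' \<in> borel_measurable borel"
    unfolding E_def E'_def by measurable
  have d: "(\<phi> has_real_derivative \<phi>' x) (at x)" for x
    unfolding \<phi>_def \<phi>'_def E_def E'_def
    using m by (auto intro!: derivative_eq_intros simp: add_pos_nonneg divide_simps)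
      (auto simp: not_sum_power2_lt_zero algebra_simps)
  have c: "continuous_on UNIV \<phi>'"
  proof -
    have "continuous_on UNIV E" "continuous_on UNIV E'" unfolding E_def E'_def by (intro continuous_intros)+
    then show ?thesis
      unfolding \<phi>'_def using less_imp_neq[OF E(1)] less_imp_neq[OF E(2)]
      by (intro continuous_intros) auto
  qed
  have mono: "(\<xi> - x) * E x \<le> x * E' x" if "x \<ge> x0" for x
  proof -
    have "\<xi> * m \<le> x * (m + m')" using that m by (simp add: x0_def divide_le_eq)
    then have "(\<xi> - x) * m \<le> x * m'" by (simp add: algebra_simps)
    then show ?thesis by (rule two_mass_cross(1)[OF E(3,4,1,2) m])
  qed
  have \<phi>'_eq: "\<phi>' x = (x * E' x - (\<xi> - x) * E x) / (E x * E' x)" for x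
    using E[of x] by (simp add: \<phi>'_def field_simps)
  \<comment> \<open>The left-hand side is the triangle function of the squared invariant mass; it
    equals the square of twice the numerator of \<open>\<phi>'\<close>, which expresses the Jacobian
    through \<open>t\<close> and \<open>\<xi>\<close> alone.\<close>
  have sq: "((\<phi> x)\<^sup>2 - \<xi>\<^sup>2 - m\<^sup>2 - m'\<^sup>2)\<^sup>2 - 4 * m\<^sup>2 * m'\<^sup>2 = (2 * (x * E' x - (\<xi> - x) * E x))\<^sup>2" for x
  proof -
    have 1: "(\<phi> x)\<^sup>2 - \<xi>\<^sup>2 - m\<^sup>2 - m'\<^sup>2 = 2 * (E x * E' x - x * (\<xi> - x))"
      using E(3,4)[of x] by (simp add: \<phi>_def power2_eq_square algebra_simps)
    have "(E x * E' x - x * (\<xi> - x))\<^sup>2 - (x * E' x - (\<xi> - x) * E x)\<^sup>2 =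
        ((E x)\<^sup>2 - x\<^sup>2) * ((E' x)\<^sup>2 - (\<xi> - x)\<^sup>2)"
      by (simp add: power2_eq_square algebra_simps)
    then have "(E x * E' x - x * (\<xi> - x))\<^sup>2 - (x * E' x - (\<xi> - x) * E x)\<^sup>2 = m\<^sup>2 * m'\<^sup>2" using E(3,4)[of x] by simp
    then show ?thesis unfolding 1 four_x_squared[symmetric] by linarith
  qed
  define h where "h t = G t * ennreal (indicator {0<..} t * two_mass_kernel m m' (t\<^sup>2 - \<xi>\<^sup>2) / 2)" for t
  have [measurable]: "h \<in> borel_measurable borel" unfolding h_def by measurable
  have pt: "G (\<phi> x) * ennreal (1 / (E x * E' x)) = h (\<phi> x) * ennreal (\<phi>' x)" if x: "x > x0" for x
  proof -
    let ?D = "x * E' x - (\<xi> - x) * E x"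
    have D: "?D > 0"
    proof -
      have "\<xi> * m < x * (m + m')" using x m by (simp add: x0_def divide_less_eq)
      then have "(\<xi> - x) * m < x * m'" by (simp add: algebra_simps)
      from two_mass_cross(2)[OF E(3,4,1,2) m this] show ?thesis by simp
    qed
    have \<phi>pos: "\<phi> x > 0" using E[of x] by (simp add: \<phi>_def)
    \<comment> \<open>Twice this product difference is s - m^2 - m'^2, so the strict inequality says
      that the energy lies above the threshold (m + m')^2 in the kernel.\<close>
    have "E x * E' x - x * (\<xi> - x) > m * m'"
    proof (rule power2_less_imp_less)
      have 1: "2 * (E x * E' x - x * (\<xi> - x)) = (\<phi> x)\<^sup>2 - \<xi>\<^sup>2 - m\<^sup>2 - m'\<^sup>2"
        using E(3,4)[of x] by (simp add: \<phi>_def power2_eq_square algebra_simps)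
      have "(2 * (E x * E' x - x * (\<xi> - x)))\<^sup>2 = 4 * m\<^sup>2 * m'\<^sup>2 + (2 * ?D)\<^sup>2" unfolding 1 using sq[of x] by simp
      moreover have "?D\<^sup>2 > 0" using D by simp
      ultimately show "(m * m')\<^sup>2 < (E x * E' x - x * (\<xi> - x))\<^sup>2"
        unfolding four_x_squared[symmetric] power_mult_distrib[of m m'] by linarith
      have "(x * (\<xi> - x))\<^sup>2 \<le> (E x * E' x)\<^sup>2"
        unfolding power_mult_distrib E by (intro mult_mono) auto
      then have "x * (\<xi> - x) \<le> E x * E' x" by (rule power2_le_imp_le) (use E(1,2)[of x] in simp)
      then show "0 \<le> E x * E' x - x * (\<xi> - x)" by simp
    qed
    then have s: "(\<phi> x)\<^sup>2 - \<xi>\<^sup>2 > (m + m')\<^sup>2"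
      using E(3,4)[of x] by (simp add: \<phi>_def power2_eq_square algebra_simps)
    have k: "two_mass_kernel m m' ((\<phi> x)\<^sup>2 - \<xi>\<^sup>2) = 2 / ?D"
    proof -
      have "sqrt ((2 * ?D)\<^sup>2) = 2 * ?D" using D by (intro real_sqrt_unique) auto
      moreover have "4 / (2 * d) = 2 / d" for d :: real by simp
      ultimately show ?thesis using s by (simp only: two_mass_kernel_def sq if_True)
    qed
    have "indicator {0<..} (\<phi> x) = (1::real)" using \<phi>pos by simp
    moreover have "2 / d / 2 = 1 / d" for d :: real by simp
    ultimately have k2: "indicator {0<..} (\<phi> x) * two_mass_kernel m m' ((\<phi> x)\<^sup>2 - \<xi>\<^sup>2) / 2 = 1 / ?D"
      by (simp only: k mult_1_left)
    have "h (\<phi> x) * ennreal (\<phi>' x) = G (\<phi> x) * (ennreal (1 / ?D) * ennreal (?D / (E x * E' x)))"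
      unfolding h_def k2 \<phi>'_eq by (simp only: mult.assoc)
    also have "ennreal (1 / ?D) * ennreal (?D / (E x * E' x)) = ennreal (1 / (E x * E' x))"
      using D E[of x] by (simp add: ennreal_mult[symmetric])
    finally show ?thesis by simp
  qed
  have "(\<integral>\<^sup>+x. G (\<phi> x) * ennreal (1 / (E x * E' x)) * indicator {x0..} x \<partial>lborel) = (\<integral>\<^sup>+x. h (\<phi> x) * ennreal (\<phi>' x) * indicator {x0..} x \<partial>lborel)"
  proof (rule nn_integral_cong_AE)
    show "AE x in lborel. G (\<phi> x) * ennreal (1 / (E x * E' x)) * indicator {x0..} x = h (\<phi> x) * ennreal (\<phi>' x) * indicator {x0..} x"
      using AE_lborel_singleton[of x0] by eventually_elim (auto simp: indicator_def pt)
  qed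
  also have "\<dots> \<le> (\<integral>\<^sup>+t. h t * indicator {\<phi> x0..} t \<partial>lborel)"
    using mono by (intro nn_integral_substitution_ge d c) (auto simp: \<phi>'_eq E less_imp_le)
  also have "\<dots> \<le> (\<integral>\<^sup>+t. h t \<partial>lborel)" by (intro nn_integral_mono) (auto simp: indicator_def)
  finally show ?thesis unfolding \<phi>_def E_def E'_def h_def x0_def .
qed

text \<open>The momenta to the left of the turning point become momenta to the right of it under the
  reflection of \<open>x\<close> into \<xi> - x, which exchanges the masses. Each branch contributes
  half of the kernel, and the kernel is symmetric in the masses.\<close>

lemma two_mass_convolution:
  fixes G :: "real \<Rightarrow> real \<Rightarrow> ennreal"
  assumes [measurable]: "case_prod G \<in> borel_measurable (borel \<Otimes>\<^sub>M borel)" and m: "m > 0" "m' > 0"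
  shows "(\<integral>\<^sup>+x. \<integral>\<^sup>+x'. G (x + x') (sqrt (m\<^sup>2 + x\<^sup>2) + sqrt (m'\<^sup>2 + x'\<^sup>2)) *
       ennreal (1 / (sqrt (m\<^sup>2 + x\<^sup>2) * sqrt (m'\<^sup>2 + x'\<^sup>2))) \<partial>lborel \<partial>lborel)
    \<le> (\<integral>\<^sup>+\<xi>. \<integral>\<^sup>+t. G \<xi> t * ennreal (indicator {0<..} t * two_mass_kernel m m' (t\<^sup>2 - \<xi>\<^sup>2)) \<partial>lborel \<partial>lborel)"
proof -
  define W where "W m m' \<xi> x = G \<xi> (sqrt (m\<^sup>2 + x\<^sup>2) + sqrt (m'\<^sup>2 + (\<xi> - x)\<^sup>2)) *
       ennreal (1 / (sqrt (m\<^sup>2 + x\<^sup>2) * sqrt (m'\<^sup>2 + (\<xi> - x)\<^sup>2)))" for m m' \<xi> x :: real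
  have [measurable]: "case_prod (W m m') \<in> borel_measurable (borel \<Otimes>\<^sub>M borel)" for m m' unfolding W_def by measurable
  have [measurable]: "G \<xi> \<in> borel_measurable borel" for \<xi> by measurable
  have "(\<integral>\<^sup>+x. \<integral>\<^sup>+x'. G (x + x') (sqrt (m\<^sup>2 + x\<^sup>2) + sqrt (m'\<^sup>2 + x'\<^sup>2)) *
       ennreal (1 / (sqrt (m\<^sup>2 + x\<^sup>2) * sqrt (m'\<^sup>2 + x'\<^sup>2))) \<partial>lborel \<partial>lborel) = (\<integral>\<^sup>+x. \<integral>\<^sup>+\<xi>. W m m' \<xi> x \<partial>lborel \<partial>lborel)"
  proof (rule nn_integral_cong)
    fix x :: real
    show "(\<integral>\<^sup>+x'. G (x + x') (sqrt (m\<^sup>2 + x\<^sup>2) + sqrt (m'\<^sup>2 + x'\<^sup>2)) *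
       ennreal (1 / (sqrt (m\<^sup>2 + x\<^sup>2) * sqrt (m'\<^sup>2 + x'\<^sup>2))) \<partial>lborel) = (\<integral>\<^sup>+\<xi>. W m m' \<xi> x \<partial>lborel)"
      using nn_integral_lborel_minus[of "\<lambda>\<xi>. W m m' \<xi> x" x] by (simp add: W_def add.commute)
  qed
  also have "\<dots> = (\<integral>\<^sup>+\<xi>. \<integral>\<^sup>+x. W m m' \<xi> x \<partial>lborel \<partial>lborel)"
    by (rule lborel_pair.Fubini') measurable
  also have "\<dots> \<le> (\<integral>\<^sup>+\<xi>. \<integral>\<^sup>+t. G \<xi> t * ennreal (indicator {0<..} t * two_mass_kernel m m' (t\<^sup>2 - \<xi>\<^sup>2)) \<partial>lborel \<partial>lborel)"
  proof (rule nn_integral_mono)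
    fix \<xi> :: real
    let ?h = "\<lambda>t. G \<xi> t * ennreal (indicator {0<..} t * two_mass_kernel m m' (t\<^sup>2 - \<xi>\<^sup>2) / 2)"
    let ?x0 = "\<xi> * m / (m + m')" and ?x1 = "\<xi> * m' / (m' + m)"
    have x01: "?x1 = \<xi> - ?x0" using m by (simp add: field_simps)
    have "(\<integral>\<^sup>+x. W m m' \<xi> x \<partial>lborel) \<le> (\<integral>\<^sup>+x. W m m' \<xi> x * indicator {?x0..} x + W m' m \<xi> (\<xi> - x) * indicator {?x1..} (\<xi> - x) \<partial>lborel)"
      unfolding x01 by (intro nn_integral_mono) (auto simp: indicator_def W_def add.commute mult.commute)
    also have "\<dots> = (\<integral>\<^sup>+x. W m m' \<xi> x * indicator {?x0..} x \<partial>lborel) + (\<integral>\<^sup>+x. W m' m \<xi> (\<xi> - x) * indicator {?x1..} (\<xi> - x) \<partial>lborel)"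
      by (rule nn_integral_add) measurable
    also have "(\<integral>\<^sup>+x. W m' m \<xi> (\<xi> - x) * indicator {?x1..} (\<xi> - x) \<partial>lborel) = (\<integral>\<^sup>+x. W m' m \<xi> x * indicator {?x1..} x \<partial>lborel)"
      using nn_integral_real_affine[of "\<lambda>x. W m' m \<xi> x * indicator {?x1..} x" "-1" \<xi>] by simp
    also have "(\<integral>\<^sup>+x. W m m' \<xi> x * indicator {?x0..} x \<partial>lborel) + (\<integral>\<^sup>+x. W m' m \<xi> x * indicator {?x1..} x \<partial>lborel) \<le>
        (\<integral>\<^sup>+t. ?h t \<partial>lborel) + (\<integral>\<^sup>+t. ?h t \<partial>lborel)"
    proof (rule add_mono)
      show "(\<integral>\<^sup>+x. W m m' \<xi> x * indicator {?x0..} x \<partial>lborel) \<le> (\<integral>\<^sup>+t. ?h t \<partial>lborel)"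
        unfolding W_def using m by (intro two_mass_half) auto
      have "two_mass_kernel m' m s = two_mass_kernel m m' s" for s
        by (simp add: two_mass_kernel_def add.commute diff_diff_eq mult.commute mult.left_commute)
      then show "(\<integral>\<^sup>+x. W m' m \<xi> x * indicator {?x1..} x \<partial>lborel) \<le> (\<integral>\<^sup>+t. ?h t \<partial>lborel)"
        unfolding W_def using two_mass_half[of "G \<xi>" m' m \<xi>] m by simp
    qed
    also have "\<dots> = (\<integral>\<^sup>+t. ?h t + ?h t \<partial>lborel)" by (rule nn_integral_add[symmetric]) measurable
    also have "\<dots> = (\<integral>\<^sup>+t. G \<xi> t * ennreal (indicator {0<..} t * two_mass_kernel m m' (t\<^sup>2 - \<xi>\<^sup>2)) \<partial>lborel)"
    proof (rule nn_integral_cong)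
      fix t
      let ?k = "indicator {0<..} t * two_mass_kernel m m' (t\<^sup>2 - \<xi>\<^sup>2)"
      have "?k \<ge> 0"
      proof -
        have "4 * m\<^sup>2 * m'\<^sup>2 \<le> (s - m\<^sup>2 - m'\<^sup>2)\<^sup>2" if "s > (m + m')\<^sup>2" for s
        proof -
          have "2 * m * m' \<le> s - m\<^sup>2 - m'\<^sup>2" using that by (simp add: power2_eq_square algebra_simps)
          from power_mono[OF this, of 2] m show ?thesis by (simp add: power_mult_distrib)
        qed
        then show ?thesis by (auto simp: two_mass_kernel_def indicator_def)
      qed
      then have "ennreal (?k / 2) + ennreal (?k / 2) = ennreal ?k"
        by (simp add: ennreal_plus[symmetric] del: ennreal_plus)
      then show "?h t + ?h t = G \<xi> t * ennreal ?k" by (simp add: distrib_left[symmetric])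
    qed
    finally show "(\<integral>\<^sup>+x. W m m' \<xi> x \<partial>lborel) \<le> (\<integral>\<^sup>+t. G \<xi> t * ennreal (indicator {0<..} t * two_mass_kernel m m' (t\<^sup>2 - \<xi>\<^sup>2)) \<partial>lborel)" .
  qed
  finally show ?thesis .
qed

section \<open>Coordinates in dimensions one and two, and forward timelike vectors\<close>

lemma prod_Basis_cart:
  fixes x :: "real ^ 'n"
  shows "(\<Prod>b\<in>Basis. x \<bullet> b) = (\<Prod>i\<in>UNIV. x $ i)"
proof -
  have B: "(Basis :: (real ^ 'n) set) = range (\<lambda>i. axis i 1)" by (auto simp: Basis_vec_def)
  have "inj (\<lambda>i. axis i (1::real) :: real ^ 'n)" by (auto simp: inj_def axis_eq_axis)
  then show ?thesis unfolding B by (subst prod.reindex) (simp_all add: inner_axis)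
qed

definition vec2 :: "real \<Rightarrow> real \<Rightarrow> real ^ 2" where
  "vec2 a b = (\<chi> i. if i = 1 then a else b)"

lemma vec2_nth [simp]: "vec2 a b $ 1 = a" "vec2 a b $ 2 = b"
  by (simp_all add: vec2_def)

lemma borel_measurable_vec1 [measurable]: "(vec :: real \<Rightarrow> real ^ 1) \<in> borel_measurable borel"
  unfolding vec_def by (intro borel_measurable_continuous_onI continuous_intros)

lemma borel_measurable_vec2 [measurable]:
  assumes [measurable]: "f \<in> borel_measurable M" "g \<in> borel_measurable M"
  shows "(\<lambda>x. vec2 (f x) (g x)) \<in> borel_measurable M"
proof -
  have "(\<lambda>z. vec2 (fst z) (snd z)) \<in> borel_measurable (borel :: (real \<times> real) measure)"
  proof -
    have "continuous_on UNIV (\<lambda>z :: real \<times> real. if i = 1 then fst z else snd z)" for i :: 2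
      by (cases "i = 1") (auto intro!: continuous_intros)
    then show ?thesis unfolding vec2_def by (intro borel_measurable_continuous_onI continuous_on_vec_lambda)
  qed
  then have "(\<lambda>x. vec2 (fst (f x, g x)) (snd (f x, g x))) \<in> borel_measurable M"
    by (rule measurable_compose[rotated]) (simp add: borel_prod[symmetric])
  then show ?thesis by simp
qed

lemma nn_integral_real1:
  fixes f :: "real ^ 1 \<Rightarrow> ennreal"
  assumes [measurable]: "f \<in> borel_measurable borel"
  shows "(\<integral>\<^sup>+y. f y \<partial>lborel) = (\<integral>\<^sup>+x. f (vec x) \<partial>lborel)"
proof -
  have "(lborel :: (real ^ 1) measure) = distr lborel borel vec"
  proof (rule lborel_eqI)
    fix l u :: "real ^ 1" assume le: "\<And>b. b \<in> Basis \<Longrightarrow> l \<bullet> b \<le> u \<bullet> b"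
    have "l $ 1 \<le> u $ 1" using le[of "axis 1 1"] by (simp add: inner_axis axis_in_Basis_iff)
    moreover have "vec -` box l u = {l $ 1 <..< u $ 1}"
      by (auto simp: mem_box_cart)
    ultimately show "emeasure (distr lborel borel vec) (box l u) = ennreal (\<Prod>b\<in>Basis. (u - l) \<bullet> b)"
      by (simp add: emeasure_distr prod_Basis_cart)
  qed simp
  then have "(\<integral>\<^sup>+y. f y \<partial>lborel) = (\<integral>\<^sup>+y. f y \<partial>distr lborel borel vec)" by simp
  then show ?thesis by (simp add: nn_integral_distr)
qed

lemma nn_integral_real2:
  fixes f :: "real ^ 2 \<Rightarrow> ennreal"
  assumes [measurable]: "f \<in> borel_measurable borel"
  shows "(\<integral>\<^sup>+y. f y \<partial>lborel) = (\<integral>\<^sup>+b. \<integral>\<^sup>+a. f (vec2 a b) \<partial>lborel \<partial>lborel)"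
proof -
  let ?D = "distr (lborel \<Otimes>\<^sub>M lborel) borel (\<lambda>(b, a). vec2 a b)"
  have "(lborel :: (real ^ 2) measure) = ?D"
  proof (rule lborel_eqI)
    fix l u :: "real ^ 2" assume le: "\<And>b. b \<in> Basis \<Longrightarrow> l \<bullet> b \<le> u \<bullet> b"
    have "l $ i \<le> u $ i" for i using le[of "axis i 1"] by (simp add: inner_axis axis_in_Basis_iff)
    moreover have "(\<lambda>(b, a). vec2 a b) -` box l u = {l $ 2 <..< u $ 2} \<times> {l $ 1 <..< u $ 1}"
      by (auto simp: mem_box_cart forall_2)
    ultimately show "emeasure ?D (box l u) = ennreal (\<Prod>b\<in>Basis. (u - l) \<bullet> b)"
      by (simp add: emeasure_distr prod_Basis_cart space_pair_measure lborel.emeasure_pair_measure_Times ennreal_mult[symmetric] UNIV_2 mult.commute)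
  qed simp
  then have "(\<integral>\<^sup>+y. f y \<partial>lborel) = (\<integral>\<^sup>+y. f y \<partial>?D)" by simp
  also have "\<dots> = (\<integral>\<^sup>+z. f (vec2 (snd z) (fst z)) \<partial>(lborel \<Otimes>\<^sub>M lborel))"
    by (simp add: nn_integral_distr split_beta)
  also have "\<dots> = (\<integral>\<^sup>+b. \<integral>\<^sup>+a. f (vec2 a b) \<partial>lborel \<partial>lborel)"
    by (subst lborel.nn_integral_fst[symmetric]) auto
  finally show ?thesis .
qed

lemma nn_integral_lborel_pair:
  fixes f :: "'a::euclidean_space \<times> 'b::euclidean_space \<Rightarrow> ennreal"
  assumes [measurable]: "f \<in> borel_measurable borel"
  shows "(\<integral>\<^sup>+z. f z \<partial>lborel) = (\<integral>\<^sup>+x. \<integral>\<^sup>+y. f (x, y) \<partial>lborel \<partial>lborel)"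
proof -
  have "f \<in> borel_measurable (lborel \<Otimes>\<^sub>M lborel)" by (simp add: lborel_prod)
  from lborel.nn_integral_fst[OF this] show ?thesis by (simp add: lborel_prod)
qed

lemma japanese_vec1: "japanese (vec x :: real ^ 1) = sqrt (1 + x\<^sup>2)"
  by (simp add: japanese_def norm_vec_def L2_set_def)

text \<open>Written as m^2 + a^2 under the root: once the second component \<open>b\<close> is
  fixed, the first one belongs to a one-dimensional particle of mass m = sqrt (1 + b^2). This
  reduces dimension two to \<open>two_mass_convolution\<close>.\<close>

lemma japanese_vec2: "japanese (vec2 a b) = sqrt ((sqrt (1 + b\<^sup>2))\<^sup>2 + a\<^sup>2)"
  by (simp add: japanese_def norm_vec_def L2_set_def sum_2 add_ac)

lemma borel_measurable_fst_snd:
  "(fst :: 'a::euclidean_space \<times> 'b::euclidean_space \<Rightarrow> 'a) \<in> borel_measurable borel"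
  "(snd :: 'a::euclidean_space \<times> 'b::euclidean_space \<Rightarrow> 'b) \<in> borel_measurable borel"
  by (intro borel_measurable_continuous_onI continuous_intros)+

text \<open>Adding a point of the hyperboloid to a forward causal vector adds 1 and twice a
  nonnegative Lorentz product to the Lorentz square. Hence the convolution step only concerns
  forward \<open>P\<close> with \<open>lor P P\<close> at least 1.\<close>

lemma timelike_plus_pos:
  assumes "0 < snd (P - pos b)" "0 \<le> lor (P - pos b) (P - pos b)"
  shows "0 < snd P" "1 \<le> lor P P" "norm (fst P) \<le> snd P"
    "lor (P - pos b) (P - pos b) = lor P P + 1 - 2 * lor P (pos b)"
proof -
  define Q where "Q = P - pos b"
  have P: "P = Q + pos b" by (simp add: Q_def)
  have Q: "0 < snd Q" "(norm (fst Q))\<^sup>2 \<le> (snd Q)\<^sup>2"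
    unfolding power2_norm_eq_inner using assms by (simp_all add: Q_def lor_def power2_eq_square)
  have n: "norm (fst Q) \<le> snd Q" by (rule power2_le_imp_le[OF Q(2)]) (use Q in simp)
  have "fst Q \<bullet> b \<le> norm (fst Q) * norm b" by (rule norm_cauchy_schwarz)
  also have "\<dots> \<le> snd Q * japanese b" using n Q(1) norm_less_japanese[of b] by (intro mult_mono) auto
  finally have "0 \<le> lor Q (pos b)" by (simp add: lor_def pos_def)
  moreover have "lor P P = lor Q Q + 2 * lor Q (pos b) + 1"
    by (simp add: P lor_bilinear lor_pos_self lor_commute)
  ultimately show "1 \<le> lor P P" using assms by (simp add: Q_def)
  show "0 < snd P" using Q(1) japanese_pos(1)[of b] unfolding P pos_def snd_add snd_conv by linarith
  show "norm (fst P) \<le> snd P"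
    using n norm_triangle_ineq[of "fst Q" b] norm_less_japanese[of b] by (simp add: P pos_def)
  show "lor (P - pos b) (P - pos b) = lor P P + 1 - 2 * lor P (pos b)"
    by (simp add: lor_bilinear lor_pos_self lor_commute)
qed

section \<open>Densities of the convolutions in dimension one\<close>

lemma conv_bound_2_real1:
  "conv_bound 2 (\<lambda>P :: (real ^ 1) \<times> real.
     ennreal (indicator {0<..} (snd P) * two_mass_kernel 1 1 (lor P P)))"
proof (rule conv_bound_2)
  show m: "(\<lambda>P :: (real ^ 1) \<times> real. ennreal (indicator {0<..} (snd P) * two_mass_kernel 1 1 (lor P P))) \<in> borel_measurable borel"
  proof -
    note borel_measurable_fst_snd [measurable]
    show ?thesis by measurable
  qed
  fix G :: "(real ^ 1) \<times> real \<Rightarrow> ennreal" assume G [measurable]: "G \<in> borel_measurable borel"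
  define K :: "(real ^ 1) \<times> real \<Rightarrow> ennreal" where
    "K P = ennreal (indicator {0<..} (snd P) * two_mass_kernel 1 1 (lor P P))" for P
  have [measurable]: "K \<in> borel_measurable (borel \<Otimes>\<^sub>M borel)" using m by (simp add: K_def[abs_def] borel_prod)
  have [measurable]: "G \<in> borel_measurable (borel \<Otimes>\<^sub>M borel)" by (simp add: borel_prod)
  let ?G = "\<lambda>\<xi> t. G (vec \<xi>, t)"
  have "(\<integral>\<^sup>+a. \<integral>\<^sup>+b. G (pos a + pos b) \<partial>hyp_measure \<partial>hyp_measure) =
     (\<integral>\<^sup>+x. \<integral>\<^sup>+x'. ?G (x + x') (sqrt (1\<^sup>2 + x\<^sup>2) + sqrt (1\<^sup>2 + x'\<^sup>2)) *
       ennreal (1 / (sqrt (1\<^sup>2 + x\<^sup>2) * sqrt (1\<^sup>2 + x'\<^sup>2))) \<partial>lborel \<partial>lborel)"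
    by (simp add: nn_integral_hyp_measure nn_integral_real1 nn_integral_cmult[symmetric] japanese_vec1 pos_def vec_add
        ennreal_mult[symmetric] mult.assoc[symmetric] mult.commute)
  also have "\<dots> \<le> (\<integral>\<^sup>+\<xi>. \<integral>\<^sup>+t. ?G \<xi> t * ennreal (indicator {0<..} t * two_mass_kernel 1 1 (t\<^sup>2 - \<xi>\<^sup>2)) \<partial>lborel \<partial>lborel)"
  proof (rule two_mass_convolution)
    show "(\<lambda>(\<xi>, t). G (vec \<xi>, t)) \<in> borel_measurable (borel \<Otimes>\<^sub>M borel)" by measurable
  qed simp_all
  also have "\<dots> = (\<integral>\<^sup>+\<xi>. \<integral>\<^sup>+t. G (vec \<xi>, t) * K (vec \<xi>, t) \<partial>lborel \<partial>lborel)"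
    by (simp add: K_def lor_def inner_vec_def power2_eq_square)
  also have "\<dots> = (\<integral>\<^sup>+x. \<integral>\<^sup>+t. G (x, t) * K (x, t) \<partial>lborel \<partial>lborel)"
    by (rule nn_integral_real1[symmetric]) measurable
  also have "\<dots> = (\<integral>\<^sup>+P. G P * K P \<partial>lborel)"
    by (rule nn_integral_lborel_pair[symmetric]) (use G m in \<open>simp add: K_def\<close>)
  also have "\<dots> = (\<integral>\<^sup>+P. G P * ennreal (indicator {0<..} (snd P) * two_mass_kernel 1 1 (lor P P)) \<partial>lborel)"
    by (simp only: K_def)
  finally show "(\<integral>\<^sup>+a. \<integral>\<^sup>+b. G (pos a + pos b) \<partial>hyp_measure \<partial>hyp_measure) \<le> \<dots>" .
qed

lemma power2_powr: "0 < (x::real) \<Longrightarrow> x\<^sup>2 powr a = x powr (2 * a)"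
  by (simp add: powr_powr flip: powr_numeral)

lemma rapidity_coords:
  fixes \<xi> t :: real
  assumes "0 < t" "\<xi>\<^sup>2 < t\<^sup>2"
  obtains w where "\<xi> = sqrt (t\<^sup>2 - \<xi>\<^sup>2) * sinh w" "t = sqrt (t\<^sup>2 - \<xi>\<^sup>2) * cosh w"
proof
  define r where "r = sqrt (t\<^sup>2 - \<xi>\<^sup>2)"
  have r: "r > 0" "r\<^sup>2 = t\<^sup>2 - \<xi>\<^sup>2" using assms by (auto simp: r_def)
  define w where "w = arsinh (\<xi> / r)"
  have s: "\<xi> = r * sinh w" using r by (simp add: w_def)
  have "(r * cosh w)\<^sup>2 = r\<^sup>2 + (r * sinh w)\<^sup>2" by (simp add: power_mult_distrib cosh_square_eq algebra_simps)
  also have "\<dots> = t\<^sup>2" using r by (simp add: s[symmetric])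
  finally have "t = r * cosh w" using r assms by (simp add: power2_eq_iff_nonneg)
  then show "t = sqrt (t\<^sup>2 - \<xi>\<^sup>2) * cosh w" by (simp add: r_def)
  show "\<xi> = sqrt (t\<^sup>2 - \<xi>\<^sup>2) * sinh w" using s by (simp add: r_def)
qed

lemma nn_integral_hyp_real1:
  fixes h :: "real ^ 1 \<Rightarrow> ennreal"
  assumes [measurable]: "h \<in> borel_measurable borel"
  shows "(\<integral>\<^sup>+b. h b \<partial>hyp_measure) = (\<integral>\<^sup>+x. h (vec x) * ennreal (1 / sqrt (1\<^sup>2 + x\<^sup>2)) \<partial>lborel)"
  by (subst nn_integral_hyp_measure, measurable, subst nn_integral_real1, measurable)
    (simp only: japanese_vec1 mult.commute power_one)

lemma nn_integral_hyp_real2: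
  fixes h :: "real ^ 2 \<Rightarrow> ennreal"
  assumes [measurable]: "h \<in> borel_measurable borel"
  shows "(\<integral>\<^sup>+b. h b \<partial>hyp_measure) =
    (\<integral>\<^sup>+y. \<integral>\<^sup>+x. h (vec2 x y) * ennreal (1 / sqrt ((sqrt (1 + y\<^sup>2))\<^sup>2 + x\<^sup>2)) \<partial>lborel \<partial>lborel)"
  by (subst nn_integral_hyp_measure, measurable, subst nn_integral_real2, measurable)
    (simp only: japanese_vec2 mult.commute)

lemma kernel_measurable:
  fixes \<kappa> :: "real \<Rightarrow> real"
  assumes "\<kappa> \<in> borel_measurable borel"
  shows "(\<lambda>P :: 'a::euclidean_space \<times> real. ennreal (indicator {0<..} (snd P) * \<kappa> (lor P P))) \<in> borel_measurable borel"
proof -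
  note borel_measurable_fst_snd [measurable] assms [measurable]
  show ?thesis by measurable
qed

text \<open>In the rest frame of \<open>P\<close>, that is with rapidities measured relative to the
  rapidity \<open>w\<close> of \<open>P\<close>, the product \<open>lor P (pos b)\<close> is the
  invariant mass of \<open>P\<close> times cosh u, and the convolution depends on
  \<open>lor P P\<close> alone.\<close>

lemma conv_step_real1:
  fixes \<kappa> :: "real \<Rightarrow> real" and P :: "(real ^ 1) \<times> real"
  assumes \<kappa> [measurable]: "\<kappa> \<in> borel_measurable borel" and zero: "\<And>s. s < 0 \<Longrightarrow> \<kappa> s = 0"
  shows "(\<integral>\<^sup>+b. ennreal (indicator {0<..} (snd (P - pos b)) * \<kappa> (lor (P - pos b) (P - pos b))) \<partial>hyp_measure)
    \<le> (if 0 < snd P \<and> 1 \<le> lor P P then \<integral>\<^sup>+u. ennreal (\<kappa> (lor P P + 1 - 2 * sqrt (lor P P) * cosh u)) \<partial>lborel else 0)"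
proof -
  let ?h = "\<lambda>b. ennreal (indicator {0<..} (snd (P - pos b)) * \<kappa> (lor (P - pos b) (P - pos b)))"
  have hm: "?h \<in> borel_measurable borel"
    using measurable_compose[OF _ kernel_measurable[OF \<kappa>], of "\<lambda>b. P - pos b" borel] by measurable
  show ?thesis
  proof (cases "0 < snd P \<and> 1 \<le> lor P P")
    case True
    define \<xi> where "\<xi> = fst P $ 1"
    have l: "lor P P = (snd P)\<^sup>2 - \<xi>\<^sup>2" by (simp add: lor_def inner_vec_def power2_eq_square \<xi>_def)
    obtain w where w: "\<xi> = sqrt (lor P P) * sinh w" "snd P = sqrt (lor P P) * cosh w"
    proof -
      have "0 < snd P" "\<xi>\<^sup>2 < (snd P)\<^sup>2" using True l by auto
      from rapidity_coords[OF this] show thesis using that unfolding l[symmetric] by blast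
    qed
    have "(\<integral>\<^sup>+b. ?h b \<partial>hyp_measure) = (\<integral>\<^sup>+x. ?h (vec x) * ennreal (1 / sqrt (1\<^sup>2 + x\<^sup>2)) \<partial>lborel)"
      by (rule nn_integral_hyp_real1[OF hm])
    also have "\<dots> \<le> (\<integral>\<^sup>+u. ?h (vec (1 * sinh (u + w))) \<partial>lborel)"
      by (rule nn_integral_rapidity_le[where h="\<lambda>x. ?h (vec x)"])
        (use measurable_compose[OF borel_measurable_vec1 hm] in simp_all)
    also have "\<dots> \<le> (\<integral>\<^sup>+u. ennreal (\<kappa> (lor P P + 1 - 2 * sqrt (lor P P) * cosh u)) \<partial>lborel)"
    proof (rule nn_integral_mono)
      fix u
      let ?b = "vec (sinh (u + w)) :: real ^ 1"
      have j: "japanese (vec (sinh (u + w)) :: real ^ 1) = cosh (u + w)"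
        using cosh_square_eq[of "u + w"] by (simp add: japanese_vec1 real_sqrt_unique add.commute)
      have "lor P (pos ?b) = sqrt (lor P P) * (cosh w * cosh (u + w) - sinh w * sinh (u + w))"
        unfolding lor_def[of P "pos ?b"] using w by (simp add: pos_def j inner_vec_def \<xi>_def[symmetric] algebra_simps)
      also have "cosh w * cosh (u + w) - sinh w * sinh (u + w) = cosh u"
        using cosh_diff[of "u + w" w] by (simp add: mult.commute)
      finally have "lor P (pos ?b) = sqrt (lor P P) * cosh u" .
      then have "lor (P - pos ?b) (P - pos ?b) = lor P P + 1 - 2 * sqrt (lor P P) * cosh u"
        by (simp add: lor_bilinear lor_pos_self lor_commute[of "pos ?b" P])
      then show "?h (vec (1 * sinh (u + w))) \<le> ennreal (\<kappa> (lor P P + 1 - 2 * sqrt (lor P P) * cosh u))"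
        by (auto simp: indicator_def)
    qed
    finally show ?thesis using True by simp
  next
    case False
    have "?h b = 0" for b
      using timelike_plus_pos(1,2)[of P b] False zero by (cases "lor (P - pos b) (P - pos b) < 0") (auto simp: indicator_def)
    then show ?thesis using False by simp
  qed
qed

text \<open>The cutoff at 1 matches the support of the convolutions found in
  \<open>timelike_plus_pos\<close> and lets the bound be fed back into
  \<open>conv_step_real1\<close>.\<close>

definition decay :: "real \<Rightarrow> real \<Rightarrow> real \<Rightarrow> real" where
  "decay C e s = (if 1 \<le> s then C * s powr - e else 0)"

lemma decay_measurable [measurable]: "decay C e \<in> borel_measurable borel"
  unfolding decay_def by measurable

text \<open>The two-fold density 4 / sqrt (S (S - 4)) has a singularity at the threshold S = 4.
  There the factor sqrt S is at least 2, and S - 4 = 2 \<rho> (A - cosh u), so the uniform cosh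
  integral applies and leaves \<rho>^(-1/2), which is the power -1/4 of the Lorentz square.\<close>

lemma conv_bound_3_real1:
  "conv_bound 3 (\<lambda>P :: (real ^ 1) \<times> real. ennreal (indicator {0<..} (snd P) * decay (2 * pi) (1/4) (lor P P)))"
proof -
  have "conv_bound (Suc 2) (\<lambda>P :: (real ^ 1) \<times> real. ennreal (indicator {0<..} (snd P) * decay (2 * pi) (1/4) (lor P P)))"
  proof (rule conv_bound_Suc[OF conv_bound_2_real1 kernel_measurable[OF decay_measurable]])
    fix P :: "(real ^ 1) \<times> real"
    let ?s = "lor P P"
    define \<rho> where "\<rho> = sqrt ?s"
    have "(\<integral>\<^sup>+b. ennreal (indicator {0<..} (snd (P - pos b)) * two_mass_kernel 1 1 (lor (P - pos b) (P - pos b))) \<partial>hyp_measure)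
      \<le> (if 0 < snd P \<and> 1 \<le> ?s then \<integral>\<^sup>+u. ennreal (two_mass_kernel 1 1 (?s + 1 - 2 * sqrt ?s * cosh u)) \<partial>lborel else 0)"
      by (rule conv_step_real1) (simp_all add: two_mass_kernel_def)
    also have "\<dots> \<le> ennreal (indicator {0<..} (snd P) * decay (2 * pi) (1/4) ?s)"
    proof (cases "0 < snd P \<and> 1 \<le> ?s")
      case True
      then have \<rho>: "\<rho> \<ge> 1" "?s = \<rho>\<^sup>2" by (auto simp: \<rho>_def)
      define A where "A = (\<rho>\<^sup>2 - 3) / (2 * \<rho>)"
      have "(\<integral>\<^sup>+u. ennreal (two_mass_kernel 1 1 (?s + 1 - 2 * sqrt ?s * cosh u)) \<partial>lborel) \<le>
        (\<integral>\<^sup>+u. ennreal (2 / sqrt (2 * \<rho>)) * (ennreal (1 / sqrt (A - cosh u)) * indicator {u. cosh u < A} u) \<partial>lborel)"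
      proof (rule nn_integral_mono)
        fix u :: real
        let ?S = "?s + 1 - 2 * sqrt ?s * cosh u"
        have S: "?S - 4 = 2 * \<rho> * (A - cosh u)"
          using \<rho> by (simp add: A_def field_simps power2_eq_square)
        show "ennreal (two_mass_kernel 1 1 ?S) \<le> ennreal (2 / sqrt (2 * \<rho>)) * (ennreal (1 / sqrt (A - cosh u)) * indicator {u. cosh u < A} u)"
        proof (cases "?S > 4")
          case True
          then have "2 * \<rho> * (A - cosh u) > 0" using S by linarith
          then have pos: "A - cosh u > 0" using \<rho> by (simp add: zero_less_mult_iff)
          have "(?S - 1\<^sup>2 - 1\<^sup>2)\<^sup>2 - 4 * 1\<^sup>2 * 1\<^sup>2 = ?S * (?S - 4)" by (simp add: power2_eq_square algebra_simps)
          then have "two_mass_kernel 1 1 ?S = 4 / (sqrt ?S * sqrt (?S - 4))"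
            using True by (simp only: two_mass_kernel_def real_sqrt_mult) simp
          also have "\<dots> \<le> 4 / (2 * sqrt (?S - 4))"
          proof (intro divide_left_mono mult_right_mono)
            have "sqrt 4 \<le> sqrt ?S" using True by (intro real_sqrt_le_mono) simp
            then show "2 \<le> sqrt ?S" by simp
          qed (use True in auto)
          also have "\<dots> = 2 / sqrt (2 * \<rho>) * (1 / sqrt (A - cosh u))" unfolding S by (simp add: real_sqrt_mult)
          finally have "ennreal (two_mass_kernel 1 1 ?S) \<le> ennreal (2 / sqrt (2 * \<rho>) * (1 / sqrt (A - cosh u)))" by (rule ennreal_leI)
          also have "\<dots> = ennreal (2 / sqrt (2 * \<rho>)) * (ennreal (1 / sqrt (A - cosh u)) * indicator {u. cosh u < A} u)"
            using pos \<rho> by (subst ennreal_mult) auto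
          finally show ?thesis .
        next
          case False
          then have "two_mass_kernel 1 1 ?S = 0" by (simp add: two_mass_kernel_def)
          then show ?thesis by simp
        qed
      qed
      also have "\<dots> = ennreal (2 / sqrt (2 * \<rho>)) * (\<integral>\<^sup>+u. ennreal (1 / sqrt (A - cosh u)) * indicator {u. cosh u < A} u \<partial>lborel)"
        by (rule nn_integral_cmult) measurable
      also have "\<dots> \<le> ennreal (2 / sqrt (2 * \<rho>)) * ennreal (sqrt 2 * pi)"
        by (intro mult_left_mono nn_integral_cosh_le) simp
      also have "\<dots> = ennreal (2 / sqrt (2 * \<rho>) * (sqrt 2 * pi))" using \<rho> by (subst ennreal_mult) auto
      also have "2 / sqrt (2 * \<rho>) * (sqrt 2 * pi) = decay (2 * pi) (1/4) ?s"
      proof -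
        have "?s powr - (1/4) = 1 / sqrt \<rho>"
          unfolding \<rho>(2) using \<rho>(1) by (subst power2_powr) (auto simp: powr_minus powr_half_sqrt inverse_eq_divide)
        then have "decay (2 * pi) (1/4) ?s = 2 * pi * (1 / sqrt \<rho>)" using True by (simp add: decay_def)
        then show ?thesis by (simp add: real_sqrt_mult)
      qed
      finally show ?thesis using True by simp
    qed auto
    finally show "(\<integral>\<^sup>+b. ennreal (indicator {0<..} (snd (P - pos b)) * two_mass_kernel 1 1 (lor (P - pos b) (P - pos b))) \<partial>hyp_measure)
      \<le> ennreal (indicator {0<..} (snd P) * decay (2 * pi) (1/4) ?s)" .
  qed
  then show ?thesis by (simp add: numeral_3_eq_3 numeral_2_eq_2)
qed

text \<open>The available rapidities fill the interval |u| < ln \<rho>, since A = cosh (ln \<rho>).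
  The interval costs a logarithm, which is paid for with half of the decay in \<rho>; counted in the
  Lorentz square \<rho>^2 the exponent drops from e to e/4.\<close>

lemma conv_bound_Suc_real1:
  assumes cb: "conv_bound m (\<lambda>P :: (real ^ 1) \<times> real. ennreal (indicator {0<..} (snd P) * decay C e (lor P P)))"
    and C: "0 \<le> C" and e: "0 < e" "e \<le> 1/2"
  shows "conv_bound (Suc m) (\<lambda>P :: (real ^ 1) \<times> real. ennreal (indicator {0<..} (snd P) * decay (C * (4 / e + sqrt 2 * pi)) (e / 4) (lor P P)))"
proof (rule conv_bound_Suc[OF cb kernel_measurable[OF decay_measurable]])
  fix P :: "(real ^ 1) \<times> real"
  let ?s = "lor P P"
  let ?C' = "C * (4 / e + sqrt 2 * pi)"
  define \<rho> where "\<rho> = sqrt ?s"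
  have "(\<integral>\<^sup>+b. ennreal (indicator {0<..} (snd (P - pos b)) * decay C e (lor (P - pos b) (P - pos b))) \<partial>hyp_measure)
    \<le> (if 0 < snd P \<and> 1 \<le> ?s then \<integral>\<^sup>+u. ennreal (decay C e (?s + 1 - 2 * sqrt ?s * cosh u)) \<partial>lborel else 0)"
    by (rule conv_step_real1) (simp_all add: decay_def)
  also have "\<dots> \<le> ennreal (indicator {0<..} (snd P) * decay ?C' (e/4) ?s)"
  proof (cases "0 < snd P \<and> 1 \<le> ?s")
    case True
    then have \<rho>: "\<rho> \<ge> 1" "?s = \<rho>\<^sup>2" by (auto simp: \<rho>_def)
    define A where "A = (\<rho>\<^sup>2 + 1) / (2 * \<rho>)"
    have A: "A = cosh (ln \<rho>)" using \<rho> by (simp add: A_def cosh_ln_real field_simps power2_eq_square)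
    have "(\<integral>\<^sup>+u. ennreal (decay C e (?s + 1 - 2 * sqrt ?s * cosh u)) \<partial>lborel) \<le>
      (\<integral>\<^sup>+u. ennreal (C * \<rho> powr - e) * (indicator {- ln \<rho>..ln \<rho>} u + ennreal (1 / sqrt (A - cosh u)) * indicator {u. cosh u < A} u) \<partial>lborel)"
    proof (rule nn_integral_mono)
      fix u :: real
      let ?S = "?s + 1 - 2 * sqrt ?s * cosh u"
      have S: "?S = 2 * \<rho> * (A - cosh u)"
        using \<rho> by (simp add: A_def field_simps power2_eq_square)
      show "ennreal (decay C e ?S) \<le> ennreal (C * \<rho> powr - e) * (indicator {- ln \<rho>..ln \<rho>} u + ennreal (1 / sqrt (A - cosh u)) * indicator {u. cosh u < A} u)"
      proof (cases "?S \<ge> 1")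
        case True
        then have "2 * \<rho> * (A - cosh u) > 0" using S by linarith
        then have pos: "A - cosh u > 0" using \<rho> by (simp add: zero_less_mult_iff)
        then have "\<bar>u\<bar> < ln \<rho>" using A \<rho> cosh_real_nonneg_less_iff[of "\<bar>u\<bar>" "ln \<rho>"] by simp
        then have u: "u \<in> {- ln \<rho>..ln \<rho>}" by auto
        \<comment> \<open>Here e \<le> 1/2 enters: near the edge of the interval the singularity is
          no worse than an inverse square root, whose integral is bounded uniformly in
          \<open>A\<close>.\<close>
        have "(A - cosh u) powr - e \<le> 1 + 1 / sqrt (A - cosh u)"
        proof (cases "A - cosh u \<ge> 1")
          case True
          then have "(A - cosh u) powr - e \<le> (A - cosh u) powr 0" using e by (intro powr_mono) auto
          then show ?thesis using pos by (simp add: add_increasing2)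
        next
          case False
          then have "(A - cosh u) powr - e \<le> (A - cosh u) powr - (1/2)" using e pos by (intro powr_mono') auto
          also have "\<dots> = 1 / sqrt (A - cosh u)" using pos by (simp add: powr_minus powr_half_sqrt inverse_eq_divide)
          finally show ?thesis by simp
        qed
        moreover have "(2 * \<rho>) powr - e \<le> \<rho> powr - e" using \<rho> e by (intro powr_mono2') auto
        ultimately have "?S powr - e \<le> \<rho> powr - e * (1 + 1 / sqrt (A - cosh u))"
          unfolding S using pos \<rho> by (subst powr_mult) (auto intro!: mult_mono)
        then have "decay C e ?S \<le> C * \<rho> powr - e * (1 + 1 / sqrt (A - cosh u))"
          using True C by (simp add: decay_def mult.assoc mult_left_mono)
        then have "ennreal (decay C e ?S) \<le> ennreal (C * \<rho> powr - e * (1 + 1 / sqrt (A - cosh u)))" by (rule ennreal_leI)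
        also have "\<dots> = ennreal (C * \<rho> powr - e) * (1 + ennreal (1 / sqrt (A - cosh u)))"
          using pos C by (subst ennreal_mult) (auto simp: ennreal_plus)
        finally show ?thesis using u pos by simp
      next
        case False
        then have "decay C e ?S = 0" by (simp add: decay_def)
        then show ?thesis by simp
      qed
    qed
    also have "\<dots> = ennreal (C * \<rho> powr - e) * (\<integral>\<^sup>+u. indicator {- ln \<rho>..ln \<rho>} u + ennreal (1 / sqrt (A - cosh u)) * indicator {u. cosh u < A} u \<partial>lborel)"
      by (rule nn_integral_cmult) measurable
    also have "(\<integral>\<^sup>+u. indicator {- ln \<rho>..ln \<rho>} u + ennreal (1 / sqrt (A - cosh u)) * indicator {u. cosh u < A} u \<partial>lborel) =
       (\<integral>\<^sup>+u. indicator {- ln \<rho>..ln \<rho>} u \<partial>lborel) + (\<integral>\<^sup>+u. ennreal (1 / sqrt (A - cosh u)) * indicator {u. cosh u < A} u \<partial>lborel)"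
      by (rule nn_integral_add) measurable
    also have "(\<integral>\<^sup>+u. indicator {- ln \<rho>..ln \<rho>} u \<partial>lborel) = ennreal (2 * ln \<rho>)" using \<rho> by simp
    also have "ennreal (C * \<rho> powr - e) * (ennreal (2 * ln \<rho>) + (\<integral>\<^sup>+u. ennreal (1 / sqrt (A - cosh u)) * indicator {u. cosh u < A} u \<partial>lborel))
      \<le> ennreal (C * \<rho> powr - e) * (ennreal (2 * ln \<rho>) + ennreal (sqrt 2 * pi))"
      by (intro mult_left_mono add_mono nn_integral_cosh_le order_refl) simp
    also have "\<dots> = ennreal (C * \<rho> powr - e * (2 * ln \<rho> + sqrt 2 * pi))"
      using \<rho> C by (subst ennreal_plus[symmetric], simp, simp, subst ennreal_mult[symmetric]) (auto simp: ln_ge_zero)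
    also have "\<dots> \<le> ennreal (decay ?C' (e/4) ?s)"
    proof (rule ennreal_leI)
      have "ln \<rho> \<le> \<rho> powr (e/2) / (e/2)" using \<rho> e by (intro ln_powr_bound) auto
      have "1 \<le> \<rho> powr (e/2)" using \<rho> e by (intro ge_one_powr_ge_zero) auto
      then have "sqrt 2 * pi * 1 \<le> sqrt 2 * pi * \<rho> powr (e/2)" by (intro mult_left_mono) auto
      moreover have "2 * ln \<rho> \<le> 4 / e * \<rho> powr (e/2)"
        using \<open>ln \<rho> \<le> \<rho> powr (e/2) / (e/2)\<close> by simp
      ultimately have "2 * ln \<rho> + sqrt 2 * pi \<le> (4 / e + sqrt 2 * pi) * \<rho> powr (e/2)"
        by (simp only: distrib_right mult_1_right)
      then have "C * \<rho> powr - e * (2 * ln \<rho> + sqrt 2 * pi) \<le> C * \<rho> powr - e * ((4 / e + sqrt 2 * pi) * \<rho> powr (e/2))"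
        using C by (intro mult_left_mono) auto
      also have "\<dots> = ?C' * (\<rho> powr - e * \<rho> powr (e/2))" by (simp add: mult_ac)
      also have "\<rho> powr - e * \<rho> powr (e/2) = ?s powr - (e/4)"
      proof -
        have "?s powr - (e/4) = \<rho> powr - (e/2)"
          unfolding \<rho>(2) using \<rho>(1) by (subst power2_powr) auto
        then show ?thesis by (simp add: powr_add[symmetric])
      qed
      finally show "C * \<rho> powr - e * (2 * ln \<rho> + sqrt 2 * pi) \<le> decay ?C' (e/4) ?s"
        using True by (simp add: decay_def)
    qed
    finally show ?thesis using True by simp
  qed auto
  finally show "(\<integral>\<^sup>+b. ennreal (indicator {0<..} (snd (P - pos b)) * decay C e (lor (P - pos b) (P - pos b))) \<partial>hyp_measure)
    \<le> ennreal (indicator {0<..} (snd P) * decay ?C' (e/4) ?s)" .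
qed

text \<open>Only boundedness is wanted, but the induction has to carry some decay: a merely bounded
  density would pick up the logarithmic length of the rapidity interval at each step. Arbitrarily
  many factors are required because \<open>p\<close> may be arbitrarily large.\<close>

lemma conv_bound_real1_const:
  assumes "3 \<le> m"
  obtains C where "0 \<le> C" "conv_bound m (\<lambda>P :: (real ^ 1) \<times> real. ennreal C)"
proof -
  have "\<exists>C e. 0 \<le> C \<and> 0 < e \<and> e \<le> 1/2 \<and>
      conv_bound m (\<lambda>P :: (real ^ 1) \<times> real. ennreal (indicator {0<..} (snd P) * decay C e (lor P P)))"
    using assms
  proof (induction m rule: dec_induct)
    case base
    show ?case by (intro exI[of _ "2 * pi"] exI[of _ "1/4"]) (simp add: conv_bound_3_real1)
  next
    case (step m)
    then obtain C e where "0 \<le> C" "0 < e" "e \<le> 1/2"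
      "conv_bound m (\<lambda>P :: (real ^ 1) \<times> real. ennreal (indicator {0<..} (snd P) * decay C e (lor P P)))" by blast
    then show ?case
      using conv_bound_Suc_real1[of m C e] by (intro exI[of _ "C * (4 / e + sqrt 2 * pi)"] exI[of _ "e / 4"]) auto
  qed
  then obtain C e where C: "0 \<le> C" "0 < e"
    "conv_bound m (\<lambda>P :: (real ^ 1) \<times> real. ennreal (indicator {0<..} (snd P) * decay C e (lor P P)))" by blast
  have "conv_bound m (\<lambda>P :: (real ^ 1) \<times> real. ennreal C)"
  proof (rule conv_bound_mono[OF C(3)])
    fix P :: "(real ^ 1) \<times> real"
    have "s powr - e \<le> 1" if "1 \<le> s" for s
      using that C powr_mono[of "- e" 0 s] by simp
    then show "ennreal (indicator {0<..} (snd P) * decay C e (lor P P)) \<le> ennreal C"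
      using C by (intro ennreal_leI) (auto simp: indicator_def decay_def mult_left_le)
  qed simp
  then show thesis using that C by blast
qed

text \<open>\<open>max 1\<close> and the missing cone indicator make the bound a continuous function
  on all of space-time, as the oscillatory estimate demands.\<close>

lemma conv_bound_real1_decay:
  "conv_bound 3 (\<lambda>P :: (real ^ 1) \<times> real. ennreal (2 * pi * max 1 (lor P P) powr - (1/4)))"
proof (rule conv_bound_mono[OF conv_bound_3_real1])
  show "(\<lambda>P :: (real ^ 1) \<times> real. ennreal (2 * pi * max 1 (lor P P) powr - (1/4))) \<in> borel_measurable borel"
    by measurable
  fix P :: "(real ^ 1) \<times> real"
  show "ennreal (indicator {0<..} (snd P) * decay (2 * pi) (1/4) (lor P P)) \<le> ennreal (2 * pi * max 1 (lor P P) powr - (1/4))"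
    by (intro ennreal_leI) (auto simp: indicator_def decay_def max_def)
qed

section \<open>Convolutions of the invariant measure in dimension two\<close>

text \<open>With total second component \<open>Z\<close> and share \<open>b\<close>, the expression
  under the root in the kernel is a quadratic polynomial in \<open>b\<close>, symmetric about Z/2
  and with leading coefficient -4 s. Its integral is an arcsine integral, and only the factor 2 /
  sqrt s remains.\<close>

lemma two_mass_kernel_real2_le:
  fixes Z s' :: real
  defines "s \<equiv> s' - Z\<^sup>2"
  shows "(\<integral>\<^sup>+b. ennreal (two_mass_kernel (sqrt (1 + b\<^sup>2)) (sqrt (1 + (Z - b)\<^sup>2)) s') \<partial>lborel)
    \<le> ennreal (if s > 4 then 2 * pi / sqrt s else 0)"
proof -
  let ?k = "\<lambda>b. two_mass_kernel (sqrt (1 + b\<^sup>2)) (sqrt (1 + (Z - b)\<^sup>2)) s'"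
  \<comment> \<open>The threshold in the squared mass, (m + m')^2 - Z^2, is at least 4 by
    Cauchy-Schwarz for the vectors (1, b) and (1, Z - b).\<close>
  have sgt: "s > 4" if "s' > (sqrt (1 + b\<^sup>2) + sqrt (1 + (Z - b)\<^sup>2))\<^sup>2" for b
  proof -
    let ?m = "sqrt (1 + b\<^sup>2)" and ?m' = "sqrt (1 + (Z - b)\<^sup>2)"
    have "(1 + b * (Z - b))\<^sup>2 \<le> (1 + b\<^sup>2) * (1 + (Z - b)\<^sup>2)"
      using zero_le_power2[of "b - (Z - b)"] by (simp add: power2_eq_square algebra_simps)
    also have "\<dots> = (?m * ?m')\<^sup>2" by (simp add: power_mult_distrib)
    finally have "1 + b * (Z - b) \<le> ?m * ?m'" by (rule power2_le_imp_le) simp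
    moreover have "(?m + ?m')\<^sup>2 = 2 + b\<^sup>2 + (Z - b)\<^sup>2 + 2 * (?m * ?m')" by (simp add: power2_sum)
    moreover have "Z\<^sup>2 = b\<^sup>2 + (Z - b)\<^sup>2 + 2 * (b * (Z - b))" by (simp add: power2_eq_square algebra_simps)
    ultimately show ?thesis using that unfolding s_def by linarith
  qed
  show ?thesis
  proof (cases "s > 4")
    case False
    then have "?k b = 0" for b using sgt[of b] by (auto simp: two_mass_kernel_def)
    then show ?thesis using False by simp
  next
    case True
    then have s': "s' > 4" using zero_le_power2[of Z] unfolding s_def by linarith
    \<comment> \<open>The half-width of the interval of admissible \<open>b\<close> around Z/2, read
      off from the zeros of the quadratic polynomial.\<close>
    define c where "c = sqrt (s' * (s - 4) / (4 * s))"
    have c: "c > 0" "c\<^sup>2 = s' * (s - 4) / (4 * s)" using True s' by (simp_all add: c_def)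
    have "(\<integral>\<^sup>+b. ennreal (?k b) \<partial>lborel) \<le> (\<integral>\<^sup>+b. ennreal (2 / sqrt s) * (ennreal (1 / sqrt (c\<^sup>2 - (b - Z/2)\<^sup>2)) * indicator {- c<..<c} (b - Z/2)) \<partial>lborel)"
    proof (rule nn_integral_mono)
      fix b :: real
      let ?m = "sqrt (1 + b\<^sup>2)" and ?m' = "sqrt (1 + (Z - b)\<^sup>2)"
      show "ennreal (?k b) \<le> ennreal (2 / sqrt s) * (ennreal (1 / sqrt (c\<^sup>2 - (b - Z/2)\<^sup>2)) * indicator {- c<..<c} (b - Z/2))"
      proof (cases "s' > (?m + ?m')\<^sup>2")
        case gt: True
        have sq: "?m\<^sup>2 = 1 + b\<^sup>2" "?m'\<^sup>2 = 1 + (Z - b)\<^sup>2" by simp_all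
        let ?Q = "(s' - ?m\<^sup>2 - ?m'\<^sup>2)\<^sup>2 - 4 * ?m\<^sup>2 * ?m'\<^sup>2"
        have "?Q = s' * (s - 4) - 4 * s * (b - Z/2)\<^sup>2"
          unfolding sq s_def by (simp add: power2_eq_square algebra_simps)
        also have "s' * (s - 4) = 4 * s * c\<^sup>2" using True by (simp add: c)
        finally have Q: "?Q = 4 * s * (c\<^sup>2 - (b - Z/2)\<^sup>2)" by (simp add: algebra_simps)
        have "2 * (?m * ?m') < s' - ?m\<^sup>2 - ?m'\<^sup>2" using gt by (simp add: power2_sum)
        then have "(2 * (?m * ?m'))\<^sup>2 < (s' - ?m\<^sup>2 - ?m'\<^sup>2)\<^sup>2" by (intro power_strict_mono) auto
        then have "?Q > 0" unfolding four_x_squared[symmetric] power_mult_distrib[of ?m ?m'] by linarith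
        then have pos: "c\<^sup>2 - (b - Z/2)\<^sup>2 > 0" unfolding Q using True by (simp add: zero_less_mult_iff)
        then have "\<bar>b - Z/2\<bar> < c" using c(1) abs_le_square_iff[of c "b - Z/2"] by force
        then have ind: "b - Z/2 \<in> {- c<..<c}" by auto
        have "?k b = 4 / sqrt ?Q" using gt by (simp only: two_mass_kernel_def if_True)
        also have "\<dots> = 2 / sqrt s * (1 / sqrt (c\<^sup>2 - (b - Z/2)\<^sup>2))"
          unfolding Q by (simp add: real_sqrt_mult)
        finally have eq: "?k b = 2 / sqrt s * (1 / sqrt (c\<^sup>2 - (b - Z/2)\<^sup>2))" .
        have "ennreal (?k b) = ennreal (2 / sqrt s) * ennreal (1 / sqrt (c\<^sup>2 - (b - Z/2)\<^sup>2))"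
          unfolding eq using True pos by (intro ennreal_mult) auto
        then show ?thesis using ind by simp
      next
        case False
        then have "?k b = 0" by (simp add: two_mass_kernel_def)
        then show ?thesis by simp
      qed
    qed
    also have "\<dots> = ennreal (2 / sqrt s) * (\<integral>\<^sup>+b. ennreal (1 / sqrt (c\<^sup>2 - (b - Z/2)\<^sup>2)) * indicator {- c<..<c} (b - Z/2) \<partial>lborel)"
      by (rule nn_integral_cmult) measurable
    also have "(\<integral>\<^sup>+b. ennreal (1 / sqrt (c\<^sup>2 - (b - Z/2)\<^sup>2)) * indicator {- c<..<c} (b - Z/2) \<partial>lborel) =
       (\<integral>\<^sup>+x. ennreal (1 / sqrt (c\<^sup>2 - x\<^sup>2)) * indicator {- c<..<c} x \<partial>lborel)"
      using nn_integral_lborel_minus[of "\<lambda>x. ennreal (1 / sqrt (c\<^sup>2 - x\<^sup>2)) * indicator {- c<..<c} x" "- (Z/2)"] by simp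
    also have "ennreal (2 / sqrt s) * \<dots> \<le> ennreal (2 / sqrt s) * ennreal pi"
      by (intro mult_left_mono nn_integral_arcsin_le c) simp
    also have "\<dots> = ennreal (2 * pi / sqrt s)" using True by (simp add: ennreal_mult[symmetric])
    finally show ?thesis using True by simp
  qed
qed

definition kernel2 :: "real \<Rightarrow> real" where
  "kernel2 s = (if s > 4 then 2 * pi / sqrt s else 0)"

lemma kernel2_measurable [measurable]: "kernel2 \<in> borel_measurable borel"
  unfolding kernel2_def by measurable

lemma lor_real2: "lor (vec2 \<xi> Z, t) (vec2 \<xi>' Z', t') = t * t' - \<xi> * \<xi>' - Z * Z'"
  by (simp add: lor_def inner_vec_def sum_2)

lemma vec2_add: "vec2 a b + vec2 a' b' = vec2 (a + a') (b + b')"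
  by (simp add: vec_eq_iff forall_2)

text \<open>For fixed second components \<open>b\<close> and \<open>b'\<close> the first components
  form a one-dimensional problem with two masses. After that the total Z = b + b' replaces
  \<open>b'\<close>, and \<open>b\<close> is integrated out.\<close>

lemma conv_bound_2_real2:
  "conv_bound 2 (\<lambda>P :: (real ^ 2) \<times> real. ennreal (indicator {0<..} (snd P) * kernel2 (lor P P)))"
proof (rule conv_bound_2)
  show Km: "(\<lambda>P :: (real ^ 2) \<times> real. ennreal (indicator {0<..} (snd P) * kernel2 (lor P P))) \<in> borel_measurable borel"
    by (rule kernel_measurable) measurable
  fix G :: "(real ^ 2) \<times> real \<Rightarrow> ennreal" assume G [measurable]: "G \<in> borel_measurable borel"
  define K :: "(real ^ 2) \<times> real \<Rightarrow> ennreal" where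
    "K P = ennreal (indicator {0<..} (snd P) * kernel2 (lor P P))" for P
  have Kb: "K \<in> borel_measurable borel" using Km by (simp add: K_def[abs_def])
  then have [measurable]: "K \<in> borel_measurable (borel \<Otimes>\<^sub>M borel)" by (simp add: borel_prod)
  have [measurable]: "G \<in> borel_measurable (borel \<Otimes>\<^sub>M borel)" using G by (simp add: borel_prod)
  define m where "m b = sqrt (1 + b\<^sup>2)" for b :: real
  have m: "m b > 0" for b by (simp add: m_def add_pos_nonneg)
  have [measurable]: "m \<in> borel_measurable borel" unfolding m_def by measurable
  define W where "W b b' a a' = G (vec2 (a + a') (b + b'), sqrt ((m b)\<^sup>2 + a\<^sup>2) + sqrt ((m b')\<^sup>2 + a'\<^sup>2)) *
     ennreal (1 / (sqrt ((m b)\<^sup>2 + a\<^sup>2) * sqrt ((m b')\<^sup>2 + a'\<^sup>2)))" for b b' a a'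
  have "(\<integral>\<^sup>+x. \<integral>\<^sup>+y. G (pos x + pos y) \<partial>hyp_measure \<partial>hyp_measure) =
    (\<integral>\<^sup>+b. \<integral>\<^sup>+a. (\<integral>\<^sup>+y. G (pos (vec2 a b) + pos y) \<partial>hyp_measure) * ennreal (1 / sqrt ((m b)\<^sup>2 + a\<^sup>2)) \<partial>lborel \<partial>lborel)"
    unfolding m_def by (rule nn_integral_hyp_real2) measurable
  also have "\<dots> = (\<integral>\<^sup>+b. \<integral>\<^sup>+a. \<integral>\<^sup>+b'. \<integral>\<^sup>+a'. W b b' a a' \<partial>lborel \<partial>lborel \<partial>lborel \<partial>lborel)"
  proof (intro nn_integral_cong)
    fix a b :: real
    have e: "(\<integral>\<^sup>+y. G (pos (vec2 a b) + pos y) \<partial>hyp_measure) =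
      (\<integral>\<^sup>+b'. \<integral>\<^sup>+a'. G (pos (vec2 a b) + pos (vec2 a' b')) * ennreal (1 / sqrt ((m b')\<^sup>2 + a'\<^sup>2)) \<partial>lborel \<partial>lborel)"
      unfolding m_def by (rule nn_integral_hyp_real2) measurable
    have "(\<integral>\<^sup>+y. G (pos (vec2 a b) + pos y) \<partial>hyp_measure) * ennreal (1 / sqrt ((m b)\<^sup>2 + a\<^sup>2)) = (\<integral>\<^sup>+b'. \<integral>\<^sup>+a'. G (pos (vec2 a b) + pos (vec2 a' b')) * ennreal (1 / sqrt ((m b')\<^sup>2 + a'\<^sup>2)) * ennreal (1 / sqrt ((m b)\<^sup>2 + a\<^sup>2)) \<partial>lborel \<partial>lborel)"
      unfolding e by (simp add: nn_integral_multc)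
    also have "\<dots> = (\<integral>\<^sup>+b'. \<integral>\<^sup>+a'. W b b' a a' \<partial>lborel \<partial>lborel)"
    proof (intro nn_integral_cong)
      fix a' b' :: real
      have "ennreal (1 / sqrt ((m b')\<^sup>2 + a'\<^sup>2)) * ennreal (1 / sqrt ((m b)\<^sup>2 + a\<^sup>2)) = ennreal (1 / (sqrt ((m b)\<^sup>2 + a\<^sup>2) * sqrt ((m b')\<^sup>2 + a'\<^sup>2)))"
      proof -
        have "ennreal (1 / x) * ennreal (1 / y) = ennreal (1 / (y * x))" if "0 \<le> x" "0 \<le> y" for x y
        proof -
          have "1 / (y * x) = 1 / x * (1 / y)" by (simp add: mult.commute)
          then show ?thesis by (simp only: ennreal_mult divide_nonneg_nonneg zero_le_one that)
        qed
        then show ?thesis by (simp only: real_sqrt_ge_zero add_nonneg_nonneg zero_le_power2)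
      qed
      then show "G (pos (vec2 a b) + pos (vec2 a' b')) * ennreal (1 / sqrt ((m b')\<^sup>2 + a'\<^sup>2)) * ennreal (1 / sqrt ((m b)\<^sup>2 + a\<^sup>2)) = W b b' a a'"
        by (simp add: W_def pos_def vec2_add japanese_vec2 m_def mult.assoc)
    qed
    finally show "(\<integral>\<^sup>+y. G (pos (vec2 a b) + pos y) \<partial>hyp_measure) * ennreal (1 / sqrt ((m b)\<^sup>2 + a\<^sup>2)) = (\<integral>\<^sup>+b'. \<integral>\<^sup>+a'. W b b' a a' \<partial>lborel \<partial>lborel)" .
  qed
  also have "\<dots> = (\<integral>\<^sup>+b. \<integral>\<^sup>+b'. \<integral>\<^sup>+a. \<integral>\<^sup>+a'. W b b' a a' \<partial>lborel \<partial>lborel \<partial>lborel \<partial>lborel)"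
    unfolding W_def by (intro nn_integral_cong lborel_pair.Fubini') measurable
  also have "\<dots> \<le> (\<integral>\<^sup>+b. \<integral>\<^sup>+b'. \<integral>\<^sup>+\<xi>. \<integral>\<^sup>+t. G (vec2 \<xi> (b + b'), t) * ennreal (indicator {0<..} t * two_mass_kernel (m b) (m b') (t\<^sup>2 - \<xi>\<^sup>2)) \<partial>lborel \<partial>lborel \<partial>lborel \<partial>lborel)"
    unfolding W_def by (intro nn_integral_mono two_mass_convolution m) measurable
  also have "\<dots> = (\<integral>\<^sup>+b. \<integral>\<^sup>+Z. \<integral>\<^sup>+\<xi>. \<integral>\<^sup>+t. G (vec2 \<xi> Z, t) * ennreal (indicator {0<..} t * two_mass_kernel (m b) (m (Z - b)) (t\<^sup>2 - \<xi>\<^sup>2)) \<partial>lborel \<partial>lborel \<partial>lborel \<partial>lborel)"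
    (is "(\<integral>\<^sup>+b. ?L b \<partial>lborel) = (\<integral>\<^sup>+b. (\<integral>\<^sup>+Z. ?R b Z \<partial>lborel) \<partial>lborel)")
  proof (rule nn_integral_cong)
    fix b :: real
    have "?R b \<in> borel_measurable borel" by measurable
    from nn_integral_lborel_minus[OF this, of b] show "?L b = (\<integral>\<^sup>+Z. ?R b Z \<partial>lborel)"
      by (simp add: add.commute)
  qed
  also have "\<dots> = (\<integral>\<^sup>+Z. \<integral>\<^sup>+b. \<integral>\<^sup>+\<xi>. \<integral>\<^sup>+t. G (vec2 \<xi> Z, t) * ennreal (indicator {0<..} t * two_mass_kernel (m b) (m (Z - b)) (t\<^sup>2 - \<xi>\<^sup>2)) \<partial>lborel \<partial>lborel \<partial>lborel \<partial>lborel)"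
    by (rule lborel_pair.Fubini') measurable
  also have "\<dots> = (\<integral>\<^sup>+Z. \<integral>\<^sup>+\<xi>. \<integral>\<^sup>+b. \<integral>\<^sup>+t. G (vec2 \<xi> Z, t) * ennreal (indicator {0<..} t * two_mass_kernel (m b) (m (Z - b)) (t\<^sup>2 - \<xi>\<^sup>2)) \<partial>lborel \<partial>lborel \<partial>lborel \<partial>lborel)"
    by (intro nn_integral_cong lborel_pair.Fubini') measurable
  also have "\<dots> = (\<integral>\<^sup>+Z. \<integral>\<^sup>+\<xi>. \<integral>\<^sup>+t. \<integral>\<^sup>+b. G (vec2 \<xi> Z, t) * ennreal (indicator {0<..} t * two_mass_kernel (m b) (m (Z - b)) (t\<^sup>2 - \<xi>\<^sup>2)) \<partial>lborel \<partial>lborel \<partial>lborel \<partial>lborel)"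
    by (intro nn_integral_cong lborel_pair.Fubini') measurable
  also have "\<dots> \<le> (\<integral>\<^sup>+Z. \<integral>\<^sup>+\<xi>. \<integral>\<^sup>+t. G (vec2 \<xi> Z, t) * K (vec2 \<xi> Z, t) \<partial>lborel \<partial>lborel \<partial>lborel)"
  proof (intro nn_integral_mono)
    fix Z \<xi> t :: real
    have "(\<integral>\<^sup>+b. G (vec2 \<xi> Z, t) * ennreal (indicator {0<..} t * two_mass_kernel (m b) (m (Z - b)) (t\<^sup>2 - \<xi>\<^sup>2)) \<partial>lborel) =
       G (vec2 \<xi> Z, t) * (\<integral>\<^sup>+b. ennreal (indicator {0<..} t * two_mass_kernel (m b) (m (Z - b)) (t\<^sup>2 - \<xi>\<^sup>2)) \<partial>lborel)"
      by (rule nn_integral_cmult) measurable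
    also have "\<dots> \<le> G (vec2 \<xi> Z, t) * K (vec2 \<xi> Z, t)"
    proof (intro mult_left_mono)
      show "(\<integral>\<^sup>+b. ennreal (indicator {0<..} t * two_mass_kernel (m b) (m (Z - b)) (t\<^sup>2 - \<xi>\<^sup>2)) \<partial>lborel) \<le> K (vec2 \<xi> Z, t)"
      proof -
        have "lor (vec2 \<xi> Z, t) (vec2 \<xi> Z, t) = t\<^sup>2 - \<xi>\<^sup>2 - Z\<^sup>2" by (simp add: lor_real2 power2_eq_square)
        then have "K (vec2 \<xi> Z, t) = ennreal (indicator {0<..} t * (if t\<^sup>2 - \<xi>\<^sup>2 - Z\<^sup>2 > 4 then 2 * pi / sqrt (t\<^sup>2 - \<xi>\<^sup>2 - Z\<^sup>2) else 0))"
          by (simp only: K_def kernel2_def snd_conv)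
        then show ?thesis
          using two_mass_kernel_real2_le[of Z "t\<^sup>2 - \<xi>\<^sup>2"] by (cases "t > 0") (simp_all add: m_def)
      qed
    qed simp
    finally show "(\<integral>\<^sup>+b. G (vec2 \<xi> Z, t) * ennreal (indicator {0<..} t * two_mass_kernel (m b) (m (Z - b)) (t\<^sup>2 - \<xi>\<^sup>2)) \<partial>lborel) \<le> G (vec2 \<xi> Z, t) * K (vec2 \<xi> Z, t)" .
  qed
  also have "\<dots> = (\<integral>\<^sup>+x. \<integral>\<^sup>+t. G (x, t) * K (x, t) \<partial>lborel \<partial>lborel)"
    by (rule nn_integral_real2[where f="\<lambda>x. \<integral>\<^sup>+t. G (x, t) * K (x, t) \<partial>lborel", symmetric]) measurable
  also have "\<dots> = (\<integral>\<^sup>+P. G P * K P \<partial>lborel)"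
    by (rule nn_integral_lborel_pair[symmetric]) (use G Kb in simp)
  also have "\<dots> = (\<integral>\<^sup>+P. G P * ennreal (indicator {0<..} (snd P) * kernel2 (lor P P)) \<partial>lborel)"
    by (simp only: K_def)
  finally show "(\<integral>\<^sup>+a. \<integral>\<^sup>+b. G (pos a + pos b) \<partial>hyp_measure \<partial>hyp_measure) \<le> \<dots>" .
qed

text \<open>Already two factors decay in dimension two, so that exponent 4 can serve as the lower
  exponent for every \<open>p\<close> above 4.\<close>

lemma conv_bound_real2_decay:
  "conv_bound 2 (\<lambda>P :: (real ^ 2) \<times> real. ennreal (2 * pi * max 1 (lor P P) powr - (1/2)))"
proof (rule conv_bound_mono[OF conv_bound_2_real2])
  show "(\<lambda>P :: (real ^ 2) \<times> real. ennreal (2 * pi * max 1 (lor P P) powr - (1/2))) \<in> borel_measurable borel"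
    by measurable
  fix P :: "(real ^ 2) \<times> real"
  show "ennreal (indicator {0<..} (snd P) * kernel2 (lor P P)) \<le> ennreal (2 * pi * max 1 (lor P P) powr - (1/2))"
  proof (rule ennreal_leI, cases "4 < lor P P")
    case True
    have "s powr - (1/2) = 1 / sqrt s" if "4 < s" for s
      using that by (simp add: powr_minus powr_half_sqrt inverse_eq_divide)
    then show "indicator {0<..} (snd P) * kernel2 (lor P P) \<le> 2 * pi * max 1 (lor P P) powr - (1/2)"
      using True by (simp add: kernel2_def indicator_def max_def)
  next
    case False
    then show "indicator {0<..} (snd P) * kernel2 (lor P P) \<le> 2 * pi * max 1 (lor P P) powr - (1/2)"
      by (simp add: kernel2_def)
  qed
qed

text \<open>For a fixed second component y of the new point the integral over rapidities is at most
  a constant over sqrt (\<tau> |y|), and y is confined to |y| \<le> \<tau>. Integrating the inverse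
  square root gives 4 sqrt \<tau>, so the dependence on \<open>P\<close> cancels.\<close>

lemma conv_bound_3_real2:
  "conv_bound 3 (\<lambda>P :: (real ^ 2) \<times> real. ennreal (8 * pi\<^sup>2))"
proof -
  have "conv_bound (Suc 2) (\<lambda>P :: (real ^ 2) \<times> real. ennreal (8 * pi\<^sup>2))"
  proof (rule conv_bound_Suc[OF conv_bound_2_real2])
    fix P :: "(real ^ 2) \<times> real"
    let ?h = "\<lambda>b. ennreal (indicator {0<..} (snd (P - pos b)) * kernel2 (lor (P - pos b) (P - pos b)))"
    have hm: "?h \<in> borel_measurable borel"
      using measurable_compose[OF _ kernel_measurable[OF kernel2_measurable], of "\<lambda>b. P - pos b" borel] by measurable
    define \<xi> Z t where "\<xi> = fst P $ 1" and "Z = fst P $ 2" and "t = snd P"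
    have P: "P = (vec2 \<xi> Z, t)" by (simp add: \<xi>_def Z_def t_def prod_eq_iff vec_eq_iff forall_2)
    show "(\<integral>\<^sup>+b. ?h b \<partial>hyp_measure) \<le> ennreal (8 * pi\<^sup>2)"
    proof (cases "0 < snd P \<and> 1 \<le> lor P P")
      case False
      have "?h b = 0" for b
        using timelike_plus_pos(1,2)[of P b] False
        by (cases "lor (P - pos b) (P - pos b) < 0") (auto simp: indicator_def kernel2_def)
      then show ?thesis by simp
    next
      case True
      have t: "0 < t" "\<xi>\<^sup>2 < t\<^sup>2"
      proof -
        have "lor P P = t\<^sup>2 - \<xi>\<^sup>2 - Z\<^sup>2" by (simp add: P lor_real2 power2_eq_square)
        then show "\<xi>\<^sup>2 < t\<^sup>2" using True zero_le_power2[of Z] by linarith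
      qed (use True in \<open>simp add: t_def\<close>)
      \<comment> \<open>The invariant mass of the first component and the energy alone; the second
        component \<open>Z\<close> is not subtracted.\<close>
      define \<tau> where "\<tau> = sqrt (t\<^sup>2 - \<xi>\<^sup>2)"
      have \<tau>: "\<tau> > 0" "\<tau>\<^sup>2 = t\<^sup>2 - \<xi>\<^sup>2" using t by (simp_all add: \<tau>_def)
      obtain w where w: "\<xi> = \<tau> * sinh w" "t = \<tau> * cosh w"
        using rapidity_coords[OF t] unfolding \<tau>_def by blast
      define m where "m y = sqrt (1 + y\<^sup>2)" for y :: real
      have m: "m y > 0" "(m y)\<^sup>2 = 1 + y\<^sup>2" for y by (simp_all add: m_def add_pos_nonneg)
      have inner: "(\<integral>\<^sup>+x. ?h (vec2 x y) * ennreal (1 / sqrt ((m y)\<^sup>2 + x\<^sup>2)) \<partial>lborel) \<le>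
         ennreal (2 * pi\<^sup>2 / sqrt \<tau>) * (ennreal (1 / sqrt \<bar>y\<bar>) * indicator {- \<tau>..\<tau>} y)" if y: "y \<noteq> 0" for y
      proof -
        \<comment> \<open>Chosen so that the Lorentz square of \<open>P - pos b\<close> becomes 2 m
          y \<tau> (A - cosh u).\<close>
        define A where "A = (\<tau>\<^sup>2 - Z\<^sup>2 + 1 + 2 * Z * y) / (2 * m y * \<tau>)"
        have "(\<integral>\<^sup>+x. ?h (vec2 x y) * ennreal (1 / sqrt ((m y)\<^sup>2 + x\<^sup>2)) \<partial>lborel) \<le> (\<integral>\<^sup>+u. ?h (vec2 (m y * sinh (u + w)) y) \<partial>lborel)"
          by (rule nn_integral_rapidity_le[where h="\<lambda>x. ?h (vec2 x y)"])
            (use measurable_compose[OF borel_measurable_vec2[OF measurable_ident measurable_const] hm] m in \<open>simp_all add: id_def\<close>)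
        also have "\<dots> \<le> (\<integral>\<^sup>+u. ennreal (2 * pi / sqrt (2 * m y * \<tau>)) * indicator {- \<tau>..\<tau>} y * (ennreal (1 / sqrt (A - cosh u)) * indicator {u. cosh u < A} u) \<partial>lborel)"
        proof (rule nn_integral_mono)
          fix u :: real
          let ?a = "m y * sinh (u + w)" and ?E = "m y * cosh (u + w)"
          let ?b = "vec2 ?a y"
          have "?E\<^sup>2 = (m y)\<^sup>2 + ?a\<^sup>2" by (simp add: power_mult_distrib cosh_square_eq algebra_simps)
          then have j: "japanese ?b = ?E" using m(1)[of y] by (simp add: japanese_vec2 m_def[symmetric] real_sqrt_unique)
          have E2: "?E\<^sup>2 = (m y)\<^sup>2 + ?a\<^sup>2" by fact
          have "lor P (pos ?b) = m y * \<tau> * (cosh w * cosh (u + w) - sinh w * sinh (u + w)) - Z * y"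
            unfolding P pos_def j lor_real2 by (subst w(1), subst w(2)) (simp add: algebra_simps)
          also have "cosh w * cosh (u + w) - sinh w * sinh (u + w) = cosh u"
            using cosh_diff[of "u + w" w] by (simp add: mult.commute)
          finally have l: "lor P (pos ?b) = m y * \<tau> * cosh u - Z * y" .
          let ?S = "lor (P - pos ?b) (P - pos ?b)"
          have "?S = lor P P + 1 - 2 * lor P (pos ?b)"
            by (simp add: lor_bilinear lor_pos_self lor_commute[of "pos ?b" P])
          also have "lor P P = \<tau>\<^sup>2 - Z\<^sup>2" unfolding \<tau>(2) P lor_real2 by (simp add: power2_eq_square)
          finally have S0: "?S = \<tau>\<^sup>2 - Z\<^sup>2 + 1 - 2 * lor P (pos ?b)" .
          have S: "?S = 2 * m y * \<tau> * (A - cosh u)"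
          proof -
            have "2 * m y * \<tau> * A = \<tau>\<^sup>2 - Z\<^sup>2 + 1 + 2 * Z * y"
              using m(1)[of y] \<tau>(1) by (simp add: A_def)
            moreover have "2 * m y * \<tau> * (A - cosh u) = 2 * m y * \<tau> * A - 2 * m y * \<tau> * cosh u"
              by (rule right_diff_distrib)
            ultimately show ?thesis using S0 unfolding l by (simp add: algebra_simps)
          qed
          show "?h ?b \<le> ennreal (2 * pi / sqrt (2 * m y * \<tau>)) * indicator {- \<tau>..\<tau>} y * (ennreal (1 / sqrt (A - cosh u)) * indicator {u. cosh u < A} u)"
          proof (cases "snd (P - pos ?b) > 0 \<and> ?S > 4")
            case T: True
            then have "?S > 4" by blast
            then have "?S > 0" by linarith
            then have "2 * m y * \<tau> * (A - cosh u) > 0" by (simp only: S)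
            then have Apos: "A - cosh u > 0" by (rule zero_less_mult_pos) (use m(1)[of y] \<tau>(1) in simp)
            have fw: "t - ?E > 0" using T by (simp add: P pos_def j)
            have "?S = (t - ?E)\<^sup>2 - (\<xi> - ?a)\<^sup>2 - (Z - y)\<^sup>2"
            proof -
              have "P - pos ?b = (vec2 (\<xi> - ?a) (Z - y), t - ?E)"
                by (simp add: P pos_def j vec_eq_iff forall_2)
              then show ?thesis by (simp add: lor_real2 power2_eq_square)
            qed
            then have Q: "(\<xi> - ?a)\<^sup>2 \<le> (t - ?E)\<^sup>2" using T zero_le_power2[of "Z - y"] by linarith
            then have "\<bar>\<xi> - ?a\<bar> \<le> t - ?E" using fw abs_le_square_iff[of "\<xi> - ?a" "t - ?E"] by simp
            moreover have "\<bar>?a\<bar> \<le> ?E"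
            proof -
              have "?a\<^sup>2 \<le> ?E\<^sup>2" using E2 by simp
              then show ?thesis using abs_le_square_iff[of ?a ?E] m(1)[of y] by simp
            qed
            ultimately have "\<bar>\<xi> - ?a\<bar> * \<bar>?a\<bar> \<le> (t - ?E) * ?E" by (intro mult_mono) auto
            then have dot: "(\<xi> - ?a) * ?a \<le> (t - ?E) * ?E" by (simp add: abs_mult[symmetric])
            \<comment> \<open>Reversed triangle inequality in the plane of the first component and
              time: \<tau>^2 is the squared mass of the difference, plus that of the new point, plus
              twice their nonnegative product. Hence m y \<le> \<tau>, which confines y.\<close>
            have eq: "\<tau>\<^sup>2 = ((t - ?E)\<^sup>2 - (\<xi> - ?a)\<^sup>2) + (?E\<^sup>2 - ?a\<^sup>2) + 2 * ((t - ?E) * ?E - (\<xi> - ?a) * ?a)"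
              unfolding \<tau>(2) by (simp add: power2_eq_square algebra_simps)
            have "a \<le> x + a + 2 * d" if "0 \<le> x" "0 \<le> d" for a x d :: real using that by simp
            moreover have "?E\<^sup>2 - ?a\<^sup>2 = (m y)\<^sup>2" using E2 by simp
            ultimately have "(m y)\<^sup>2 \<le> \<tau>\<^sup>2" unfolding eq using Q dot by (simp only: diff_ge_0_iff_ge)
            then have "y\<^sup>2 \<le> \<tau>\<^sup>2" using m(2)[of y] by simp
            then have "\<bar>y\<bar> \<le> \<tau>" using \<tau>(1) abs_le_square_iff[of y \<tau>] by simp
            then have yi: "y \<in> {- \<tau>..\<tau>}" by auto
            have "kernel2 ?S = 2 * pi / sqrt (2 * m y * \<tau>) * (1 / sqrt (A - cosh u))"
              using T unfolding kernel2_def by (simp only: if_True S real_sqrt_mult) simp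
            then have "ennreal (kernel2 ?S) = ennreal (2 * pi / sqrt (2 * m y * \<tau>)) * ennreal (1 / sqrt (A - cosh u))"
              using m(1)[of y] \<tau>(1) Apos by (subst ennreal_mult[symmetric]) auto
            then show ?thesis using T yi Apos by (simp add: indicator_def)
          next
            case F: False
            then have "?h ?b = 0" by (auto simp: kernel2_def indicator_def)
            then show ?thesis by simp
          qed
        qed
        also have "\<dots> = ennreal (2 * pi / sqrt (2 * m y * \<tau>)) * indicator {- \<tau>..\<tau>} y * (\<integral>\<^sup>+u. ennreal (1 / sqrt (A - cosh u)) * indicator {u. cosh u < A} u \<partial>lborel)"
          by (rule nn_integral_cmult) measurable
        also have "\<dots> \<le> ennreal (2 * pi / sqrt (2 * m y * \<tau>)) * indicator {- \<tau>..\<tau>} y * ennreal (sqrt 2 * pi)"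
          by (intro mult_left_mono nn_integral_cosh_le) simp
        also have "\<dots> = ennreal (2 * pi / sqrt (2 * m y * \<tau>) * (sqrt 2 * pi)) * indicator {- \<tau>..\<tau>} y"
          using m(1)[of y] \<tau>(1) by (subst ennreal_mult) (auto simp: mult_ac)
        also have "\<dots> \<le> ennreal (2 * pi\<^sup>2 / sqrt \<tau> * (1 / sqrt \<bar>y\<bar>)) * indicator {- \<tau>..\<tau>} y"
        proof (intro mult_right_mono ennreal_leI)
          have "2 * pi / sqrt (2 * m y * \<tau>) * (sqrt 2 * pi) = 2 * pi\<^sup>2 / sqrt \<tau> * (1 / sqrt (m y))"
            by (simp add: real_sqrt_mult power2_eq_square)
          also have "\<dots> \<le> 2 * pi\<^sup>2 / sqrt \<tau> * (1 / sqrt \<bar>y\<bar>)"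
          proof (intro mult_left_mono divide_left_mono)
            have "\<bar>y\<bar> \<le> m y" unfolding m_def by (rule real_le_rsqrt) simp
            then show "sqrt \<bar>y\<bar> \<le> sqrt (m y)" by simp
            show "0 < sqrt (m y) * sqrt \<bar>y\<bar>" using y m(1)[of y] by simp
          qed (use \<tau> in auto)
          finally show "2 * pi / sqrt (2 * m y * \<tau>) * (sqrt 2 * pi) \<le> 2 * pi\<^sup>2 / sqrt \<tau> * (1 / sqrt \<bar>y\<bar>)" .
        qed simp
        also have "\<dots> = ennreal (2 * pi\<^sup>2 / sqrt \<tau>) * (ennreal (1 / sqrt \<bar>y\<bar>) * indicator {- \<tau>..\<tau>} y)"
          using \<tau>(1) by (subst ennreal_mult) (auto simp: mult.assoc)
        finally show ?thesis .
      qed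
      have "(\<integral>\<^sup>+b. ?h b \<partial>hyp_measure) = (\<integral>\<^sup>+y. \<integral>\<^sup>+x. ?h (vec2 x y) * ennreal (1 / sqrt ((m y)\<^sup>2 + x\<^sup>2)) \<partial>lborel \<partial>lborel)"
        unfolding m_def by (rule nn_integral_hyp_real2[OF hm])
      \<comment> \<open>At y = 0 the weight 1 / sqrt |y| is 0 by the convention for division, so the
        inner bound is claimed for y different from 0 and used almost everywhere.\<close>
      also have "\<dots> \<le> (\<integral>\<^sup>+y. ennreal (2 * pi\<^sup>2 / sqrt \<tau>) * (ennreal (1 / sqrt \<bar>y\<bar>) * indicator {- \<tau>..\<tau>} y) \<partial>lborel)"
        by (intro nn_integral_mono_AE) (use AE_lborel_singleton[of "0::real"] inner in \<open>auto elim!: eventually_mono\<close>)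
      also have "\<dots> = ennreal (2 * pi\<^sup>2 / sqrt \<tau>) * (\<integral>\<^sup>+y. ennreal (1 / sqrt \<bar>y\<bar>) * indicator {- \<tau>..\<tau>} y \<partial>lborel)"
        by (rule nn_integral_cmult) measurable
      also have "\<dots> \<le> ennreal (2 * pi\<^sup>2 / sqrt \<tau>) * ennreal (4 * sqrt \<tau>)"
        by (intro mult_left_mono nn_integral_inv_sqrt_le \<tau>) simp
      also have "\<dots> = ennreal (2 * pi\<^sup>2 / sqrt \<tau> * (4 * sqrt \<tau>))" using \<tau>(1) by (intro ennreal_mult[symmetric]) auto
      also have "2 * pi\<^sup>2 / sqrt \<tau> * (4 * sqrt \<tau>) = 8 * pi\<^sup>2" using \<tau>(1) by simp
      finally show ?thesis .
    qed
  qed simp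
  then show ?thesis by (simp add: numeral_3_eq_3 numeral_2_eq_2)
qed

section \<open>Lorentz boosts\<close>

text \<open>A pair of actions: \<open>\<Lambda>\<close> on the parameters of the hyperboloid and
  \<open>L\<close> on space-time, tied by duality of the phase, so that composing \<open>f\<close>
  with \<open>\<Lambda>\<close> composes its extension with \<open>L\<close>. Preservation of both
  measures makes all norms invariant.\<close>

definition lorentz :: "('a::euclidean_space \<Rightarrow> 'a) \<Rightarrow> ('a \<times> real \<Rightarrow> 'a \<times> real) \<Rightarrow> bool" where
  "lorentz \<Lambda> L \<longleftrightarrow>
     \<Lambda> \<in> borel_measurable borel \<and> distr hyp_measure borel \<Lambda> = hyp_measure \<and>
     L \<in> borel_measurable borel \<and> distr lborel borel L = lborel \<and>
     (\<forall>z y. L z \<bullet> pos (\<Lambda> y) = z \<bullet> pos y) \<and>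
     (\<forall>a b. lor (pos (\<Lambda> a)) (pos (\<Lambda> b)) = lor (pos a) (pos b))"

text \<open>The hyperbolic rotation by rapidity \<open>r\<close> in the plane spanned by
  \<open>b\<close> and the time axis. It is symmetric for the Euclidean inner product, so its dual
  action on space-time is the inverse boost.\<close>

definition boost :: "'a::euclidean_space \<Rightarrow> real \<Rightarrow> 'a \<times> real \<Rightarrow> 'a \<times> real" where
  "boost b r P = (fst P + ((cosh r - 1) * (fst P \<bullet> b) + sinh r * snd P) *\<^sub>R b,
     cosh r * snd P + sinh r * (fst P \<bullet> b))"

lemma boost_inner: "boost b r P \<bullet> Q = P \<bullet> boost b r Q"
  by (simp add: boost_def inner_prod_def inner_add_left inner_add_right algebra_simps inner_commute)

lemma boost_scaleR: "boost b r (c *\<^sub>R P) = c *\<^sub>R boost b r P"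
  by (simp add: boost_def scaleR_add_right algebra_simps)

context
  fixes b :: "'a::euclidean_space"
  assumes b: "b \<in> Basis"
begin

lemma fst_boost_inner: "fst (boost b r P) \<bullet> b = cosh r * (fst P \<bullet> b) + sinh r * snd P"
  using b by (simp add: boost_def inner_add_left algebra_simps)

lemma boost_boost_minus: "boost b (- r) (boost b r P) = P"
proof (rule prod_eqI)
  have c: "cosh r * cosh r = 1 + sinh r * sinh r"
    using cosh_square_eq[of r] by (simp add: power2_eq_square)
  show "snd (boost b (- r) (boost b r P)) = snd P"
  proof -
    have "cosh r * (cosh r * snd P + sinh r * (fst P \<bullet> b)) - sinh r * (cosh r * (fst P \<bullet> b) + sinh r * snd P) =
        (cosh r * cosh r - sinh r * sinh r) * snd P" by (simp add: algebra_simps)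
    then show ?thesis using c by (simp add: boost_def[of b "- r"] fst_boost_inner) (simp add: boost_def)
  qed
  have "(cosh r - 1) * (cosh r * (fst P \<bullet> b) + sinh r * snd P) - sinh r * (cosh r * snd P + sinh r * (fst P \<bullet> b)) =
     - ((cosh r - 1) * (fst P \<bullet> b) + sinh r * snd P)"
  proof -
    have "(cosh r - 1) * (cosh r * (fst P \<bullet> b) + sinh r * snd P) - sinh r * (cosh r * snd P + sinh r * (fst P \<bullet> b)) =
        (cosh r * cosh r - sinh r * sinh r) * (fst P \<bullet> b) - cosh r * (fst P \<bullet> b) - sinh r * snd P"
      by (simp add: algebra_simps)
    then show ?thesis using c by (simp add: algebra_simps)
  qed
  then have "(cosh r - 1) * (fst (boost b r P) \<bullet> b) - sinh r * snd (boost b r P) = - ((cosh r - 1) * (fst P \<bullet> b) + sinh r * snd P)"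
    by (simp only: fst_boost_inner) (simp add: boost_def)
  then have "fst (boost b (- r) (boost b r P)) = fst (boost b r P) + (- ((cosh r - 1) * (fst P \<bullet> b) + sinh r * snd P)) *\<^sub>R b"
    by (simp add: boost_def[of b "- r"])
  also have "\<dots> = fst P" by (simp only: boost_def fst_conv scaleR_minus_left) simp
  finally show "fst (boost b (- r) (boost b r P)) = fst P" .
qed

lemma lor_boost: "lor (boost b r P) (boost b r Q) = lor P Q"
proof -
  have c: "cosh r * cosh r = 1 + sinh r * sinh r"
    using cosh_square_eq[of r] by (simp add: power2_eq_square)
  have bb: "b \<bullet> b = 1" using b by simp
  define p q where "p = fst P \<bullet> b" and "q = fst Q \<bullet> b"
  define A B where "A = (cosh r - 1) * p + sinh r * snd P" and "B = (cosh r - 1) * q + sinh r * snd Q"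
  have "fst (boost b r P) \<bullet> fst (boost b r Q) = fst P \<bullet> fst Q + (B * p + A * q + A * B)"
    using bb by (simp add: boost_def A_def[symmetric] B_def[symmetric] p_def[symmetric] q_def[symmetric] inner_add_left inner_add_right inner_commute[of b "fst Q"])
      (simp add: algebra_simps)
  also have "B * p + A * q + A * B = (cosh r * p + sinh r * snd P) * (cosh r * q + sinh r * snd Q) - p * q"
    by (simp add: A_def B_def algebra_simps)
  finally have "fst (boost b r P) \<bullet> fst (boost b r Q) = fst P \<bullet> fst Q + ((cosh r * p + sinh r * snd P) * (cosh r * q + sinh r * snd Q) - p * q)"
    by (simp add: algebra_simps)
  moreover have "snd (boost b r P) * snd (boost b r Q) = (cosh r * snd P + sinh r * p) * (cosh r * snd Q + sinh r * q)"
    by (simp add: boost_def p_def q_def)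
  moreover have "(cosh r * snd P + sinh r * p) * (cosh r * snd Q + sinh r * q) - (cosh r * p + sinh r * snd P) * (cosh r * q + sinh r * snd Q)
     = snd P * snd Q - p * q"
  proof -
    have "(cosh r * snd P + sinh r * p) * (cosh r * snd Q + sinh r * q) - (cosh r * p + sinh r * snd P) * (cosh r * q + sinh r * snd Q)
      = (cosh r * cosh r - sinh r * sinh r) * (snd P * snd Q - p * q)" by (simp add: algebra_simps)
    then show ?thesis using c by simp
  qed
  ultimately show ?thesis unfolding lor_def by linarith
qed

lemma snd_boost_pos:
  assumes "norm (fst P) < snd P"
  shows "0 < snd (boost b r P)"
proof -
  have "\<bar>fst P \<bullet> b\<bar> \<le> norm (fst P)" using Basis_le_norm[OF b] by simp
  then have "\<bar>fst P \<bullet> b\<bar> < snd P" using assms by linarith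
  moreover have "\<bar>sinh r\<bar> < cosh r"
  proof -
    have "\<bar>sinh r\<bar>\<^sup>2 < (cosh r)\<^sup>2" by (simp add: cosh_square_eq)
    then show ?thesis by (rule power2_less_imp_less) simp
  qed
  ultimately have "\<bar>sinh r\<bar> * \<bar>fst P \<bullet> b\<bar> < cosh r * snd P" by (intro mult_strict_mono') auto
  moreover have "- (\<bar>sinh r\<bar> * \<bar>fst P \<bullet> b\<bar>) \<le> sinh r * (fst P \<bullet> b)"
    using abs_ge_minus_self[of "sinh r * (fst P \<bullet> b)"] by (simp add: abs_mult)
  ultimately show ?thesis unfolding boost_def snd_conv by linarith
qed

text \<open>The hyperboloid consists of the vectors with Lorentz square 1 and positive time, and a
  boost preserves both conditions.\<close>

lemma boost_pos: "boost b r (pos y) = pos (fst (boost b r (pos y)))"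
proof -
  let ?Q = "boost b r (pos y)"
  have "lor ?Q ?Q = 1" by (simp add: lor_boost lor_pos_self)
  then have "(snd ?Q)\<^sup>2 = 1 + (norm (fst ?Q))\<^sup>2" unfolding power2_norm_eq_inner by (simp add: lor_def power2_eq_square)
  moreover have "snd ?Q > 0" by (rule snd_boost_pos) (simp add: pos_def norm_less_japanese)
  ultimately have "snd ?Q = japanese (fst ?Q)" unfolding japanese_def by (intro real_sqrt_unique[symmetric]) auto
  then show ?thesis by (simp add: pos_def prod_eq_iff)
qed

lemma boost_measurable: "boost b r \<in> borel_measurable borel"
  unfolding boost_def by (intro borel_measurable_continuous_onI continuous_intros)

text \<open>A hyperbolic rotation is a product of three shears with parameters tanh (r/2), sinh r,
  tanh (r/2). Each shear is a translation in one variable for fixed values of the other, so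
  invariance of Lebesgue measure follows from translation invariance.\<close>

lemma boost_shears:
  "boost b r P = (\<lambda>P. (fst P + (tanh (r / 2) * snd P) *\<^sub>R b, snd P))
     ((\<lambda>P. (fst P, snd P + sinh r * (fst P \<bullet> b))) ((fst P + (tanh (r / 2) * snd P) *\<^sub>R b, snd P)))"
proof -
  let ?a = "tanh (r / 2)"
  have ch: "cosh (r/2) \<noteq> 0" by (metis cosh_real_pos less_irrefl)
  have s: "sinh r = 2 * sinh (r/2) * cosh (r/2)" using sinh_double[of "r/2"] by simp
  have c: "cosh r = 1 + 2 * (sinh (r/2))\<^sup>2" using cosh_double[of "r/2"] cosh_square_eq[of "r/2"] by simp
  have c': "(cosh (r/2))\<^sup>2 = 1 + (sinh (r/2))\<^sup>2" using cosh_square_eq[of "r/2"] by simp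
  have 1: "?a * sinh r = cosh r - 1" using ch by (simp add: tanh_def s c power2_eq_square)
  have "?a * (cosh r + 1) = sinh r"
  proof -
    have "cosh r + 1 = 2 * (cosh (r/2))\<^sup>2" using c c' by simp
    then show ?thesis using ch by (simp add: tanh_def s power2_eq_square)
  qed
  then have 2: "?a + ?a * cosh r = sinh r" by (simp add: algebra_simps)
  have "snd P + sinh r * ((fst P + (?a * snd P) *\<^sub>R b) \<bullet> b) = snd P * (1 + ?a * sinh r) + sinh r * (fst P \<bullet> b)"
    using b by (simp add: inner_add_left algebra_simps)
  also have "\<dots> = cosh r * snd P + sinh r * (fst P \<bullet> b)" by (simp add: 1)
  finally have A: "snd P + sinh r * ((fst P + (?a * snd P) *\<^sub>R b) \<bullet> b) = cosh r * snd P + sinh r * (fst P \<bullet> b)" .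
  have "?a * snd P + ?a * (cosh r * snd P + sinh r * (fst P \<bullet> b)) = (?a + ?a * cosh r) * snd P + (?a * sinh r) * (fst P \<bullet> b)"
    by (simp add: algebra_simps)
  also have "\<dots> = (cosh r - 1) * (fst P \<bullet> b) + sinh r * snd P" by (simp only: 1 2)
  finally have B: "?a * snd P + ?a * (cosh r * snd P + sinh r * (fst P \<bullet> b)) = (cosh r - 1) * (fst P \<bullet> b) + sinh r * snd P" .
  show ?thesis
    by (simp only: fst_conv snd_conv A boost_def B[symmetric] scaleR_add_left add.assoc)
qed

section \<open>Invariance of Lebesgue measure and of the hyperboloid measure\<close>

lemma nn_integral_shear_fst:
  fixes h :: "'a \<times> real \<Rightarrow> ennreal"
  assumes h: "h \<in> borel_measurable borel"
  shows "(\<integral>\<^sup>+P. h (fst P + (a * snd P) *\<^sub>R b, snd P) \<partial>lborel) = (\<integral>\<^sup>+P. h P \<partial>lborel)"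
proof -
  have [measurable]: "h \<in> borel_measurable (borel \<Otimes>\<^sub>M borel)" using h by (simp add: borel_prod)
  have m: "(\<lambda>P. h (fst P + (a * snd P) *\<^sub>R b, snd P)) \<in> borel_measurable borel"
    unfolding borel_prod[symmetric] by measurable
  have "(\<integral>\<^sup>+P. h (fst P + (a * snd P) *\<^sub>R b, snd P) \<partial>lborel) = (\<integral>\<^sup>+x. \<integral>\<^sup>+t. h (x + (a * t) *\<^sub>R b, t) \<partial>lborel \<partial>lborel)"
    by (subst nn_integral_lborel_pair[OF m]) simp
  also have "\<dots> = (\<integral>\<^sup>+t. \<integral>\<^sup>+x. h (x + (a * t) *\<^sub>R b, t) \<partial>lborel \<partial>lborel)"
    by (rule lborel_pair.Fubini'[symmetric]) measurable
  also have "\<dots> = (\<integral>\<^sup>+t. \<integral>\<^sup>+x. h (x, t) \<partial>lborel \<partial>lborel)"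
  proof (rule nn_integral_cong)
    fix t :: real
    have "(\<lambda>x. h (x, t)) \<in> borel_measurable borel" by measurable
    from nn_integral_lborel_minus[OF this] show "(\<integral>\<^sup>+x. h (x + (a * t) *\<^sub>R b, t) \<partial>lborel) = (\<integral>\<^sup>+x. h (x, t) \<partial>lborel)" .
  qed
  also have "\<dots> = (\<integral>\<^sup>+x. \<integral>\<^sup>+t. h (x, t) \<partial>lborel \<partial>lborel)"
    by (rule lborel_pair.Fubini') measurable
  also have "\<dots> = (\<integral>\<^sup>+P. h P \<partial>lborel)" by (rule nn_integral_lborel_pair[OF h, symmetric])
  finally show ?thesis .
qed

lemma nn_integral_shear_snd:
  fixes h :: "'a \<times> real \<Rightarrow> ennreal"
  assumes h: "h \<in> borel_measurable borel"
  shows "(\<integral>\<^sup>+P. h (fst P, snd P + c * (fst P \<bullet> b)) \<partial>lborel) = (\<integral>\<^sup>+P. h P \<partial>lborel)"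
proof -
  have [measurable]: "h \<in> borel_measurable (borel \<Otimes>\<^sub>M borel)" using h by (simp add: borel_prod)
  have m: "(\<lambda>P. h (fst P, snd P + c * (fst P \<bullet> b))) \<in> borel_measurable borel"
    unfolding borel_prod[symmetric] by measurable
  have "(\<integral>\<^sup>+P. h (fst P, snd P + c * (fst P \<bullet> b)) \<partial>lborel) = (\<integral>\<^sup>+x. \<integral>\<^sup>+t. h (x, t + c * (x \<bullet> b)) \<partial>lborel \<partial>lborel)"
    by (subst nn_integral_lborel_pair[OF m]) simp
  also have "\<dots> = (\<integral>\<^sup>+x. \<integral>\<^sup>+t. h (x, t) \<partial>lborel \<partial>lborel)"
  proof (rule nn_integral_cong)
    fix x :: 'a
    have "(\<lambda>t. h (x, t)) \<in> borel_measurable borel" by measurable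
    from nn_integral_lborel_minus[OF this] show "(\<integral>\<^sup>+t. h (x, t + c * (x \<bullet> b)) \<partial>lborel) = (\<integral>\<^sup>+t. h (x, t) \<partial>lborel)" .
  qed
  also have "\<dots> = (\<integral>\<^sup>+P. h P \<partial>lborel)" by (rule nn_integral_lborel_pair[OF h, symmetric])
  finally show ?thesis .
qed

lemma nn_integral_boost:
  fixes h :: "'a \<times> real \<Rightarrow> ennreal"
  assumes h: "h \<in> borel_measurable borel"
  shows "(\<integral>\<^sup>+P. h (boost b r P) \<partial>lborel) = (\<integral>\<^sup>+P. h P \<partial>lborel)"
proof -
  let ?S = "\<lambda>P :: 'a \<times> real. (fst P + (tanh (r / 2) * snd P) *\<^sub>R b, snd P)"
  let ?R = "\<lambda>P :: 'a \<times> real. (fst P, snd P + sinh r * (fst P \<bullet> b))"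
  have S: "?S \<in> borel_measurable borel" and R: "?R \<in> borel_measurable borel"
    by (intro borel_measurable_continuous_onI continuous_intros)+
  have hS: "(\<lambda>P. h (?S P)) \<in> borel_measurable borel" using measurable_compose[OF S h] .
  have hSR: "(\<lambda>P. h (?S (?R P))) \<in> borel_measurable borel" using measurable_compose[OF R hS] .
  have "(\<integral>\<^sup>+P. h (boost b r P) \<partial>lborel) = (\<integral>\<^sup>+P. h (?S (?R (?S P))) \<partial>lborel)"
    unfolding boost_shears by simp
  also have "\<dots> = (\<integral>\<^sup>+P. h (?S (?R P)) \<partial>lborel)" by (rule nn_integral_shear_fst[OF hSR])
  also have "\<dots> = (\<integral>\<^sup>+P. h (?S P) \<partial>lborel)" by (rule nn_integral_shear_snd[OF hS])
  also have "\<dots> = (\<integral>\<^sup>+P. h P \<partial>lborel)" by (rule nn_integral_shear_fst[OF h])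
  finally show ?thesis .
qed

end

text \<open>Polar coordinates in the forward cone: \<open>\<sigma>\<close> is the surface measure of the shells
  \<open>{P. lor P P = l\<^sup>2}\<close> up to the factor \<open>l ^ DIM('a)\<close>.\<close>

lemma nn_integral_cone:
  fixes h :: "'a::euclidean_space \<Rightarrow> ennreal"
  assumes [measurable]: "h \<in> borel_measurable borel"
  shows "(\<integral>\<^sup>+P. h (fst P /\<^sub>R sqrt (lor P P)) * indicator {P. 0 < snd P \<and> 1 \<le> lor P P \<and> lor P P \<le> 4} P \<partial>lborel) =
     (\<integral>\<^sup>+l. ennreal (l ^ DIM('a)) * indicator {1..2} l \<partial>lborel) * (\<integral>\<^sup>+y. h y \<partial>hyp_measure)"
proof -
  let ?C = "{P :: 'a \<times> real. 0 < snd P \<and> 1 \<le> lor P P \<and> lor P P \<le> 4}"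
  define g where "g x l = sqrt ((norm x)\<^sup>2 + l\<^sup>2)" for x :: 'a and l :: real
  define f where "f x t = h (x /\<^sub>R sqrt (t\<^sup>2 - (norm x)\<^sup>2))" for x :: 'a and t :: real
  have [measurable]: "case_prod f \<in> borel_measurable (borel \<Otimes>\<^sub>M borel)" unfolding f_def by measurable
  have lp: "lor (x, t) (x, t) = t\<^sup>2 - (norm x)\<^sup>2" for x :: 'a and t :: real
    unfolding power2_norm_eq_inner by (simp add: lor_def power2_eq_square)
  have ind: "indicator ?C (x, t) = (indicator {g x 1..g x 2} t :: ennreal)" for x t
  proof -
    have "(x, t) \<in> ?C \<longleftrightarrow> t \<in> {g x 1..g x 2}"
    proof
      assume "(x, t) \<in> ?C"
      then have "0 \<le> t" "(norm x)\<^sup>2 + 1\<^sup>2 \<le> t\<^sup>2" "t\<^sup>2 \<le> (norm x)\<^sup>2 + 2\<^sup>2" by (auto simp: lp)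
      then show "t \<in> {g x 1..g x 2}"
        using real_le_lsqrt[of t "(norm x)\<^sup>2 + 1\<^sup>2"] real_le_rsqrt[of t "(norm x)\<^sup>2 + 2\<^sup>2"] by (simp add: g_def)
    next
      assume "t \<in> {g x 1..g x 2}"
      then have "g x 1 \<le> t" "t \<le> g x 2" by auto
      moreover have "g x 1 > 0" by (simp add: g_def add_nonneg_pos)
      ultimately have "(g x 1)\<^sup>2 \<le> t\<^sup>2" "t\<^sup>2 \<le> (g x 2)\<^sup>2" "0 < t" by (auto intro!: power_mono)
      then show "(x, t) \<in> ?C" by (simp add: lp g_def)
    qed
    then show ?thesis by (simp add: indicator_def)
  qed
  have "(\<integral>\<^sup>+P. h (fst P /\<^sub>R sqrt (lor P P)) * indicator ?C P \<partial>lborel) = (\<integral>\<^sup>+x. \<integral>\<^sup>+t. f x t * indicator {g x 1..g x 2} t \<partial>lborel \<partial>lborel)"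
  proof (subst nn_integral_lborel_pair)
    note borel_measurable_fst_snd [measurable]
    have [measurable]: "?C \<in> sets borel" by measurable
    show "(\<lambda>P. h (fst P /\<^sub>R sqrt (lor P P)) * indicator ?C P) \<in> borel_measurable borel" by measurable
  qed (simp add: ind f_def lp)
  also have "\<dots> = (\<integral>\<^sup>+x. \<integral>\<^sup>+l. h (x /\<^sub>R l) * ennreal (l / g x l) * indicator {1..2} l \<partial>lborel \<partial>lborel)"
  proof (rule nn_integral_cong)
    fix x :: 'a
    have gp: "g x l > 0" if "l \<ge> 1" for l using that by (simp add: g_def add_nonneg_pos)
    have "(\<integral>\<^sup>+t. f x t * indicator {g x 1..g x 2} t \<partial>lborel) = (\<integral>\<^sup>+l. f x (g x l) * ennreal (l / g x l) * indicator {1..2} l \<partial>lborel)"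
    proof (rule nn_integral_substitution_aux)
      show "(g x has_real_derivative l / g x l) (at l)" if "l \<in> {1..2}" for l
      proof -
        have "((\<lambda>l. (norm x)\<^sup>2 + l\<^sup>2) has_real_derivative 2 * l) (at l)"
          by (auto intro!: derivative_eq_intros)
        moreover have "0 < (norm x)\<^sup>2 + l\<^sup>2" using that by (simp add: add_nonneg_pos)
        ultimately have "((\<lambda>l. sqrt ((norm x)\<^sup>2 + l\<^sup>2)) has_real_derivative inverse (sqrt ((norm x)\<^sup>2 + l\<^sup>2)) / 2 * (2 * l)) (at l)"
          by (intro DERIV_chain2[OF DERIV_real_sqrt])
        then show ?thesis unfolding g_def by (rule DERIV_cong) (simp add: inverse_eq_divide)
      qed
      show "continuous_on {1..2} (\<lambda>l. l / g x l)"
        using gp unfolding g_def by (intro continuous_intros) (auto simp: add_nonneg_eq_0_iff)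
      show "0 \<le> l / g x l" if "l \<in> {1..2}" for l using that gp[of l] by simp
    qed (auto, measurable)
    also have "\<dots> = (\<integral>\<^sup>+l. h (x /\<^sub>R l) * ennreal (l / g x l) * indicator {1..2} l \<partial>lborel)"
    proof (rule nn_integral_cong)
      fix l :: real
      have "f x (g x l) = h (x /\<^sub>R l)" if "l \<in> {1..2}" using that by (simp add: f_def g_def)
      then show "f x (g x l) * ennreal (l / g x l) * indicator {1..2} l = h (x /\<^sub>R l) * ennreal (l / g x l) * indicator {1..2} l"
        by (auto simp: indicator_def)
    qed
    finally show "(\<integral>\<^sup>+t. f x t * indicator {g x 1..g x 2} t \<partial>lborel) = \<dots>" .
  qed
  also have "\<dots> = (\<integral>\<^sup>+l. \<integral>\<^sup>+x. h (x /\<^sub>R l) * ennreal (l / g x l) * indicator {1..2} l \<partial>lborel \<partial>lborel)"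
    unfolding g_def by (rule lborel_pair.Fubini'[symmetric]) measurable
  also have "\<dots> = (\<integral>\<^sup>+l. ennreal (l ^ DIM('a)) * indicator {1..2} l * (\<integral>\<^sup>+y. h y \<partial>hyp_measure) \<partial>lborel)"
  proof (rule nn_integral_cong)
    fix l :: real
    show "(\<integral>\<^sup>+x. h (x /\<^sub>R l) * ennreal (l / g x l) * indicator {1..2} l \<partial>lborel) = ennreal (l ^ DIM('a)) * indicator {1..2} l * (\<integral>\<^sup>+y. h y \<partial>hyp_measure)"
    proof (cases "l \<in> {1..2}")
      case True
      then have l: "l > 0" by simp
      have "(\<integral>\<^sup>+x. h (x /\<^sub>R l) * ennreal (l / g x l) * indicator {1..2} l \<partial>lborel) = (\<integral>\<^sup>+x. h (x /\<^sub>R l) * ennreal (l / g x l) \<partial>lborel)"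
        using True by simp
      \<comment> \<open>Scaling x = l y brings the shell of mass \<open>l\<close> to the unit
        hyperboloid: the energy \<open>g\<close> becomes l times \<open>japanese y\<close>, so the
        Jacobian l / g is exactly the invariant density.\<close>
      also have "\<dots> = ennreal (l ^ DIM('a)) * (\<integral>\<^sup>+y. h ((0 + l *\<^sub>R y) /\<^sub>R l) * ennreal (l / g (0 + l *\<^sub>R y) l) \<partial>lborel)"
        using l unfolding g_def by (intro nn_integral_lborel_affine) measurable
      also have "(\<integral>\<^sup>+y. h ((0 + l *\<^sub>R y) /\<^sub>R l) * ennreal (l / g (0 + l *\<^sub>R y) l) \<partial>lborel) = (\<integral>\<^sup>+y. ennreal (1 / japanese y) * h y \<partial>lborel)"
      proof (rule nn_integral_cong)
        fix y :: 'a
        have "g (0 + l *\<^sub>R y) l = sqrt (l\<^sup>2 * (1 + (norm y)\<^sup>2))" by (simp add: g_def power_mult_distrib algebra_simps)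
        also have "\<dots> = l * japanese y" using l by (simp add: real_sqrt_mult japanese_def)
        finally show "h ((0 + l *\<^sub>R y) /\<^sub>R l) * ennreal (l / g (0 + l *\<^sub>R y) l) = ennreal (1 / japanese y) * h y"
          using l by (simp add: mult.commute)
      qed
      also have "\<dots> = (\<integral>\<^sup>+y. h y \<partial>hyp_measure)" by (rule nn_integral_hyp_measure[symmetric]) measurable
      finally show ?thesis using True by simp
    qed simp
  qed
  also have "\<dots> = (\<integral>\<^sup>+l. ennreal (l ^ DIM('a)) * indicator {1..2} l \<partial>lborel) * (\<integral>\<^sup>+y. h y \<partial>hyp_measure)"
    by (rule nn_integral_multc) measurable
  finally show ?thesis .
qed

text \<open>Invariance is inherited from Lebesgue measure: the integral of a function that is
  constant along rays, over a shell of the cone, is a fixed multiple of its integral over the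
  hyperboloid, and boosts map the shell to itself.\<close>

lemma nn_integral_hyp_boost:
  fixes h :: "'a::euclidean_space \<Rightarrow> ennreal"
  assumes b: "b \<in> Basis" and [measurable]: "h \<in> borel_measurable borel"
  shows "(\<integral>\<^sup>+y. h (fst (boost b r (pos y))) \<partial>hyp_measure) = (\<integral>\<^sup>+y. h y \<partial>hyp_measure)"
proof -
  note borel_measurable_fst_snd [measurable] boost_measurable[OF b, measurable]
  let ?C = "{P :: 'a \<times> real. 0 < snd P \<and> 1 \<le> lor P P \<and> lor P P \<le> 4}"
  have [measurable]: "?C \<in> sets borel" by measurable
  let ?c = "\<integral>\<^sup>+l. ennreal (l ^ DIM('a)) * indicator {1..2} l \<partial>lborel"
  let ?H = "\<lambda>P. h (fst P /\<^sub>R sqrt (lor P P)) * indicator ?C P"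
  let ?h' = "\<lambda>y. h (fst (boost b r (pos y)))"
  have "?c * (\<integral>\<^sup>+y. h y \<partial>hyp_measure) = (\<integral>\<^sup>+P. ?H P \<partial>lborel)"
    by (rule nn_integral_cone[symmetric]) measurable
  also have "\<dots> = (\<integral>\<^sup>+P. ?H (boost b r P) \<partial>lborel)"
    by (rule nn_integral_boost[OF b, symmetric]) measurable
  also have "\<dots> = (\<integral>\<^sup>+P. ?h' (fst P /\<^sub>R sqrt (lor P P)) * indicator ?C P \<partial>lborel)"
  proof (rule nn_integral_cong)
    fix P :: "'a \<times> real"
    have l: "lor (boost b r P) (boost b r P) = lor P P" by (rule lor_boost[OF b])
    have fw: "0 < snd (boost b s Q)" if "0 < snd Q" "1 \<le> lor Q Q" for Q s
    proof (rule snd_boost_pos[OF b])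
      have "(norm (fst Q))\<^sup>2 < (snd Q)\<^sup>2" using that unfolding power2_norm_eq_inner by (simp add: lor_def power2_eq_square)
      then show "norm (fst Q) < snd Q" by (rule power2_less_imp_less) (use that in simp)
    qed
    have iff: "boost b r P \<in> ?C \<longleftrightarrow> P \<in> ?C"
      using fw[of P r] fw[of "boost b r P" "- r"] by (auto simp: l boost_boost_minus[OF b])
    show "?H (boost b r P) = ?h' (fst P /\<^sub>R sqrt (lor P P)) * indicator ?C P"
    proof (cases "P \<in> ?C")
      case True
      let ?s = "sqrt (lor P P)"
      have s: "?s > 0" "?s\<^sup>2 = lor P P" using True by auto
      have "pos (fst P /\<^sub>R ?s) = P /\<^sub>R ?s"
      proof -
        have "(snd P / ?s)\<^sup>2 = 1 + (norm (fst P /\<^sub>R ?s))\<^sup>2"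
        proof -
          have "(snd P)\<^sup>2 = ?s\<^sup>2 + (norm (fst P))\<^sup>2"
            unfolding s(2) power2_norm_eq_inner by (simp add: lor_def power2_eq_square)
          then show ?thesis using s(1) by (simp add: power_divide power_mult_distrib field_simps)
        qed
        then have "japanese (fst P /\<^sub>R ?s) = snd P / ?s"
          unfolding japanese_def using s(1) True by (intro real_sqrt_unique) auto
        then show ?thesis by (simp add: pos_def prod_eq_iff divide_inverse mult.commute)
      qed
      then show ?thesis using True iff by (simp add: l boost_scaleR)
    qed (use iff in simp)
  qed
  also have "\<dots> = ?c * (\<integral>\<^sup>+y. ?h' y \<partial>hyp_measure)"
    by (rule nn_integral_cone) measurable
  finally have eq: "?c * (\<integral>\<^sup>+y. h y \<partial>hyp_measure) = ?c * (\<integral>\<^sup>+y. ?h' y \<partial>hyp_measure)" .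
  \<comment> \<open>Restricting to masses between 1 and 2 makes the radial factor positive and
    finite, so that it can be cancelled.\<close>
  have "(\<integral>\<^sup>+l. indicator {1..2::real} l \<partial>lborel) \<le> ?c"
    by (intro nn_integral_mono) (auto simp: indicator_def)
  then have c0: "?c \<noteq> 0" by auto
  have "?c \<le> (\<integral>\<^sup>+l. ennreal (2 ^ DIM('a)) * indicator {1..2::real} l \<partial>lborel)"
    by (intro nn_integral_mono) (auto simp: indicator_def intro!: ennreal_leI power_mono)
  also have "\<dots> < top" by (subst nn_integral_cmult) (auto simp: ennreal_mult_less_top)
  finally have "?c \<noteq> top" by simp
  then show ?thesis using eq c0 by (simp add: ennreal_mult_cancel_left)
qed

text \<open>The space-time action is the opposite boost: moving it across the inner product, where
  it is symmetric, undoes the boost of \<open>pos y\<close>.\<close>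

lemma lorentz_boost:
  fixes b :: "'a::euclidean_space"
  assumes b: "b \<in> Basis"
  shows "lorentz (\<lambda>y. fst (boost b r (pos y))) (boost b (- r))"
proof -
  note borel_measurable_fst_snd [measurable] boost_measurable[OF b, measurable]
  show ?thesis
    unfolding lorentz_def
  proof (intro conjI allI)
    show m: "(\<lambda>y. fst (boost b r (pos y))) \<in> borel_measurable borel" by measurable
    show "distr hyp_measure borel (\<lambda>y. fst (boost b r (pos y))) = hyp_measure"
    proof (rule measure_eqI)
      fix A assume "A \<in> sets (distr hyp_measure borel (\<lambda>y. fst (boost b r (pos y))))"
      then have [measurable]: "A \<in> sets borel" by simp
      have "emeasure (distr hyp_measure borel (\<lambda>y. fst (boost b r (pos y)))) A = (\<integral>\<^sup>+y. indicator A y \<partial>distr hyp_measure borel (\<lambda>y. fst (boost b r (pos y))))"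
        by simp
      also have "\<dots> = (\<integral>\<^sup>+y. indicator A (fst (boost b r (pos y))) \<partial>hyp_measure)"
        by (rule nn_integral_distr) measurable
      also have "\<dots> = (\<integral>\<^sup>+y. indicator A y \<partial>hyp_measure)" by (rule nn_integral_hyp_boost[OF b]) measurable
      finally show "emeasure (distr hyp_measure borel (\<lambda>y. fst (boost b r (pos y)))) A = emeasure hyp_measure A" by simp
    qed simp
    show "boost b (- r) \<in> borel_measurable borel" by measurable
    show "distr lborel borel (boost b (- r)) = lborel"
    proof (rule measure_eqI)
      fix A assume "A \<in> sets (distr lborel borel (boost b (- r)))"
      then have [measurable]: "A \<in> sets borel" by simp
      have "emeasure (distr lborel borel (boost b (- r))) A = (\<integral>\<^sup>+y. indicator A y \<partial>distr lborel borel (boost b (- r)))"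
        by simp
      also have "\<dots> = (\<integral>\<^sup>+y. indicator A (boost b (- r) y) \<partial>lborel)"
        by (rule nn_integral_distr) measurable
      also have "\<dots> = (\<integral>\<^sup>+y. indicator A y \<partial>lborel)" by (rule nn_integral_boost[OF b]) measurable
      finally show "emeasure (distr lborel borel (boost b (- r))) A = emeasure lborel A" by simp
    qed simp
    fix z :: "'a \<times> real" and y y' :: 'a
    show "boost b (- r) z \<bullet> pos (fst (boost b r (pos y))) = z \<bullet> pos y"
      by (simp add: boost_pos[OF b, symmetric] boost_inner boost_boost_minus[OF b])
    show "lor (pos (fst (boost b r (pos y)))) (pos (fst (boost b r (pos y')))) = lor (pos y) (pos y')"
      by (simp add: boost_pos[OF b, symmetric] lor_boost[OF b])
  qed
qed

lemma lorentz_id: "lorentz (\<lambda>y. y) (\<lambda>z. z)"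
  by (simp add: lorentz_def distr_id2)

lemma lorentz_comp:
  assumes 1: "lorentz \<Lambda>1 L1" and 2: "lorentz \<Lambda>2 L2"
  shows "lorentz (\<lambda>y. \<Lambda>1 (\<Lambda>2 y)) (\<lambda>z. L1 (L2 z))"
proof -
  have [measurable]: "\<Lambda>1 \<in> borel_measurable borel" "\<Lambda>2 \<in> borel_measurable borel" "L1 \<in> borel_measurable borel" "L2 \<in> borel_measurable borel"
    using 1 2 by (auto simp: lorentz_def)
  have "distr hyp_measure borel (\<lambda>y. \<Lambda>1 (\<Lambda>2 y)) = distr (distr hyp_measure borel \<Lambda>2) borel \<Lambda>1"
    by (subst distr_distr) (auto simp: comp_def)
  moreover have "distr lborel borel (\<lambda>z. L1 (L2 z)) = distr (distr lborel borel L2) borel L1"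
    by (subst distr_distr) (auto simp: comp_def)
  moreover have "L1 z \<bullet> pos (\<Lambda>1 y) = z \<bullet> pos y" "L2 z \<bullet> pos (\<Lambda>2 y) = z \<bullet> pos y"
    "lor (pos (\<Lambda>1 y)) (pos (\<Lambda>1 y')) = lor (pos y) (pos y')" "lor (pos (\<Lambda>2 y)) (pos (\<Lambda>2 y')) = lor (pos y) (pos y')" for z y y'
    using 1 2 unfolding lorentz_def by blast+
  ultimately show ?thesis using 1 2 unfolding lorentz_def by (simp del: split_paired_All)
qed

text \<open>The coordinates of \<open>b\<close> are created one after another. A boost along
  \<open>j\<close> leaves the other coordinates alone, and since the \<open>j\<close>-th coordinate
  is still 0 it becomes sinh r times \<open>japanese\<close>, which determines
  \<open>r\<close>.\<close>

lemma lorentz_transitive: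
  fixes b :: "'a::euclidean_space"
  obtains \<Lambda> L where "lorentz \<Lambda> L" "\<Lambda> 0 = b"
proof -
  have "\<exists>\<Lambda> L. lorentz \<Lambda> L \<and> (\<forall>i\<in>Basis. \<Lambda> (0::'a) \<bullet> i = (if i \<in> B then b \<bullet> i else 0))" if "finite B" "B \<subseteq> Basis" for B
    using that
  proof (induction B)
    case empty
    show ?case using lorentz_id by (intro exI[of _ "\<lambda>y. y"] exI[of _ "\<lambda>z. z"]) simp
  next
    case (insert j B)
    then obtain \<Lambda> L where L: "lorentz \<Lambda> L" "\<forall>i\<in>Basis. \<Lambda> (0::'a) \<bullet> i = (if i \<in> B then b \<bullet> i else 0)" by auto
    have j: "j \<in> Basis" using insert by simp
    let ?y = "\<Lambda> 0"
    define r where "r = arsinh (b \<bullet> j / japanese ?y)"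
    have yj: "?y \<bullet> j = 0" using L(2) j insert by simp
    have "fst (boost j r (pos ?y)) \<bullet> i = (if i \<in> insert j B then b \<bullet> i else 0)" if i: "i \<in> Basis" for i
    proof (cases "i = j")
      case True
      then show ?thesis using yj by (simp add: fst_boost_inner[OF j]) (simp add: pos_def r_def)
    next
      case False
      then have "j \<bullet> i = 0" using i j by (simp add: inner_Basis)
      then show ?thesis using False L(2) i by (simp add: boost_def pos_def inner_add_left)
    qed
    then show ?case using lorentz_comp[OF lorentz_boost[OF j, of r] L(1)] by blast
  qed
  from this[of Basis] obtain \<Lambda> L where "lorentz \<Lambda> L" "\<forall>i\<in>Basis. \<Lambda> (0::'a) \<bullet> i = b \<bullet> i" by auto
  then show thesis using that[of \<Lambda> L] by (metis euclidean_eqI)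
qed

section \<open>Density of Schwartz functions\<close>

text \<open>The products of these functions with a Gaussian form a class of Schwartz functions that is closed
  under differentiation.\<close>

inductive hyp_poly :: "('a::euclidean_space \<Rightarrow> complex) \<Rightarrow> bool" where
  const: "hyp_poly (\<lambda>y. c)"
| coord: "b \<in> Basis \<Longrightarrow> hyp_poly (\<lambda>y. of_real (y \<bullet> b))"
| inv: "hyp_poly (\<lambda>y. of_real (1 / japanese y))"
| add: "hyp_poly p \<Longrightarrow> hyp_poly q \<Longrightarrow> hyp_poly (\<lambda>y. p y + q y)"
| mult: "hyp_poly p \<Longrightarrow> hyp_poly q \<Longrightarrow> hyp_poly (\<lambda>y. p y * q y)"

lemma hyp_poly_sum:
  "(\<And>i. i \<in> I \<Longrightarrow> hyp_poly (p i)) \<Longrightarrow> hyp_poly (\<lambda>y. \<Sum>i\<in>I. p i y)"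
  by (induction I rule: infinite_finite_induct) (auto intro: hyp_poly.const hyp_poly.add)

lemma has_derivative_inv_japanese:
  "((\<lambda>y::'a::euclidean_space. 1 / japanese y) has_derivative (\<lambda>h. - (x \<bullet> h) * (1 / japanese x) * (1 / japanese x) * (1 / japanese x))) (at x)"
proof -
  have "((\<lambda>y::'a. y \<bullet> y) has_derivative (\<lambda>h. x \<bullet> h + h \<bullet> x)) (at x)"
    by (auto intro!: derivative_eq_intros)
  then have 1: "((\<lambda>y::'a. 1 + y \<bullet> y) has_derivative (\<lambda>h. 2 * (x \<bullet> h))) (at x)"
    by (auto intro!: derivative_eq_intros simp: inner_commute)
  have p: "1 + x \<bullet> x > 0" by (simp add: add_pos_nonneg)
  have j: "japanese y = sqrt (1 + y \<bullet> y)" for y :: 'a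
    by (simp only: japanese_def power2_norm_eq_inner)
  have eq: "(\<lambda>h. 2 * (x \<bullet> h) * (inverse (japanese x) / 2)) = (\<lambda>h. (x \<bullet> h) / japanese x)"
    by (rule ext) (simp add: inverse_eq_divide)
  have "((\<lambda>y::'a. sqrt (1 + y \<bullet> y)) has_derivative (\<lambda>h. 2 * (x \<bullet> h) * (inverse (sqrt (1 + x \<bullet> x)) / 2))) (at x)"
    using has_derivative_real_sqrt[OF p 1] by (simp only: mult.commute)
  from this[folded j, unfolded eq] have 2: "((\<lambda>y::'a. japanese y) has_derivative (\<lambda>h. (x \<bullet> h) / japanese x)) (at x)" .
  have "((\<lambda>y::'a. inverse (japanese y)) has_derivative (\<lambda>h. - (inverse (japanese x) * ((x \<bullet> h) / japanese x) * inverse (japanese x)))) (at x)"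
    by (rule Deriv.has_derivative_inverse[OF _ 2]) simp
  then show ?thesis by (simp add: divide_inverse mult_ac)
qed

lemma hyp_poly_derivative:
  assumes "hyp_poly (p :: 'a::euclidean_space \<Rightarrow> complex)"
  shows "\<exists>D. (\<forall>x. (p has_derivative D x) (at x)) \<and> (\<forall>b\<in>Basis. hyp_poly (\<lambda>x. D x b))"
  using assms
proof induction
  case (const c)
  show ?case by (intro exI[of _ "\<lambda>x h. 0"]) (auto intro: hyp_poly.const)
next
  case (coord i)
  have "((\<lambda>y. complex_of_real (y \<bullet> i)) has_derivative (\<lambda>h. of_real (h \<bullet> i))) (at x)" for x
    by (auto intro!: derivative_eq_intros)
  then show ?case by (intro exI[of _ "\<lambda>x h. of_real (h \<bullet> i)"]) (auto intro: hyp_poly.const)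
next
  case inv
  let ?D = "\<lambda>x h::'a. complex_of_real (- (x \<bullet> h) * (1 / japanese x) * (1 / japanese x) * (1 / japanese x))"
  have "((\<lambda>y::'a. complex_of_real (1 / japanese y)) has_derivative ?D x) (at x)" for x
    by (rule has_derivative_of_real[OF has_derivative_inv_japanese])
  moreover have "hyp_poly (\<lambda>x. ?D x b)" if "b \<in> Basis" for b
  proof -
    have "hyp_poly (\<lambda>x::'a. (- 1) * of_real (x \<bullet> b) * of_real (1 / japanese x) * of_real (1 / japanese x) * of_real (1 / japanese x))"
      by (intro hyp_poly.intros that)
    then show ?thesis by simp
  qed
  ultimately show ?case by (intro exI[of _ ?D] conjI allI ballI)
next
  case (add p q)
  then obtain D E where "\<forall>x. (p has_derivative D x) (at x)" "\<forall>b\<in>Basis. hyp_poly (\<lambda>x. D x b)"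
    "\<forall>x. (q has_derivative E x) (at x)" "\<forall>b\<in>Basis. hyp_poly (\<lambda>x. E x b)" by blast
  then show ?case
    by (intro exI[of _ "\<lambda>x h. D x h + E x h"]) (auto intro!: has_derivative_add hyp_poly.intros)
next
  case (mult p q)
  then obtain D E where "\<forall>x. (p has_derivative D x) (at x)" "\<forall>b\<in>Basis. hyp_poly (\<lambda>x. D x b)"
    "\<forall>x. (q has_derivative E x) (at x)" "\<forall>b\<in>Basis. hyp_poly (\<lambda>x. E x b)" by blast
  with mult show ?case
    by (intro exI[of _ "\<lambda>x h. p x * E x h + D x h * q x"]) (auto intro!: has_derivative_mult hyp_poly.intros)
qed

definition gauss_poly :: "('a::euclidean_space \<Rightarrow> complex) \<Rightarrow> bool" where
  "gauss_poly f \<longleftrightarrow> (\<exists>p. hyp_poly p \<and> f = (\<lambda>y. of_real (exp (- (norm y)\<^sup>2)) * p y))"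

lemma gauss_poly_derivative:
  assumes "gauss_poly (f :: 'a::euclidean_space \<Rightarrow> complex)"
  shows "f differentiable (at x)" "b \<in> Basis \<Longrightarrow> gauss_poly (partial_derivative b f)"
proof -
  obtain p where p: "hyp_poly p" "f = (\<lambda>y. of_real (exp (- (norm y)\<^sup>2)) * p y)"
    using assms by (auto simp: gauss_poly_def)
  obtain D where D: "\<And>x. (p has_derivative D x) (at x)" "\<And>b. b \<in> Basis \<Longrightarrow> hyp_poly (\<lambda>x. D x b)"
    using hyp_poly_derivative[OF p(1)] by blast
  have n: "(norm y)\<^sup>2 = y \<bullet> y" for y :: 'a by (rule power2_norm_eq_inner)
  have e: "((\<lambda>y::'a. exp (- (norm y)\<^sup>2)) has_derivative (\<lambda>h. exp (- (norm x)\<^sup>2) * (- 2 * (x \<bullet> h)))) (at x)" for x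
    unfolding n by (auto intro!: derivative_eq_intros simp: inner_commute)
  define F where "F x h = complex_of_real (exp (- (norm x)\<^sup>2)) * D x h + of_real (exp (- (norm x)\<^sup>2) * (- 2 * (x \<bullet> h))) * p x" for x h
  have F: "(f has_derivative F x) (at x)" for x
    unfolding p(2) F_def by (rule has_derivative_mult[OF has_derivative_of_real[OF e] D(1)])
  then show "f differentiable (at x)" by (auto simp: differentiable_def)
  assume b: "b \<in> Basis"
  have "partial_derivative b f = (\<lambda>x. F x b)"
    unfolding partial_derivative_def using frechet_derivative_at[OF F] by auto
  also have "\<dots> = (\<lambda>x. of_real (exp (- (norm x)\<^sup>2)) * (D x b + (- 2) * of_real (x \<bullet> b) * p x))"
    by (auto simp: F_def algebra_simps)
  finally have "partial_derivative b f = (\<lambda>x. of_real (exp (- (norm x)\<^sup>2)) * (D x b + (- 2) * of_real (x \<bullet> b) * p x))" .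
  moreover have "hyp_poly (\<lambda>x. D x b + (- 2) * of_real (x \<bullet> b) * p x)"
    by (intro hyp_poly.add hyp_poly.mult hyp_poly.const hyp_poly.coord D(2) b p(1))
  ultimately show "gauss_poly (partial_derivative b f)"
    unfolding gauss_poly_def by (intro exI[of _ "\<lambda>x. D x b + (- 2) * of_real (x \<bullet> b) * p x"] conjI)
qed

lemma hyp_poly_growth:
  assumes "hyp_poly (p :: 'a::euclidean_space \<Rightarrow> complex)"
  shows "\<exists>C N. 0 \<le> C \<and> (\<forall>y. cmod (p y) \<le> C * (1 + norm y) ^ N)"
  using assms
proof induction
  case (const c)
  show ?case by (intro exI[of _ "cmod c"] exI[of _ 0]) simp
next
  case (coord b)
  have "\<bar>y \<bullet> b\<bar> \<le> 1 + norm y" for y using Basis_le_norm[OF coord, of y] by simp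
  then show ?case by (intro exI[of _ 1] exI[of _ 1]) simp
next
  case inv
  have "1 / japanese y \<le> 1 + norm y" for y :: 'a
  proof -
    have "1 / japanese y \<le> 1" using japanese_ge_1[of y] by simp
    then show ?thesis using norm_ge_zero[of y] by linarith
  qed
  then show ?case by (intro exI[of _ 1] exI[of _ 1]) (simp add: norm_divide)
next
  case (add p q)
  then obtain C N C' N' where *: "0 \<le> C" "\<forall>y. cmod (p y) \<le> C * (1 + norm y) ^ N" "0 \<le> C'" "\<forall>y. cmod (q y) \<le> C' * (1 + norm y) ^ N'"
    by blast
  have "cmod (p y + q y) \<le> (C + C') * (1 + norm y) ^ (N + N')" for y
  proof -
    have "C * (1 + norm y) ^ N \<le> C * (1 + norm y) ^ (N + N')"
      by (intro mult_left_mono power_increasing *) auto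
    moreover have "C' * (1 + norm y) ^ N' \<le> C' * (1 + norm y) ^ (N + N')"
      by (intro mult_left_mono power_increasing *) auto
    ultimately show ?thesis
      using norm_triangle_ineq[of "p y" "q y"] *(2)[rule_format, of y] *(4)[rule_format, of y]
      unfolding distrib_right by linarith
  qed
  then show ?case using * by (intro exI[of _ "C + C'"] exI[of _ "N + N'"]) auto
next
  case (mult p q)
  then obtain C N C' N' where *: "0 \<le> C" "\<forall>y. cmod (p y) \<le> C * (1 + norm y) ^ N" "0 \<le> C'" "\<forall>y. cmod (q y) \<le> C' * (1 + norm y) ^ N'"
    by blast
  have "cmod (p y * q y) \<le> (C * C') * (1 + norm y) ^ (N + N')" for y
  proof -
    have "cmod (p y) * cmod (q y) \<le> (C * (1 + norm y) ^ N) * (C' * (1 + norm y) ^ N')"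
      using * by (intro mult_mono) auto
    then show ?thesis by (simp add: norm_mult power_add mult_ac)
  qed
  then show ?case using * by (intro exI[of _ "C * C'"] exI[of _ "N + N'"]) auto
qed

text \<open>One term of the exponential series bounds the power by N! exp (1 + t), and the remaining
  exponent 1 + t - t^2 is bounded.\<close>

lemma gaussian_power_bounded:
  obtains B where "\<And>t::real. 0 \<le> t \<Longrightarrow> (1 + t) ^ N * exp (- t\<^sup>2) \<le> B"
proof -
  have "(1 + t) ^ N * exp (- t\<^sup>2) \<le> fact N * exp 3" if "0 \<le> t" for t :: real
  proof -
    have "(1 + t) ^ N \<le> fact N * exp (1 + t)"
    proof -
      have "(1 + t) ^ N / fact N \<le> exp (1 + t)"
      proof -
        have "sum (\<lambda>n. (1 + t) ^ n /\<^sub>R fact n) {N} \<le> (\<Sum>n. (1 + t) ^ n /\<^sub>R fact n)"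
          by (rule sum_le_suminf[OF summable_exp_generic]) (use that in auto)
        then show ?thesis by (simp add: exp_def divide_inverse mult.commute)
      qed
      then show ?thesis by (simp add: field_simps)
    qed
    then have "(1 + t) ^ N * exp (- t\<^sup>2) \<le> fact N * exp (1 + t) * exp (- t\<^sup>2)" by (rule mult_right_mono) simp
    also have "\<dots> = fact N * exp (1 + t - t\<^sup>2)" by (simp add: exp_add[symmetric])
    also have "\<dots> \<le> fact N * exp 3"
    proof -
      have "1 + t - t\<^sup>2 \<le> 3" using zero_le_power2[of "t - 1/2"] by (simp add: power2_eq_square algebra_simps)
      then show ?thesis by simp
    qed
    finally show ?thesis .
  qed
  then show thesis using that by blast
qed

lemma schwartz_gauss_poly:
  assumes "gauss_poly (f :: 'a::euclidean_space \<Rightarrow> complex)"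
  shows "schwartz f"
  unfolding schwartz_def
proof (intro ballI conjI allI)
  fix bs :: "'a list" assume "bs \<in> lists Basis"
  then have g: "gauss_poly (foldr partial_derivative bs f)"
    by (induction bs) (auto intro: assms gauss_poly_derivative)
  show "foldr partial_derivative bs f differentiable (at x)" for x by (rule gauss_poly_derivative(1)[OF g])
  fix k :: nat
  obtain p where p: "hyp_poly p" "foldr partial_derivative bs f = (\<lambda>y. of_real (exp (- (norm y)\<^sup>2)) * p y)"
    using g by (auto simp: gauss_poly_def)
  obtain C N where C: "0 \<le> C" "\<And>y. cmod (p y) \<le> C * (1 + norm y) ^ N" using hyp_poly_growth[OF p(1)] by blast
  obtain B where B: "\<And>t::real. 0 \<le> t \<Longrightarrow> (1 + t) ^ (k + N) * exp (- t\<^sup>2) \<le> B" using gaussian_power_bounded by blast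
  show "bounded (range (\<lambda>x. norm x ^ k *\<^sub>R foldr partial_derivative bs f x))"
    unfolding bounded_iff
  proof (intro exI[of _ "C * B"] ballI, elim imageE)
    fix z x assume z: "z = norm x ^ k *\<^sub>R foldr partial_derivative bs f x"
    have "norm z = norm x ^ k * (exp (- (norm x)\<^sup>2) * cmod (p x))" by (simp add: z p(2) norm_mult)
    also have "\<dots> \<le> (1 + norm x) ^ k * (exp (- (norm x)\<^sup>2) * (C * (1 + norm x) ^ N))"
      using C by (intro mult_mono power_mono mult_nonneg_nonneg) auto
    also have "\<dots> = C * ((1 + norm x) ^ (k + N) * exp (- (norm x)\<^sup>2))" by (simp add: power_add mult_ac)
    also have "\<dots> \<le> C * B" using B[of "norm x"] C by (intro mult_left_mono) auto
    finally show "norm z \<le> C * B" .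
  qed
qed

text \<open>The bounded coordinates (y, 1) / \<open>japanese y\<close> put all of space into a
  compact set, so that polynomials in them can be used for uniform approximation. This is the reason
  for the generator 1 / \<open>japanese\<close>.\<close>

lemma hyp_poly_compose:
  assumes "real_polynomial_function (q :: 'a::euclidean_space \<times> real \<Rightarrow> real)"
  shows "hyp_poly (\<lambda>y. of_real (q (y /\<^sub>R japanese y, 1 / japanese y)))"
  using assms
proof induction
  case (linear f)
  have lin: "Real_Vector_Spaces.linear f" using linear by (rule bounded_linear.linear)
  have "f (y /\<^sub>R japanese y, 1 / japanese y) = (1 / japanese y) * ((\<Sum>b\<in>Basis. (y \<bullet> b) * f (b, 0)) + f (0, 1))" for y
  proof -
    have "(y /\<^sub>R japanese y, 1 / japanese y) = (1 / japanese y) *\<^sub>R ((\<Sum>b\<in>Basis. (y \<bullet> b) *\<^sub>R (b, 0)) + (0, 1))"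
      by (simp add: prod_eq_iff fst_sum snd_sum euclidean_representation divide_inverse)
    then show ?thesis by (simp add: linear_cmul[OF lin] linear_add[OF lin] linear_sum[OF lin] del: scaleR_Pair)
  qed
  moreover have "hyp_poly (\<lambda>y. of_real (1 / japanese y) * ((\<Sum>b\<in>Basis. of_real (y \<bullet> b) * of_real (f (b, 0))) + of_real (f (0, 1))))"
    by (rule hyp_poly.mult[OF hyp_poly.inv hyp_poly.add[OF hyp_poly_sum[OF hyp_poly.mult[OF hyp_poly.coord hyp_poly.const]] hyp_poly.const]])
  ultimately show ?case by simp
qed (auto intro: hyp_poly.intros)

text \<open>Divided by the Gaussian, \<open>f\<close> is still continuous with bounded support and
  therefore extends continuously in the bounded coordinates; Stone-Weierstrass applies on a ball.
  The error keeps the Gaussian factor and is thus small in L2.\<close>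

lemma gauss_poly_approx:
  fixes f :: "'a::euclidean_space \<Rightarrow> complex"
  assumes f: "continuous_on UNIV f" and R: "0 < R" "\<And>y. R \<le> norm y \<Longrightarrow> f y = 0" and e: "0 < e"
  obtains g where "gauss_poly g" "\<And>y. cmod (g y - f y) \<le> e * exp (- (norm y)\<^sup>2)"
proof -
  define h where "h y = of_real (exp ((norm y)\<^sup>2)) * f y" for y
  have h: "continuous_on UNIV h" "\<And>y. R \<le> norm y \<Longrightarrow> h y = 0"
    unfolding h_def using R by (auto intro!: continuous_intros f)
  \<comment> \<open>The value of the last bounded coordinate at norm \<open>R\<close>. Below it
    \<open>h\<close> vanishes, so freezing the denominator at \<open>s0\<close> changes nothing and
    avoids the division by zero at infinity.\<close>
  define s0 where "s0 = 1 / sqrt (1 + R\<^sup>2)"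
  have s0: "s0 > 0" using R by (simp add: s0_def add_pos_nonneg)
  define H where "H z = h (fst z /\<^sub>R max (snd z) s0)" for z :: "'a \<times> real"
  have H: "continuous_on UNIV H"
    unfolding H_def using s0
    by (intro continuous_on_compose2[OF h(1)] continuous_intros) (auto simp: max_def)
  have H_eq: "H (y /\<^sub>R japanese y, 1 / japanese y) = h y" for y
  proof (cases "1 / japanese y \<ge> s0")
    case True
    then show ?thesis by (simp add: H_def max_def)
  next
    case False
    then have "sqrt (1 + R\<^sup>2) < japanese y"
      using R by (simp add: s0_def divide_simps add_pos_nonneg split: if_splits)
    then have "R\<^sup>2 < (norm y)\<^sup>2" by (simp add: japanese_def)
    then have Ry: "R \<le> norm y" by (meson less_imp_le norm_ge_zero power2_less_imp_less)
    have "R \<le> norm (y /\<^sub>R japanese y /\<^sub>R s0)"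
    proof -
      have "R\<^sup>2 * (1 + (norm y)\<^sup>2) \<le> (norm y)\<^sup>2 * (1 + R\<^sup>2)" using \<open>R\<^sup>2 < (norm y)\<^sup>2\<close> by (simp add: algebra_simps)
      then have "sqrt (R\<^sup>2 * (1 + (norm y)\<^sup>2)) \<le> sqrt ((norm y)\<^sup>2 * (1 + R\<^sup>2))" by (rule real_sqrt_le_mono)
      then have "R * japanese y \<le> norm y * sqrt (1 + R\<^sup>2)" using R by (simp add: real_sqrt_mult japanese_def)
      moreover have "norm (y /\<^sub>R japanese y /\<^sub>R s0) = norm y * sqrt (1 + R\<^sup>2) / japanese y"
        using R by (simp add: s0_def divide_inverse mult_ac)
      ultimately show ?thesis by (simp add: pos_le_divide_eq)
    qed
    then show ?thesis using False h(2) Ry by (simp add: H_def max_def)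
  qed
  have "compact (cball 0 2 :: ('a \<times> real) set)" by simp
  from Stone_Weierstrass_polynomial_function[OF this continuous_on_subset[OF H] e]
  obtain q where q: "polynomial_function q" "\<And>z. z \<in> cball 0 2 \<Longrightarrow> norm (H z - q z) < e" by auto
  define p where "p y = q (y /\<^sub>R japanese y, 1 / japanese y)" for y
  have "real_polynomial_function (\<lambda>z. Re (q z))" "real_polynomial_function (\<lambda>z. Im (q z))"
    using q(1) bounded_linear_Re bounded_linear_Im by (auto simp: polynomial_function_def comp_def)
  note hyp_poly_compose[OF this(1)] hyp_poly_compose[OF this(2)]
  then have "hyp_poly (\<lambda>y. of_real (Re (p y)) + \<i> * of_real (Im (p y)))"
    unfolding p_def by (intro hyp_poly.add hyp_poly.mult[OF hyp_poly.const]) auto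
  then have p: "hyp_poly p" by (simp add: complex_eq[symmetric])
  have pe: "cmod (p y - h y) \<le> e" for y
  proof -
    have "norm (y /\<^sub>R japanese y, 1 / japanese y) \<le> norm (y /\<^sub>R japanese y) + norm (1 / japanese y)"
      by (rule norm_Pair_le)
    also have "\<dots> \<le> 1 + 1"
      using norm_less_japanese[of y] japanese_ge_1[of y] by (intro add_mono) (auto simp: divide_simps)
    finally have "(y /\<^sub>R japanese y, 1 / japanese y) \<in> cball 0 2" by simp
    from q(2)[OF this] show ?thesis by (simp add: H_eq p_def norm_minus_commute)
  qed
  define g where "g y = of_real (exp (- (norm y)\<^sup>2)) * p y" for y
  have "gauss_poly g" unfolding gauss_poly_def using p by (intro exI[of _ p]) (simp add: g_def fun_eq_iff)
  moreover have "cmod (g y - f y) \<le> e * exp (- (norm y)\<^sup>2)" for y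
  proof -
    have "f y = of_real (exp (- (norm y)\<^sup>2)) * h y"
    proof -
      have "complex_of_real (exp (- (norm y)\<^sup>2)) * of_real (exp ((norm y)\<^sup>2)) = 1"
        by (simp only: of_real_mult[symmetric] exp_add[symmetric]) simp
      then show ?thesis unfolding h_def mult.assoc[symmetric] by simp
    qed
    then have "g y - f y = of_real (exp (- (norm y)\<^sup>2)) * (p y - h y)" by (simp add: g_def algebra_simps)
    then show ?thesis using pe[of y] by (simp add: norm_mult mult.commute mult_right_mono)
  qed
  ultimately show thesis using that by blast
qed

section \<open>Dominated convergence and density in L2\<close>

lemma nrm_dominated:
  assumes p: "0 < p" and f: "\<And>n. f n \<in> borel_measurable M" and g: "g \<in> borel_measurable M"
    and lim: "AE x in M. (\<lambda>n. f n x) \<longlonglongrightarrow> g x"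
    and w: "integrable M (\<lambda>x. w x powr p)" "\<And>n. AE x in M. cmod (f n x) \<le> w x"
  shows "\<And>n. f n \<in> Lp_space p M" "g \<in> Lp_space p M" "(\<lambda>n. nrm p M (\<lambda>x. f n x - g x)) \<longlonglongrightarrow> 0"
proof -
  note [measurable] = f g
  have ae: "AE x in M. \<forall>n. cmod (f n x) \<le> w x" using w(2) by (simp add: AE_all_countable)
  have gw: "AE x in M. cmod (g x) \<le> w x"
    using lim ae
  proof eventually_elim
    case (elim x)
    then show ?case by (intro LIMSEQ_le_const2[OF tendsto_norm]) auto
  qed
  have dom: "h \<in> Lp_space p M" if [measurable]: "h \<in> borel_measurable M" and h: "AE x in M. cmod (h x) \<le> w x" for h
  proof -
    have "integrable M (\<lambda>x. cmod (h x) powr p)"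
    proof (rule Bochner_Integration.integrable_bound[OF w(1)])
      show "AE x in M. norm (cmod (h x) powr p) \<le> norm (w x powr p)"
        using h by eventually_elim (use p in \<open>auto intro: powr_mono2\<close>)
    qed measurable
    then show ?thesis using p by (simp add: Lp_space_iff)
  qed
  show "f n \<in> Lp_space p M" for n by (rule dom) (use w in auto)
  show "g \<in> Lp_space p M" by (rule dom[OF g gw])
  have "(\<lambda>n. \<integral>x. cmod (f n x - g x) powr p \<partial>M) \<longlonglongrightarrow> (\<integral>x. 0 \<partial>M)"
  proof (rule integral_dominated_convergence[where w="\<lambda>x. 2 powr p * w x powr p"])
    show "AE x in M. (\<lambda>n. cmod (f n x - g x) powr p) \<longlonglongrightarrow> 0"
      using lim
    proof eventually_elim
      case (elim x)
      have "(\<lambda>n. cmod (f n x - g x) powr p) \<longlonglongrightarrow> cmod (g x - g x) powr p"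
        using p by (intro tendsto_powr' tendsto_intros elim) auto
      then show ?case by simp
    qed
    show "AE x in M. norm (cmod (f n x - g x) powr p) \<le> 2 powr p * w x powr p" for n
      using ae gw
    proof eventually_elim
      case (elim x)
      have "cmod (f n x - g x) \<le> 2 * w x" using elim(1)[rule_format, of n] elim(2) norm_triangle_ineq4[of "f n x" "g x"] by linarith
      moreover have "0 \<le> w x" using elim(2) norm_ge_zero[of "g x"] by linarith
      ultimately show ?case using p powr_mono2[of p "cmod (f n x - g x)" "2 * w x"] by (simp add: powr_mult)
    qed
  qed (use w in auto)
  then have "(\<lambda>n. (\<integral>x. cmod (f n x - g x) powr p \<partial>M) powr (1/p)) \<longlonglongrightarrow> 0 powr (1/p)"
    using p by (intro tendsto_powr' tendsto_const) auto
  then show "(\<lambda>n. nrm p M (\<lambda>x. f n x - g x)) \<longlonglongrightarrow> 0" by (simp add: nrm_def)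
qed

lemma AE_hyp_measure:
  assumes "AE y in lborel. P y"
  shows "AE y in hyp_measure. P y"
  unfolding hyp_measure_def using assms by (subst AE_density) auto

lemma integrable_hyp_measure:
  fixes f :: "'a::euclidean_space \<Rightarrow> 'b::{banach, second_countable_topology}"
  assumes f: "integrable lborel f"
  shows "integrable hyp_measure f"
proof -
  have [measurable]: "f \<in> borel_measurable borel" using f by auto
  have "integrable lborel (\<lambda>y. (1 / japanese y) *\<^sub>R f y)"
  proof (rule Bochner_Integration.integrable_bound[OF f])
    show "AE y in lborel. norm ((1 / japanese y) *\<^sub>R f y) \<le> norm (f y)"
      using mult_left_mono[OF japanese_ge_1 norm_ge_zero] by (intro AE_I2) (simp add: divide_simps)
  qed measurable
  then show ?thesis unfolding hyp_measure_def by (subst integrable_density) auto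
qed

lemma integrable_indicator_cball: "integrable hyp_measure (indicator (cball (0::'a::euclidean_space) r) :: 'a \<Rightarrow> real)"
  using emeasure_bounded_finite[OF bounded_cball, of 0 r]
  by (intro integrable_hyp_measure integrable_real_indicator) simp_all

text \<open>Rapid decay of order 2 d dominates \<open>f\<close> by a multiple of the product of the
  functions 1 / (1 + x^2) over the coordinates, which is bounded and integrable.\<close>

lemma schwartz_nice:
  fixes f :: "'a::euclidean_space \<Rightarrow> complex"
  assumes "schwartz f"
  shows "nice f"
proof -
  have "f differentiable (at x)" for x
    using assms unfolding schwartz_def by (elim ballE[of _ _ "[]"]) auto
  then have "continuous_on UNIV f"
    by (intro continuous_at_imp_continuous_on ballI differentiable_imp_continuous_within) auto
  then have [measurable]: "f \<in> borel_measurable borel" by (rule borel_measurable_continuous_onI)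
  have "bounded (range (\<lambda>x. norm x ^ k *\<^sub>R f x))" for k :: nat
    using assms unfolding schwartz_def by (elim ballE[of _ _ "[]"]) auto
  then obtain B where B: "\<And>k x. norm x ^ k * cmod (f x) \<le> B k"
    unfolding bounded_iff by (simp add: image_iff) metis
  define n where "n = DIM('a)"
  \<comment> \<open>From (1 + |y|^2)^n \<le> 2^n (1 + |y|^(2 n)), with the decay bounds of order 0
    and 2 n.\<close>
  define C where "C = 2 ^ n * (B 0 + B (2 * n))"
  define w where "w y = (\<Prod>b\<in>Basis. 1 / (1 + (y \<bullet> b)\<^sup>2))" for y :: 'a
  have wpos: "0 < w y" "w y \<le> 1" for y
    unfolding w_def by (auto intro!: prod_pos prod_le_1 simp: add_pos_nonneg)
  have fw: "cmod (f y) \<le> C * w y" for y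
  proof -
    have "(\<Prod>b\<in>(Basis::'a set). 1 + (y \<bullet> b)\<^sup>2) \<le> (\<Prod>b\<in>(Basis::'a set). 1 + (norm y)\<^sup>2)"
    proof (rule prod_mono)
      fix b :: 'a assume b: "b \<in> Basis"
      have "\<bar>y \<bullet> b\<bar>\<^sup>2 \<le> (norm y)\<^sup>2" using Basis_le_norm[OF b, of y] by (intro power_mono) auto
      then show "0 \<le> 1 + (y \<bullet> b)\<^sup>2 \<and> 1 + (y \<bullet> b)\<^sup>2 \<le> 1 + (norm y)\<^sup>2" by simp
    qed
    also have "\<dots> = (1 + (norm y)\<^sup>2) ^ n" by (simp add: n_def)
    also have "\<dots> \<le> 2 ^ n * (1 + norm y ^ (2 * n))"
    proof (cases "norm y \<le> 1")
      case True
      then have "(1 + (norm y)\<^sup>2) ^ n \<le> 2 ^ n" by (intro power_mono) (auto simp: power_le_one)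
      also have "\<dots> \<le> 2 ^ n * (1 + norm y ^ (2 * n))" by simp
      finally show ?thesis .
    next
      case False
      then have "1 \<le> (norm y)\<^sup>2" by simp
      then have "(1 + (norm y)\<^sup>2) ^ n \<le> (2 * (norm y)\<^sup>2) ^ n" by (intro power_mono) auto
      also have "\<dots> = 2 ^ n * norm y ^ (2 * n)" by (simp add: power_mult_distrib power_mult)
      also have "\<dots> \<le> 2 ^ n * (1 + norm y ^ (2 * n))" by simp
      finally show ?thesis .
    qed
    finally have "(\<Prod>b\<in>(Basis::'a set). 1 + (y \<bullet> b)\<^sup>2) * cmod (f y) \<le> 2 ^ n * (1 + norm y ^ (2 * n)) * cmod (f y)"
      by (rule mult_right_mono) simp
    also have "\<dots> = 2 ^ n * (norm y ^ 0 * cmod (f y) + norm y ^ (2 * n) * cmod (f y))" by (simp add: algebra_simps)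
    also have "\<dots> \<le> C" unfolding C_def by (intro mult_left_mono add_mono B) simp
    finally have *: "(\<Prod>b\<in>(Basis::'a set). 1 + (y \<bullet> b)\<^sup>2) * cmod (f y) \<le> C" .
    have "w y * (\<Prod>b\<in>(Basis::'a set). 1 + (y \<bullet> b)\<^sup>2) = (\<Prod>b\<in>(Basis::'a set). 1)"
      unfolding w_def prod.distrib[symmetric] by (intro prod.cong refl) (simp add: add_nonneg_eq_0_iff)
    then have "cmod (f y) = w y * ((\<Prod>b\<in>(Basis::'a set). 1 + (y \<bullet> b)\<^sup>2) * cmod (f y))" by (simp add: mult.assoc[symmetric])
    also have "\<dots> \<le> w y * C" using wpos[of y] * by (intro mult_left_mono) auto
    finally show ?thesis by (simp add: mult.commute)
  qed
  have C: "C \<ge> 0" using fw[of 0] wpos[of 0] norm_ge_zero[of "f 0"] by (metis linorder_not_le mult_neg_pos order_trans not_less)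
  have wi: "integrable lborel w"
  proof (rule integrableI_bounded)
    show "w \<in> borel_measurable lborel" unfolding w_def by measurable
    have "(\<integral>\<^sup>+y. ennreal (norm (w y)) \<partial>lborel) = (\<integral>\<^sup>+y. (\<Prod>b\<in>Basis. ennreal (1 / (1 + (y \<bullet> b)\<^sup>2))) \<partial>(lborel :: 'a measure))"
      using wpos by (intro nn_integral_cong) (simp add: w_def abs_of_pos prod_ennreal)
    also have "\<dots> = (\<Prod>b\<in>(Basis::'a set). \<integral>\<^sup>+x. ennreal (1 / (1 + x\<^sup>2)) \<partial>lborel)"
      by (rule nn_integral_lborel_prod) auto
    also have "\<dots> < \<infinity>"
    proof -
      have "integrable lborel (\<lambda>x::real. inverse (1 + x\<^sup>2))"
        using integrable_inverse_1_plus_square by (simp add: set_integrable_def)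
      then have "(\<integral>\<^sup>+x. ennreal (1 / (1 + x\<^sup>2)) \<partial>lborel) < \<infinity>"
        by (simp add: integrable_iff_bounded inverse_eq_divide)
      then show ?thesis by (simp add: less_top[symmetric] power_eq_top_ennreal)
    qed
    finally show "(\<integral>\<^sup>+y. ennreal (norm (w y)) \<partial>lborel) < \<infinity>" .
  qed
  have "integrable hyp_measure f"
  proof (rule integrable_hyp_measure[OF Bochner_Integration.integrable_bound])
    show "integrable lborel (\<lambda>y. C * w y)" using wi by simp
    show "AE y in lborel. norm (f y) \<le> norm (C * w y)"
      using fw C wpos(1) by (intro AE_I2) (simp add: abs_of_nonneg abs_mult less_imp_le)
  qed measurable
  moreover have "integrable hyp_measure (\<lambda>y. (cmod (f y))\<^sup>2)"
  proof (rule integrable_hyp_measure[OF Bochner_Integration.integrable_bound])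
    show "integrable lborel (\<lambda>y. C\<^sup>2 * w y)" using wi by simp
    show "AE y in lborel. norm ((cmod (f y))\<^sup>2) \<le> norm (C\<^sup>2 * w y)"
    proof (rule AE_I2)
      fix y
      have "(cmod (f y))\<^sup>2 \<le> (C * w y)\<^sup>2" using fw by (intro power_mono) auto
      also have "\<dots> = C\<^sup>2 * (w y * w y)" by (simp add: power2_eq_square)
      also have "\<dots> \<le> C\<^sup>2 * (w y * 1)" using wpos[of y] by (intro mult_left_mono) auto
      finally show "norm ((cmod (f y))\<^sup>2) \<le> norm (C\<^sup>2 * w y)" using wpos(1)[of y] by (simp add: abs_mult)
    qed
  qed measurable
  ultimately show ?thesis by (auto simp: nice_def Lp_space_2_iff)
qed

text \<open>A measurable function is an almost everywhere limit of continuous ones. Clipping their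
  values and cutting off their supports makes them dominated, so the limit holds in L2, and one of
  them is then approximated by a polynomial times a Gaussian.\<close>

lemma gauss_poly_dense_bounded:
  fixes f :: "'a::euclidean_space \<Rightarrow> complex"
  assumes f [measurable]: "f \<in> borel_measurable borel" and K: "0 < K" "\<And>y. cmod (f y) \<le> K"
    and r: "0 < r" "\<And>y. r < norm y \<Longrightarrow> f y = 0" and e: "0 < e"
  obtains g where "gauss_poly g" "nrm 2 hyp_measure (\<lambda>y. g y - f y) < e"
proof -
  have f2: "f \<in> Lp_space 2 hyp_measure"
  proof -
    have "integrable hyp_measure (\<lambda>y. (cmod (f y))\<^sup>2)"
    proof (rule Bochner_Integration.integrable_bound)
      show "integrable hyp_measure (\<lambda>y. K\<^sup>2 * indicator (cball 0 r) y)"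
        by (rule integrable_mult_right[OF integrable_indicator_cball])
      show "AE y in hyp_measure. norm ((cmod (f y))\<^sup>2) \<le> norm (K\<^sup>2 * indicator (cball 0 r) y :: real)"
        using K r by (intro AE_I2) (auto simp: indicator_def power_mono)
    qed measurable
    then show ?thesis by (auto simp: Lp_space_2_iff)
  qed
  have "f \<in> borel_measurable lebesgue" using f by (simp add: measurable_completion)
  then have "f measurable_on UNIV" by (simp add: measurable_on_iff_borel_measurable)
  then obtain N h where N: "negligible N" and hc: "\<And>n. continuous_on UNIV (h n)"
    and h: "\<And>x. x \<notin> N \<Longrightarrow> (\<lambda>n. h n x) \<longlonglongrightarrow> f x"
    by (auto simp: measurable_on_def)
  \<comment> \<open>The radial retraction onto the disc of radius \<open>K\<close>: continuous,
    bounded by \<open>K\<close>, and the identity on the values of \<open>f\<close>.\<close>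
  define c where "c z = of_real (K / max K (cmod z)) * z" for z
  have cc: "continuous_on UNIV c" unfolding c_def using K by (intro continuous_intros) (auto simp: max_def)
  have cK: "cmod (c z) \<le> K" for z
  proof -
    have "max K (cmod z) > 0" using K(1) by simp
    moreover have "cmod (c z) = K / max K (cmod z) * cmod z"
      using K(1) by (simp add: c_def norm_mult norm_divide abs_of_pos less_max_iff_disj)
    moreover have "K / max K (cmod z) * cmod z \<le> K / max K (cmod z) * max K (cmod z)"
      using K(1) by (intro mult_left_mono) auto
    ultimately show ?thesis by simp
  qed
  have cid: "c z = z" if "cmod z \<le> K" for z using K that by (simp add: c_def max_def)
  \<comment> \<open>A continuous cutoff, 1 up to radius r and 0 from r + 1 on.\<close>
  define \<eta> where "\<eta> y = max 0 (min 1 (r + 1 - norm y))" for y :: 'a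
  define k where "k n y = of_real (\<eta> y) * c (h n y)" for n y
  have kc: "continuous_on UNIV (k n)" for n
    unfolding k_def \<eta>_def by (intro continuous_intros continuous_on_compose2[OF cc] hc) auto
  have k0: "k n y = 0" if "r + 1 \<le> norm y" for n y using that by (simp add: k_def \<eta>_def)
  have kK: "cmod (k n y) \<le> K * indicator (cball 0 (r + 1)) y" for n y
  proof (cases "r + 1 < norm y")
    case True then show ?thesis using k0[of y n] by simp
  next
    case False
    have "\<bar>\<eta> y\<bar> * cmod (c (h n y)) \<le> 1 * K" using cK by (intro mult_mono) (auto simp: \<eta>_def)
    then show ?thesis using False by (simp add: k_def norm_mult)
  qed
  have kf: "(\<lambda>n. k n x) \<longlonglongrightarrow> f x" if x: "x \<notin> N" for x
  proof -
    have "(\<lambda>n. c (h n x)) \<longlonglongrightarrow> c (f x)"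
      by (rule continuous_on_tendsto_compose[OF cc h[OF x]]) auto
    then have "(\<lambda>n. k n x) \<longlonglongrightarrow> of_real (\<eta> x) * f x"
      unfolding k_def using cid[OF K(2)] by (auto intro!: tendsto_intros)
    moreover have "of_real (\<eta> x) * f x = f x"
    proof (cases "norm x \<le> r")
      case True then show ?thesis by (simp add: \<eta>_def)
    next
      case False then show ?thesis using r by simp
    qed
    ultimately show ?thesis by simp
  qed
  have ae: "AE x in hyp_measure. (\<lambda>n. k n x) \<longlonglongrightarrow> f x"
  proof (rule AE_hyp_measure)
    have "N \<in> null_sets lebesgue" using N by (simp add: negligible_iff_null_sets)
    then have "AE x in lebesgue. x \<notin> N" by (rule AE_not_in)
    then have "AE x in lborel. x \<notin> N" by (simp add: AE_completion_iff)
    then show "AE x in lborel. (\<lambda>n. k n x) \<longlonglongrightarrow> f x" by eventually_elim (rule kf)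
  qed
  have km [measurable]: "k n \<in> borel_measurable borel" for n using kc by (rule borel_measurable_continuous_onI)
  have w: "integrable hyp_measure (\<lambda>y::'a. (K * indicator (cball 0 (r + 1)) y) powr 2)"
  proof -
    have "(K * indicator (cball 0 (r + 1)) y) powr 2 = K\<^sup>2 * indicator (cball 0 (r + 1)) y" for y :: 'a
      using K by (simp add: indicator_def)
    then show ?thesis using integrable_mult_right[OF integrable_indicator_cball] by simp
  qed
  have lim: "(\<lambda>n. nrm 2 hyp_measure (\<lambda>x. k n x - f x)) \<longlonglongrightarrow> 0" and k2: "\<And>n. k n \<in> Lp_space 2 hyp_measure"
    using nrm_dominated[OF _ _ _ ae w] kK by auto
  then have "\<forall>\<^sub>F n in sequentially. nrm 2 hyp_measure (\<lambda>x. k n x - f x) < e / 2"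
    using e by (intro order_tendstoD(2)[OF lim]) simp
  then obtain n where n: "nrm 2 hyp_measure (\<lambda>x. k n x - f x) < e / 2" by (auto simp: eventually_sequentially)
  define G where "G y = complex_of_real (exp (- (norm y)\<^sup>2))" for y :: 'a
  have "gauss_poly G" unfolding gauss_poly_def G_def by (intro exI[of _ "\<lambda>y. 1"]) (simp add: hyp_poly.const)
  then have G2: "G \<in> Lp_space 2 hyp_measure" using schwartz_nice[OF schwartz_gauss_poly] by (auto simp: nice_def)
  define e' where "e' = e / (2 * (nrm 2 hyp_measure G + 1))"
  have e': "e' > 0" using e by (simp add: e'_def add_nonneg_pos)
  obtain g where g: "gauss_poly g" "\<And>y. cmod (g y - k n y) \<le> e' * exp (- (norm y)\<^sup>2)"
    using gauss_poly_approx[OF kc _ k0 e', of "r+1" n] r by auto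
  have g2: "g \<in> Lp_space 2 hyp_measure" using schwartz_nice[OF schwartz_gauss_poly[OF g(1)]] by (auto simp: nice_def)
  have "nrm 2 hyp_measure (\<lambda>y. g y - k n y) \<le> nrm 2 hyp_measure (\<lambda>y. of_real e' * G y)"
  proof (rule nrm_mono)
    show "(\<lambda>y. of_real e' * G y) \<in> Lp_space 2 hyp_measure" by (rule nrm_cmult) (use G2 in auto)
    show "(\<lambda>y. g y - k n y) \<in> borel_measurable hyp_measure" using Lp_diff(1)[OF _ g2 k2] by (auto simp: Lp_space_def)
    show "AE y in hyp_measure. cmod (g y - k n y) \<le> cmod (of_real e' * G y)"
      using g(2) e' by (intro AE_I2) (simp add: G_def norm_mult)
  qed simp
  also have "\<dots> = e' * nrm 2 hyp_measure G" using e' by (subst nrm_cmult) (use G2 in auto)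
  also have "\<dots> \<le> e' * (nrm 2 hyp_measure G + 1)" using e' by simp
  also have "\<dots> = e / 2"
  proof -
    have "nrm 2 hyp_measure G + 1 \<noteq> 0" using nrm_nonneg[of 2 hyp_measure G] by linarith
    moreover have "e / (2 * x) * x = e / 2" if "x \<noteq> 0" for x using that by simp
    ultimately show ?thesis unfolding e'_def by blast
  qed
  finally have "nrm 2 hyp_measure (\<lambda>y. g y - k n y) \<le> e / 2" .
  moreover have "nrm 2 hyp_measure (\<lambda>y. g y - f y) \<le> nrm 2 hyp_measure (\<lambda>y. g y - k n y) + nrm 2 hyp_measure (\<lambda>y. k n y - f y)"
    by (rule nrm_triangle3) (use g2 k2 f2 in auto)
  ultimately have "nrm 2 hyp_measure (\<lambda>y. g y - f y) < e" using n by linarith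
  then show thesis using that g(1) by blast
qed

lemma schwartz_dense:
  fixes f :: "'a::euclidean_space \<Rightarrow> complex"
  assumes f: "f \<in> Lp_space 2 hyp_measure" and e: "0 < e"
  obtains g where "schwartz g" "nrm 2 hyp_measure (\<lambda>y. g y - f y) < e"
proof -
  have [measurable]: "f \<in> borel_measurable borel" using f by (auto simp: Lp_space_def cong: measurable_cong_sets)
  define F where "F n y = (if norm y \<le> real n \<and> cmod (f y) \<le> real n then f y else 0)" for n y
  have [measurable]: "F n \<in> borel_measurable borel" for n unfolding F_def by measurable
  have "(\<lambda>n. nrm 2 hyp_measure (\<lambda>y. F n y - f y)) \<longlonglongrightarrow> 0" and F2: "\<And>n. F n \<in> Lp_space 2 hyp_measure"
  proof -
    have ae: "AE y in hyp_measure. (\<lambda>n. F n y) \<longlonglongrightarrow> f y"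
    proof (rule AE_I2)
      fix y
      obtain n :: nat where "norm y + cmod (f y) \<le> real n" using real_arch_simple by blast
      then have "F m y = f y" if "m \<ge> n" for m
        using that norm_ge_zero[of y] norm_ge_zero[of "f y"] of_nat_mono[OF that, where 'a=real] unfolding F_def by (auto simp del: norm_ge_zero of_nat_le_iff)
      then show "(\<lambda>n. F n y) \<longlonglongrightarrow> f y" by (intro tendsto_eventually) (auto simp: eventually_sequentially)
    qed
    have "integrable hyp_measure (\<lambda>y. cmod (f y) powr 2)" using f by (simp add: Lp_space_iff)
    note * = nrm_dominated[where f=F, OF _ _ _ ae this]
    show "(\<lambda>n. nrm 2 hyp_measure (\<lambda>y. F n y - f y)) \<longlonglongrightarrow> 0" by (rule *(3)) (auto simp: F_def)
    show "F n \<in> Lp_space 2 hyp_measure" for n by (rule *(1)) (auto simp: F_def)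
  qed
  then have "\<forall>\<^sub>F n in sequentially. nrm 2 hyp_measure (\<lambda>x. F n x - f x) < e / 2"
    using e by (intro order_tendstoD(2)[of _ 0]) simp_all
  then obtain n where n: "nrm 2 hyp_measure (\<lambda>x. F n x - f x) < e / 2" by (auto simp: eventually_sequentially)
  obtain g where g: "gauss_poly g" "nrm 2 hyp_measure (\<lambda>y. g y - F n y) < e / 2"
  proof -
    \<comment> \<open>The bound is raised by 1 because n may be 0, while both constants have to be
      positive.\<close>
    have "cmod (F n y) \<le> real n + 1" "real n + 1 < norm y \<Longrightarrow> F n y = 0" for y by (auto simp: F_def)
    then show thesis
      using gauss_poly_dense_bounded[of "F n" "real n + 1" "real n + 1" "e/2"] that e by auto
  qed
  have sg: "schwartz g" by (rule schwartz_gauss_poly[OF g(1)])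
  have "nrm 2 hyp_measure (\<lambda>y. g y - f y) \<le> nrm 2 hyp_measure (\<lambda>y. g y - F n y) + nrm 2 hyp_measure (\<lambda>y. F n y - f y)"
    by (rule nrm_triangle3) (use schwartz_nice[OF sg] F2 f in \<open>auto simp: nice_def\<close>)
  then have "nrm 2 hyp_measure (\<lambda>y. g y - f y) < e" using n g(2) by linarith
  then show thesis using that sg by blast
qed

section \<open>Weak compactness\<close>

lemma L2_mult_integrable:
  assumes f: "f \<in> Lp_space 2 M" and g: "g \<in> Lp_space 2 M"
  shows "integrable M (\<lambda>x. cmod (f x) * cmod (g x))" "integrable M (\<lambda>x. f x * cnj (g x))"
proof -
  have [measurable]: "f \<in> borel_measurable M" "g \<in> borel_measurable M" using f g by (auto simp: Lp_space_def)
  have [measurable]: "cnj \<in> borel_measurable borel" by (intro borel_measurable_continuous_onI continuous_intros)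
  have I: "integrable M (\<lambda>x. (cmod (f x))\<^sup>2 + (cmod (g x))\<^sup>2)" using f g by (auto simp: Lp_space_2_iff)
  have le: "cmod (f x) * cmod (g x) \<le> (cmod (f x))\<^sup>2 + (cmod (g x))\<^sup>2" for x
    using sum_squares_bound[of "cmod (f x)" "cmod (g x)"] mult_nonneg_nonneg[OF norm_ge_zero[of "f x"] norm_ge_zero[of "g x"]] by linarith
  show "integrable M (\<lambda>x. cmod (f x) * cmod (g x))"
    by (rule Bochner_Integration.integrable_bound[OF I]) (use le in auto)
  show "integrable M (\<lambda>x. f x * cnj (g x))"
    by (rule Bochner_Integration.integrable_bound[OF I]) (use le in \<open>auto simp: norm_mult\<close>)
qed

text \<open>The elementary inequality for products, weighted by positive upper bounds A and B of the
  norms; letting these decrease to the norms includes functions of norm 0.\<close>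

lemma Cauchy_Schwarz_L2:
  assumes f: "f \<in> Lp_space 2 M" and g: "g \<in> Lp_space 2 M"
  shows "(\<integral>x. cmod (f x) * cmod (g x) \<partial>M) \<le> nrm 2 M f * nrm 2 M g"
proof -
  have main: "(\<integral>x. cmod (f x) * cmod (g x) \<partial>M) \<le> A * B" if "nrm 2 M f \<le> A" "nrm 2 M g \<le> B" "0 < A" "0 < B" for A B
  proof -
    have "(\<integral>x. cmod (f x) * cmod (g x) \<partial>M) \<le> (\<integral>x. B / (2 * A) * (cmod (f x))\<^sup>2 + A / (2 * B) * (cmod (g x))\<^sup>2 \<partial>M)"
    proof (rule integral_mono)
      show "integrable M (\<lambda>x. cmod (f x) * cmod (g x))" by (rule L2_mult_integrable[OF f g])
      show "integrable M (\<lambda>x. B / (2 * A) * (cmod (f x))\<^sup>2 + A / (2 * B) * (cmod (g x))\<^sup>2)"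
        using f g by (auto simp: Lp_space_2_iff)
      fix x
      have "2 * (B * cmod (f x)) * (A * cmod (g x)) \<le> (B * cmod (f x))\<^sup>2 + (A * cmod (g x))\<^sup>2" by (rule sum_squares_bound)
      then show "cmod (f x) * cmod (g x) \<le> B / (2 * A) * (cmod (f x))\<^sup>2 + A / (2 * B) * (cmod (g x))\<^sup>2"
        using that(3,4) by (simp add: field_simps power2_eq_square)
    qed
    also have "\<dots> = B / (2 * A) * (nrm 2 M f)\<^sup>2 + A / (2 * B) * (nrm 2 M g)\<^sup>2"
      using f g by (simp add: nrm_2_power2 Lp_space_2_iff)
    also have "\<dots> \<le> B / (2 * A) * A\<^sup>2 + A / (2 * B) * B\<^sup>2"
      using that by (intro add_mono mult_left_mono power_mono) auto
    also have "\<dots> = A * B" using that(3,4) by (simp add: power2_eq_square field_simps)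
    finally show ?thesis .
  qed
  have "((\<lambda>e. (nrm 2 M f + e) * (nrm 2 M g + e)) \<longlongrightarrow> (nrm 2 M f + 0) * (nrm 2 M g + 0)) (at_right 0)"
    by (intro tendsto_intros)
  moreover have "\<forall>\<^sub>F e in at_right 0. (\<integral>x. cmod (f x) * cmod (g x) \<partial>M) \<le> (nrm 2 M f + e) * (nrm 2 M g + e)"
    unfolding eventually_at_right_field by (intro exI[of _ 1]) (auto intro!: main simp: add_nonneg_pos)
  ultimately show ?thesis using tendsto_lowerbound by fastforce
qed

text \<open>Only the real part of the pairing. It makes L2 a real inner product space, where
  midpoints and limits of real functionals can be compared by inequalities; the imaginary part is
  recovered from \<open>h\<close> multiplied by the imaginary unit.\<close>

definition ip :: "'a measure \<Rightarrow> ('a \<Rightarrow> complex) \<Rightarrow> ('a \<Rightarrow> complex) \<Rightarrow> real" where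
  "ip M f g = (\<integral>x. Re (f x * cnj (g x)) \<partial>M)"

lemma ip_integrable:
  assumes "f \<in> Lp_space 2 M" "g \<in> Lp_space 2 M"
  shows "integrable M (\<lambda>x. Re (f x * cnj (g x)))"
  by (intro integrable_Re L2_mult_integrable assms)

lemma ip_commute: "ip M f g = ip M g f"
  unfolding ip_def by (intro Bochner_Integration.integral_cong refl) (simp add: mult.commute)

lemma ip_self: "ip M f f = (nrm 2 M f)\<^sup>2"
  by (simp add: ip_def nrm_2_power2 complex_norm_square[symmetric] del: of_real_power)

lemma ip_CS:
  assumes "f \<in> Lp_space 2 M" "g \<in> Lp_space 2 M"
  shows "\<bar>ip M f g\<bar> \<le> nrm 2 M f * nrm 2 M g"
proof -
  have "\<bar>ip M f g\<bar> \<le> (\<integral>x. norm (Re (f x * cnj (g x))) \<partial>M)"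
    unfolding ip_def using integral_norm_bound[of M "\<lambda>x. Re (f x * cnj (g x))"] by simp
  also have "\<dots> \<le> (\<integral>x. cmod (f x) * cmod (g x) \<partial>M)"
  proof (rule integral_mono)
    show "norm (Re (f x * cnj (g x))) \<le> cmod (f x) * cmod (g x)" for x
      using abs_Re_le_cmod[of "f x * cnj (g x)"] by (simp add: norm_mult)
  qed (use ip_integrable[OF assms] L2_mult_integrable[OF assms] in auto)
  also have "\<dots> \<le> nrm 2 M f * nrm 2 M g" by (rule Cauchy_Schwarz_L2[OF assms])
  finally show ?thesis .
qed

lemma ip_add:
  assumes "f \<in> Lp_space 2 M" "g \<in> Lp_space 2 M" "h \<in> Lp_space 2 M"
  shows "ip M (\<lambda>x. f x + g x) h = ip M f h + ip M g h" "ip M h (\<lambda>x. f x + g x) = ip M h f + ip M h g"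
    "ip M (\<lambda>x. f x - g x) h = ip M f h - ip M g h" "ip M h (\<lambda>x. f x - g x) = ip M h f - ip M h g"
    "ip M (\<lambda>x. (f x + g x) / 2) h = (ip M f h + ip M g h) / 2" "ip M h (\<lambda>x. (f x + g x) / 2) = (ip M h f + ip M h g) / 2"
proof -
  note I = ip_integrable[OF assms(1,3)] ip_integrable[OF assms(2,3)]
  show 1: "ip M (\<lambda>x. f x + g x) h = ip M f h + ip M g h"
    using Bochner_Integration.integral_add[OF I] by (simp add: ip_def distrib_right del: times_complex.sel)
  then show "ip M h (\<lambda>x. f x + g x) = ip M h f + ip M h g" by (simp add: ip_commute[of M h])
  show 2: "ip M (\<lambda>x. f x - g x) h = ip M f h - ip M g h"
    using Bochner_Integration.integral_diff[OF I] by (simp add: ip_def left_diff_distrib del: times_complex.sel)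
  then show "ip M h (\<lambda>x. f x - g x) = ip M h f - ip M h g" by (simp add: ip_commute[of M h])
  have "ip M (\<lambda>x. (f x + g x) / 2) h = ip M (\<lambda>x. f x + g x) h / 2"
    unfolding ip_def by (simp only: times_divide_eq_left Re_divide_numeral integral_divide_zero)
  then show 3: "ip M (\<lambda>x. (f x + g x) / 2) h = (ip M f h + ip M g h) / 2" by (simp add: 1)
  then show "ip M h (\<lambda>x. (f x + g x) / 2) = (ip M h f + ip M h g) / 2" by (simp add: ip_commute[of M h])
qed

lemma L2_midpoint:
  assumes "f \<in> Lp_space 2 M" "g \<in> Lp_space 2 M"
  shows "(\<lambda>x. (f x + g x) / 2) \<in> Lp_space 2 M" "nrm 2 M (\<lambda>x. (f x + g x) / 2) \<le> (nrm 2 M f + nrm 2 M g) / 2"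
proof -
  have fg: "(\<lambda>x. f x + g x) \<in> Lp_space 2 M" "nrm 2 M (\<lambda>x. f x + g x) \<le> nrm 2 M f + nrm 2 M g"
    using Minkowski[OF _ assms] by auto
  from nrm_cmult[OF _ fg(1), of "1/2"] fg(2)
  show "(\<lambda>x. (f x + g x) / 2) \<in> Lp_space 2 M" "nrm 2 M (\<lambda>x. (f x + g x) / 2) \<le> (nrm 2 M f + nrm 2 M g) / 2"
    by (auto simp: norm_divide)
qed

lemma nrm_diff_power2:
  assumes f: "f \<in> Lp_space 2 M" and g: "g \<in> Lp_space 2 M"
  shows "(nrm 2 M (\<lambda>x. f x - g x))\<^sup>2 = (nrm 2 M f)\<^sup>2 - 2 * ip M f g + (nrm 2 M g)\<^sup>2"
proof -
  have d: "(\<lambda>x. f x - g x) \<in> Lp_space 2 M" by (rule Lp_diff(1)[OF _ f g]) simp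
  have "(nrm 2 M (\<lambda>x. f x - g x))\<^sup>2 = (ip M f f - ip M f g) - (ip M g f - ip M g g)"
    unfolding ip_self[symmetric] ip_add(3)[OF f g d] ip_add(4)[OF f g f] ip_add(4)[OF f g g] ..
  then show ?thesis unfolding ip_self ip_commute[of M g f] by linarith
qed

lemma parallelogram:
  assumes f: "f \<in> Lp_space 2 M" and g: "g \<in> Lp_space 2 M"
  shows "(nrm 2 M (\<lambda>x. f x - g x))\<^sup>2 = 2 * (nrm 2 M f)\<^sup>2 + 2 * (nrm 2 M g)\<^sup>2 - 4 * (nrm 2 M (\<lambda>x. (f x + g x) / 2))\<^sup>2"
proof -
  note m = L2_midpoint(1)[OF f g]
  have "(nrm 2 M (\<lambda>x. (f x + g x) / 2))\<^sup>2 = ((ip M f f + ip M f g) / 2 + (ip M g f + ip M g g) / 2) / 2"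
    unfolding ip_self[symmetric] ip_add(5)[OF f g m] ip_add(6)[OF f g f] ip_add(6)[OF f g g] ..
  then show ?thesis unfolding nrm_diff_power2[OF f g] ip_self ip_commute[of M g f] by (simp add: field_simps)
qed

text \<open>Elements of these hulls of nearly minimal norm form a Cauchy sequence by the parallelogram law,
  and every functional that converges along \<open>G\<close> has the same limit along them. This yields weak
  limits without the representation theorem for functionals.\<close>

inductive tail_hull :: "(nat \<Rightarrow> 'a \<Rightarrow> complex) \<Rightarrow> nat \<Rightarrow> ('a \<Rightarrow> complex) \<Rightarrow> bool" for G n where
  base: "n \<le> k \<Longrightarrow> tail_hull G n (G k)"
| mid: "tail_hull G n u \<Longrightarrow> tail_hull G n v \<Longrightarrow> tail_hull G n (\<lambda>x. (u x + v x) / 2)"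

lemma tail_hull_mono: "tail_hull G m u \<Longrightarrow> n \<le> m \<Longrightarrow> tail_hull G n u"
proof (induction rule: tail_hull.induct)
  case (base k)
  then show ?case by (intro tail_hull.base) simp
next
  case (mid u v)
  then show ?case by (intro tail_hull.mid[of G n u v]) auto
qed

context
  fixes M :: "'a measure" and G :: "nat \<Rightarrow> 'a \<Rightarrow> complex" and B :: real
  assumes G: "\<And>n. G n \<in> Lp_space 2 M" "\<And>n. nrm 2 M (G n) \<le> B"
begin

lemma tail_hull_L2: "tail_hull G n u \<Longrightarrow> u \<in> Lp_space 2 M \<and> nrm 2 M u \<le> B"
proof (induction rule: tail_hull.induct)
  case (mid u v)
  then show ?case using L2_midpoint[of u M v] by auto
qed (use G in auto)

lemma tail_hull_functional:
  assumes "tail_hull G n u" and h: "h \<in> Lp_space 2 M" and b: "\<And>k. n \<le> k \<Longrightarrow> \<bar>ip M (G k) h - b\<bar> \<le> e"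
  shows "\<bar>ip M u h - b\<bar> \<le> e"
  using assms(1)
proof (induction rule: tail_hull.induct)
  case (mid u v)
  then have "ip M (\<lambda>x. (u x + v x) / 2) h = (ip M u h + ip M v h) / 2"
    using tail_hull_L2 h by (intro ip_add) auto
  then show ?case using mid.IH by (simp add: abs_le_iff field_simps)
qed (use b in auto)

text \<open>The infimum \<open>d n\<close> of the squared norm over the hull of the n-th tail
  increases with n, since the hulls shrink, and is bounded by B^2. For m \<le> n the midpoint of two
  near-minimal elements still lies in the m-th hull, so its squared norm is at least
  \<open>d m\<close>, and the parallelogram law makes their distance small.\<close>

lemma tail_hull_limit:
  obtains f c where "f \<in> Lp_space 2 M" "\<And>n. tail_hull G n (c n)" "(\<lambda>n. nrm 2 M (\<lambda>x. c n x - f x)) \<longlonglongrightarrow> 0"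
proof -
  define S where "S n = {(nrm 2 M u)\<^sup>2 | u. tail_hull G n u}" for n
  have Sne: "S n \<noteq> {}" for n unfolding S_def using tail_hull.base[of n n G] by blast
  have Sbdd: "bdd_below (S n)" for n unfolding S_def by (auto intro!: bdd_belowI[of _ 0])
  define d where "d n = Inf (S n)" for n
  have dle: "d n \<le> (nrm 2 M u)\<^sup>2" if "tail_hull G n u" for n u
    unfolding d_def using that Sbdd by (intro cInf_lower) (auto simp: S_def)
  have "\<exists>u. tail_hull G n u \<and> (nrm 2 M u)\<^sup>2 < d n + 1 / real (Suc n)" for n
  proof -
    have "\<exists>x\<in>S n. x < d n + 1 / real (Suc n)"
      unfolding d_def using Sne Sbdd by (subst cInf_less_iff[symmetric]) auto
    then show ?thesis by (auto simp: S_def)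
  qed
  then obtain c where c: "\<And>n. tail_hull G n (c n)" "\<And>n. (nrm 2 M (c n))\<^sup>2 < d n + 1 / real (Suc n)" by metis
  have dmono: "d m \<le> d n" if "m \<le> n" for m n
    unfolding d_def using that Sne Sbdd by (intro cInf_superset_mono) (auto simp: S_def intro: tail_hull_mono)
  have dB: "d n \<le> B\<^sup>2" for n
    using dle[OF tail_hull.base[of n n G]] power_mono[OF G(2)[of n], of 2] by simp
  have "incseq d" using dmono by (simp add: incseq_def)
  with incseq_convergent[of d "B\<^sup>2"] dB obtain l where "d \<longlonglongrightarrow> l" by blast
  then have "convergent d" by (rule convergentI)
  then have Cd: "Cauchy d" by (rule convergent_Cauchy)
  have L: "c n \<in> Lp_space 2 M" for n using tail_hull_L2[OF c(1)] by auto
  have arith: "w \<le> 2 * \<bar>u - v\<bar> + 4 * a"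
    if "u \<le> q" "a' \<le> a" "w = 2 * x + 2 * y - 4 * q" "x < u + a" "y < v + a'" for u v w x y q a a' :: real
  proof -
    have "w \<le> 2 * (v - u) + 4 * a" using that by auto
    then show ?thesis using abs_ge_minus_self[of "u - v"] by auto
  qed
  have est: "(nrm 2 M (\<lambda>x. c m x - c n x))\<^sup>2 \<le> 2 * \<bar>d m - d n\<bar> + 4 / real (Suc (min m n))" for m n
  proof -
    have main: "(nrm 2 M (\<lambda>x. c m x - c n x))\<^sup>2 \<le> 2 * \<bar>d m - d n\<bar> + 4 / real (Suc m)" if "m \<le> n" for m n
    proof -
      have "tail_hull G m (\<lambda>x. (c m x + c n x) / 2)"
        by (rule tail_hull.mid[OF c(1) tail_hull_mono[OF c(1) that]])
      from dle[OF this] have "d m \<le> (nrm 2 M (\<lambda>x. (c m x + c n x) / 2))\<^sup>2" .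
      moreover have "1 / real (Suc n) \<le> 1 / real (Suc m)" using that by (intro divide_left_mono) auto
      ultimately show ?thesis
        using arith[OF _ _ parallelogram[OF L L, of m n] c(2)[of m] c(2)[of n]] by simp
    qed
    show ?thesis
    proof (cases "m \<le> n")
      case True then show ?thesis using main[OF True] by (simp only: min_absorb1)
    next
      case False
      then have "n \<le> m" by simp
      from main[OF this] this show ?thesis
        by (simp only: min_absorb2 nrm_minus_commute[of 2 M "c n" "c m"] abs_minus_commute[of "d n" "d m"])
    qed
  qed
  have "\<exists>N. \<forall>m\<ge>N. \<forall>n\<ge>N. nrm 2 M (\<lambda>x. c m x - c n x) < e" if e: "e > 0" for e
  proof -
    from metric_CauchyD[OF Cd, of "e\<^sup>2 / 8"] e obtain N1 where N1: "\<And>m n. m \<ge> N1 \<Longrightarrow> n \<ge> N1 \<Longrightarrow> \<bar>d m - d n\<bar> < e\<^sup>2 / 8"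
      by (auto simp: dist_real_def)
    obtain N2 :: nat where N2: "8 / e\<^sup>2 < real N2" using reals_Archimedean2 by blast
    show ?thesis
    proof (intro exI[of _ "max N1 N2"] allI impI)
      fix m n assume mn: "max N1 N2 \<le> m" "max N1 N2 \<le> n"
      have "4 / real (Suc (min m n)) < e\<^sup>2 / 2"
      proof -
        have "real N2 < real (Suc (min m n))" using mn by (intro of_nat_less_iff[THEN iffD2]) auto
        then have "8 / e\<^sup>2 < real (Suc (min m n))" using N2 by linarith
        then show ?thesis using e by (simp add: field_simps)
      qed
      moreover have "\<bar>d m - d n\<bar> < e\<^sup>2 / 8" using N1 mn by simp
      moreover have "a < x" if "q < x / 2" "r < x / 8" "a \<le> 2 * r + q" "0 < x" for a q r x :: real using that by auto
      ultimately have "(nrm 2 M (\<lambda>x. c m x - c n x))\<^sup>2 < e\<^sup>2" using est[of m n] e by (metis zero_less_power)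
      then show "nrm 2 M (\<lambda>x. c m x - c n x) < e" using e by (intro power2_less_imp_less[of _ e]) auto
    qed
  qed
  from Riesz_Fischer[OF _ L this] obtain f where "f \<in> Lp_space 2 M" "(\<lambda>n. nrm 2 M (\<lambda>x. c n x - f x)) \<longlonglongrightarrow> 0" by auto
  then show thesis using that c(1) by blast
qed

end

lemma ip_tendsto:
  assumes c: "\<And>n. c n \<in> Lp_space 2 M" "f \<in> Lp_space 2 M" "(\<lambda>n. nrm 2 M (\<lambda>x. c n x - f x)) \<longlonglongrightarrow> 0" and h: "h \<in> Lp_space 2 M"
  shows "(\<lambda>n. ip M (c n) h) \<longlonglongrightarrow> ip M f h"
proof -
  have "(\<lambda>n. ip M (c n) h - ip M f h) \<longlonglongrightarrow> 0"
  proof (rule Lim_null_comparison)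
    show "\<forall>\<^sub>F n in sequentially. norm (ip M (c n) h - ip M f h) \<le> nrm 2 M (\<lambda>x. c n x - f x) * nrm 2 M h"
    proof (intro always_eventually allI)
      fix n
      have "ip M (c n) h - ip M f h = ip M (\<lambda>x. c n x - f x) h" using ip_add(3)[OF c(1,2) h] by simp
      then show "norm (ip M (c n) h - ip M f h) \<le> nrm 2 M (\<lambda>x. c n x - f x) * nrm 2 M h"
        using ip_CS[OF Lp_diff(1)[OF _ c(1,2)] h, of n] by simp
    qed
    show "(\<lambda>n. nrm 2 M (\<lambda>x. c n x - f x) * nrm 2 M h) \<longlonglongrightarrow> 0"
      using tendsto_mult[OF c(3) tendsto_const, of "nrm 2 M h"] by simp
  qed
  then show ?thesis by (simp add: LIM_zero_iff)
qed

text \<open>A diagonal subsequence makes the pairings with every \<open>G m\<close> converge, and a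
  hull limit \<open>f\<close> has these limits as its pairings. If some \<open>h\<close> failed, a
  further subsequence would have a hull limit \<open>f'\<close> with a different value at
  \<open>h\<close>. But \<open>f\<close> and \<open>f'\<close> pair equally with all
  \<open>G m\<close>, hence with all hull elements, hence with \<open>f\<close> and
  \<open>f'\<close> themselves, which forces their distance to be 0.\<close>

lemma L2_weakly_compact:
  fixes G :: "nat \<Rightarrow> 'a \<Rightarrow> complex"
  assumes G: "\<And>n. G n \<in> Lp_space 2 M" "\<And>n. nrm 2 M (G n) \<le> B"
  obtains r f where "strict_mono r" "f \<in> Lp_space 2 M" "\<And>h. h \<in> Lp_space 2 M \<Longrightarrow> (\<lambda>n. ip M (G (r n)) h) \<longlonglongrightarrow> ip M f h"
proof -
  have bnd: "\<bar>ip M (G n) h\<bar> \<le> B * nrm 2 M h" if "h \<in> Lp_space 2 M" for n h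
    using ip_CS[OF G(1) that, of n] mult_right_mono[OF G(2) nrm_nonneg, of n 2 M h] by linarith
  have subseq: "\<exists>r'. strict_mono r' \<and> convergent (\<lambda>n. ip M (G (s (r' n))) h)" if h: "h \<in> Lp_space 2 M" for s :: "nat \<Rightarrow> nat" and h
  proof -
    have "bounded (range (\<lambda>n. ip M (G (s n)) h))"
      using bnd[OF h] by (intro boundedI[of _ "B * nrm 2 M h"]) auto
    from bounded_imp_convergent_subsequence[OF this]
    obtain l r' where "strict_mono r'" "((\<lambda>n. ip M (G (s n)) h) \<circ> r') \<longlonglongrightarrow> l" by auto
    then show ?thesis by (auto simp: comp_def convergent_def)
  qed
  interpret subseqs "\<lambda>m s. convergent (\<lambda>n. ip M (G (s n)) (G m))"
  proof
    fix m :: nat and s :: "nat \<Rightarrow> nat" assume "strict_mono s"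
    show "\<exists>r'. strict_mono r' \<and> convergent (\<lambda>n. ip M (G ((s \<circ> r') n)) (G m))"
      using subseq[OF G(1)] by simp
  qed
  define r where "r = diagseq"
  have r: "strict_mono r" unfolding r_def by (rule subseq_diagseq)
  have conv: "convergent (\<lambda>n. ip M (G (r n)) (G m))" for m
  proof -
    have "convergent (\<lambda>n. ip M (G ((diagseq \<circ> ((+) (Suc m))) n)) (G m))"
    proof (rule diagseq_holds)
      fix s r' :: "nat \<Rightarrow> nat" and n assume "strict_mono r'" "convergent (\<lambda>n'. ip M (G (s n')) (G n))"
      then show "convergent (\<lambda>n'. ip M (G ((s \<circ> r') n')) (G n))"
        using convergent_subseq_convergent[of "\<lambda>n'. ip M (G (s n')) (G n)" r'] by (simp add: comp_def)
    qed
    then have "convergent (\<lambda>n. ip M (G (r (n + Suc m))) (G m))" by (simp add: r_def add.commute)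
    then show ?thesis by (rule convergent_ignore_initial_segment[THEN iffD1])
  qed
  define a where "a m = lim (\<lambda>n. ip M (G (r n)) (G m))" for m
  have a: "(\<lambda>n. ip M (G (r n)) (G m)) \<longlonglongrightarrow> a m" for m
    unfolding a_def using conv by (simp add: convergent_LIMSEQ_iff)
  \<comment> \<open>Whenever the pairings with \<open>h\<close> converge along the chosen indices,
    any hull limit formed along the same indices has that limit as its pairing.\<close>
  have key: "ip M f' h = b"
    if s: "strict_mono s" and lim: "(\<lambda>n. ip M (G (r (s n))) h) \<longlonglongrightarrow> b" and h: "h \<in> Lp_space 2 M"
      and f': "f' \<in> Lp_space 2 M" and c: "\<And>n. tail_hull (\<lambda>n. G (r (s n))) n (c n)" "(\<lambda>n. nrm 2 M (\<lambda>x. c n x - f' x)) \<longlonglongrightarrow> 0"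
    for s :: "nat \<Rightarrow> nat" and h b f' c
  proof -
    have cL: "c n \<in> Lp_space 2 M" for n using tail_hull_L2[OF _ _ c(1), of M B] G by auto
    have "(\<lambda>n. ip M (c n) h) \<longlonglongrightarrow> b"
    proof (rule LIMSEQ_I)
      fix e :: real assume e: "e > 0"
      from LIMSEQ_D[OF lim, of "e/2"] e obtain N where N: "\<And>n. n \<ge> N \<Longrightarrow> \<bar>ip M (G (r (s n))) h - b\<bar> < e/2" by auto
      have "\<bar>ip M (c n) h - b\<bar> \<le> e/2" if "n \<ge> N" for n
        using that N G by (intro tail_hull_functional[OF _ _ c(1) h]) (auto intro: less_imp_le)
      then show "\<exists>N. \<forall>n\<ge>N. norm (ip M (c n) h - b) < e" using e by (intro exI[of _ N]) force
    qed
    with ip_tendsto[OF cL f' c(2) h] show ?thesis by (rule LIMSEQ_unique)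
  qed
  obtain f c where f: "f \<in> Lp_space 2 M" and c: "\<And>n. tail_hull (\<lambda>n. G (r n)) n (c n)" "(\<lambda>n. nrm 2 M (\<lambda>x. c n x - f x)) \<longlonglongrightarrow> 0"
    using tail_hull_limit[of "\<lambda>n. G (r n)" M B] G by auto
  have fa: "ip M f (G m) = a m" for m
    by (rule key[of "\<lambda>n. n", OF _ _ G(1) f, where c=c]) (use a c in \<open>auto simp: strict_mono_def\<close>)
  have "(\<lambda>n. ip M (G (r n)) h) \<longlonglongrightarrow> ip M f h" if h: "h \<in> Lp_space 2 M" for h
  proof (rule ccontr)
    assume "\<not> ?thesis"
    then obtain e where e: "e > 0" "\<And>N. \<exists>n\<ge>N. e \<le> \<bar>ip M (G (r n)) h - ip M f h\<bar>"
      unfolding LIMSEQ_iff by (auto simp: not_less)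
    then have "infinite {n. e \<le> \<bar>ip M (G (r n)) h - ip M f h\<bar>}"
      unfolding infinite_nat_iff_unbounded_le by auto
    from infinite_enumerate[OF this] obtain s :: "nat \<Rightarrow> nat" where s: "strict_mono s" "\<And>n. e \<le> \<bar>ip M (G (r (s n))) h - ip M f h\<bar>"
      by auto
    from subseq[OF h, of "\<lambda>n. r (s n)"] obtain t :: "nat \<Rightarrow> nat" and b where t: "strict_mono t" "(\<lambda>n. ip M (G (r (s (t n)))) h) \<longlonglongrightarrow> b"
      unfolding convergent_def by blast
    have st: "strict_mono (\<lambda>n. s (t n))" using s(1) t(1) by (auto simp: strict_mono_def)
    obtain f' c' where f': "f' \<in> Lp_space 2 M" and c': "\<And>n. tail_hull (\<lambda>n. G (r (s (t n)))) n (c' n)" "(\<lambda>n. nrm 2 M (\<lambda>x. c' n x - f' x)) \<longlonglongrightarrow> 0"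
      using tail_hull_limit[of "\<lambda>n. G (r (s (t n)))" M B] G by auto
    have fb: "ip M f' h = b" by (rule key[OF st t(2) h f' c'])
    have fa': "ip M f' (G m) = a m" for m
    proof (rule key[OF st _ G(1) f' c'])
      show "(\<lambda>n. ip M (G (r (s (t n)))) (G m)) \<longlonglongrightarrow> a m"
        using LIMSEQ_subseq_LIMSEQ[OF a st] by (simp add: comp_def)
    qed
    \<comment> \<open>The hull may be formed along any reindexing \<rho>, because the two limits
      agree on every single \<open>G m\<close>.\<close>
    have hull_eq: "ip M f u = ip M f' u" if "tail_hull (\<lambda>n. G (\<rho> n)) n u" for \<rho> :: "nat \<Rightarrow> nat" and n u
      using that
    proof (induction rule: tail_hull.induct)
      case (base k)
      then show ?case by (simp add: fa fa')
    next
      case (mid u v)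
      have "u \<in> Lp_space 2 M" "v \<in> Lp_space 2 M"
        using mid(1,2) tail_hull_L2[of "\<lambda>n. G (\<rho> n)" M B] G by auto
      then show ?case using mid.IH f f' by (simp add: ip_add)
    qed
    have lims: "(\<lambda>n. ip M F (C n)) \<longlonglongrightarrow> ip M F E"
      if "F \<in> Lp_space 2 M" "E \<in> Lp_space 2 M" "\<And>n. C n \<in> Lp_space 2 M" "(\<lambda>n. nrm 2 M (\<lambda>x. C n x - E x)) \<longlonglongrightarrow> 0" for F E C
      using ip_tendsto[OF that(3,2,4,1)] by (simp add: ip_commute[of M F])
    have cL: "c n \<in> Lp_space 2 M" "c' n \<in> Lp_space 2 M" for n
      using tail_hull_L2[OF _ _ c(1), of M B] tail_hull_L2[OF _ _ c'(1), of M B] G by auto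
    have 1: "ip M f f = ip M f' f"
      using lims[OF f f cL(1) c(2)] lims[OF f' f cL(1) c(2)] hull_eq[OF c(1)] LIMSEQ_unique by auto
    have 2: "ip M f f' = ip M f' f'"
      using lims[OF f f' cL(2) c'(2)] lims[OF f' f' cL(2) c'(2)] hull_eq[OF c'(1)] LIMSEQ_unique by auto
    have "(nrm 2 M (\<lambda>x. f x - f' x))\<^sup>2 = 0"
      using nrm_diff_power2[OF f f'] 1 2 by (simp add: ip_self[symmetric] ip_commute[of M f' f])
    then have "ip M f h - ip M f' h = 0"
      using ip_CS[OF Lp_diff(1)[OF _ f f'] h] ip_add(3)[OF f f' h] by simp
    then have "(\<lambda>n. \<bar>ip M (G (r (s (t n)))) h - ip M f h\<bar>) \<longlonglongrightarrow> \<bar>ip M f h - ip M f h\<bar>"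
      using t(2) fb by (intro tendsto_intros) simp
    then have "e \<le> \<bar>ip M f h - ip M f h\<bar>"
      using s(2) by (intro LIMSEQ_le_const) auto
    then show False using e(1) by simp
  qed
  then show thesis using that r f by blast
qed

text \<open>The imaginary part of the pairing with \<open>h\<close> is the real pairing with the
  multiple of \<open>h\<close> by the imaginary unit.\<close>

lemma L2_weakly_compact_complex:
  fixes G :: "nat \<Rightarrow> 'a \<Rightarrow> complex"
  assumes G: "\<And>n. G n \<in> Lp_space 2 M" "\<And>n. nrm 2 M (G n) \<le> B"
  obtains r f where "strict_mono r" "f \<in> Lp_space 2 M"
    "\<And>h. h \<in> Lp_space 2 M \<Longrightarrow> (\<lambda>n. \<integral>x. G (r n) x * cnj (h x) \<partial>M) \<longlonglongrightarrow> (\<integral>x. f x * cnj (h x) \<partial>M)"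
proof -
  obtain r f where r: "strict_mono r" and f: "f \<in> Lp_space 2 M"
    and w: "\<And>h. h \<in> Lp_space 2 M \<Longrightarrow> (\<lambda>n. ip M (G (r n)) h) \<longlonglongrightarrow> ip M f h"
    by (rule L2_weakly_compact[OF G]) (rule that)
  have eq: "(\<integral>x. u x * cnj (h x) \<partial>M) = Complex (ip M u h) (ip M u (\<lambda>x. \<i> * h x))"
    if "u \<in> Lp_space 2 M" "h \<in> Lp_space 2 M" for u h
  proof (rule complex_eqI)
    have I: "integrable M (\<lambda>x. u x * cnj (h x))" by (rule L2_mult_integrable[OF that])
    show "Re (\<integral>x. u x * cnj (h x) \<partial>M) = Re (Complex (ip M u h) (ip M u (\<lambda>x. \<i> * h x)))"
      using integral_Re[OF I] by (simp add: ip_def)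
    show "Im (\<integral>x. u x * cnj (h x) \<partial>M) = Im (Complex (ip M u h) (ip M u (\<lambda>x. \<i> * h x)))"
      using integral_Im[OF I] by (simp add: ip_def algebra_simps)
  qed
  have "(\<lambda>n. \<integral>x. G (r n) x * cnj (h x) \<partial>M) \<longlonglongrightarrow> (\<integral>x. f x * cnj (h x) \<partial>M)" if h: "h \<in> Lp_space 2 M" for h
    unfolding eq[OF f h] eq[OF G(1) h] using nrm_cmult(1)[OF _ h, of \<i>]
    by (intro tendsto_Complex w h) auto
  then show thesis using that r f by blast
qed

section \<open>Local smoothing and convergence almost everywhere\<close>

lemma borel_measurable_cutoff [measurable]:
  "(\<lambda>y::'a::euclidean_space. complex_of_real (indicator (cball 0 R) y)) \<in> borel_measurable borel"
  by (intro measurable_compose[OF borel_measurable_indicator borel_measurable_of_real]) auto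

lemma cutoff_L2: "(\<lambda>y::'a::euclidean_space. complex_of_real (indicator (cball 0 R) y)) \<in> Lp_space 2 hyp_measure"
proof -
  have "integrable hyp_measure (\<lambda>y::'a. (cmod (complex_of_real (indicator (cball 0 R) y)))\<^sup>2)"
    by (rule Bochner_Integration.integrable_bound[OF integrable_indicator_cball[of R]]) (auto simp: indicator_def)
  then show ?thesis by (simp add: Lp_space_2_iff)
qed

text \<open>On a ball, where the invariant measure is finite, |f| \<le> |f|^2 + 1 turns square
  integrability into integrability.\<close>

lemma nice_cutoff:
  fixes f :: "'a::euclidean_space \<Rightarrow> complex"
  assumes f: "f \<in> Lp_space 2 hyp_measure"
  shows "nice (\<lambda>y. f y * of_real (indicator (cball 0 R) y))"
    "(\<lambda>R::nat. nrm 2 hyp_measure (\<lambda>y. f y * of_real (indicator (cball 0 (real R)) y) - f y)) \<longlonglongrightarrow> 0"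
proof -
  have [measurable]: "f \<in> borel_measurable borel" using Lp_space_measurable[OF f] by simp
  have f2: "integrable hyp_measure (\<lambda>x. (cmod (f x))\<^sup>2)" using f by (auto simp: Lp_space_2_iff)
  have "integrable hyp_measure (\<lambda>y. f y * of_real (indicator (cball 0 R) y))"
  proof (rule Bochner_Integration.integrable_bound)
    show "integrable hyp_measure (\<lambda>y. (cmod (f y))\<^sup>2 + indicator (cball 0 R) y)"
      using f2 integrable_indicator_cball by (intro Bochner_Integration.integrable_add)
    have "a \<le> a\<^sup>2 + 1" for a :: real
    proof -
      have "2 * a \<le> a\<^sup>2 + 1" using sum_squares_bound[of a 1] by simp
      with zero_le_power2[of a] show ?thesis by linarith
    qed
    then show "AE y in hyp_measure. norm (f y * of_real (indicator (cball 0 R) y)) \<le> norm ((cmod (f y))\<^sup>2 + indicator (cball 0 R) y)"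
      by (auto simp: indicator_def norm_mult)
  qed simp
  moreover have "(\<lambda>y. f y * of_real (indicator (cball 0 R) y)) \<in> Lp_space 2 hyp_measure"
    by (rule nrm_mono(1)[OF _ f]) (auto simp: indicator_def norm_mult)
  ultimately show "nice (\<lambda>y. f y * of_real (indicator (cball 0 R) y))" by (simp add: nice_def)
  show "(\<lambda>R::nat. nrm 2 hyp_measure (\<lambda>y. f y * of_real (indicator (cball 0 (real R)) y) - f y)) \<longlonglongrightarrow> 0"
  proof (rule nrm_dominated(3))
    show "AE y in hyp_measure. (\<lambda>R::nat. f y * of_real (indicator (cball 0 (real R)) y)) \<longlonglongrightarrow> f y"
    proof (intro AE_I2)
      fix y :: 'a
      obtain N :: nat where "norm y \<le> real N" using real_arch_simple by blast
      then have "\<forall>\<^sub>F R in sequentially. f y * of_real (indicator (cball 0 (real R)) y) = f y"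
        by (intro eventually_sequentiallyI[of N]) (auto simp: indicator_def)
      then show "(\<lambda>R::nat. f y * of_real (indicator (cball 0 (real R)) y)) \<longlonglongrightarrow> f y"
        by (rule tendsto_eventually)
    qed
    show "integrable hyp_measure (\<lambda>x. cmod (f x) powr 2)" using f2 by simp
  qed (auto simp: indicator_def norm_mult)
qed

lemma nice_diff: "nice f \<Longrightarrow> nice g \<Longrightarrow> nice (\<lambda>y. f y - g y)"
  unfolding nice_def by (intro conjI Bochner_Integration.integrable_diff Lp_diff(1)) auto

lemma ext_schwartz_diff:
  fixes f g :: "'a::euclidean_space \<Rightarrow> complex"
  assumes "nice f" "nice g"
  shows "ext_schwartz (\<lambda>y. f y - g y) z = ext_schwartz f z - ext_schwartz g z"
proof -
  have "integrable hyp_measure (\<lambda>y. iexp (z \<bullet> pos y) * f y)" "integrable hyp_measure (\<lambda>y. iexp (z \<bullet> pos y) * g y)"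
    using assms by (auto intro!: integrable_iexp_mult simp: nice_def)
  then show ?thesis unfolding ext_schwartz_eq right_diff_distrib by (rule Bochner_Integration.integral_diff)
qed

text \<open>The density \<open>1 / \<langle>y\<rangle>\<close> of the invariant measure is at most \<open>1 / R\<close> on the support of \<open>g\<close>.\<close>

lemma local_smoothing:
  fixes g :: "'a::euclidean_space \<Rightarrow> complex"
  assumes g: "nice g" and R: "0 < R" and g0: "\<And>y. norm y \<le> R \<Longrightarrow> g y = 0"
  shows "(\<integral>\<^sup>+x. ennreal ((cmod (ext_schwartz g (x, t)))\<^sup>2) \<partial>lborel) \<le> ennreal ((2 * pi) ^ DIM('a) * ((nrm 2 hyp_measure g)\<^sup>2 / R))"
proof -
  have [measurable]: "g \<in> borel_measurable borel" using nice_measurable[OF g] .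
  have gi: "integrable hyp_measure g" and g2: "integrable hyp_measure (\<lambda>x. (cmod (g x))\<^sup>2)"
    using g by (auto simp: nice_def Lp_space_2_iff)
  \<comment> \<open>At a fixed time the time phase has modulus 1 and joins the amplitude; what
    remains is a Fourier integral in space, with the identity as phase map and 1 /
    \<open>japanese\<close> as density.\<close>
  define F where "F = (\<lambda>y. iexp (t * japanese y) * g y)"
  have nF: "cmod (F y) = cmod (g y)" for y by (simp add: F_def norm_mult)
  have eq: "ext_schwartz g (x, t) = (\<integral>y. iexp (x \<bullet> y) * F y \<partial>hyp_measure)" for x
    by (simp add: ext_schwartz_def F_def mult.assoc)
  have le1: "1 / japanese y \<le> 1" for y :: 'a using japanese_ge_1[of y] by simp
  have "(\<integral>\<^sup>+x. ennreal ((cmod (\<integral>y. iexp (x \<bullet> y) * F y \<partial>hyp_measure))\<^sup>2) \<partial>lborel)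
    \<le> ennreal ((2 * pi) ^ DIM('a) * (\<integral>y. (cmod (F y))\<^sup>2 * (1 / japanese y) \<partial>hyp_measure))"
  proof (rule hyp.oscillatory_L2)
    show "integrable hyp_measure F" unfolding F_def by (intro integrable_iexp_mult gi) simp
    show "integrable hyp_measure (\<lambda>x. (cmod (F x))\<^sup>2)" using g2 by (simp add: nF)
    show "continuous_on UNIV (\<lambda>y::'a. 1 / japanese y)" by (intro continuous_intros) auto
    show "1 / japanese P \<le> 1" for P :: 'a by (rule le1)
    show "(\<integral>\<^sup>+x. G x \<partial>hyp_measure) \<le> (\<integral>\<^sup>+Q. G Q * ennreal (1 / japanese Q) \<partial>lborel)" if "G \<in> borel_measurable borel" for G :: "'a \<Rightarrow> ennreal"
      unfolding nn_integral_hyp_measure[OF that] by (simp add: mult.commute)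
  qed auto
  also have "(\<integral>y. (cmod (F y))\<^sup>2 * (1 / japanese y) \<partial>hyp_measure) \<le> (\<integral>y. (cmod (g y))\<^sup>2 / R \<partial>hyp_measure)"
  proof (rule integral_mono)
    show "integrable hyp_measure (\<lambda>y. (cmod (F y))\<^sup>2 * (1 / japanese y))"
    proof (rule Bochner_Integration.integrable_bound[OF g2])
      show "AE y in hyp_measure. norm ((cmod (F y))\<^sup>2 * (1 / japanese y)) \<le> norm ((cmod (g y))\<^sup>2)"
        using mult_left_mono[OF le1 zero_le_power2] by (auto simp: nF)
    qed (simp add: nF)
    show "integrable hyp_measure (\<lambda>y. (cmod (g y))\<^sup>2 / R)" using g2 by simp
    show "(cmod (F y))\<^sup>2 * (1 / japanese y) \<le> (cmod (g y))\<^sup>2 / R" for y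
    proof (cases "norm y \<le> R")
      case False
      then have "1 / japanese y \<le> 1 / R" using norm_less_japanese[of y] R by (intro divide_left_mono) auto
      then show ?thesis using mult_left_mono[of "1 / japanese y" "1 / R" "(cmod (g y))\<^sup>2"] by (simp add: nF)
    qed (simp add: nF g0)
  qed
  then have "ennreal ((2 * pi) ^ DIM('a) * (\<integral>y. (cmod (F y))\<^sup>2 * (1 / japanese y) \<partial>hyp_measure)) \<le>
     ennreal ((2 * pi) ^ DIM('a) * ((nrm 2 hyp_measure g)\<^sup>2 / R))"
    by (intro ennreal_leI mult_left_mono) (simp_all add: nrm_2_power2)
  finally show ?thesis by (simp add: eq)
qed

text \<open>A finite measure with the same null sets as Lebesgue measure: convergence in its L1
  yields almost everywhere convergence on all of space-time at once, and bounded functions are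
  integrable.\<close>

definition gauss_measure :: "'b::euclidean_space measure" where
  "gauss_measure = density lborel (\<lambda>z. ennreal (exp (- (norm z)\<^sup>2 / 2)))"

lemma sets_gauss_measure [simp, measurable_cong]: "sets gauss_measure = sets borel"
  by (simp add: gauss_measure_def)

lemma space_gauss_measure [simp]: "space gauss_measure = UNIV"
  by (simp add: gauss_measure_def)

lemma finite_gauss_measure: "finite_measure (gauss_measure :: 'b::euclidean_space measure)"
proof
  have "emeasure (gauss_measure :: 'b measure) (space gauss_measure) = (\<integral>\<^sup>+z. ennreal (exp (- (norm (z::'b))\<^sup>2 / 2)) \<partial>lborel)"
    by (simp add: gauss_measure_def emeasure_density)
  also have "\<dots> < \<infinity>"
    using gaussian_integral(1)[of 1, where 'b='b] by (simp add: integrable_iff_bounded)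
  finally show "emeasure (gauss_measure :: 'b measure) (space gauss_measure) \<noteq> \<infinity>" by simp
qed

lemma AE_gauss_measure:
  fixes P :: "'b::euclidean_space \<Rightarrow> bool"
  shows "(AE z in gauss_measure. P z) \<longleftrightarrow> (AE z in lborel. P z)"
  unfolding gauss_measure_def by (subst AE_density) auto

text \<open>The spatial estimate is uniform in time, so the Gaussian weight is needed in
  \<open>t\<close> only; its integral supplies the factor sqrt (2 pi).\<close>

lemma local_smoothing_gauss:
  fixes g :: "'a::euclidean_space \<Rightarrow> complex"
  assumes g: "nice g" and R: "0 < R" and g0: "\<And>y. norm y \<le> R \<Longrightarrow> g y = 0"
  shows "(\<integral>\<^sup>+z. ennreal ((cmod (ext_schwartz g z))\<^sup>2) \<partial>gauss_measure) \<le> ennreal (sqrt (2 * pi) * (2 * pi) ^ DIM('a) * ((nrm 2 hyp_measure g)\<^sup>2 / R))"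
proof -
  have [measurable]: "g \<in> borel_measurable borel" using nice_measurable[OF g] .
  note borel_measurable_fst_snd [measurable]
  have "(\<integral>\<^sup>+z. ennreal ((cmod (ext_schwartz g z))\<^sup>2) \<partial>gauss_measure) =
     (\<integral>\<^sup>+z. ennreal (exp (- (norm z)\<^sup>2 / 2)) * ennreal ((cmod (ext_schwartz g z))\<^sup>2) \<partial>lborel)"
    unfolding gauss_measure_def by (rule nn_integral_density) auto
  also have "\<dots> \<le> (\<integral>\<^sup>+z. ennreal (exp (- (snd z)\<^sup>2 / 2)) * ennreal ((cmod (ext_schwartz g z))\<^sup>2) \<partial>lborel)"
  proof (intro nn_integral_mono mult_right_mono ennreal_leI)
    fix z :: "'a \<times> real"
    have "(snd z)\<^sup>2 \<le> (norm z)\<^sup>2" by (cases z) (simp add: norm_Pair)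
    then show "exp (- (norm z)\<^sup>2 / 2) \<le> exp (- (snd z)\<^sup>2 / 2)" by simp
  qed auto
  also have "\<dots> = (\<integral>\<^sup>+t. \<integral>\<^sup>+x. ennreal (exp (- t\<^sup>2 / 2)) * ennreal ((cmod (ext_schwartz g (x, t)))\<^sup>2) \<partial>lborel \<partial>lborel)"
    by (subst lborel_prod[symmetric], subst lborel_pair.nn_integral_snd[symmetric]) (auto simp: lborel_prod borel_prod)
  also have "\<dots> \<le> (\<integral>\<^sup>+t. ennreal (exp (- t\<^sup>2 / 2)) * ennreal ((2 * pi) ^ DIM('a) * ((nrm 2 hyp_measure g)\<^sup>2 / R)) \<partial>lborel)"
  proof (rule nn_integral_mono)
    fix t :: real
    have [measurable]: "(\<lambda>x. ext_schwartz g (x, t)) \<in> borel_measurable borel"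
      by (rule measurable_compose[OF _ ext_schwartz_measurable]) auto
    show "(\<integral>\<^sup>+x. ennreal (exp (- t\<^sup>2 / 2)) * ennreal ((cmod (ext_schwartz g (x, t)))\<^sup>2) \<partial>lborel)
      \<le> ennreal (exp (- t\<^sup>2 / 2)) * ennreal ((2 * pi) ^ DIM('a) * ((nrm 2 hyp_measure g)\<^sup>2 / R))"
      by (subst nn_integral_cmult, simp, rule mult_left_mono[OF local_smoothing[OF g R g0]]) auto
  qed
  also have "\<dots> = (\<integral>\<^sup>+t. ennreal (exp (- (t::real)\<^sup>2 / 2)) \<partial>lborel) * ennreal ((2 * pi) ^ DIM('a) * ((nrm 2 hyp_measure g)\<^sup>2 / R))"
    by (rule nn_integral_multc) auto
  also have "(\<integral>\<^sup>+t. ennreal (exp (- (t::real)\<^sup>2 / 2)) \<partial>lborel) = ennreal (sqrt (2 * pi))"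
    using gaussian_integral[of 1, where 'b=real] by (simp add: nn_integral_eq_integral)
  also have "ennreal (sqrt (2 * pi)) * ennreal ((2 * pi) ^ DIM('a) * ((nrm 2 hyp_measure g)\<^sup>2 / R)) =
      ennreal (sqrt (2 * pi) * (2 * pi) ^ DIM('a) * ((nrm 2 hyp_measure g)\<^sup>2 / R))"
    using R by (simp add: ennreal_mult[symmetric] mult.assoc)
  finally show ?thesis .
qed

text \<open>For bounded frequencies the value of the extension at a point is the pairing with one
  fixed L2 function, so weak convergence gives pointwise convergence.\<close>

lemma ext_cutoff_tendsto:
  fixes f :: "'a::euclidean_space \<Rightarrow> complex"
  assumes g: "\<And>n. g n \<in> Lp_space 2 hyp_measure" and f: "f \<in> Lp_space 2 hyp_measure"
    and weak: "\<And>h. h \<in> Lp_space 2 hyp_measure \<Longrightarrow> (\<lambda>n. \<integral>y. g n y * cnj (h y) \<partial>hyp_measure) \<longlonglongrightarrow> (\<integral>y. f y * cnj (h y) \<partial>hyp_measure)"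
  shows "(\<lambda>n. ext_schwartz (\<lambda>y. g n y * of_real (indicator (cball 0 R) y)) z) \<longlonglongrightarrow> ext_schwartz (\<lambda>y. f y * of_real (indicator (cball 0 R) y)) z"
proof -
  define h where "h = (\<lambda>y. cnj (iexp (z \<bullet> pos y)) * complex_of_real (indicator (cball 0 R) y))"
  have cnjm [measurable]: "cnj \<in> borel_measurable borel" by (intro borel_measurable_continuous_onI continuous_intros)
  have [measurable]: "h \<in> borel_measurable borel" unfolding h_def by measurable
  have "integrable hyp_measure (\<lambda>y. (cmod (h y))\<^sup>2)"
    by (rule Bochner_Integration.integrable_bound[OF integrable_indicator_cball[of R]])
      (auto simp: h_def norm_mult indicator_def)
  then have h: "h \<in> Lp_space 2 hyp_measure" by (auto simp: Lp_space_2_iff)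
  have "ext_schwartz (\<lambda>y. u y * of_real (indicator (cball 0 R) y)) z = (\<integral>y. u y * cnj (h y) \<partial>hyp_measure)" for u
    unfolding ext_schwartz_eq by (intro Bochner_Integration.integral_cong refl) (simp add: h_def mult_ac)
  with weak[OF h] show ?thesis by simp
qed

text \<open>Cauchy-Schwarz against the indicator of the ball. The bound is uniform over points and
  over norm-bounded families and serves as dominating constant.\<close>

lemma ext_cutoff_bounded:
  obtains C where "\<And>g z. g \<in> Lp_space 2 hyp_measure \<Longrightarrow> nrm 2 hyp_measure g \<le> B \<Longrightarrow>
     cmod (ext_schwartz (\<lambda>y::'a::euclidean_space. g y * of_real (indicator (cball 0 R) y)) z) \<le> C"
proof -
  define I :: "'a \<Rightarrow> complex" where "I = (\<lambda>y. of_real (indicator (cball 0 R) y))"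
  have I: "I \<in> Lp_space 2 hyp_measure" unfolding I_def by (rule cutoff_L2)
  have "cmod (ext_schwartz (\<lambda>y::'a. g y * of_real (indicator (cball 0 R) y)) z) \<le> B * nrm 2 hyp_measure I"
    if g: "g \<in> Lp_space 2 hyp_measure" "nrm 2 hyp_measure g \<le> B" for g z
  proof -
    have "cmod (ext_schwartz (\<lambda>y::'a. g y * of_real (indicator (cball 0 R) y)) z) \<le> (\<integral>y. norm (iexp (z \<bullet> pos y) * (g y * of_real (indicator (cball 0 R) y))) \<partial>hyp_measure)"
      unfolding ext_schwartz_eq by (rule integral_norm_bound)
    also have "\<dots> = (\<integral>y. cmod (g y) * cmod (I y) \<partial>hyp_measure)" by (simp add: norm_mult I_def)
    also have "\<dots> \<le> nrm 2 hyp_measure g * nrm 2 hyp_measure I" by (rule Cauchy_Schwarz_L2[OF g(1) I])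
    also have "\<dots> \<le> B * nrm 2 hyp_measure I" using g(2) by (intro mult_right_mono) auto
    finally show ?thesis .
  qed
  then show thesis using that by blast
qed

text \<open>Frequencies above \<open>R\<close> contribute O(R^(-1/2)) uniformly in n by local
  smoothing, while those below converge pointwise by weak convergence. \<open>F\<close> stands for
  the extension of \<open>f\<close>, which is known only as a limit in norm; this is why its
  relation to \<open>f\<close> is stated through cutoffs along the subsequence
  \<open>\<kappa>\<close>.\<close>

lemma extension_AE_convergent:
  fixes f :: "'a::euclidean_space \<Rightarrow> complex" and F :: "'a \<times> real \<Rightarrow> complex"
  assumes g: "\<And>n. nice (g n)" "\<And>n. nrm 2 hyp_measure (g n) \<le> B" and f: "f \<in> Lp_space 2 hyp_measure"
    and weak: "\<And>h. h \<in> Lp_space 2 hyp_measure \<Longrightarrow> (\<lambda>n. \<integral>y. g n y * cnj (h y) \<partial>hyp_measure) \<longlonglongrightarrow> (\<integral>y. f y * cnj (h y) \<partial>hyp_measure)"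
    and F: "F \<in> borel_measurable borel" and \<kappa>: "strict_mono (\<kappa> :: nat \<Rightarrow> nat)"
    and Fl: "AE z in lborel. (\<lambda>j. ext_schwartz (\<lambda>y. f y * of_real (indicator (cball 0 (real (\<kappa> j))) y)) z) \<longlonglongrightarrow> F z"
  obtains r where "strict_mono r" "AE z in lborel. (\<lambda>n. ext_schwartz (g (r n)) z) \<longlonglongrightarrow> F z"
proof -
  interpret gm: finite_measure "gauss_measure :: ('a \<times> real) measure" by (rule finite_gauss_measure)
  note [measurable] = F
  have [measurable]: "f \<in> borel_measurable borel" using Lp_space_measurable[OF f] by simp
  have [measurable]: "g n \<in> borel_measurable borel" for n using nice_measurable[OF g(1)] .
  have gL: "g n \<in> Lp_space 2 hyp_measure" for n using g(1) by (simp add: nice_def)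
  define lo where "lo R u = (\<lambda>y::'a. u y * complex_of_real (indicator (cball 0 R) y))" for R :: real and u
  have [measurable]: "lo R u \<in> borel_measurable borel" if [measurable]: "u \<in> borel_measurable borel" for R u
    unfolding lo_def by measurable
  have lo: "nice (lo R u)" if "u \<in> Lp_space 2 hyp_measure" for R u
    unfolding lo_def by (rule nice_cutoff(1)[OF that])
  \<comment> \<open>Truncation at 1 makes the distance integrable for any measurable
    \<open>F\<close> and does not affect the statement that it tends to 0.\<close>
  define D where "D n z = min 1 (cmod (ext_schwartz (g n) z - F z))" for n z
  have [measurable]: "D n \<in> borel_measurable borel" for n unfolding D_def by measurable
  have D01: "0 \<le> D n z" "D n z \<le> 1" for n z by (auto simp: D_def)
  have Dint: "integrable gauss_measure (D n)" for n
    by (rule gm.integrable_const_bound[of _ 1]) (use D01 in auto)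
  define C where "C = sqrt (2 * pi) * (2 * pi) ^ DIM('a) * B\<^sup>2"
  have C0: "0 \<le> C" by (simp add: C_def)
  define \<mu> where "\<mu> = measure gauss_measure (UNIV :: ('a \<times> real) set)"
  have high: "integrable gauss_measure (\<lambda>z. cmod (ext_schwartz (g n) z - ext_schwartz (lo R (g n)) z))"
    "(\<integral>z. cmod (ext_schwartz (g n) z - ext_schwartz (lo R (g n)) z) \<partial>gauss_measure) \<le> (C + \<mu>) / sqrt R" if R: "0 < R" for n R
  proof -
    define u where "u = (\<lambda>y. g n y - lo R (g n) y)"
    have u: "nice u" unfolding u_def by (rule nice_diff[OF g(1) lo[OF gL]])
    have eq: "ext_schwartz (g n) z - ext_schwartz (lo R (g n)) z = ext_schwartz u z" for z
      unfolding u_def by (rule ext_schwartz_diff[OF g(1) lo[OF gL], symmetric])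
    have [measurable]: "u \<in> borel_measurable borel" by (rule nice_measurable[OF u])
    have nu: "nrm 2 hyp_measure u \<le> B"
      by (rule order_trans[OF nrm_mono(2)[OF _ gL] g(2)]) (auto simp: u_def lo_def indicator_def)
    have "(\<integral>\<^sup>+z. ennreal ((cmod (ext_schwartz u z))\<^sup>2) \<partial>gauss_measure) \<le> ennreal (sqrt (2 * pi) * (2 * pi) ^ DIM('a) * ((nrm 2 hyp_measure u)\<^sup>2 / R))"
      by (rule local_smoothing_gauss[OF u R]) (simp add: u_def lo_def)
    also have "\<dots> \<le> ennreal (C / R)"
      using power_mono[OF nu, of 2] R unfolding C_def by (intro ennreal_leI) (simp add: mult_left_mono divide_right_mono)
    finally have le: "(\<integral>\<^sup>+z. ennreal ((cmod (ext_schwartz u z))\<^sup>2) \<partial>gauss_measure) \<le> ennreal (C / R)" .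
    have I2: "integrable gauss_measure (\<lambda>z. (cmod (ext_schwartz u z))\<^sup>2)"
    proof (rule integrableI_bounded)
      show "(\<integral>\<^sup>+z. ennreal (norm ((cmod (ext_schwartz u z))\<^sup>2)) \<partial>gauss_measure) < \<infinity>"
        using le by (simp add: le_less_trans)
    qed measurable
    have I2le: "(\<integral>z. (cmod (ext_schwartz u z))\<^sup>2 \<partial>gauss_measure) \<le> C / R"
      using le I2 C0 R by (simp add: nn_integral_eq_integral)
    \<comment> \<open>The weights balance the two terms: the integral of the square is O(1/R), so
      both contributions are of order R^(-1/2).\<close>
    have pt: "a \<le> sqrt R * a\<^sup>2 + 1 / sqrt R" for a :: real
    proof -
      have "2 * (sqrt R * a) * 1 \<le> (sqrt R * a)\<^sup>2 + 1\<^sup>2" by (rule sum_squares_bound)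
      then have "2 * (sqrt R * a) \<le> sqrt R * (sqrt R * a\<^sup>2) + 1" by (simp add: power2_eq_square mult_ac)
      moreover have "sqrt R * (sqrt R * a\<^sup>2) \<ge> 0" using R by simp
      ultimately have "sqrt R * a \<le> sqrt R * (sqrt R * a\<^sup>2) + 1" by linarith
      also have "\<dots> = sqrt R * (sqrt R * a\<^sup>2 + 1 / sqrt R)" using R by (simp add: distrib_left)
      finally show ?thesis using R by (simp only: mult_le_cancel_left_pos real_sqrt_gt_zero)
    qed
    have I3: "integrable gauss_measure (\<lambda>z. sqrt R * (cmod (ext_schwartz u z))\<^sup>2 + 1 / sqrt R)"
      using I2 by (intro Bochner_Integration.integrable_add gm.integrable_const) simp
    show I1: "integrable gauss_measure (\<lambda>z. cmod (ext_schwartz (g n) z - ext_schwartz (lo R (g n)) z))"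
      unfolding eq
    proof (rule Bochner_Integration.integrable_bound[OF I3])
      show "AE z in gauss_measure. norm (cmod (ext_schwartz u z)) \<le> norm (sqrt R * (cmod (ext_schwartz u z))\<^sup>2 + 1 / sqrt R)"
        using order_trans[OF pt abs_ge_self] by (intro AE_I2) simp
    qed measurable
    have "(\<integral>z. cmod (ext_schwartz u z) \<partial>gauss_measure) \<le> (\<integral>z. sqrt R * (cmod (ext_schwartz u z))\<^sup>2 + 1 / sqrt R \<partial>gauss_measure)"
      using I1 I3 pt unfolding eq by (intro integral_mono) auto
    also have "\<dots> = sqrt R * (\<integral>z. (cmod (ext_schwartz u z))\<^sup>2 \<partial>gauss_measure) + (1 / sqrt R) * \<mu>"
      using I2 by (simp add: \<mu>_def gm.integrable_const)
    also have "\<dots> \<le> sqrt R * (C / R) + (1 / sqrt R) * \<mu>"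
      using I2le R by (intro add_mono mult_left_mono) auto
    also have "\<dots> = (C + \<mu>) / sqrt R"
      using R by (simp add: field_simps real_sqrt_mult[symmetric])
    finally show "(\<integral>z. cmod (ext_schwartz (g n) z - ext_schwartz (lo R (g n)) z) \<partial>gauss_measure) \<le> (C + \<mu>) / sqrt R"
      unfolding eq .
  qed
  have mid: "integrable gauss_measure (\<lambda>z. cmod (ext_schwartz (lo R (g n)) z - ext_schwartz (lo R f) z))"
    "(\<lambda>n. \<integral>z. cmod (ext_schwartz (lo R (g n)) z - ext_schwartz (lo R f) z) \<partial>gauss_measure) \<longlonglongrightarrow> 0" for R n
  proof -
    obtain C1 where C1: "\<And>u z. u \<in> Lp_space 2 hyp_measure \<Longrightarrow> nrm 2 hyp_measure u \<le> max B (nrm 2 hyp_measure f) \<Longrightarrow> cmod (ext_schwartz (lo R u) z) \<le> C1"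
      unfolding lo_def using ext_cutoff_bounded[of "max B (nrm 2 hyp_measure f)" R] by blast
    have b: "cmod (ext_schwartz (lo R (g n)) z - ext_schwartz (lo R f) z) \<le> C1 + C1" for n z
      using norm_triangle_ineq4[of "ext_schwartz (lo R (g n)) z" "ext_schwartz (lo R f) z"] C1[OF gL, of n z] C1[OF f, of z] g(2)[of n]
      by (simp add: le_max_iff_disj)
    then show "integrable gauss_measure (\<lambda>z. cmod (ext_schwartz (lo R (g n)) z - ext_schwartz (lo R f) z))"
      by (intro gm.integrable_const_bound[of _ "C1 + C1"]) auto
    have "(\<lambda>n. \<integral>z. cmod (ext_schwartz (lo R (g n)) z - ext_schwartz (lo R f) z) \<partial>gauss_measure) \<longlonglongrightarrow> (\<integral>z. 0 \<partial>(gauss_measure :: ('a \<times> real) measure))"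
    proof (rule integral_dominated_convergence[where w="\<lambda>_. C1 + C1"])
      show "AE z in gauss_measure. (\<lambda>n. cmod (ext_schwartz (lo R (g n)) z - ext_schwartz (lo R f) z)) \<longlonglongrightarrow> 0"
        using ext_cutoff_tendsto[OF gL f weak, of R] unfolding lo_def[symmetric]
        by (intro AE_I2 tendsto_norm_zero LIM_zero) auto
    qed (use b in auto)
    then show "(\<lambda>n. \<integral>z. cmod (ext_schwartz (lo R (g n)) z - ext_schwartz (lo R f) z) \<partial>gauss_measure) \<longlonglongrightarrow> 0" by simp
  qed
  define E where "E j z = min 1 (cmod (ext_schwartz (lo (real (\<kappa> j)) f) z - F z))" for j z
  have [measurable]: "E j \<in> borel_measurable borel" for j unfolding E_def by measurable
  have Eint: "integrable gauss_measure (E j)" for j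
    by (rule gm.integrable_const_bound[of _ 1]) (auto simp: E_def)
  have Elim: "(\<lambda>j. \<integral>z. E j z \<partial>gauss_measure) \<longlonglongrightarrow> 0"
  proof -
    have "(\<lambda>j. \<integral>z. E j z \<partial>gauss_measure) \<longlonglongrightarrow> (\<integral>z. 0 \<partial>(gauss_measure :: ('a \<times> real) measure))"
    proof (rule integral_dominated_convergence[where w="\<lambda>_. 1"])
      show "AE z in gauss_measure. (\<lambda>j. E j z) \<longlonglongrightarrow> 0"
        using Fl unfolding AE_gauss_measure
      proof (eventually_elim)
        fix z assume "(\<lambda>j. ext_schwartz (\<lambda>y. f y * of_real (indicator (cball 0 (real (\<kappa> j))) y)) z) \<longlonglongrightarrow> F z"
        then have "(\<lambda>j. cmod (ext_schwartz (lo (real (\<kappa> j)) f) z - F z)) \<longlonglongrightarrow> 0"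
          unfolding lo_def by (intro tendsto_norm_zero LIM_zero)
        from tendsto_min[OF tendsto_const this, of 1] show "(\<lambda>j. E j z) \<longlonglongrightarrow> 0" by (simp add: E_def)
      qed
    qed (auto simp: E_def)
    then show ?thesis by simp
  qed
  have Dle: "(\<integral>z. D n z \<partial>gauss_measure) \<le> (C + \<mu>) / sqrt (real (\<kappa> j)) +
      (\<integral>z. cmod (ext_schwartz (lo (real (\<kappa> j)) (g n)) z - ext_schwartz (lo (real (\<kappa> j)) f) z) \<partial>gauss_measure) +
      (\<integral>z. E j z \<partial>gauss_measure)" if "0 < \<kappa> j" for n j
  proof -
    let ?R = "real (\<kappa> j)"
    have "(\<integral>z. D n z \<partial>gauss_measure) \<le> (\<integral>z. cmod (ext_schwartz (g n) z - ext_schwartz (lo ?R (g n)) z) +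
        cmod (ext_schwartz (lo ?R (g n)) z - ext_schwartz (lo ?R f) z) + E j z \<partial>gauss_measure)"
    proof (rule integral_mono)
      have "min 1 (cmod (a - d)) \<le> cmod (a - b) + cmod (b - c) + min 1 (cmod (c - d))" for a b c d
      proof -
        have "cmod (a - d) \<le> cmod (a - b) + cmod (b - d)" "cmod (b - d) \<le> cmod (b - c) + cmod (c - d)"
          by (auto intro: norm_diff_triangle_ineq[THEN order_trans] norm_triangle_ineq4 norm_diff_triangle_le)
        then show ?thesis using norm_ge_zero[of "a - b"] norm_ge_zero[of "b - c"] by linarith
      qed
      then show "D n z \<le> cmod (ext_schwartz (g n) z - ext_schwartz (lo ?R (g n)) z) + cmod (ext_schwartz (lo ?R (g n)) z - ext_schwartz (lo ?R f) z) + E j z" for z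
        unfolding D_def E_def .
    qed (use Dint Eint high(1) mid(1) that in auto)
    also have "\<dots> = (\<integral>z. cmod (ext_schwartz (g n) z - ext_schwartz (lo ?R (g n)) z) \<partial>gauss_measure) +
        (\<integral>z. cmod (ext_schwartz (lo ?R (g n)) z - ext_schwartz (lo ?R f) z) \<partial>gauss_measure) + (\<integral>z. E j z \<partial>gauss_measure)"
      using Eint high(1) mid(1) that by simp
    also have "\<dots> \<le> (C + \<mu>) / sqrt ?R + (\<integral>z. cmod (ext_schwartz (lo ?R (g n)) z - ext_schwartz (lo ?R f) z) \<partial>gauss_measure) + (\<integral>z. E j z \<partial>gauss_measure)"
      using high(2)[of ?R n] that by (intro add_mono) auto
    finally show ?thesis .
  qed
  have "(\<lambda>n. \<integral>z. norm (D n z) \<partial>gauss_measure) \<longlonglongrightarrow> 0"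
  proof (rule LIMSEQ_I)
    fix e :: real assume e: "e > 0"
    have "filterlim (\<lambda>j. real (\<kappa> j)) at_top sequentially"
      using filterlim_compose[OF filterlim_real_sequentially filterlim_subseq[OF \<kappa>]] .
    then have "((\<lambda>j. (C + \<mu>) / sqrt (real (\<kappa> j))) \<longlongrightarrow> 0) sequentially"
      by (intro tendsto_divide_0[OF tendsto_const] filterlim_at_top_imp_at_infinity filterlim_compose[OF sqrt_at_top])
    from tendsto_add[OF this Elim] have "(\<lambda>j. (C + \<mu>) / sqrt (real (\<kappa> j)) + (\<integral>z. E j z \<partial>gauss_measure)) \<longlonglongrightarrow> 0" by simp
    from LIMSEQ_D[OF this half_gt_zero[OF e]] obtain N where
      N: "\<And>j. j \<ge> N \<Longrightarrow> \<bar>(C + \<mu>) / sqrt (real (\<kappa> j)) + (\<integral>z. E j z \<partial>gauss_measure)\<bar> < e / 2" by auto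
    \<comment> \<open>The successor makes \<open>\<kappa> j\<close> positive, as the high-frequency
      estimate requires a positive radius.\<close>
    define j where "j = Suc N"
    have j: "0 < \<kappa> j" using strict_mono_imp_increasing[OF \<kappa>, of j] by (simp add: j_def)
    from LIMSEQ_D[OF mid(2)[of "real (\<kappa> j)"] half_gt_zero[OF e]] obtain N' where
      N': "\<And>n. n \<ge> N' \<Longrightarrow> \<bar>\<integral>z. cmod (ext_schwartz (lo (real (\<kappa> j)) (g n)) z - ext_schwartz (lo (real (\<kappa> j)) f) z) \<partial>gauss_measure\<bar> < e / 2" by auto
    have "norm ((\<integral>z. norm (D n z) \<partial>gauss_measure) - 0) < e" if "n \<ge> N'" for n
    proof -
      have "0 \<le> (\<integral>z. D n z \<partial>gauss_measure)" using D01 by simp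
      moreover have "(\<integral>z. D n z \<partial>gauss_measure) < e"
      proof -
        have arith: "d < e" if "d \<le> a + b + c" "\<bar>a + c\<bar> < e / 2" "\<bar>b\<bar> < e / 2" for a b c d :: real
          using that by linarith
        show ?thesis by (rule arith[OF Dle[OF j] N N'[OF that]]) (simp add: j_def)
      qed
      ultimately show ?thesis using D01 by simp
    qed
    then show "\<exists>N. \<forall>n\<ge>N. norm ((\<integral>z. norm (D n z) \<partial>gauss_measure) - 0) < e" by blast
  qed
  from tendsto_L1_AE_subseq[OF Dint this] obtain r where r: "strict_mono r" "AE z in gauss_measure. (\<lambda>n. D (r n) z) \<longlonglongrightarrow> 0" by blast
  have "AE z in lborel. (\<lambda>n. ext_schwartz (g (r n)) z) \<longlonglongrightarrow> F z"
    using r(2) unfolding AE_gauss_measure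
  proof eventually_elim
    fix z assume l: "(\<lambda>n. D (r n) z) \<longlonglongrightarrow> 0"
    have "eventually (\<lambda>n. D (r n) z < 1) sequentially" using order_tendstoD(2)[OF l, of 1] by simp
    then have "eventually (\<lambda>n. D (r n) z = cmod (ext_schwartz (g (r n)) z - F z)) sequentially"
      by eventually_elim (auto simp: D_def min_def split: if_splits)
    with l have "(\<lambda>n. cmod (ext_schwartz (g (r n)) z - F z)) \<longlonglongrightarrow> 0" by (rule Lim_transform_eventually)
    then show "(\<lambda>n. ext_schwartz (g (r n)) z) \<longlonglongrightarrow> F z" by (simp add: tendsto_norm_zero_iff LIM_zero_iff)
  qed
  with r(1) that show thesis by blast
qed

section \<open>The extension operator on \<open>L\<^sup>2\<close>\<close>

lemma Lp_norm_tendsto_0_iff: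
  assumes "0 < p" "\<And>n. f n \<in> Lp_space p M"
  shows "(\<lambda>n. Lp_norm p M (f n)) \<longlonglongrightarrow> 0 \<longleftrightarrow> (\<lambda>n. nrm p M (f n)) \<longlonglongrightarrow> 0"
proof -
  have "Lp_norm p M (f n) = ennreal (nrm p M (f n))" for n by (rule Lp_norm_eq_nrm[OF assms])
  then show ?thesis
    using tendsto_ennrealI[of "\<lambda>n. nrm p M (f n)" 0 sequentially] tendsto_ennrealD[of "\<lambda>n. nrm p M (f n)" 0 sequentially]
    by auto
qed

lemma nice_cmult: "nice f \<Longrightarrow> nice (\<lambda>y. c * f y)"
  using nrm_cmult(1)[of 2 f hyp_measure c] by (simp add: nice_def)

lemma nice_zero: "nice (\<lambda>y. 0)"
  by (auto simp: nice_def Lp_space_2_iff)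

lemma ext_schwartz_cmult: "ext_schwartz (\<lambda>y. c * f y) z = c * ext_schwartz f z"
proof -
  have "(\<integral>y. iexp (z \<bullet> pos y) * (c * f y) \<partial>hyp_measure) = (\<integral>y. c * (iexp (z \<bullet> pos y) * f y) \<partial>hyp_measure)"
    by (simp add: mult_ac)
  then show ?thesis unfolding ext_schwartz_eq by simp
qed

text \<open>\<open>ty\<close> fixes the dimension. \<open>A\<close> is any a priori bound and only
  makes the supremum \<open>H\<close> finite; all sharp statements refer to
  \<open>H\<close>.\<close>

locale bounded_extension =
  fixes p A :: real and ty :: "'a::euclidean_space itself"
  assumes p: "2 \<le> p"
    and bounded: "\<And>f :: 'a \<Rightarrow> complex. nice f \<Longrightarrow> nrm 2 hyp_measure f \<le> 1 \<Longrightarrow>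
      ext_schwartz f \<in> Lp_space p lborel \<and> nrm p lborel (ext_schwartz f) \<le> A"
begin

text \<open>The best constant over integrable functions in the closed unit ball. The ball contains
  0, so the supremum is over a nonempty set even without a normalised function at hand.\<close>

definition H :: real where
  "H = (SUP f \<in> {f :: 'a \<Rightarrow> complex. nice f \<and> nrm 2 hyp_measure f \<le> 1}. nrm p lborel (ext_schwartz f))"

lemma H_upper: "nice (f :: 'a \<Rightarrow> complex) \<Longrightarrow> nrm 2 hyp_measure f \<le> 1 \<Longrightarrow> nrm p lborel (ext_schwartz f) \<le> H"
  unfolding H_def using bounded by (intro cSUP_upper) (auto intro!: bdd_aboveI[of _ A])

lemma H_nonneg: "0 \<le> H"
  using order_trans[OF nrm_nonneg H_upper[OF nice_zero]] by (simp add: nrm_def)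

text \<open>Homogeneity with a positive upper bound \<open>N\<close> in place of the norm, so that
  functions of norm 0 are included; \<open>ext_bound\<close> then lets \<open>N\<close> decrease to
  the norm.\<close>

lemma ext_Lp_aux:
  fixes f :: "'a \<Rightarrow> complex"
  assumes f: "nice f" and N: "nrm 2 hyp_measure f \<le> N" "0 < N"
  shows "ext_schwartz f \<in> Lp_space p lborel" "nrm p lborel (ext_schwartz f) \<le> H * N"
proof -
  define g where "g = (\<lambda>y. of_real (inverse N) * f y)"
  have g: "nice g" unfolding g_def by (rule nice_cmult[OF f])
  have "nrm 2 hyp_measure g = inverse N * nrm 2 hyp_measure f"
    unfolding g_def using nrm_cmult(2)[of 2 f hyp_measure "of_real (inverse N)"] f N by (simp add: nice_def norm_inverse)
  also have "\<dots> \<le> inverse N * N" using N by (intro mult_left_mono) auto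
  finally have ng: "nrm 2 hyp_measure g \<le> 1" using N by simp
  have eq: "ext_schwartz f = (\<lambda>z. of_real N * ext_schwartz g z)"
    using N by (simp add: g_def ext_schwartz_cmult fun_eq_iff)
  have 1: "ext_schwartz g \<in> Lp_space p lborel" using bounded[OF g ng] by simp
  have 2: "nrm p lborel (ext_schwartz g) \<le> H" by (rule H_upper[OF g ng])
  show "ext_schwartz f \<in> Lp_space p lborel" unfolding eq using p by (intro nrm_cmult 1) auto
  have "nrm p lborel (ext_schwartz f) = N * nrm p lborel (ext_schwartz g)"
    unfolding eq using nrm_cmult(2)[OF _ 1, of "of_real N"] p N by simp
  also have "\<dots> \<le> N * H" using 2 N by (intro mult_left_mono) auto
  finally show "nrm p lborel (ext_schwartz f) \<le> H * N" by (simp add: mult.commute)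
qed

lemma ext_Lp:
  fixes f :: "'a \<Rightarrow> complex"
  assumes f: "nice f"
  shows "ext_schwartz f \<in> Lp_space p lborel"
  using ext_Lp_aux(1)[OF f less_imp_le[OF less_add_one]] nrm_nonneg[of 2 hyp_measure f] by linarith

lemma ext_bound:
  fixes f :: "'a \<Rightarrow> complex"
  assumes f: "nice f"
  shows "nrm p lborel (ext_schwartz f) \<le> H * nrm 2 hyp_measure f"
proof -
  have "((\<lambda>e. H * (nrm 2 hyp_measure f + e)) \<longlongrightarrow> H * (nrm 2 hyp_measure f + 0)) (at_right 0)"
    by (intro tendsto_intros)
  moreover have "\<forall>\<^sub>F e in at_right 0. nrm p lborel (ext_schwartz f) \<le> H * (nrm 2 hyp_measure f + e)"
    unfolding eventually_at_right_field using ext_Lp_aux(2)[OF f]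
    by (intro exI[of _ 1]) (auto simp: add_nonneg_pos)
  ultimately show ?thesis using tendsto_lowerbound by fastforce
qed

lemma ext_diff:
  fixes f g :: "'a \<Rightarrow> complex"
  assumes "nice f" "nice g"
  shows "nrm p lborel (\<lambda>z. ext_schwartz f z - ext_schwartz g z) \<le> H * nrm 2 hyp_measure (\<lambda>y. f y - g y)"
proof -
  have "ext_schwartz (\<lambda>y. f y - g y) = (\<lambda>z. ext_schwartz f z - ext_schwartz g z)"
    by (rule ext) (rule ext_schwartz_diff[OF assms])
  with ext_bound[OF nice_diff[OF assms]] show ?thesis by simp
qed

text \<open>Dividing by a norm that is positive and at most 1 only enlarges the extension, so
  near-maximizers in the ball may be taken on the sphere. The norm is positive because the extension
  is nonzero.\<close>

lemma near_maximizer: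
  assumes "0 < H" "e < H"
  obtains f :: "'a \<Rightarrow> complex" where "nice f" "nrm 2 hyp_measure f = 1" "e < nrm p lborel (ext_schwartz f)"
proof -
  have "max 0 e < H" using assms by simp
  then obtain g :: "'a \<Rightarrow> complex" where g: "nice g" "nrm 2 hyp_measure g \<le> 1" "max 0 e < nrm p lborel (ext_schwartz g)"
  proof -
    let ?S = "{f :: 'a \<Rightarrow> complex. nice f \<and> nrm 2 hyp_measure f \<le> 1}"
    have "(\<lambda>y. 0) \<in> ?S" using nice_zero by (simp add: nrm_def)
    then have "?S \<noteq> {}" by blast
    moreover have "bdd_above ((\<lambda>f. nrm p lborel (ext_schwartz f)) ` ?S)"
      using bounded by (auto intro!: bdd_aboveI[of _ A])
    ultimately have "\<exists>g\<in>?S. max 0 e < nrm p lborel (ext_schwartz g)"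
      using \<open>max 0 e < H\<close> unfolding H_def by (rule less_cSUP_iff[THEN iffD1])
    with that show thesis by blast
  qed
  define N where "N = nrm 2 hyp_measure g"
  have N: "0 < N"
  proof (rule ccontr)
    assume "\<not> 0 < N"
    then have "nrm 2 hyp_measure g = 0" using nrm_nonneg[of 2 hyp_measure g] by (simp add: N_def)
    then show False using ext_bound[OF g(1)] g(3) by simp
  qed
  define f where "f = (\<lambda>y. of_real (inverse N) * g y)"
  have gL: "g \<in> Lp_space 2 hyp_measure" using g(1) by (simp add: nice_def)
  have f: "nice f" unfolding f_def by (rule nice_cmult[OF g(1)])
  have "nrm 2 hyp_measure f = 1"
    unfolding f_def using nrm_cmult(2)[OF _ gL, of "of_real (inverse N)"] N by (simp add: N_def norm_inverse)
  moreover have "nrm p lborel (ext_schwartz f) = inverse N * nrm p lborel (ext_schwartz g)"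
    using nrm_cmult(2)[OF _ ext_Lp[OF g(1)], of "of_real (inverse N)"] p N
    by (simp add: f_def ext_schwartz_cmult[abs_def] norm_inverse)
  moreover have "1 * nrm p lborel (ext_schwartz g) \<le> inverse N * nrm p lborel (ext_schwartz g)"
    using N g(2) by (intro mult_right_mono) (auto simp: N_def one_le_inverse)
  moreover have "e < nrm p lborel (ext_schwartz g)" using g(3) by simp
  ultimately show thesis using that[OF f] by linarith
qed

section \<open>Extension by density and the optimal constant\<close>

lemma is_extension_iff:
  fixes f :: "'a \<Rightarrow> complex"
  assumes f: "f \<in> Lp_space 2 hyp_measure"
  shows "is_extension p f F \<longleftrightarrow> F \<in> Lp_space p lborel \<and> (\<exists>g. (\<forall>n. schwartz (g n)) \<and>
     (\<lambda>n. nrm 2 hyp_measure (\<lambda>y. g n y - f y)) \<longlonglongrightarrow> 0 \<and> (\<lambda>n. nrm p lborel (\<lambda>z. ext_schwartz (g n) z - F z)) \<longlonglongrightarrow> 0)"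
proof -
  have 1: "(\<lambda>n. Lp_norm 2 hyp_measure (\<lambda>y. g n y - f y)) \<longlonglongrightarrow> 0 \<longleftrightarrow> (\<lambda>n. nrm 2 hyp_measure (\<lambda>y. g n y - f y)) \<longlonglongrightarrow> 0"
    if "\<forall>n. schwartz (g n)" for g
    using that schwartz_nice by (intro Lp_norm_tendsto_0_iff Lp_diff(1) f) (auto simp: nice_def)
  have 2: "(\<lambda>n. Lp_norm p lborel (\<lambda>z. ext_schwartz (g n) z - F z)) \<longlonglongrightarrow> 0 \<longleftrightarrow> (\<lambda>n. nrm p lborel (\<lambda>z. ext_schwartz (g n) z - F z)) \<longlonglongrightarrow> 0"
    if "\<forall>n. schwartz (g n)" "F \<in> Lp_space p lborel" for g :: "nat \<Rightarrow> 'a \<Rightarrow> complex"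
    using that schwartz_nice p by (intro Lp_norm_tendsto_0_iff Lp_diff(1) ext_Lp) auto
  show ?thesis unfolding is_extension_def using 1 2 by blast
qed

text \<open>The extensions of an approximating Schwartz sequence form a Cauchy sequence by the bound
  \<open>H\<close>, so a limit exists and the choice in \<open>fourier_ext\<close> is
  justified.\<close>

lemma fourier_ext_is_extension:
  fixes f :: "'a \<Rightarrow> complex"
  assumes f: "f \<in> Lp_space 2 hyp_measure"
  shows "is_extension p f (fourier_ext p f)"
proof -
  have "\<exists>g. schwartz g \<and> nrm 2 hyp_measure (\<lambda>y. g y - f y) < 1 / real (Suc n)" for n
    using schwartz_dense[OF f, of "1 / real (Suc n)"] by auto
  then obtain g where g: "\<And>n. schwartz (g n)" "\<And>n. nrm 2 hyp_measure (\<lambda>y. g n y - f y) < 1 / real (Suc n)" by metis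
  have ng: "nice (g n)" for n by (rule schwartz_nice[OF g(1)])
  then have gL: "g n \<in> Lp_space 2 hyp_measure" for n by (simp add: nice_def)
  have lim: "(\<lambda>n. nrm 2 hyp_measure (\<lambda>y. g n y - f y)) \<longlonglongrightarrow> 0"
    by (rule Lim_null_comparison[OF always_eventually LIMSEQ_inverse_real_of_nat])
      (use less_imp_le[OF g(2)] in \<open>auto simp: inverse_eq_divide\<close>)
  have gg: "nrm p lborel (\<lambda>z. ext_schwartz (g m) z - ext_schwartz (g n) z) \<le>
      H * (nrm 2 hyp_measure (\<lambda>y. g m y - f y) + nrm 2 hyp_measure (\<lambda>y. g n y - f y))" for m n
  proof -
    have "nrm 2 hyp_measure (\<lambda>y. g m y - g n y) \<le> nrm 2 hyp_measure (\<lambda>y. g m y - f y) + nrm 2 hyp_measure (\<lambda>y. g n y - f y)"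
      using nrm_triangle3[OF _ gL f gL, of m n] by (simp add: nrm_minus_commute[of 2 hyp_measure f])
    from order_trans[OF ext_diff[OF ng ng] mult_left_mono[OF this H_nonneg]] show ?thesis .
  qed
  have "\<exists>N. \<forall>m\<ge>N. \<forall>n\<ge>N. nrm p lborel (\<lambda>z. ext_schwartz (g m) z - ext_schwartz (g n) z) < e" if e: "e > 0" for e
  proof -
    have "0 < e / (2 * (H + 1))" using e H_nonneg by simp
    from LIMSEQ_D[OF lim this] obtain N where N: "\<And>n. n \<ge> N \<Longrightarrow> nrm 2 hyp_measure (\<lambda>y. g n y - f y) < e / (2 * (H + 1))" by auto
    show ?thesis
    proof (intro exI[of _ N] allI impI)
      fix m n assume "N \<le> m" "N \<le> n"
      with N have "nrm 2 hyp_measure (\<lambda>y. g m y - f y) + nrm 2 hyp_measure (\<lambda>y. g n y - f y) \<le> e / (2 * (H + 1)) + e / (2 * (H + 1))"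
        by (intro add_mono less_imp_le)
      from order_trans[OF gg mult_left_mono[OF this H_nonneg]]
      have "nrm p lborel (\<lambda>z. ext_schwartz (g m) z - ext_schwartz (g n) z) \<le> H * (e / (2 * (H + 1)) + e / (2 * (H + 1)))" .
      also have "\<dots> = e * (H / (H + 1))"
      proof -
        have "H * (e / (2 * y) + e / (2 * y)) = e * (H / y)" if "y \<noteq> 0" for y :: real
          using that by (simp add: field_simps)
        from this[of "H + 1"] H_nonneg show ?thesis by simp
      qed
      also have "\<dots> < e * 1" using e H_nonneg by (intro mult_strict_left_mono) auto
      finally show "nrm p lborel (\<lambda>z. ext_schwartz (g m) z - ext_schwartz (g n) z) < e" by simp
    qed
  qed
  from Riesz_Fischer[OF _ ext_Lp[OF ng] this] p obtain F where
    "F \<in> Lp_space p lborel" "(\<lambda>n. nrm p lborel (\<lambda>z. ext_schwartz (g n) z - F z)) \<longlonglongrightarrow> 0" by auto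
  then have "is_extension p f F" unfolding is_extension_iff[OF f] using g(1) lim by blast
  then show ?thesis unfolding fourier_ext_def by (rule someI[of "is_extension p f"])
qed

lemma fourier_ext_Lp:
  fixes f :: "'a \<Rightarrow> complex"
  assumes f: "f \<in> Lp_space 2 hyp_measure"
  shows "fourier_ext p f \<in> Lp_space p lborel"
  using fourier_ext_is_extension[OF f] by (simp add: is_extension_def)

text \<open>\<open>fourier_ext\<close> is a choice determined only up to null sets, so it is
  accessed through this inequality alone. With f = g it says that the chosen extension of an
  integrable function agrees with its integral almost everywhere.\<close>

lemma ext_fourier_ext_diff:
  fixes f g :: "'a \<Rightarrow> complex"
  assumes f: "f \<in> Lp_space 2 hyp_measure" and g: "nice g"
  shows "nrm p lborel (\<lambda>z. ext_schwartz g z - fourier_ext p f z) \<le> H * nrm 2 hyp_measure (\<lambda>y. g y - f y)"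
proof -
  obtain h where h: "\<And>n. schwartz (h n)" "(\<lambda>n. nrm 2 hyp_measure (\<lambda>y. h n y - f y)) \<longlonglongrightarrow> 0"
    "(\<lambda>n. nrm p lborel (\<lambda>z. ext_schwartz (h n) z - fourier_ext p f z)) \<longlonglongrightarrow> 0"
    using fourier_ext_is_extension[OF f] unfolding is_extension_iff[OF f] by blast
  have nh: "nice (h n)" for n by (rule schwartz_nice[OF h(1)])
  then have hL: "h n \<in> Lp_space 2 hyp_measure" for n by (simp add: nice_def)
  have gL: "g \<in> Lp_space 2 hyp_measure" using g by (simp add: nice_def)
  have le: "nrm p lborel (\<lambda>z. ext_schwartz g z - fourier_ext p f z) \<le>
     H * (nrm 2 hyp_measure (\<lambda>y. g y - f y) + nrm 2 hyp_measure (\<lambda>y. h n y - f y)) +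
     nrm p lborel (\<lambda>z. ext_schwartz (h n) z - fourier_ext p f z)" for n
  proof -
    have "nrm 2 hyp_measure (\<lambda>y. g y - h n y) \<le> nrm 2 hyp_measure (\<lambda>y. g y - f y) + nrm 2 hyp_measure (\<lambda>y. h n y - f y)"
      using nrm_triangle3[OF _ gL f hL, of n] by (simp add: nrm_minus_commute[of 2 hyp_measure f])
    from order_trans[OF ext_diff[OF g nh] mult_left_mono[OF this H_nonneg]]
    have "nrm p lborel (\<lambda>z. ext_schwartz g z - ext_schwartz (h n) z) \<le>
      H * (nrm 2 hyp_measure (\<lambda>y. g y - f y) + nrm 2 hyp_measure (\<lambda>y. h n y - f y))" .
    moreover have "nrm p lborel (\<lambda>z. ext_schwartz g z - fourier_ext p f z) \<le>
       nrm p lborel (\<lambda>z. ext_schwartz g z - ext_schwartz (h n) z) + nrm p lborel (\<lambda>z. ext_schwartz (h n) z - fourier_ext p f z)"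
      using p by (intro nrm_triangle3 ext_Lp g nh fourier_ext_Lp f) simp
    ultimately show ?thesis by linarith
  qed
  have "(\<lambda>n. H * (nrm 2 hyp_measure (\<lambda>y. g y - f y) + nrm 2 hyp_measure (\<lambda>y. h n y - f y)) +
     nrm p lborel (\<lambda>z. ext_schwartz (h n) z - fourier_ext p f z)) \<longlonglongrightarrow> H * (nrm 2 hyp_measure (\<lambda>y. g y - f y) + 0) + 0"
    by (intro tendsto_intros h)
  from LIMSEQ_le_const[OF this] le show ?thesis by auto
qed

text \<open>The previous inequality with g = 0, up to signs.\<close>

lemma fourier_ext_bound:
  fixes f :: "'a \<Rightarrow> complex"
  assumes f: "f \<in> Lp_space 2 hyp_measure"
  shows "nrm p lborel (fourier_ext p f) \<le> H * nrm 2 hyp_measure f"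
proof -
  have "ext_schwartz (\<lambda>y::'a. 0) z = 0" for z by (simp add: ext_schwartz_eq)
  then have "nrm p lborel (\<lambda>z. - fourier_ext p f z) \<le> H * nrm 2 hyp_measure (\<lambda>y. - f y)"
    using ext_fourier_ext_diff[OF f nice_zero] by simp
  then show ?thesis using Lp_uminus(2)[OF _ fourier_ext_Lp[OF f]] Lp_uminus(2)[OF _ f] p by simp
qed

text \<open>\<open>H\<close> bounds every quotient in \<open>opt_const\<close>, and \<open>f\<close>
  attains it, so the two constants agree as soon as one function attains \<open>H\<close>. This
  settles the passage from integrable functions to all of L2.\<close>

lemma extremizerI:
  fixes f :: "'a \<Rightarrow> complex"
  assumes f: "f \<in> Lp_space 2 hyp_measure" "\<not> (AE y in hyp_measure. f y = 0)"
    and ge: "H * nrm 2 hyp_measure f \<le> nrm p lborel (fourier_ext p f)"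
  shows "extremizer p f"
proof -
  have pos: "0 < nrm 2 hyp_measure u" if "u \<in> nonzero_L2" for u :: "'a \<Rightarrow> complex"
    using nrm_eq_0_AE[of 2 u hyp_measure] that nrm_nonneg[of 2 hyp_measure u] by (auto simp: nonzero_L2_def less_le)
  have fn: "f \<in> nonzero_L2" using f by (simp add: nonzero_L2_def)
  have quot: "Lp_norm p lborel (fourier_ext p u) / Lp_norm 2 hyp_measure u =
      ennreal (nrm p lborel (fourier_ext p u) / nrm 2 hyp_measure u)" if u: "u \<in> nonzero_L2" for u :: "'a \<Rightarrow> complex"
  proof -
    have "u \<in> Lp_space 2 hyp_measure" using u by (simp add: nonzero_L2_def)
    then show ?thesis using p pos[OF u]
      by (simp add: Lp_norm_eq_nrm fourier_ext_Lp divide_ennreal)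
  qed
  have eq: "nrm p lborel (fourier_ext p f) = H * nrm 2 hyp_measure f"
    using ge fourier_ext_bound[OF f(1)] by simp
  have "opt_const TYPE('a) p = ennreal H"
    unfolding opt_const_def
  proof (rule antisym)
    show "(SUP f\<in>nonzero_L2. Lp_norm p lborel (fourier_ext p f) / Lp_norm 2 hyp_measure (f :: 'a \<Rightarrow> complex)) \<le> ennreal H"
    proof (rule SUP_least)
      fix u :: "'a \<Rightarrow> complex" assume u: "u \<in> nonzero_L2"
      then have "nrm p lborel (fourier_ext p u) \<le> H * nrm 2 hyp_measure u"
        by (intro fourier_ext_bound) (simp add: nonzero_L2_def)
      then show "Lp_norm p lborel (fourier_ext p u) / Lp_norm 2 hyp_measure u \<le> ennreal H"
        unfolding quot[OF u] using pos[OF u] by (intro ennreal_leI) (simp add: divide_le_eq)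
    qed
    have "ennreal H = Lp_norm p lborel (fourier_ext p f) / Lp_norm 2 hyp_measure f"
      unfolding quot[OF fn] eq using pos[OF fn] by simp
    also have "\<dots> \<le> (SUP f\<in>nonzero_L2. Lp_norm p lborel (fourier_ext p f) / Lp_norm 2 hyp_measure (f :: 'a \<Rightarrow> complex))"
      by (rule SUP_upper[OF fn])
    finally show "ennreal H \<le> (SUP f\<in>nonzero_L2. Lp_norm p lborel (fourier_ext p f) / Lp_norm 2 hyp_measure (f :: 'a \<Rightarrow> complex))" .
  qed
  then show ?thesis unfolding extremizer_def
    using fn eq p f(1) H_nonneg by (simp add: Lp_norm_eq_nrm fourier_ext_Lp ennreal_mult)
qed

end

section \<open>Concentration of maximizing sequences\<close>

lemma nrm_distr_self:
  assumes "distr M borel \<Lambda> = M" "\<Lambda> \<in> measurable M borel" "f \<in> borel_measurable borel"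
  shows "nrm p M (\<lambda>x. f (\<Lambda> x)) = nrm p M f"
proof -
  have [measurable]: "f \<in> borel_measurable borel" by fact
  have "(\<integral>x. cmod (f (\<Lambda> x)) powr p \<partial>M) = (\<integral>x. cmod (f x) powr p \<partial>distr M borel \<Lambda>)"
    by (rule integral_distr[symmetric]) (use assms in auto)
  then show ?thesis by (simp add: nrm_def assms(1))
qed

lemma nn_integral_distr_self:
  assumes "distr M borel \<Lambda> = M" "\<Lambda> \<in> measurable M borel" "f \<in> borel_measurable borel"
  shows "(\<integral>\<^sup>+x. f (\<Lambda> x) \<partial>M) = (\<integral>\<^sup>+x. f x \<partial>M)"
proof -
  have "(\<integral>\<^sup>+x. f (\<Lambda> x) \<partial>M) = (\<integral>\<^sup>+x. f x \<partial>distr M borel \<Lambda>)"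
    by (rule nn_integral_distr[symmetric]) (simp_all only: assms(2,3) measurable_distr_eq1)
  then show ?thesis by (simp add: assms(1))
qed

lemma nice_lorentz:
  fixes g :: "'a::euclidean_space \<Rightarrow> complex"
  assumes L: "lorentz \<Lambda> L" and g: "nice g"
  shows "nice (\<lambda>y. g (\<Lambda> y))" "nrm 2 hyp_measure (\<lambda>y. g (\<Lambda> y)) = nrm 2 hyp_measure g"
    "ext_schwartz (\<lambda>y. g (\<Lambda> y)) z = ext_schwartz g (L z)"
    "nrm p lborel (ext_schwartz (\<lambda>y. g (\<Lambda> y))) = nrm p lborel (ext_schwartz g)"
proof -
  have [measurable]: "g \<in> borel_measurable borel" using nice_measurable[OF g] .
  have [measurable]: "\<Lambda> \<in> borel_measurable borel" "L \<in> borel_measurable borel"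
    and d: "distr hyp_measure borel \<Lambda> = hyp_measure" "distr lborel borel L = lborel"
    and Lp: "\<And>z y. L z \<bullet> pos (\<Lambda> y) = z \<bullet> pos y" using L by (auto simp: lorentz_def)
  have m: "\<Lambda> \<in> measurable hyp_measure borel" "L \<in> measurable lborel borel" by simp_all
  show 2: "nrm 2 hyp_measure (\<lambda>y. g (\<Lambda> y)) = nrm 2 hyp_measure g"
    by (rule nrm_distr_self[OF d(1) m(1)]) simp
  have int: "integrable hyp_measure (\<lambda>y. u (\<Lambda> y))" if "integrable hyp_measure u" for u :: "'a \<Rightarrow> 'b::{banach, second_countable_topology}"
    using that integrable_distr_eq[OF m(1), of u] borel_measurable_integrable[OF that] by (simp add: d(1))
  have "integrable hyp_measure (\<lambda>y. g (\<Lambda> y))" "integrable hyp_measure (\<lambda>y. (cmod (g (\<Lambda> y)))\<^sup>2)"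
    using g int[of g] int[of "\<lambda>y. (cmod (g y))\<^sup>2"] by (auto simp: nice_def Lp_space_2_iff)
  then show "nice (\<lambda>y. g (\<Lambda> y))" by (simp add: nice_def Lp_space_2_iff)
  have T: "ext_schwartz (\<lambda>y. g (\<Lambda> y)) z = ext_schwartz g (L z)" for z
  proof -
    have "ext_schwartz (\<lambda>y. g (\<Lambda> y)) z = (\<integral>y. iexp (L z \<bullet> pos (\<Lambda> y)) * g (\<Lambda> y) \<partial>hyp_measure)"
      by (simp add: ext_schwartz_eq Lp)
    also have "\<dots> = (\<integral>y. iexp (L z \<bullet> pos y) * g y \<partial>distr hyp_measure borel \<Lambda>)"
      by (rule integral_distr[symmetric]) auto
    also have "\<dots> = ext_schwartz g (L z)" by (simp add: d(1) ext_schwartz_eq)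
    finally show ?thesis .
  qed
  then show "ext_schwartz (\<lambda>y. g (\<Lambda> y)) z = ext_schwartz g (L z)" .
  have "ext_schwartz (\<lambda>y. g (\<Lambda> y)) = (\<lambda>z. ext_schwartz g (L z))" by (rule ext) (rule T)
  then show "nrm p lborel (ext_schwartz (\<lambda>y. g (\<Lambda> y))) = nrm p lborel (ext_schwartz g)"
    using nrm_distr_self[OF d(2) m(2), of "ext_schwartz g" p] by simp
qed

text \<open>A Lorentz map taking 0 to \<open>b\<close> pulls the Lorentz ball around
  \<open>b\<close> back to the set where \<open>japanese\<close> is at most \<open>R\<close>, which
  lies in the Euclidean ball of radius \<open>R\<close>.\<close>

lemma recentre:
  fixes g :: "'a::euclidean_space \<Rightarrow> complex" and b :: 'a
  assumes g: "nice g"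
  obtains h :: "'a \<Rightarrow> complex" where "nice h" "nrm 2 hyp_measure h = nrm 2 hyp_measure g" "nrm p lborel (ext_schwartz h) = nrm p lborel (ext_schwartz g)"
    "(\<integral>\<^sup>+a. ennreal ((cmod (g a))\<^sup>2) * indicator {a. lor (pos b) (pos a) \<le> R} a \<partial>hyp_measure) \<le> ennreal ((nrm 2 hyp_measure (\<lambda>y. h y * of_real (indicator (cball 0 R) y)))\<^sup>2)"
proof -
  obtain \<Lambda> L where L: "lorentz \<Lambda> L" and b: "\<Lambda> 0 = b" by (rule lorentz_transitive)
  note n = nice_lorentz[OF L g]
  have [measurable]: "g \<in> borel_measurable borel" using nice_measurable[OF g] .
  have [measurable]: "\<Lambda> \<in> borel_measurable borel" and d: "distr hyp_measure borel \<Lambda> = hyp_measure"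
    and Ll: "\<And>a c. lor (pos (\<Lambda> a)) (pos (\<Lambda> c)) = lor (pos a) (pos c)" using L by (auto simp: lorentz_def)
  have hL: "(\<lambda>y. g (\<Lambda> y)) \<in> Lp_space 2 hyp_measure" using n(1) by (simp add: nice_def)
  have "(\<integral>\<^sup>+a. ennreal ((cmod (g a))\<^sup>2) * indicator {a. lor (pos b) (pos a) \<le> R} a \<partial>hyp_measure) =
     (\<integral>\<^sup>+a. ennreal ((cmod (g (\<Lambda> a)))\<^sup>2) * indicator {a. lor (pos b) (pos a) \<le> R} (\<Lambda> a) \<partial>hyp_measure)"
    by (rule nn_integral_distr_self[OF d, symmetric]) measurable
  also have "\<dots> \<le> (\<integral>\<^sup>+y. ennreal ((cmod (g (\<Lambda> y) * of_real (indicator (cball 0 R) y)))\<^sup>2) \<partial>hyp_measure)"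
  proof (rule nn_integral_mono)
    fix a
    have "lor (pos b) (pos (\<Lambda> a)) = japanese a" using Ll[of 0 a] by (simp add: b lor_def pos_def japanese_def)
    then show "ennreal ((cmod (g (\<Lambda> a)))\<^sup>2) * indicator {a. lor (pos b) (pos a) \<le> R} (\<Lambda> a) \<le> ennreal ((cmod (g (\<Lambda> a) * of_real (indicator (cball 0 R) a)))\<^sup>2)"
      using norm_less_japanese[of a] by (auto simp: indicator_def)
  qed
  also have "\<dots> = ennreal ((nrm 2 hyp_measure (\<lambda>y. g (\<Lambda> y) * of_real (indicator (cball 0 R) y)))\<^sup>2)"
    using nice_cutoff(1)[OF hL, of R] by (intro nn_integral_power2_eq_nrm) (simp add: nice_def)
  finally show thesis by (intro that[of "\<lambda>y. g (\<Lambda> y)"] n)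
qed

text \<open>A factor \<open>iexp (z0 \<bullet> pos y)\<close> translates the extension by
  \<open>z0\<close>, and Lebesgue measure is translation invariant.\<close>

lemma modulate:
  fixes g :: "'a::euclidean_space \<Rightarrow> complex"
  assumes g: "nice g"
  shows "nice (\<lambda>y. iexp (z0 \<bullet> pos y) * g y)" "nrm 2 hyp_measure (\<lambda>y. iexp (z0 \<bullet> pos y) * g y) = nrm 2 hyp_measure g"
    "nrm p lborel (ext_schwartz (\<lambda>y. iexp (z0 \<bullet> pos y) * g y)) = nrm p lborel (ext_schwartz g)"
proof -
  have [measurable]: "g \<in> borel_measurable borel" using nice_measurable[OF g] .
  have n: "cmod (iexp (z0 \<bullet> pos y) * g y) = cmod (g y)" for y by (simp add: norm_mult)
  show "nice (\<lambda>y. iexp (z0 \<bullet> pos y) * g y)"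
    using g integrable_iexp_mult[of hyp_measure g "\<lambda>y. z0 \<bullet> pos y"] unfolding nice_def Lp_space_2_iff n by auto
  show "nrm 2 hyp_measure (\<lambda>y. iexp (z0 \<bullet> pos y) * g y) = nrm 2 hyp_measure g"
    unfolding nrm_def n ..
  have "iexp (z \<bullet> pos y) * (iexp (z0 \<bullet> pos y) * g y) = iexp ((z0 + z) \<bullet> pos y) * g y" for z y
    by (simp add: inner_add_left distrib_left exp_add mult_ac)
  then have "ext_schwartz (\<lambda>y. iexp (z0 \<bullet> pos y) * g y) = (\<lambda>z. ext_schwartz g (z0 + z))"
    by (intro ext) (simp only: ext_schwartz_eq)
  then show "nrm p lborel (ext_schwartz (\<lambda>y. iexp (z0 \<bullet> pos y) * g y)) = nrm p lborel (ext_schwartz g)"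
    using nrm_distr_self[OF lborel_distr_plus[of z0], of "ext_schwartz g" p] by simp
qed

context bounded_extension begin

text \<open>If every Lorentz ball of radius \<open>R\<close> had mass below \<delta>, the norm at
  the even exponent below \<open>p\<close> would be tiny; interpolation with the bounded norm at
  \<open>p1\<close> would then push the \<open>p\<close>-norm below H/2.\<close>

lemma mass_concentrates:
  fixes m :: nat and p1 A1 :: real
  assumes H: "0 < H"
    and cb: "conv_bound m (\<lambda>P :: 'a \<times> real. ennreal (K * max 1 (lor P P) powr - e))"
    and K: "0 \<le> K" and e: "0 < e" and m: "2 \<le> m" "2 * real m < p"
    and A0: "\<And>f :: 'a \<Rightarrow> complex. nice f \<Longrightarrow> ext_schwartz f \<in> Lp_space (2 * real m) lborel"
    and p1: "p < p1" and A1: "\<And>f :: 'a \<Rightarrow> complex. nice f \<Longrightarrow> ext_schwartz f \<in> Lp_space p1 lborel \<and> nrm p1 lborel (ext_schwartz f) \<le> A1 * nrm 2 hyp_measure f"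
  obtains \<delta> R where "0 < \<delta>" "\<delta> \<le> 1"
    "\<And>g :: 'a \<Rightarrow> complex. nice g \<Longrightarrow> nrm 2 hyp_measure g = 1 \<Longrightarrow> H / 2 \<le> nrm p lborel (ext_schwartz g) \<Longrightarrow>
      \<exists>b. ennreal \<delta> \<le> (\<integral>\<^sup>+a. ennreal ((cmod (g a))\<^sup>2) * indicator {a. lor (pos b) (pos a) \<le> R} a \<partial>hyp_measure)"
proof -
  define p0 where "p0 = 2 * real m"
  define D where "D = (2 * pi) ^ DIM('a \<times> real) * K"
  have D0: "0 \<le> D" using K by (simp add: D_def)
  define h where "h = (H / 2) powr p"
  have h0: "0 < h" using H by (simp add: h_def)
  have "((\<lambda>l. l powr (p - p1) * A1 powr p1) \<longlongrightarrow> 0 * A1 powr p1) at_top"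
    using p1 by (intro tendsto_mult tendsto_const tendsto_neg_powr filterlim_ident) auto
  then have "\<forall>\<^sub>F l in at_top. l powr (p - p1) * A1 powr p1 < h / 2"
    using h0 by (intro order_tendstoD) auto
  moreover have "\<forall>\<^sub>F l in at_top. 0 < (l::real)" by (rule eventually_gt_at_top)
  ultimately have "\<forall>\<^sub>F l in at_top. 0 < l \<and> l powr (p - p1) * A1 powr p1 < h / 2" by eventually_elim simp
  then obtain l where l: "0 < l" "l powr (p - p1) * A1 powr p1 < h / 2"
    using eventually_happens'[OF trivial_limit_at_top_linorder] by blast
  \<comment> \<open>Makes the lower-exponent term of the interpolation at height \<open>l\<close>
    equal to h/2; the upper-exponent term is below h/2 by the choice of \<open>l\<close>.\<close>
  define c0 where "c0 = h / 2 / l powr (p - p0)"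
  have c0: "0 < c0" using h0 l by (simp add: c0_def)
  have "((\<lambda>R. D * R powr - e) \<longlongrightarrow> D * 0) at_top"
    using e by (intro tendsto_mult tendsto_const tendsto_neg_powr filterlim_ident) auto
  then have "\<forall>\<^sub>F R in at_top. D * R powr - e < c0 / 2" using c0 by (intro order_tendstoD) auto
  moreover have "\<forall>\<^sub>F R in at_top. 1 \<le> (R::real)" by (rule eventually_ge_at_top)
  ultimately have "\<forall>\<^sub>F R in at_top. 1 \<le> R \<and> D * R powr - e < c0 / 2" by eventually_elim simp
  then obtain R where R: "1 \<le> R" "D * R powr - e < c0 / 2"
    using eventually_happens'[OF trivial_limit_at_top_linorder] by blast
  \<comment> \<open>The second entry makes D \<delta> at most c0/2, the other half being the decay
    at \<open>R\<close>. The bound 1 keeps sqrt (1 - \<delta>) meaningful later.\<close>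
  define \<delta> where "\<delta> = min 1 (c0 / (2 * (D + 1)))"
  have \<delta>: "0 < \<delta>" "\<delta> \<le> 1" using c0 D0 by (auto simp: \<delta>_def)
  have D\<delta>: "D * \<delta> \<le> c0 / 2"
  proof -
    have "D * \<delta> \<le> (D + 1) * (c0 / (2 * (D + 1)))" using D0 \<delta>(1) by (intro mult_mono) (auto simp: \<delta>_def)
    also have "\<dots> = c0 / 2"
    proof -
      have "x * (c0 / (2 * x)) = c0 / 2" if "x \<noteq> 0" for x :: real using that by simp
      from this[of "D + 1"] show ?thesis using D0 by (elim meta_mp) simp
    qed
    finally show ?thesis .
  qed
  have "\<exists>b. ennreal \<delta> \<le> (\<integral>\<^sup>+a. ennreal ((cmod (g a))\<^sup>2) * indicator {a. lor (pos b) (pos a) \<le> R} a \<partial>hyp_measure)"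
    if g: "nice g" "nrm 2 hyp_measure g = 1" "H / 2 \<le> nrm p lborel (ext_schwartz g)" for g :: "'a \<Rightarrow> complex"
  proof (rule ccontr)
    assume "\<not> ?thesis"
    then have small: "(\<integral>\<^sup>+a. ennreal ((cmod (g a))\<^sup>2) * indicator {a. lor (pos b) (pos a) \<le> R} a \<partial>hyp_measure) \<le> ennreal \<delta>" for b
      by (auto simp: not_le intro: less_imp_le)
    have "nrm p0 lborel (ext_schwartz g) powr p0 \<le> D * (\<delta> + R powr - e)"
      unfolding p0_def D_def
      by (rule extension_small_of_spread[OF cb K e m(1) g(1) _ R(1) _ small]) (use g(2) \<delta> in auto)
    also have "\<dots> < c0" using D\<delta> R(2) by (simp add: distrib_left)
    finally have lt: "nrm p0 lborel (ext_schwartz g) powr p0 < c0" .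
    have "h \<le> nrm p lborel (ext_schwartz g) powr p" unfolding h_def using g(3) H p by (intro powr_mono2) auto
    also have "\<dots> \<le> l powr (p - p0) * nrm p0 lborel (ext_schwartz g) powr p0 + l powr (p - p1) * nrm p1 lborel (ext_schwartz g) powr p1"
      by (rule Lp_interpolation(2)[OF _ _ p1 l(1)]) (use m A0[OF g(1)] A1[OF g(1)] in \<open>auto simp: p0_def\<close>)
    also have "\<dots> \<le> l powr (p - p0) * nrm p0 lborel (ext_schwartz g) powr p0 + l powr (p - p1) * A1 powr p1"
      using A1[OF g(1)] g(2) p p1 by (intro add_left_mono mult_left_mono powr_mono2) auto
    also have "\<dots> < l powr (p - p0) * c0 + h / 2"
      using lt l by (intro add_strict_mono mult_strict_left_mono) auto
    also have "\<dots> = h" using l by (simp add: c0_def)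
    finally show False by simp
  qed
  then show thesis using that \<delta> by blast
qed

text \<open>The part of the function outside the ball has norm at most sqrt (1 - \<delta>), so its
  extension cannot reach \<open>H\<close>; near the maximum the part inside must supply the rest.
  Its extension is then bounded below in the \<open>p\<close>-norm, hence large at a point, and a
  modulation moves that point to the origin, where the extension is the integral over the
  ball.\<close>

lemma near_maximizers_concentrate:
  fixes m :: nat and p1 A0 A1 :: real
  assumes H: "0 < H"
    and cb: "conv_bound m (\<lambda>P :: 'a \<times> real. ennreal (K * max 1 (lor P P) powr - e))"
    and K: "0 \<le> K" and e: "0 < e" and m: "2 \<le> m" "2 * real m < p"
    and A0: "0 \<le> A0" "\<And>f :: 'a \<Rightarrow> complex. nice f \<Longrightarrow> ext_schwartz f \<in> Lp_space (2 * real m) lborel \<and> nrm (2 * real m) lborel (ext_schwartz f) \<le> A0 * nrm 2 hyp_measure f"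
    and p1: "p < p1" and A1: "\<And>f :: 'a \<Rightarrow> complex. nice f \<Longrightarrow> ext_schwartz f \<in> Lp_space p1 lborel \<and> nrm p1 lborel (ext_schwartz f) \<le> A1 * nrm 2 hyp_measure f"
  obtains \<eta> c R where "\<eta> < H" "0 < c"
    "\<And>g :: 'a \<Rightarrow> complex. nice g \<Longrightarrow> nrm 2 hyp_measure g = 1 \<Longrightarrow> \<eta> \<le> nrm p lborel (ext_schwartz g) \<Longrightarrow>
      \<exists>h :: 'a \<Rightarrow> complex. nice h \<and> nrm 2 hyp_measure h = 1 \<and> nrm p lborel (ext_schwartz h) = nrm p lborel (ext_schwartz g) \<and>
        c \<le> cmod (\<integral>y. h y * of_real (indicator (cball 0 R) y) \<partial>hyp_measure)"
proof -
  define p0 where "p0 = 2 * real m"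
  have p0: "0 < p0" "p0 < p" using m by (auto simp: p0_def)
  obtain \<delta> R where \<delta>: "0 < \<delta>" "\<delta> \<le> 1" and conc:
    "\<And>g :: 'a \<Rightarrow> complex. nice g \<Longrightarrow> nrm 2 hyp_measure g = 1 \<Longrightarrow> H / 2 \<le> nrm p lborel (ext_schwartz g) \<Longrightarrow>
      \<exists>b. ennreal \<delta> \<le> (\<integral>\<^sup>+a. ennreal ((cmod (g a))\<^sup>2) * indicator {a. lor (pos b) (pos a) \<le> R} a \<partial>hyp_measure)"
    using mass_concentrates[OF H cb K e m _ p1 A1] A0(2) by blast
  \<comment> \<open>Half of the gap between \<open>H\<close> and the largest value H sqrt (1 -
    \<delta>) available to the outer part; the other half is the tolerance for
    near-maximizers.\<close>
  define c1 where "c1 = H * (1 - sqrt (1 - \<delta>)) / 2"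
  have sq: "sqrt (1 - \<delta>) < 1" using \<delta> by simp
  have c1: "0 < c1" using H sq by (simp add: c1_def)
  \<comment> \<open>Solved from c^(p - p0) A0^p0 < c1^p: an extension bounded by \<open>c\<close>
    everywhere would have too small a \<open>p\<close>-norm. The added 1 excludes a zero
    denominator.\<close>
  define c where "c = (c1 powr p / (2 * (A0 powr p0 + 1))) powr (1 / (p - p0))"
  have "0 < c1 powr p / (2 * (A0 powr p0 + 1))"
    using c1 by (intro divide_pos_pos mult_pos_pos add_nonneg_pos) auto
  then have c0: "0 < c" and "c powr (p - p0) = c1 powr p / (2 * (A0 powr p0 + 1))"
    unfolding c_def powr_powr powr_gt_zero using p0 by (metis less_irrefl, simp)
  then have "c powr (p - p0) * A0 powr p0 = c1 powr p * (A0 powr p0 / (2 * (A0 powr p0 + 1)))" by simp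
  also have "\<dots> < c1 powr p * 1"
  proof (intro mult_strict_left_mono)
    have *: "x / (2 * (x + 1)) < 1" if "0 \<le> x" for x :: real using that by (simp add: divide_less_eq)
    show "A0 powr p0 / (2 * (A0 powr p0 + 1)) < 1" by (rule *) (rule powr_ge_zero)
  qed (use c1 in simp)
  finally have c: "c powr (p - p0) * A0 powr p0 < c1 powr p" by simp
  \<comment> \<open>The first entry allows the use of mass concentration, the second leaves a loss
    of at most \<open>c1\<close>.\<close>
  define \<eta> where "\<eta> = max (H / 2) (H - c1)"
  have "\<exists>h :: 'a \<Rightarrow> complex. nice h \<and> nrm 2 hyp_measure h = 1 \<and> nrm p lborel (ext_schwartz h) = nrm p lborel (ext_schwartz g) \<and>
        c \<le> cmod (\<integral>y. h y * of_real (indicator (cball 0 R) y) \<partial>hyp_measure)"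
    if g: "nice g" "nrm 2 hyp_measure g = 1" "\<eta> \<le> nrm p lborel (ext_schwartz g)" for g :: "'a \<Rightarrow> complex"
  proof -
    obtain b where b: "ennreal \<delta> \<le> (\<integral>\<^sup>+a. ennreal ((cmod (g a))\<^sup>2) * indicator {a. lor (pos b) (pos a) \<le> R} a \<partial>hyp_measure)"
      using conc[OF g(1,2)] g(3) by (auto simp: \<eta>_def)
    obtain u :: "'a \<Rightarrow> complex" where u: "nice u" "nrm 2 hyp_measure u = nrm 2 hyp_measure g" "nrm p lborel (ext_schwartz u) = nrm p lborel (ext_schwartz g)"
      and bu: "(\<integral>\<^sup>+a. ennreal ((cmod (g a))\<^sup>2) * indicator {a. lor (pos b) (pos a) \<le> R} a \<partial>hyp_measure) \<le> ennreal ((nrm 2 hyp_measure (\<lambda>y. u y * of_real (indicator (cball 0 R) y)))\<^sup>2)"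
      by (rule recentre[OF g(1), where b=b and R=R and p=p]) (erule (3) that)
    define v where "v = (\<lambda>y. u y * of_real (indicator (cball 0 R) y))"
    have uL: "u \<in> Lp_space 2 hyp_measure" using u(1) by (simp add: nice_def)
    have v: "nice v" unfolding v_def by (rule nice_cutoff(1)[OF uL])
    then have vL: "v \<in> Lp_space 2 hyp_measure" by (simp add: nice_def)
    have \<delta>v: "\<delta> \<le> (nrm 2 hyp_measure v)\<^sup>2"
      using order_trans[OF b bu] unfolding v_def[symmetric] by simp
    have w: "nice (\<lambda>y. u y - v y)" by (rule nice_diff[OF u(1) v])
    \<comment> \<open>Inside and outside parts have disjoint supports, so their squared norms add
      up.\<close>
    have orth: "(nrm 2 hyp_measure (\<lambda>y. u y - v y))\<^sup>2 + (nrm 2 hyp_measure v)\<^sup>2 = (nrm 2 hyp_measure u)\<^sup>2"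
    proof -
      have "(cmod (u y - v y))\<^sup>2 + (cmod (v y))\<^sup>2 = (cmod (u y))\<^sup>2" for y
        by (auto simp: v_def indicator_def)
      moreover have "integrable hyp_measure (\<lambda>y. (cmod (u y - v y))\<^sup>2)" "integrable hyp_measure (\<lambda>y. (cmod (v y))\<^sup>2)"
        using w vL by (auto simp: nice_def Lp_space_2_iff)
      ultimately show ?thesis unfolding nrm_2_power2
        by (subst Bochner_Integration.integral_add[symmetric]) auto
    qed
    then have "(nrm 2 hyp_measure (\<lambda>y. u y - v y))\<^sup>2 \<le> 1 - \<delta>" using \<delta>v u(2) g(2) by simp
    then have nw: "nrm 2 hyp_measure (\<lambda>y. u y - v y) \<le> sqrt (1 - \<delta>)" by (rule real_le_rsqrt)
    have "nrm p lborel (ext_schwartz u) - nrm p lborel (ext_schwartz v) \<le> nrm p lborel (\<lambda>z. ext_schwartz u z - ext_schwartz v z)"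
      using p by (intro nrm_diff_ge ext_Lp u(1) v) simp
    also have "\<dots> \<le> H * nrm 2 hyp_measure (\<lambda>y. u y - v y)" by (rule ext_diff[OF u(1) v])
    also have "\<dots> \<le> H * sqrt (1 - \<delta>)" using nw H by (intro mult_left_mono) auto
    finally have "nrm p lborel (ext_schwartz u) - H * sqrt (1 - \<delta>) \<le> nrm p lborel (ext_schwartz v)" by simp
    moreover have "H - c1 \<le> nrm p lborel (ext_schwartz u)" using g(3) u(3) by (simp add: \<eta>_def)
    moreover have "H - H * sqrt (1 - \<delta>) = 2 * c1" by (simp add: c1_def right_diff_distrib)
    ultimately have cv: "c1 \<le> nrm p lborel (ext_schwartz v)" by linarith
    have "\<exists>z. c < cmod (ext_schwartz v z)"
    proof (rule ccontr)
      assume "\<not> ?thesis"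
      then have "\<forall>z. cmod (ext_schwartz v z) \<le> c" unfolding not_ex not_less .
      then have le: "cmod (ext_schwartz v z) \<le> c" for z by blast
      have "c1 powr p \<le> nrm p lborel (ext_schwartz v) powr p" using cv c1 p by (intro powr_mono2) auto
      also have "\<dots> \<le> c powr (p - p0) * nrm p0 lborel (ext_schwartz v) powr p0"
        by (rule Lp_interpolation_bounded[OF p0 le]) (use A0(2)[OF v] in \<open>simp add: p0_def\<close>)
      also have "\<dots> \<le> c powr (p - p0) * A0 powr p0"
      proof (intro mult_left_mono powr_mono2)
        have "(nrm 2 hyp_measure v)\<^sup>2 \<le> (nrm 2 hyp_measure u)\<^sup>2"
          using orth zero_le_power2[of "nrm 2 hyp_measure (\<lambda>y. u y - v y)"] by linarith
        then have "(nrm 2 hyp_measure v)\<^sup>2 \<le> 1\<^sup>2" using u(2) g(2) by simp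
        then have "nrm 2 hyp_measure v \<le> 1" by (rule power2_le_imp_le) simp
        then have "A0 * nrm 2 hyp_measure v \<le> A0 * 1" by (rule mult_left_mono) (rule A0(1))
        with A0(2)[OF v] show "nrm p0 lborel (ext_schwartz v) \<le> A0" by (simp add: p0_def)
      qed (use p0 in auto)
      also note c
      finally show False by simp
    qed
    then obtain z0 where z0: "c < cmod (ext_schwartz v z0)" by blast
    note md = modulate(1,2)[OF u(1), of z0] modulate(3)[OF u(1), of p z0]
    have "(\<integral>y. (iexp (z0 \<bullet> pos y) * u y) * of_real (indicator (cball 0 R) y) \<partial>hyp_measure) = ext_schwartz v z0"
      by (simp add: ext_schwartz_eq v_def mult.assoc)
    then show ?thesis using md u g(2) z0 by (intro exI[of _ "\<lambda>y. iexp (z0 \<bullet> pos y) * u y"]) simp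
  qed
  moreover have "\<eta> < H" using H c1 by (simp add: \<eta>_def)
  ultimately show thesis using that c0 by blast
qed

end

section \<open>Existence of extremizers\<close>

lemma Lp_tendsto_AE_subseq:
  assumes p: "0 < p" and u: "\<And>n. (\<lambda>x. u n x - v x) \<in> Lp_space p M"
    and lim: "(\<lambda>n. nrm p M (\<lambda>x. u n x - v x)) \<longlonglongrightarrow> 0"
  obtains \<kappa> where "strict_mono (\<kappa> :: nat \<Rightarrow> nat)" "AE x in M. (\<lambda>n. u (\<kappa> n) x) \<longlonglongrightarrow> v x"
proof -
  have I: "integrable M (\<lambda>x. cmod (u n x - v x) powr p)" for n using u p by (simp add: Lp_space_iff)
  have "(\<lambda>n. nrm p M (\<lambda>x. u n x - v x) powr p) \<longlonglongrightarrow> 0 powr p"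
    using p by (intro tendsto_powr'[OF lim tendsto_const]) auto
  then have "(\<lambda>n. \<integral>x. norm (cmod (u n x - v x) powr p) \<partial>M) \<longlonglongrightarrow> 0"
    using p by (simp add: nrm_powr)
  from tendsto_L1_AE_subseq[OF I this] obtain \<kappa> where \<kappa>: "strict_mono \<kappa>" "AE x in M. (\<lambda>n. cmod (u (\<kappa> n) x - v x) powr p) \<longlonglongrightarrow> 0" by blast
  have "AE x in M. (\<lambda>n. u (\<kappa> n) x) \<longlonglongrightarrow> v x"
    using \<kappa>(2)
  proof eventually_elim
    fix x assume l: "(\<lambda>n. cmod (u (\<kappa> n) x - v x) powr p) \<longlonglongrightarrow> 0"
    have "(\<lambda>n. (cmod (u (\<kappa> n) x - v x) powr p) powr (1 / p)) \<longlonglongrightarrow> 0 powr (1 / p)"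
      using p by (intro tendsto_powr'[OF l tendsto_const]) auto
    then have "(\<lambda>n. cmod (u (\<kappa> n) x - v x)) \<longlonglongrightarrow> 0" using p by (simp add: powr_powr)
    then show "(\<lambda>n. u (\<kappa> n) x) \<longlonglongrightarrow> v x" by (simp add: tendsto_norm_zero_iff LIM_zero_iff)
  qed
  with \<kappa>(1) that show thesis by blast
qed

text \<open>For exponents at least 1 the power lies below the identity on the unit interval, so s^q
  + (1 - s)^q \<le> 1.\<close>

lemma one_minus_powr_ge:
  assumes "1 \<le> q" "0 \<le> s" "s \<le> (1::real)"
  shows "s powr q \<le> 1 - (1 - s) powr q"
proof -
  have "t powr q \<le> t" if "0 \<le> t" "t \<le> 1" for t :: real
    using powr_mono'[of 1 q t] that assms(1) by simp
  from this[of s] this[of "1 - s"] assms show ?thesis by simp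
qed

context bounded_extension begin

text \<open>Let N be the norm of the weak limit. The remainder u n - f has squared norm tending to 1
  - N^2, so Brezis-Lieb and the bound for its extension give at least H^p (1 - (1 - N^2)^(p/2)) for
  the \<open>p\<close>-th power of the norm of \<open>F\<close>. Since p/2 \<ge> 1 this is at least
  (H N)^p.\<close>

lemma weak_limit_extremizes:
  fixes g :: "nat \<Rightarrow> 'a \<Rightarrow> complex"
  assumes g: "\<And>n. nice (g n)" "\<And>n. nrm 2 hyp_measure (g n) = 1"
    and lim: "(\<lambda>n. nrm p lborel (ext_schwartz (g n))) \<longlonglongrightarrow> H" and c: "0 < c"
    and low: "\<And>n. c \<le> cmod (\<integral>y. g n y * of_real (indicator (cball 0 R) y) \<partial>hyp_measure)"
  shows "\<exists>f :: 'a \<Rightarrow> complex. extremizer p f"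
proof -
  have gL: "g n \<in> Lp_space 2 hyp_measure" for n using g(1) by (simp add: nice_def)
  obtain r f where r: "strict_mono r" and f: "f \<in> Lp_space 2 hyp_measure" and weak:
    "\<And>h. h \<in> Lp_space 2 hyp_measure \<Longrightarrow> (\<lambda>n. \<integral>x. g (r n) x * cnj (h x) \<partial>hyp_measure) \<longlonglongrightarrow> (\<integral>x. f x * cnj (h x) \<partial>hyp_measure)"
    using L2_weakly_compact_complex[of g hyp_measure 1] gL g(2) by auto
  define F where "F = fourier_ext p f"
  have FL: "F \<in> Lp_space p lborel" unfolding F_def by (rule fourier_ext_Lp[OF f])
  have Fm: "F \<in> borel_measurable borel" using Lp_space_measurable[OF FL] by simp
  define lo where "lo k = (\<lambda>y. f y * complex_of_real (indicator (cball 0 (real k)) y))" for k :: nat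
  have lo: "nice (lo k)" for k unfolding lo_def by (rule nice_cutoff(1)[OF f])
  have "(\<lambda>k. nrm p lborel (\<lambda>z. ext_schwartz (lo k) z - F z)) \<longlonglongrightarrow> 0"
  proof (rule Lim_null_comparison[OF always_eventually])
    show "\<forall>k. norm (nrm p lborel (\<lambda>z. ext_schwartz (lo k) z - F z)) \<le> H * nrm 2 hyp_measure (\<lambda>y. lo k y - f y)"
      using ext_fourier_ext_diff[OF f lo] by (simp add: F_def)
    show "(\<lambda>k. H * nrm 2 hyp_measure (\<lambda>y. lo k y - f y)) \<longlonglongrightarrow> 0"
      unfolding lo_def using tendsto_mult[OF tendsto_const nice_cutoff(2)[OF f], of H] by simp
  qed
  moreover have "(\<lambda>z. ext_schwartz (lo k) z - F z) \<in> Lp_space p lborel" for k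
    using p by (intro Lp_diff(1) ext_Lp lo FL) simp
  ultimately obtain \<kappa> :: "nat \<Rightarrow> nat" where \<kappa>: "strict_mono \<kappa>" "AE z in lborel. (\<lambda>j. ext_schwartz (lo (\<kappa> j)) z) \<longlonglongrightarrow> F z"
    using Lp_tendsto_AE_subseq[of p "\<lambda>k. ext_schwartz (lo k)" F lborel] p by auto
  obtain s where s: "strict_mono s" and ae: "AE z in lborel. (\<lambda>n. ext_schwartz (g (r (s n))) z) \<longlonglongrightarrow> F z"
    by (rule extension_AE_convergent[of "\<lambda>n. g (r n)" 1 f F \<kappa>, OF g(1) _ f weak Fm \<kappa>(1)])
      (use g(2) \<kappa>(2) that in \<open>auto simp: lo_def\<close>)
  define u where "u n = g (r (s n))" for n
  have u: "nice (u n)" "nrm 2 hyp_measure (u n) = 1" for n using g by (auto simp: u_def)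
  have uL: "u n \<in> Lp_space 2 hyp_measure" for n using u(1) by (simp add: nice_def)
  have rs: "strict_mono (r \<circ> s)" using r s by (auto simp: strict_mono_def)
  have ulim: "(\<lambda>n. nrm p lborel (ext_schwartz (u n))) \<longlonglongrightarrow> H"
    using LIMSEQ_subseq_LIMSEQ[OF lim rs] by (simp add: u_def comp_def)
  define N where "N = nrm 2 hyp_measure f"
  \<comment> \<open>The lower bound \<open>low\<close> is a pairing with the indicator of a ball and
    therefore survives the weak limit.\<close>
  have fpos: "\<not> (AE y in hyp_measure. f y = 0)"
  proof
    assume z: "AE y in hyp_measure. f y = 0"
    have [measurable]: "f \<in> borel_measurable borel" using Lp_space_measurable[OF f] by simp
    define I :: "'a \<Rightarrow> complex" where "I = (\<lambda>y. of_real (indicator (cball 0 R) y))"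
    have [measurable]: "I \<in> borel_measurable borel" unfolding I_def by measurable
    have "I \<in> Lp_space 2 hyp_measure" unfolding I_def by (rule cutoff_L2)
    from weak[OF this] have "(\<lambda>n. cmod (\<integral>x. g (r n) x * cnj (I x) \<partial>hyp_measure)) \<longlonglongrightarrow> cmod (\<integral>x. f x * cnj (I x) \<partial>hyp_measure)"
      by (rule tendsto_norm)
    moreover have "(\<integral>x. f x * cnj (I x) \<partial>hyp_measure) = (\<integral>x. 0 \<partial>(hyp_measure :: 'a measure))"
      using z by (intro integral_cong_AE) (auto simp: I_def)
    moreover have "cnj (I x) = of_real (indicator (cball 0 R) x)" for x by (simp add: I_def)
    ultimately have "(\<lambda>n. cmod (\<integral>x. g (r n) x * of_real (indicator (cball 0 R) x) \<partial>hyp_measure)) \<longlonglongrightarrow> 0" by simp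
    from LIMSEQ_le_const[OF this] low have "c \<le> 0" by blast
    with c show False by simp
  qed
  have ipl: "(\<lambda>n. ip hyp_measure (u n) f) \<longlonglongrightarrow> N\<^sup>2"
  proof -
    have ipeq: "ip hyp_measure v f = Re (\<integral>x. v x * cnj (f x) \<partial>hyp_measure)" if "v \<in> Lp_space 2 hyp_measure" for v
      unfolding ip_def using integral_Re[OF L2_mult_integrable(2)[OF that f]] by simp
    have "(\<lambda>n. ip hyp_measure (g (r n)) f) \<longlonglongrightarrow> ip hyp_measure f f"
      unfolding ipeq[OF gL] ipeq[OF f] by (intro tendsto_Re weak f)
    from LIMSEQ_subseq_LIMSEQ[OF this s] show ?thesis by (simp add: u_def comp_def ip_self N_def)
  qed
  have dl: "(\<lambda>n. (nrm 2 hyp_measure (\<lambda>y. u n y - f y))\<^sup>2) \<longlonglongrightarrow> 1 - N\<^sup>2"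
  proof -
    have "(\<lambda>n. 1\<^sup>2 - 2 * ip hyp_measure (u n) f + N\<^sup>2) \<longlonglongrightarrow> 1\<^sup>2 - 2 * N\<^sup>2 + N\<^sup>2"
      by (intro tendsto_intros ipl)
    then show ?thesis by (simp add: nrm_diff_power2[OF uL f] u(2) N_def)
  qed
  have N1: "N\<^sup>2 \<le> 1" using LIMSEQ_le_const[OF dl, of 0] by auto
  have N0: "0 \<le> N" by (simp add: N_def)
  have q: "1 \<le> p / 2" using p by simp
  have uTL: "ext_schwartz (u n) \<in> Lp_space p lborel" for n by (rule ext_Lp[OF u(1)])
  have "(\<lambda>n. nrm p lborel (ext_schwartz (u n)) powr p - nrm p lborel (\<lambda>z. ext_schwartz (u n) z - F z) powr p) \<longlonglongrightarrow> nrm p lborel F powr p"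
  proof (rule Brezis_Lieb[OF _ uTL FL])
    show "nrm p lborel (ext_schwartz (u n)) \<le> H" for n using ext_bound[OF u(1)[of n]] u(2)[of n] by simp
    show "AE z in lborel. (\<lambda>n. ext_schwartz (u n) z) \<longlonglongrightarrow> F z" using ae by (simp add: u_def)
  qed (use p in simp)
  \<comment> \<open>The norm of the extension of the remainder need not converge separately; it is
    replaced by its upper bound, which does.\<close>
  moreover have "(\<lambda>n. nrm p lborel (ext_schwartz (u n)) powr p - H powr p * ((nrm 2 hyp_measure (\<lambda>y. u n y - f y))\<^sup>2) powr (p / 2))
      \<longlonglongrightarrow> H powr p - H powr p * (1 - N\<^sup>2) powr (p / 2)"
    using p N1 H_nonneg by (intro tendsto_diff tendsto_mult tendsto_const tendsto_powr' ulim dl) auto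
  moreover have "nrm p lborel (\<lambda>z. ext_schwartz (u n) z - F z) powr p \<le> H powr p * ((nrm 2 hyp_measure (\<lambda>y. u n y - f y))\<^sup>2) powr (p / 2)" for n
  proof -
    have "nrm p lborel (\<lambda>z. ext_schwartz (u n) z - F z) powr p \<le> (H * nrm 2 hyp_measure (\<lambda>y. u n y - f y)) powr p"
      unfolding F_def using p by (intro powr_mono2 ext_fourier_ext_diff f u) auto
    also have "\<dots> = H powr p * (nrm 2 hyp_measure (\<lambda>y. u n y - f y)) powr p"
      by (intro powr_mult)
    also have "(nrm 2 hyp_measure (\<lambda>y. u n y - f y)) powr p = ((nrm 2 hyp_measure (\<lambda>y. u n y - f y)) powr 2) powr (p / 2)"
      unfolding powr_powr by simp
    finally show ?thesis by simp
  qed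
  ultimately have "H powr p - H powr p * (1 - N\<^sup>2) powr (p / 2) \<le> nrm p lborel F powr p"
    by (intro LIMSEQ_le[of _ _ "\<lambda>n. nrm p lborel (ext_schwartz (u n)) powr p - nrm p lborel (\<lambda>z. ext_schwartz (u n) z - F z) powr p"]) auto
  moreover have "H powr p * (N\<^sup>2) powr (p / 2) \<le> H powr p * (1 - (1 - N\<^sup>2) powr (p / 2))"
    using one_minus_powr_ge[OF q, of "N\<^sup>2"] N1 by (intro mult_left_mono) auto
  moreover have "(N\<^sup>2) powr (p / 2) = N powr p"
  proof -
    have "(N powr 2) powr (p / 2) = N powr p" unfolding powr_powr by simp
    then show ?thesis using N0 by simp
  qed
  moreover have "H powr p * N powr p = (H * N) powr p" using H_nonneg N0 by (intro powr_mult[symmetric])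
  ultimately have "(H * N) powr p \<le> nrm p lborel F powr p" by (simp add: right_diff_distrib)
  then have "H * N \<le> nrm p lborel F"
  proof (rule contrapos_pp)
    assume "\<not> H * N \<le> nrm p lborel F"
    then have "nrm p lborel F powr p < (H * N) powr p" using p by (intro powr_less_mono2) auto
    then show "\<not> (H * N) powr p \<le> nrm p lborel F powr p" by simp
  qed
  then have "extremizer p f" using extremizerI[OF f fpos] by (simp add: F_def N_def)
  then show ?thesis by blast
qed

text \<open>If the constant is 0, any nonzero function attains it; the indicator of the unit ball is
  one.\<close>

lemma extremizer_trivial:
  assumes "H = 0"
  shows "\<exists>f :: 'a \<Rightarrow> complex. extremizer p f"
proof -
  define f :: "'a \<Rightarrow> complex" where "f = (\<lambda>y. of_real (indicator (cball 0 1) y))"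
  have [measurable]: "f \<in> borel_measurable borel" unfolding f_def by measurable
  have f: "f \<in> Lp_space 2 hyp_measure" unfolding f_def by (rule cutoff_L2)
  have "\<not> (AE y in hyp_measure. f y = 0)"
  proof
    assume "AE y in hyp_measure. f y = 0"
    then have "AE y in lborel. f y = 0" unfolding hyp_measure_def by (subst (asm) AE_density) auto
    then have "AE y in lborel. y \<notin> cball (0::'a) 1" by eventually_elim (auto simp: f_def)
    then have "emeasure lborel (cball (0::'a) 1) = 0" by (subst (asm) AE_iff_measurable[of "cball 0 1"]) auto
    moreover have "0 < measure lborel (cball (0::'a) 1)" by (rule content_cball_pos) simp
    ultimately show False by (simp add: measure_def)
  qed
  from extremizerI[OF f this] assms show ?thesis by auto
qed

end

text \<open>All that depends on the dimension is collected in the hypotheses: a decaying density at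
  the even exponent below \<open>p\<close> and a bounded one at an even exponent above.\<close>

lemma extremizer_exists:
  fixes p :: real and m0 m1 :: nat
  assumes cb0: "conv_bound m0 (\<lambda>P :: 'a::euclidean_space \<times> real. ennreal (K * max 1 (lor P P) powr - e))"
    and K: "0 \<le> K" and e: "0 < e" and m0: "2 \<le> m0" "2 * real m0 < p"
    and cb1: "conv_bound m1 (\<lambda>P :: 'a \<times> real. ennreal C)" and C: "0 \<le> C" and m1: "p < 2 * real m1"
  shows "\<exists>f :: 'a \<Rightarrow> complex. extremizer p f"
proof -
  have cb0': "conv_bound m0 (\<lambda>P :: 'a \<times> real. ennreal K)"
  proof (rule conv_bound_mono[OF cb0])
    fix P :: "'a \<times> real"
    have "max 1 (lor P P) powr - e \<le> max 1 (lor P P) powr 0" using e by (intro powr_mono) auto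
    also have "\<dots> = 1" by (simp add: max_def)
    finally have "K * max 1 (lor P P) powr - e \<le> K * 1" using K by (intro mult_left_mono) auto
    then show "ennreal (K * max 1 (lor P P) powr - e) \<le> ennreal K" by (intro ennreal_leI) simp
  qed simp
  obtain A0 where A0: "0 \<le> A0" "\<And>f :: 'a \<Rightarrow> complex. nice f \<Longrightarrow>
    ext_schwartz f \<in> Lp_space (2 * real m0) lborel \<and> nrm (2 * real m0) lborel (ext_schwartz f) \<le> A0 * nrm 2 hyp_measure f"
    using Strichartz_even[OF cb0' K] m0 by auto
  obtain A1 where A1: "0 \<le> A1" "\<And>f :: 'a \<Rightarrow> complex. nice f \<Longrightarrow>
    ext_schwartz f \<in> Lp_space (2 * real m1) lborel \<and> nrm (2 * real m1) lborel (ext_schwartz f) \<le> A1 * nrm 2 hyp_measure f"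
    using Strichartz_even[OF cb1 C] m0 m1 by auto
  \<comment> \<open>The interpolation bound with splitting height 1.\<close>
  define A where "A = (A0 powr (2 * real m0) + A1 powr (2 * real m1)) powr (1 / p)"
  interpret bounded_extension p A "TYPE('a)"
  proof
    show "2 \<le> p" using m0 by simp
    fix f :: "'a \<Rightarrow> complex" assume f: "nice f" "nrm 2 hyp_measure f \<le> 1"
    have b: "nrm (2 * real m0) lborel (ext_schwartz f) \<le> A0" "nrm (2 * real m1) lborel (ext_schwartz f) \<le> A1"
      using A0(2)[OF f(1)] A1(2)[OF f(1)] mult_left_mono[OF f(2) A0(1)] mult_left_mono[OF f(2) A1(1)] by auto
    note I = Lp_interpolation[of "2 * real m0" p "2 * real m1" 1 "ext_schwartz f" lborel]
    have L: "ext_schwartz f \<in> Lp_space p lborel" using I(1) A0(2)[OF f(1)] A1(2)[OF f(1)] m0 m1 by auto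
    have "nrm p lborel (ext_schwartz f) powr p \<le> nrm (2 * real m0) lborel (ext_schwartz f) powr (2 * real m0) + nrm (2 * real m1) lborel (ext_schwartz f) powr (2 * real m1)"
      using I(2) A0(2)[OF f(1)] A1(2)[OF f(1)] m0 m1 by auto
    also have "\<dots> \<le> A0 powr (2 * real m0) + A1 powr (2 * real m1)"
      using b by (intro add_mono powr_mono2) auto
    finally have "(nrm p lborel (ext_schwartz f) powr p) powr (1 / p) \<le> A"
      unfolding A_def using m0 by (intro powr_mono2) auto
    then have "nrm p lborel (ext_schwartz f) \<le> A" using m0 by (simp add: powr_powr)
    with L show "ext_schwartz f \<in> Lp_space p lborel \<and> nrm p lborel (ext_schwartz f) \<le> A" ..
  qed
  show ?thesis
  proof (cases "H = 0")
    case True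
    then show ?thesis by (rule extremizer_trivial)
  next
    case False
    then have H: "0 < H" using H_nonneg by simp
    obtain \<eta> c R where \<eta>: "\<eta> < H" and c: "0 < c" and conc:
      "\<And>g :: 'a \<Rightarrow> complex. nice g \<Longrightarrow> nrm 2 hyp_measure g = 1 \<Longrightarrow> \<eta> \<le> nrm p lborel (ext_schwartz g) \<Longrightarrow>
      \<exists>h :: 'a \<Rightarrow> complex. nice h \<and> nrm 2 hyp_measure h = 1 \<and> nrm p lborel (ext_schwartz h) = nrm p lborel (ext_schwartz g) \<and>
        c \<le> cmod (\<integral>y. h y * of_real (indicator (cball 0 R) y) \<partial>hyp_measure)"
      by (rule near_maximizers_concentrate[OF H cb0 K e m0 A0(1) _ m1]) (erule A0(2), erule A1(2), blast intro: that)
    \<comment> \<open>The levels increase to \<open>H\<close> and start at \<eta> for n = 0, so that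
      concentration applies to every term.\<close>
    have "\<exists>h :: 'a \<Rightarrow> complex. nice h \<and> nrm 2 hyp_measure h = 1 \<and> H - (H - \<eta>) / real (Suc n) < nrm p lborel (ext_schwartz h) \<and>
        c \<le> cmod (\<integral>y. h y * of_real (indicator (cball 0 R) y) \<partial>hyp_measure)" for n
    proof -
      have "H - (H - \<eta>) / real (Suc n) < H" using \<eta> by simp
      from near_maximizer[OF H this] obtain g :: "'a \<Rightarrow> complex" where
        g: "nice g" "nrm 2 hyp_measure g = 1" "H - (H - \<eta>) / real (Suc n) < nrm p lborel (ext_schwartz g)" by blast
      have "(H - \<eta>) / real (Suc n) \<le> (H - \<eta>) / 1" using \<eta> by (intro divide_left_mono) auto
      then have "\<eta> \<le> nrm p lborel (ext_schwartz g)" using g(3) by simp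
      from conc[OF g(1,2) this] g(3) show ?thesis by auto
    qed
    then obtain g :: "nat \<Rightarrow> 'a \<Rightarrow> complex" where g: "\<And>n. nice (g n)" "\<And>n. nrm 2 hyp_measure (g n) = 1"
      "\<And>n. H - (H - \<eta>) / real (Suc n) < nrm p lborel (ext_schwartz (g n))"
      "\<And>n. c \<le> cmod (\<integral>y. g n y * of_real (indicator (cball 0 R) y) \<partial>hyp_measure)" by metis
    have "(\<lambda>n. nrm p lborel (ext_schwartz (g n))) \<longlonglongrightarrow> H"
    proof (rule tendsto_sandwich[OF always_eventually always_eventually])
      show "\<forall>n. H - (H - \<eta>) / real (Suc n) \<le> nrm p lborel (ext_schwartz (g n))" using g(3) by (auto intro: less_imp_le)
      show "\<forall>n. nrm p lborel (ext_schwartz (g n)) \<le> H" using ext_bound[OF g(1)] g(2) by simp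
      have "(\<lambda>n. H - (H - \<eta>) * inverse (real (Suc n))) \<longlonglongrightarrow> H - (H - \<eta>) * 0"
        by (intro tendsto_intros LIMSEQ_inverse_real_of_nat)
      then show "(\<lambda>n. H - (H - \<eta>) / real (Suc n)) \<longlonglongrightarrow> H" by (simp add: divide_inverse)
    qed simp
    from weak_limit_extremizes[OF g(1,2) this c g(4)] show ?thesis .
  qed
qed

theorem theorem2:
  fixes p :: real
  shows "(6 < p \<longrightarrow> (\<exists>f :: real ^ 1 \<Rightarrow> complex. extremizer p f)) \<and>
         (4 < p \<and> p < 6 \<longrightarrow> (\<exists>f :: real ^ 2 \<Rightarrow> complex. extremizer p f))"
proof (intro conjI impI)
  assume p: "6 < p"
  \<comment> \<open>Generous: 2 n is then above \<open>p\<close> as well, and n \<ge> 3 holds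
    because \<open>p\<close> exceeds 6.\<close>
  obtain n :: nat where n: "p < real n" using reals_Archimedean2 by blast
  then have "3 \<le> n" using p by linarith
  then obtain C where C: "0 \<le> C" "conv_bound n (\<lambda>P :: (real ^ 1) \<times> real. ennreal C)"
    using conv_bound_real1_const by blast
  show "\<exists>f :: real ^ 1 \<Rightarrow> complex. extremizer p f"
    by (rule extremizer_exists[OF conv_bound_real1_decay _ _ _ _ C(2,1)]) (use p n in auto)
next
  assume p: "4 < p \<and> p < 6"
  show "\<exists>f :: real ^ 2 \<Rightarrow> complex. extremizer p f"
    \<comment> \<open>Two factors below and three above: the even exponents 4 and 6 enclose the
      range of \<open>p\<close>.\<close>
    by (rule extremizer_exists[OF conv_bound_real2_decay _ _ _ _ conv_bound_3_real2]) (use p in auto)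
qed

end
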